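(* Let $0<\gamma<1$, $\lambda\ge0$, $K_\gamma>0$, $T>0$, $\Omega=(a,b)$, $\mathrm{Re}(p)>0$, and $U(x_0)\ge0$ with $|pU|$ bounded on $\Omega$. With $h=\frac{b-a}{M}$, $\tau=\frac TN$, $t_n=n\tau$ and the finite element space $S_h$ defined in the context, consider the fully discrete finite element scheme: for $n=1,2,\dots,N$ find $G_h^n\in S_h$ such that $$\left(\frac{1}{\tau^{\gamma}}\sum_{k=0}^n d_k^{(\gamma,\lambda)}e^{-pUk\tau}G_h^{n-k},\,\eta\right)+K_{\gamma}\left(\frac{\partial G_h^n}{\partial x_0},\frac{\partial \eta}{\partial x_0}\right)=\left(f^n,\,\eta\right)\qquad\forall\,\eta\in S_h,$$ with $G_h^0=0$ and $f^n=f(x_0,p,t_n)$. This finite element scheme is unconditionally stable. Moreover, the approximate solution $G_h^n$ satisfies the error estimate $$\left\||E|\right\|_{0,h,1}\le c_5\left(\tau+h^{\min\{l,\,q-1\}}\right),$$ where $E=\left(G_{x_0}(p,t_1)-G_h^1,\dots,G_{x_0}(p,t_n)-G_h^n,\dots,G_{x_0}(p,t_N)-G_h^N\right)$, the function $G_{x_0}(p,t)\in H_0^1(\Omega)$ is the weak solution, i.e. $$\left(D_t^{\gamma,\lambda}G_{x_0}(p,t),\eta\right)-\left(\lambda^\gamma G_{x_0}(p,t),\eta\right)+K_\gamma\left(\frac{\partial G_{x_0}(p,t)}{\partial x_0},\frac{\partial\eta}{\partial x_0}\right)=(f,\eta)\qquad\forall\,\eta\in H_0^1(\Omega),$$ and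 $c_5$ is a constant independent of $\tau$ and $h$, which can be obtained from the explicit bound for $\||E|\|_{0,h,1}^2$ given at the end of the context.
   Context: Inner product and norms: $(v,w)=\int_\Omega v\overline{w}\,dx_0$, $\|v\|_0=\sqrt{(v,v)}$, $|v|_1=\left\|\frac{\partial v}{\partial x_0}\right\|_0$; $\|v\|_q$ is the norm of the Sobolev space $H^q(\Omega)$, and $\|v\|_{\infty,q}=\sup_{0\le t\le T}\|v(\cdot,t)\|_q$. For $v=(v^1,\dots,v^N)$, $\||v|\|_{0,h,1}=\left[\sum_{n=1}^N|v^n|_1^2\,\tau\right]^{1/2}$. Finite element space: with nodes $x_{0,m}=a+mh$ ($0\le m\le M$) and $I_m=(x_{0,m-1},x_{0,m})$, $S_h=\{v\in H_0^1(\Omega)\cap C(\overline\Omega): v|_{I_m}\in P_l(I_m)\}$, where $P_l(I_m)$ is the space of polynomials of degree no greater than $l$ on $I_m$, $l\ge1$ an integer. Coefficients: $\sum_{k=0}^\infty g_k^{(\gamma)}z^k=(1-z)^\gamma$; $g_k^{(\gamma,\lambda)}=e^{-k\lambda\tau}g_k^{(\gamma)}$; $d_0^{(\gamma,\lambda)}=1-e^{-\gamma\lambda\tau}(\lambda\tau)^\gamma$ and $d_k^{(\gamma,\lambda)}=g_k^{(\gamma,\lambda)}$ for $k\ge1$. Tempered fractional substantial derivative: $D_t^{\gamma,\lambda}G_{x_0}(p,t)=e^{-(\lambda+pU(x_0))t}\,{}_0D_t^{\gamma}\left(e^{(\lambda+pU(x_0))t}G_{x_0}(p,t)\right)$, where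 ${}_0D_t^\gamma v(t)=\frac{1}{\Gamma(1-\gamma)}\frac{\partial}{\partial t}\int_0^t(t-\xi)^{-\gamma}v(\xi)\,d\xi$ is the Riemann-Liouville derivative. Equation: the problem is the backward time tempered fractional Feynman-Kac equation in the form $D_t^{\gamma,\lambda}G_{x_0}(p,t)-\lambda^\gamma G_{x_0}(p,t)=K_\gamma\frac{\partial^2}{\partial x_0^2}G_{x_0}(p,t)+f(x_0,p,t)$ on $\Omega\times(0,T]$. Here $f(x_0,p,t)=-\lambda^{\gamma}e^{-pU(x_0)t}+\lambda e^{-(\lambda+pU(x_0))t}\frac{1}{\Gamma(1-\gamma)}\int_0^t(t-\xi)^{-\gamma}e^{\lambda\xi}d\xi$; problems with nonzero initial or boundary data are reduced to zero data by subtracting a known function, which modifies $f$ accordingly. So, without loss of generality, $G_{x_0}(p,0)=0$ and $G_a(p,t)=G_b(p,t)=0$. Regularity: the solution is assumed sufficiently regular. In particular: $G_{x_0}(p,t)$ is in $C^1[0,T]$ with respect to $t$; the zero extension to $t\le0$ of $e^{(\lambda+pU(x_0))t}G_{x_0}(p,t)$ belongs to $\mathscr{S}^{1+\gamma}(\mathbb{R})=\{v\in L^1(\mathbb{R}):\int_{\mathbb{R}}(1+|\omega|)^{1+\gamma}|\mathscr{F}[v](\omega)|\,d\omega<\infty\}$ ($\mathscr{F}$ the Fourier transform), so that the time discretization in the scheme has truncation error $\mathcal{O}(\tau)$; and $G_{x_0}(p,t)\in H_0^1(\Omega)\cap H^q(\Omega)$, with $\|G_{x_0}(p,t)\|_{\infty,q}$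 and $\|\partial_tG_{x_0}(p,t)\|_{\infty,q}$ finite. Bound from which $c_5$ is obtained: $$\||E|\|_{0,h,1}^2\le\frac{4(b-a)^2}{\pi^2K_\gamma^2}T\left((b-a)c_6^2\tau^2+c_8^2h^{2\min\{l+1,q\}}\right)+2c_4^2\|G_{x_0}(p,t)\|_{\infty,q}^2\,T\,h^{2\min\{l,q-1\}}.$$ Here $c_6$ is the constant in the $\mathcal{O}(\tau)$ time truncation error (error at most $c_6\tau$). The constant $c_4$ is that of the Ritz projection estimate $\|\rho\|_0+h|\rho|_1\le c_4h^{\min\{l+1,q\}}\|G_{x_0}(p,t)\|_q$, where $\rho=G_{x_0}(p,t)-R_hG_{x_0}(p,t)$ and $R_h:H_0^1(\Omega)\to S_h$ is defined by $\left(\frac{\partial (R_hG)}{\partial x_0},\frac{\partial\eta}{\partial x_0}\right)=\left(\frac{\partial G}{\partial x_0},\frac{\partial\eta}{\partial x_0}\right)$ for all $\eta\in S_h$. The constant $c_7$ satisfies $\tau^{1-\gamma}\sum_{k=0}^{n-1}\sum_{j=0}^{k}g_j^{(\gamma)}\le c_7T^{1-\gamma}$ for $1\le n\le N$. Finally, $c_8=\left(c_4c_7T^{1-\gamma}\left(\lambda+|p|\sup_{x_0\in\Omega}U(x_0)\right)+c_4\lambda^\gamma\right)\|G_{x_0}(p,t)\|_{\infty,q}+c_4c_7T^{1-\gamma}\left\|\frac{\partial G_{x_0}(p,t)}{\partial t}\right\|_{\infty,q}$. *)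

theory Defs
  imports "HOL-Analysis.Analysis" "HOL-Computational_Algebra.Polynomial"
begin

(* Lebesgue and Sobolev spaces of complex-valued functions on an open set S of reals.
   Elements are functions, not classes modulo null sets; values outside S are irrelevant. *)

definition L2_space :: "real set \<Rightarrow> (real \<Rightarrow> complex) set" where
  "L2_space S = {v. v \<in> borel_measurable (lebesgue_on S) \<and>
                    integrable (lebesgue_on S) (\<lambda>x. (norm (v x))\<^sup>2)}"

definition L2_inner :: "real set \<Rightarrow> (real \<Rightarrow> complex) \<Rightarrow> (real \<Rightarrow> complex) \<Rightarrow> complex" where
  "L2_inner S v w = (LINT x|lebesgue_on S. v x * cnj (w x))"

definition L2_norm :: "real set \<Rightarrow> (real \<Rightarrow> complex) \<Rightarrow> real" where
  "L2_norm S v = sqrt (Re (L2_inner S v v))"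

definition vderiv_iter :: "nat \<Rightarrow> (real \<Rightarrow> complex) \<Rightarrow> real \<Rightarrow> complex" where
  "vderiv_iter k f = ((\<lambda>g x. vector_derivative g (at x)) ^^ k) f"

definition test_fun :: "real set \<Rightarrow> (real \<Rightarrow> complex) \<Rightarrow> bool" where
  "test_fun S \<phi> \<longleftrightarrow> (\<forall>k x. vderiv_iter k \<phi> differentiable (at x)) \<and>
     (\<exists>C. compact C \<and> C \<subseteq> S \<and> (\<forall>x. x \<notin> C \<longrightarrow> \<phi> x = 0))"

definition locally_integrable :: "real set \<Rightarrow> (real \<Rightarrow> complex) \<Rightarrow> bool" where
  "locally_integrable S v \<longleftrightarrow>
     (\<forall>C. compact C \<and> C \<subseteq> S \<longrightarrow> integrable (lebesgue_on C) v)"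

definition has_weak_deriv ::
  "real set \<Rightarrow> nat \<Rightarrow> (real \<Rightarrow> complex) \<Rightarrow> (real \<Rightarrow> complex) \<Rightarrow> bool" where
  "has_weak_deriv S k v g \<longleftrightarrow> locally_integrable S v \<and> locally_integrable S g \<and>
     (\<forall>\<phi>. test_fun S \<phi> \<longrightarrow>
        (LINT x|lebesgue_on S. v x * vderiv_iter k \<phi> x) =
        (- 1) ^ k * (LINT x|lebesgue_on S. g x * \<phi> x))"

(* Weak derivatives are unique up to null sets, so the choice is immaterial
   wherever it is used below, namely under integrals over S. *)
definition weak_deriv :: "real set \<Rightarrow> nat \<Rightarrow> (real \<Rightarrow> complex) \<Rightarrow> real \<Rightarrow> complex" where
  "weak_deriv S k v = (SOME g. has_weak_deriv S k v g)"

definition sobolev :: "real set \<Rightarrow> nat \<Rightarrow> (real \<Rightarrow> complex) set" where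
  "sobolev S q = {v \<in> L2_space S. \<forall>k\<le>q. \<exists>g \<in> L2_space S. has_weak_deriv S k v g}"

definition sobolev_norm :: "real set \<Rightarrow> nat \<Rightarrow> (real \<Rightarrow> complex) \<Rightarrow> real" where
  "sobolev_norm S q v = sqrt (\<Sum>k\<le>q. (L2_norm S (weak_deriv S k v))\<^sup>2)"

definition H1_seminorm :: "real set \<Rightarrow> (real \<Rightarrow> complex) \<Rightarrow> real" where
  "H1_seminorm S v = L2_norm S (weak_deriv S 1 v)"

(* Closure of the test functions in the first-order Sobolev space. *)
definition H1_zero :: "real set \<Rightarrow> (real \<Rightarrow> complex) set" where
  "H1_zero S = {v \<in> sobolev S 1.
     \<forall>e>0. \<exists>\<phi>. test_fun S \<phi> \<and> sobolev_norm S 1 (\<lambda>x. v x - \<phi> x) < e}"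

(* Functions of space and time are written G x t. *)
definition sup_sobolev_norm :: "real set \<Rightarrow> real \<Rightarrow> nat \<Rightarrow> (real \<Rightarrow> real \<Rightarrow> complex) \<Rightarrow> real" where
  "sup_sobolev_norm S T q v = (SUP t\<in>{0..T}. sobolev_norm S q (\<lambda>x. v x t))"

definition grid_norm_0 :: "real set \<Rightarrow> real \<Rightarrow> nat \<Rightarrow> (nat \<Rightarrow> real \<Rightarrow> complex) \<Rightarrow> real" where
  "grid_norm_0 S \<tau> N v = sqrt (\<Sum>n=1..N. (L2_norm S (v n))\<^sup>2 * \<tau>)"

definition grid_norm_1 :: "real set \<Rightarrow> real \<Rightarrow> nat \<Rightarrow> (nat \<Rightarrow> real \<Rightarrow> complex) \<Rightarrow> real" where
  "grid_norm_1 S \<tau> N v = sqrt (\<Sum>n=1..N. (H1_seminorm S (v n))\<^sup>2 * \<tau>)"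

(* One-sided in time at the end points 0 and T. *)
definition time_deriv :: "real \<Rightarrow> (real \<Rightarrow> real \<Rightarrow> complex) \<Rightarrow> real \<Rightarrow> real \<Rightarrow> complex" where
  "time_deriv T G x t = vector_derivative (G x) (at t within {0..T})"

definition fourier :: "(real \<Rightarrow> complex) \<Rightarrow> real \<Rightarrow> complex" where
  "fourier v \<omega> = (LINT t|lebesgue. exp (- (\<i> * of_real (\<omega> * t))) * v t)"

definition fourier_space :: "real \<Rightarrow> (real \<Rightarrow> complex) set" where
  "fourier_space r = {v. integrable lebesgue v \<and>
     integrable lebesgue (\<lambda>\<omega>. (1 + \<bar>\<omega>\<bar>) powr r * norm (fourier v \<omega>))}"

definition fourier_space_norm :: "real \<Rightarrow> (real \<Rightarrow> complex) \<Rightarrow> real" where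
  "fourier_space_norm r v = (LINT \<omega>|lebesgue. (1 + \<bar>\<omega>\<bar>) powr r * norm (fourier v \<omega>))"

(* Riemann-Liouville derivative of order gam in (0,1) of a function on [0,T]; the outer
   derivative is one-sided at the end points because nothing is known beyond T. *)
definition rl_deriv :: "real \<Rightarrow> real \<Rightarrow> (real \<Rightarrow> complex) \<Rightarrow> real \<Rightarrow> complex" where
  "rl_deriv gam T v t = of_real (1 / Gamma (1 - gam)) *
     vector_derivative (\<lambda>s. LINT \<xi>|lebesgue_on {0..s}. of_real ((s - \<xi>) powr (- gam)) * v \<xi>)
       (at t within {0..T})"

definition tempered_subst_deriv ::
  "real \<Rightarrow> real \<Rightarrow> complex \<Rightarrow> (real \<Rightarrow> real) \<Rightarrow> real \<Rightarrow> (real \<Rightarrow> real \<Rightarrow> complex) \<Rightarrow> real \<Rightarrow> real \<Rightarrow> complex"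
  where
  "tempered_subst_deriv gam lam p U T G x t =
     exp (- ((of_real lam + p * of_real (U x)) * of_real t)) *
     rl_deriv gam T (\<lambda>s. exp ((of_real lam + p * of_real (U x)) * of_real s) * G x s) t"

definition g_coeff :: "real \<Rightarrow> nat \<Rightarrow> real" where
  "g_coeff gam k = (- 1) ^ k * (gam gchoose k)"

lemma g_coeff_generating_function:
  assumes "\<bar>z\<bar> < (1::real)"
  shows "(\<lambda>k. g_coeff gam k * z ^ k) sums (1 - z) powr gam"
proof -
  have "(\<lambda>k. g_coeff gam k * z ^ k) = (\<lambda>k. (gam gchoose k) * (- z) ^ k)"
    unfolding g_coeff_def power_minus[of z] by (simp add: mult_ac)
  then show ?thesis
    using gen_binomial_real[of "- z" gam] assms by simp
qed

definition tempered_g_coeff :: "real \<Rightarrow> real \<Rightarrow> real \<Rightarrow> nat \<Rightarrow> real" where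
  "tempered_g_coeff gam lam \<tau> k = exp (- (real k * lam * \<tau>)) * g_coeff gam k"

definition d_coeff :: "real \<Rightarrow> real \<Rightarrow> real \<Rightarrow> nat \<Rightarrow> real" where
  "d_coeff gam lam \<tau> k =
     (if k = 0 then 1 - exp (- (gam * lam * \<tau>)) * (lam * \<tau>) powr gam
      else tempered_g_coeff gam lam \<tau> k)"

definition discrete_deriv ::
  "real \<Rightarrow> real \<Rightarrow> complex \<Rightarrow> (real \<Rightarrow> real) \<Rightarrow> real \<Rightarrow> (nat \<Rightarrow> real \<Rightarrow> complex) \<Rightarrow> nat \<Rightarrow> real \<Rightarrow> complex"
  where
  "discrete_deriv gam lam p U \<tau> v n x = of_real (1 / \<tau> powr gam) *
     (\<Sum>k=0..n. of_real (d_coeff gam lam \<tau> k) *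
        exp (- (p * of_real (U x * real k * \<tau>))) * v (n - k) x)"

definition fe_space :: "real \<Rightarrow> real \<Rightarrow> nat \<Rightarrow> nat \<Rightarrow> (real \<Rightarrow> complex) set" where
  "fe_space a b M l = {v \<in> H1_zero {a<..<b}. continuous_on {a..b} v \<and>
     (\<forall>m\<in>{1..M}. \<exists>P :: complex poly. degree P \<le> l \<and>
        (\<forall>x\<in>{a + (real m - 1) * ((b - a) / real M) <..< a + real m * ((b - a) / real M)}.
           v x = poly P (of_real x)))}"

(* The scheme with source values F 1, ..., F N and step T / N; the initial value v 0 is an
   arbitrary element of the finite element space, so that it can be perturbed. *)
definition fe_scheme ::
  "real \<Rightarrow> real \<Rightarrow> real \<Rightarrow> real \<Rightarrow> real \<Rightarrow> complex \<Rightarrow> (real \<Rightarrow> real) \<Rightarrow> real \<Rightarrow> nat \<Rightarrow> nat \<Rightarrow> nat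
   \<Rightarrow> (nat \<Rightarrow> real \<Rightarrow> complex) \<Rightarrow> (nat \<Rightarrow> real \<Rightarrow> complex) \<Rightarrow> bool" where
  "fe_scheme a b gam lam K p U T l M N F v \<longleftrightarrow>
     (\<forall>n\<le>N. v n \<in> fe_space a b M l) \<and>
     (\<forall>n\<in>{1..N}. \<forall>\<eta>\<in>fe_space a b M l.
        L2_inner {a<..<b} (discrete_deriv gam lam p U (T / real N) v n) \<eta>
        + of_real K * L2_inner {a<..<b} (weak_deriv {a<..<b} 1 (v n)) (weak_deriv {a<..<b} 1 \<eta>)
        = L2_inner {a<..<b} (F n) \<eta>)"

(* Perturbations of the initial value and of the source are controlled, for all mesh sizes
   and time steps, with a constant that depends on neither. *)
definition unconditionally_stable ::
  "real \<Rightarrow> real \<Rightarrow> real \<Rightarrow> real \<Rightarrow> real \<Rightarrow> complex \<Rightarrow> (real \<Rightarrow> real) \<Rightarrow> real \<Rightarrow> nat \<Rightarrow> bool" where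
  "unconditionally_stable a b gam lam K p U T l \<longleftrightarrow>
     (\<exists>C. \<forall>M\<ge>1. \<forall>N\<ge>1. \<forall>F F' v v'.
        (\<forall>n\<in>{1..N}. F n \<in> L2_space {a<..<b} \<and> F' n \<in> L2_space {a<..<b}) \<longrightarrow>
        fe_scheme a b gam lam K p U T l M N F v \<longrightarrow>
        fe_scheme a b gam lam K p U T l M N F' v' \<longrightarrow>
        grid_norm_1 {a<..<b} (T / real N) N (\<lambda>n x. v n x - v' n x)
        \<le> C * (L2_norm {a<..<b} (\<lambda>x. v 0 x - v' 0 x)
               + grid_norm_0 {a<..<b} (T / real N) N (\<lambda>n x. F n x - F' n x)))"

definition is_ritz_projection ::
  "real \<Rightarrow> real \<Rightarrow> nat \<Rightarrow> nat \<Rightarrow> (real \<Rightarrow> complex) \<Rightarrow> (real \<Rightarrow> complex) \<Rightarrow> bool" where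
  "is_ritz_projection a b M l v r \<longleftrightarrow> r \<in> fe_space a b M l \<and>
     (\<forall>\<eta>\<in>fe_space a b M l.
        L2_inner {a<..<b} (weak_deriv {a<..<b} 1 r) (weak_deriv {a<..<b} 1 \<eta>) =
        L2_inner {a<..<b} (weak_deriv {a<..<b} 1 v) (weak_deriv {a<..<b} 1 \<eta>))"

(* The constants c4, c6, c7 have to be valid for every mesh and time step. The Ritz estimate is
   required for all functions of the space and not just for the values of one solution, because
   the error bound also uses it for their differences in time. *)

definition ritz_constant :: "real \<Rightarrow> real \<Rightarrow> nat \<Rightarrow> nat \<Rightarrow> real \<Rightarrow> bool" where
  "ritz_constant a b l q c4 \<longleftrightarrow>
     (\<forall>M\<ge>1. \<forall>v \<in> H1_zero {a<..<b} \<inter> sobolev {a<..<b} q. \<forall>r.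
        is_ritz_projection a b M l v r \<longrightarrow>
        L2_norm {a<..<b} (\<lambda>x. v x - r x)
        + ((b - a) / real M) * H1_seminorm {a<..<b} (\<lambda>x. v x - r x)
        \<le> c4 * ((b - a) / real M) ^ min (l + 1) q * sobolev_norm {a<..<b} q v)"

definition truncation_constant ::
  "real \<Rightarrow> real \<Rightarrow> real \<Rightarrow> real \<Rightarrow> complex \<Rightarrow> (real \<Rightarrow> real) \<Rightarrow> real \<Rightarrow> (real \<Rightarrow> real \<Rightarrow> complex) \<Rightarrow> real \<Rightarrow> bool"
  where
  "truncation_constant a b gam lam p U T G c6 \<longleftrightarrow>
     (\<forall>N\<ge>1. \<forall>n\<in>{1..N}. \<forall>x\<in>{a<..<b}.
        norm (discrete_deriv gam lam p U (T / real N) (\<lambda>k y. G y (real k * (T / real N))) n x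
              - (tempered_subst_deriv gam lam p U T G x (real n * (T / real N))
                 - of_real (lam powr gam) * G x (real n * (T / real N))))
        \<le> c6 * (T / real N))"

definition g_sum_constant :: "real \<Rightarrow> real \<Rightarrow> real \<Rightarrow> bool" where
  "g_sum_constant gam T c7 \<longleftrightarrow>
     (\<forall>N\<ge>1. \<forall>n\<in>{1..N}.
        (T / real N) powr (1 - gam) * (\<Sum>k=0..n - 1. \<Sum>j=0..k. g_coeff gam j)
        \<le> c7 * T powr (1 - gam))"

definition c8_constant ::
  "real \<Rightarrow> real \<Rightarrow> real \<Rightarrow> real \<Rightarrow> complex \<Rightarrow> (real \<Rightarrow> real) \<Rightarrow> real \<Rightarrow> (real \<Rightarrow> real \<Rightarrow> complex) \<Rightarrow> nat
   \<Rightarrow> real \<Rightarrow> real \<Rightarrow> real" where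
  "c8_constant a b gam lam p U T G q c4 c7 =
     (c4 * c7 * T powr (1 - gam) * (lam + norm p * (SUP x\<in>{a<..<b}. U x)) + c4 * lam powr gam)
       * sup_sobolev_norm {a<..<b} T q G
     + c4 * c7 * T powr (1 - gam) * sup_sobolev_norm {a<..<b} T q (time_deriv T G)"

end

theory Submission
  imports Defs "HOL-Probability.Characteristic_Functions"
begin

text \<open>Write \<open>G(t\<^sub>n) - G\<^sub>h\<^sup>n = \<rho>\<^sup>n - \<theta>\<^sup>n\<close> with \<open>\<rho>\<^sup>n\<close> the error of the Ritz projection \<open>R\<^sub>h G(t\<^sub>n)\<close>
  and \<open>\<theta>\<^sup>n = G\<^sub>h\<^sup>n - R\<^sub>h G(t\<^sub>n)\<close>; the two are orthogonal in the \<open>H\<^sup>1\<close> seminorm.  The remainder \<open>\<theta>\<close> solves the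
  scheme with a source made of the truncation error in time and the discrete derivative of \<open>\<rho>\<close>.  Testing
  with \<open>\<theta>\<^sup>n\<close> and summing over \<open>n\<close> bounds \<open>\<theta>\<close>, because \<open>\<Sum>\<^sub>k \<bar>d\<^sub>k\<bar> \<le> d\<^sub>0\<close> makes the discrete derivative
  positive up to the initial value; the same argument for the difference of two discrete solutions is
  the stability.  Summation by parts trades the coefficients \<open>g\<^sub>k\<close> for their positive partial sums and
  thereby the discrete derivative of \<open>\<rho>\<close> for increments of \<open>\<rho>\<close>, hence for the time derivative of \<open>G\<close>.
  The truncation error is estimated on the Fourier side, where
  \<open>\<tau>\<^sup>-\<^sup>\<gamma> (1 - e\<^sup>-\<^sup>i\<^sup>\<omega>\<^sup>\<tau>)\<^sup>\<gamma>\<close> differs from \<open>(i\<omega>)\<^sup>\<gamma>\<close> by \<open>O(\<tau> \<bar>\<omega>\<bar>\<^sup>1\<^sup>+\<^sup>\<gamma>)\<close>.\<close>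

section \<open>Square integrable functions\<close>

text \<open>The claims use different strengths of the Ritz estimate. The rate asks for the power
  \<open>min l (q - 1)\<close> of the mesh size only, and Poincare's inequality carries it from the
  seminorm to the L2 norm, so no duality argument occurs. The better power
  \<open>min (l + 1) q\<close> in the L2 norm enters only the explicit bound, through a given
  \<open>ritz_constant\<close>.

  Two obstacles shape the analysis. Sobolev elements are functions with weak derivatives picked by
  choice, while smoothness in time is given for each x separately. In space, everything is read off
  the almost everywhere identity between a function and the primitive of its weak derivative;
  increments in time are controlled by Riemann sums and lower semicontinuity, which replaces
  integrals with values in a Sobolev space. Moreover the function with a decaying Fourier transform
  is tied to the solution only up to time T, and the fractional derivative is not given by a Fourier
  formula; it is reached as a limit of grids.

  The factor 4 / pi^2 of the explicit bound is slack: Poincare's constant 1/8, doubled by (e + d)^2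
  <= 2 (e^2 + d^2), gives 1/4.\<close>

lemma L2_spaceD:
  assumes "v \<in> L2_space S"
  shows "v \<in> borel_measurable (lebesgue_on S)"
    and "integrable (lebesgue_on S) (\<lambda>x. (norm (v x))\<^sup>2)"
  using assms by (auto simp: L2_space_def)

lemma L2_integrable_norm_mult:
  assumes "u \<in> L2_space S" "v \<in> L2_space S"
  shows "integrable (lebesgue_on S) (\<lambda>x. norm (u x) * norm (v x))"
proof (rule Bochner_Integration.integrable_bound)
  show "integrable (lebesgue_on S) (\<lambda>x. (norm (u x))\<^sup>2 + (norm (v x))\<^sup>2)"
    using assms by (intro Bochner_Integration.integrable_add L2_spaceD)
  note [measurable] = L2_spaceD(1)[OF assms(1)] L2_spaceD(1)[OF assms(2)]
  show "(\<lambda>x. norm (u x) * norm (v x)) \<in> borel_measurable (lebesgue_on S)"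
    by measurable
  have "norm (u x) * norm (v x) \<le> (norm (u x))\<^sup>2 + (norm (v x))\<^sup>2" for x
    using sum_squares_bound[of "norm (u x)" "norm (v x)"]
      mult_nonneg_nonneg[OF norm_ge_zero[of "u x"] norm_ge_zero[of "v x"]] by linarith
  then show "AE x in lebesgue_on S. norm (norm (u x) * norm (v x))
      \<le> norm ((norm (u x))\<^sup>2 + (norm (v x))\<^sup>2)"
    by (intro AE_I2) (simp add: abs_mult)
qed

lemma L2_integrable_mult:
  assumes "u \<in> L2_space S" "v \<in> L2_space S"
  shows "integrable (lebesgue_on S) (\<lambda>x. u x * v x)"
proof (rule Bochner_Integration.integrable_bound[OF L2_integrable_norm_mult[OF assms]])
  note [measurable] = L2_spaceD(1)[OF assms(1)] L2_spaceD(1)[OF assms(2)]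
  show "(\<lambda>x. u x * v x) \<in> borel_measurable (lebesgue_on S)"
    by measurable
qed (simp add: norm_mult)

lemma L2_cnj:
  assumes "v \<in> L2_space S"
  shows "(\<lambda>x. cnj (v x)) \<in> L2_space S"
proof -
  have "cnj \<in> borel_measurable borel"
    by (intro borel_measurable_continuous_onI continuous_intros)
  then have "(\<lambda>x. cnj (v x)) \<in> borel_measurable (lebesgue_on S)"
    using L2_spaceD(1)[OF assms] measurable_compose by blast
  then show ?thesis
    using L2_spaceD[OF assms] by (simp add: L2_space_def)
qed

lemma L2_integrable_inner:
  assumes "u \<in> L2_space S" "v \<in> L2_space S"
  shows "integrable (lebesgue_on S) (\<lambda>x. u x * cnj (v x))"
  by (rule L2_integrable_mult[OF assms(1) L2_cnj[OF assms(2)]])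

lemma L2_bounded_by:
  assumes "u \<in> L2_space S" "v \<in> borel_measurable (lebesgue_on S)"
    and "AE x in lebesgue_on S. norm (v x) \<le> C * norm (u x)"
  shows "v \<in> L2_space S"
proof -
  note [measurable] = assms(2)
  have "integrable (lebesgue_on S) (\<lambda>x. (norm (v x))\<^sup>2)"
  proof (rule Bochner_Integration.integrable_bound)
    show "integrable (lebesgue_on S) (\<lambda>x. C\<^sup>2 * (norm (u x))\<^sup>2)"
      using L2_spaceD(2)[OF assms(1)] by simp
    show "AE x in lebesgue_on S. norm ((norm (v x))\<^sup>2) \<le> norm (C\<^sup>2 * (norm (u x))\<^sup>2)"
      using assms(3)
    proof eventually_elim
      case (elim x)
      then have "(norm (v x))\<^sup>2 \<le> (C * norm (u x))\<^sup>2"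
        by (intro power_mono) auto
      then show ?case by (simp add: power_mult_distrib)
    qed
  qed measurable
  then show ?thesis using assms(2) by (simp add: L2_space_def)
qed

lemma L2_add:
  assumes "u \<in> L2_space S" "v \<in> L2_space S"
  shows "(\<lambda>x. u x + v x) \<in> L2_space S"
proof -
  note [measurable] = L2_spaceD(1)[OF assms(1)] L2_spaceD(1)[OF assms(2)]
  have "integrable (lebesgue_on S) (\<lambda>x. (norm (u x + v x))\<^sup>2)"
  proof (rule Bochner_Integration.integrable_bound)
    show "integrable (lebesgue_on S) (\<lambda>x. 2 * (norm (u x))\<^sup>2 + 2 * (norm (v x))\<^sup>2)"
      using assms by (intro Bochner_Integration.integrable_add integrable_mult_right L2_spaceD)
    have "(norm (u x + v x))\<^sup>2 \<le> 2 * (norm (u x))\<^sup>2 + 2 * (norm (v x))\<^sup>2" for x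
    proof -
      have "(norm (u x + v x))\<^sup>2 \<le> (norm (u x) + norm (v x))\<^sup>2"
        by (intro power_mono norm_triangle_ineq) auto
      also have "\<dots> \<le> 2 * (norm (u x))\<^sup>2 + 2 * (norm (v x))\<^sup>2"
        using sum_squares_bound[of "norm (u x)" "norm (v x)"] by (simp add: power2_sum)
      finally show ?thesis .
    qed
    then show "AE x in lebesgue_on S. norm ((norm (u x + v x))\<^sup>2)
        \<le> norm (2 * (norm (u x))\<^sup>2 + 2 * (norm (v x))\<^sup>2)"
      by (intro AE_I2) simp
  qed measurable
  then show ?thesis by (simp add: L2_space_def)
qed

lemma L2_cmult:
  assumes "u \<in> L2_space S"
  shows "(\<lambda>x. c * u x) \<in> L2_space S"
proof (rule L2_bounded_by[OF assms, where C="norm c"])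
  note [measurable] = L2_spaceD(1)[OF assms(1)]
  show "(\<lambda>x. c * u x) \<in> borel_measurable (lebesgue_on S)" by measurable
qed (simp add: norm_mult)

lemma L2_uminus: "u \<in> L2_space S \<Longrightarrow> (\<lambda>x. - u x) \<in> L2_space S"
  using L2_cmult[of u S "-1"] by simp

lemma L2_diff:
  assumes "u \<in> L2_space S" "v \<in> L2_space S"
  shows "(\<lambda>x. u x - v x) \<in> L2_space S"
  using L2_add[OF assms(1) L2_uminus[OF assms(2)]] by simp

lemma L2_zero [simp]: "(\<lambda>x. 0) \<in> L2_space S"
  by (simp add: L2_space_def)

lemma L2_sum:
  assumes "\<And>i. i \<in> I \<Longrightarrow> u i \<in> L2_space S"
  shows "(\<lambda>x. \<Sum>i\<in>I. u i x) \<in> L2_space S"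
  using assms by (induction I rule: infinite_finite_induct) (auto intro: L2_add)

lemma L2_mult_bounded:
  assumes "u \<in> L2_space S" "m \<in> borel_measurable (lebesgue_on S)"
    and "\<And>x. x \<in> S \<Longrightarrow> norm (m x) \<le> C"
  shows "(\<lambda>x. m x * u x) \<in> L2_space S"
proof (rule L2_bounded_by[OF assms(1), where C=C])
  note [measurable] = L2_spaceD(1)[OF assms(1)] assms(2)
  show "(\<lambda>x. m x * u x) \<in> borel_measurable (lebesgue_on S)" by measurable
  show "AE x in lebesgue_on S. norm (m x * u x) \<le> C * norm (u x)"
    using assms(3) by (intro AE_I2) (auto simp: norm_mult intro!: mult_right_mono)
qed

lemma L2_cong_AE:
  assumes "u \<in> L2_space S" "AE x in lebesgue_on S. u x = v x"
    and "v \<in> borel_measurable (lebesgue_on S)"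
  shows "v \<in> L2_space S"
  by (rule L2_bounded_by[OF assms(1,3), where C=1]) (use assms(2) in \<open>auto elim: eventually_mono\<close>)

lemma L2_norm_eq: "L2_norm S v = sqrt (LINT x|lebesgue_on S. (norm (v x))\<^sup>2)"
  unfolding L2_norm_def L2_inner_def
  by (simp flip: complex_norm_square of_real_power)

lemma L2_norm_nonneg [simp]: "0 \<le> L2_norm S v"
  by (simp add: L2_norm_eq)

lemma L2_norm_power2: "(L2_norm S v)\<^sup>2 = (LINT x|lebesgue_on S. (norm (v x))\<^sup>2)"
  by (simp add: L2_norm_eq)

lemma L2_inner_self: "L2_inner S v v = of_real ((L2_norm S v)\<^sup>2)"
  unfolding L2_norm_power2 L2_inner_def
  by (simp flip: complex_norm_square of_real_power)

text \<open>Cauchy-Schwarz for the moduli, from the nonnegative quadratic in t given by the squared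
  norm of |u| - t |v|. If v has norm zero the quadratic is affine, and I = 0 follows because t = (A
  + 1) / (2 I) would make it -1.\<close>

lemma L2_norm_mult_integral_le:
  assumes "u \<in> L2_space S" "v \<in> L2_space S"
  shows "(LINT x|lebesgue_on S. norm (u x) * norm (v x)) \<le> L2_norm S u * L2_norm S v"
proof -
  define A B I where "A = (L2_norm S u)\<^sup>2" and "B = (L2_norm S v)\<^sup>2"
    and "I = (LINT x|lebesgue_on S. norm (u x) * norm (v x))"
  have pos: "0 \<le> A - 2 * t * I + t\<^sup>2 * B" for t
  proof -
    have "0 \<le> (LINT x|lebesgue_on S. (norm (u x) - t * norm (v x))\<^sup>2)"
      by (intro integral_nonneg_AE) auto
    also have "\<dots> = (LINT x|lebesgue_on S. (norm (u x))\<^sup>2 - 2 * t * (norm (u x) * norm (v x))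
        + t\<^sup>2 * (norm (v x))\<^sup>2)"
      by (intro Bochner_Integration.integral_cong) (auto simp: power2_eq_square algebra_simps)
    also have "\<dots> = A - 2 * t * I + t\<^sup>2 * B"
      unfolding A_def B_def I_def L2_norm_power2
      using L2_integrable_norm_mult[OF assms] L2_spaceD(2)[OF assms(1)] L2_spaceD(2)[OF assms(2)]
      by (subst Bochner_Integration.integral_add Bochner_Integration.integral_diff; simp)+
    finally show ?thesis .
  qed
  have "I\<^sup>2 \<le> A * B"
  proof (cases "B = 0")
    case True
    have "I = 0"
    proof (rule ccontr)
      assume "I \<noteq> 0"
      then show False using pos[of "(A + 1) / (2 * I)"] True by simp
    qed
    then show ?thesis using True by simp
  next
    case False
    then have "B > 0" by (simp add: B_def)
    then show ?thesis using pos[of "I / B"]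
      by (simp add: field_simps power2_eq_square)
  qed
  then have "I\<^sup>2 \<le> (L2_norm S u * L2_norm S v)\<^sup>2"
    by (simp add: A_def B_def power_mult_distrib)
  then show ?thesis unfolding I_def
    by (rule power2_le_imp_le) simp
qed

lemma L2_cauchy_schwarz:
  assumes "u \<in> L2_space S" "v \<in> L2_space S"
  shows "norm (L2_inner S u v) \<le> L2_norm S u * L2_norm S v"
proof -
  have "norm (L2_inner S u v) \<le> (LINT x|lebesgue_on S. norm (u x * cnj (v x)))"
    unfolding L2_inner_def by (rule integral_norm_bound)
  also have "\<dots> \<le> L2_norm S u * L2_norm S v"
    using L2_norm_mult_integral_le[OF assms] by (simp add: norm_mult)
  finally show ?thesis .
qed

lemma L2_inner_cmult_left: "L2_inner S (\<lambda>x. c * u x) v = c * L2_inner S u v"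
  unfolding L2_inner_def by (simp add: mult.assoc)

lemma L2_inner_cmult_right: "L2_inner S u (\<lambda>x. c * v x) = cnj c * L2_inner S u v"
  unfolding L2_inner_def by (simp add: mult.left_commute)

lemma L2_inner_add_left:
  assumes "u \<in> L2_space S" "v \<in> L2_space S" "w \<in> L2_space S"
  shows "L2_inner S (\<lambda>x. u x + v x) w = L2_inner S u w + L2_inner S v w"
  unfolding L2_inner_def
  using L2_integrable_inner[OF assms(1,3)] L2_integrable_inner[OF assms(2,3)]
  by (simp add: distrib_right)

lemma L2_inner_diff_left:
  assumes "u \<in> L2_space S" "v \<in> L2_space S" "w \<in> L2_space S"
  shows "L2_inner S (\<lambda>x. u x - v x) w = L2_inner S u w - L2_inner S v w"
  unfolding L2_inner_def
  using L2_integrable_inner[OF assms(1,3)] L2_integrable_inner[OF assms(2,3)]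
  by (simp add: left_diff_distrib)

lemma L2_inner_add_right:
  assumes "u \<in> L2_space S" "v \<in> L2_space S" "w \<in> L2_space S"
  shows "L2_inner S w (\<lambda>x. u x + v x) = L2_inner S w u + L2_inner S w v"
  unfolding L2_inner_def
  using L2_integrable_inner[OF assms(3,1)] L2_integrable_inner[OF assms(3,2)]
  by (simp add: distrib_left)

lemma L2_inner_zero_left [simp]: "L2_inner S (\<lambda>x. 0) v = 0"
  by (simp add: L2_inner_def)

lemma L2_inner_sum_left:
  assumes "\<And>i. i \<in> I \<Longrightarrow> u i \<in> L2_space S" "w \<in> L2_space S"
  shows "L2_inner S (\<lambda>x. \<Sum>i\<in>I. u i x) w = (\<Sum>i\<in>I. L2_inner S (u i) w)"
  using assms(1)
  by (induction I rule: infinite_finite_induct)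
     (auto simp: L2_inner_add_left L2_sum assms(2))

lemma L2_inner_commute: "L2_inner S v u = cnj (L2_inner S u v)"
  unfolding L2_inner_def by (subst Bochner_Integration.integral_cnj [symmetric]) (simp add: mult.commute)

text \<open>Representatives chosen by \<open>weak_deriv\<close> are known almost everywhere only.
  Measurability is asked of all four functions because the integral of a nonmeasurable function is a
  default value, on which almost everywhere equality has no hold.\<close>

lemma L2_inner_cong_AE:
  assumes "u \<in> borel_measurable (lebesgue_on S)" "u' \<in> borel_measurable (lebesgue_on S)"
    and "v \<in> borel_measurable (lebesgue_on S)" "v' \<in> borel_measurable (lebesgue_on S)"
    and "AE x in lebesgue_on S. u x = u' x" "AE x in lebesgue_on S. v x = v' x"
  shows "L2_inner S u v = L2_inner S u' v'"
proof -
  have c: "cnj \<in> borel_measurable borel"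
    by (intro borel_measurable_continuous_onI continuous_intros)
  note [measurable] = assms(1-4) measurable_compose[OF assms(3) c] measurable_compose[OF assms(4) c]
  show ?thesis unfolding L2_inner_def
  proof (rule integral_cong_AE)
    show "AE x in lebesgue_on S. u x * cnj (v x) = u' x * cnj (v' x)"
      using assms(5,6) by eventually_elim simp
  qed measurable
qed

lemma L2_norm_cong_AE:
  assumes "u \<in> borel_measurable (lebesgue_on S)" "v \<in> borel_measurable (lebesgue_on S)"
    and "AE x in lebesgue_on S. u x = v x"
  shows "L2_norm S u = L2_norm S v"
  unfolding L2_norm_def by (subst L2_inner_cong_AE[OF assms(1,2,1,2,3,3)]) simp

lemma L2_inner_cong:
  assumes "\<And>x. x \<in> S \<Longrightarrow> u x = u' x" "\<And>x. x \<in> S \<Longrightarrow> v x = v' x"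
  shows "L2_inner S u v = L2_inner S u' v'"
  unfolding L2_inner_def by (intro Bochner_Integration.integral_cong) (use assms in auto)

lemma L2_norm_cong:
  assumes "\<And>x. x \<in> S \<Longrightarrow> u x = v x"
  shows "L2_norm S u = L2_norm S v"
  unfolding L2_norm_def by (subst L2_inner_cong[of S u v u v]) (use assms in auto)

lemma L2_norm_mono:
  assumes "u \<in> L2_space S" "v \<in> L2_space S" "0 \<le> C"
    and "AE x in lebesgue_on S. norm (v x) \<le> C * norm (u x)"
  shows "L2_norm S v \<le> C * L2_norm S u"
proof (rule power2_le_imp_le)
  have "(L2_norm S v)\<^sup>2 \<le> (LINT x|lebesgue_on S. C\<^sup>2 * (norm (u x))\<^sup>2)"
    unfolding L2_norm_power2
  proof (rule integral_mono_AE)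
    show "AE x in lebesgue_on S. (norm (v x))\<^sup>2 \<le> C\<^sup>2 * (norm (u x))\<^sup>2"
      using assms(4)
    proof eventually_elim
      case (elim x)
      then have "(norm (v x))\<^sup>2 \<le> (C * norm (u x))\<^sup>2"
        by (intro power_mono) auto
      then show ?case by (simp add: power_mult_distrib)
    qed
  qed (use assms(1,2) in \<open>auto simp: L2_space_def\<close>)
  then show "(L2_norm S v)\<^sup>2 \<le> (C * L2_norm S u)\<^sup>2"
    by (simp add: power_mult_distrib L2_norm_power2)
qed (use assms(3) in auto)

lemma L2_norm_mult_bounded:
  assumes "u \<in> L2_space S" "m \<in> borel_measurable (lebesgue_on S)" "0 \<le> C"
    and "\<And>x. x \<in> S \<Longrightarrow> norm (m x) \<le> C"
  shows "L2_norm S (\<lambda>x. m x * u x) \<le> C * L2_norm S u"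
  by (rule L2_norm_mono[OF assms(1) L2_mult_bounded[OF assms(1,2,4)] assms(3)])
     (use assms(4) in \<open>auto simp: norm_mult intro!: AE_I2 mult_right_mono\<close>)

lemma L2_norm_cmult: "L2_norm S (\<lambda>x. c * u x) = norm c * L2_norm S u"
  unfolding L2_norm_eq by (simp add: norm_mult power_mult_distrib real_sqrt_mult)

lemma L2_norm_uminus: "L2_norm S (\<lambda>x. - u x) = L2_norm S u"
  unfolding L2_norm_eq by simp

lemma L2_norm_zero [simp]: "L2_norm S (\<lambda>x. 0) = 0"
  unfolding L2_norm_eq by simp

lemma L2_norm_add_power2:
  assumes "u \<in> L2_space S" "v \<in> L2_space S"
  shows "(L2_norm S (\<lambda>x. u x + v x))\<^sup>2
    = (L2_norm S u)\<^sup>2 + 2 * Re (L2_inner S u v) + (L2_norm S v)\<^sup>2"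
proof -
  have "complex_of_real ((L2_norm S (\<lambda>x. u x + v x))\<^sup>2)
    = of_real ((L2_norm S u)\<^sup>2) + L2_inner S u v + cnj (L2_inner S u v) + of_real ((L2_norm S v)\<^sup>2)"
    unfolding L2_inner_self[symmetric] L2_inner_commute[of S u v, symmetric]
    using assms by (simp add: L2_inner_add_left L2_inner_add_right L2_add)
       (simp flip: L2_inner_commute)
  then have "Re (complex_of_real ((L2_norm S (\<lambda>x. u x + v x))\<^sup>2))
    = Re (of_real ((L2_norm S u)\<^sup>2) + L2_inner S u v + cnj (L2_inner S u v) + of_real ((L2_norm S v)\<^sup>2))"
    by (rule arg_cong)
  then show ?thesis by simp
qed

lemma L2_norm_triangle:
  assumes "u \<in> L2_space S" "v \<in> L2_space S"
  shows "L2_norm S (\<lambda>x. u x + v x) \<le> L2_norm S u + L2_norm S v"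
proof (rule power2_le_imp_le)
  have "Re (L2_inner S u v) \<le> L2_norm S u * L2_norm S v"
    using L2_cauchy_schwarz[OF assms] complex_Re_le_cmod order_trans by blast
  then show "(L2_norm S (\<lambda>x. u x + v x))\<^sup>2 \<le> (L2_norm S u + L2_norm S v)\<^sup>2"
    unfolding L2_norm_add_power2[OF assms] by (simp add: power2_sum)
qed simp

lemma L2_norm_triangle_diff:
  assumes "u \<in> L2_space S" "v \<in> L2_space S"
  shows "L2_norm S (\<lambda>x. u x - v x) \<le> L2_norm S u + L2_norm S v"
  using L2_norm_triangle[OF assms(1) L2_uminus[OF assms(2)]] by (simp add: L2_norm_uminus)

lemma L2_norm_sum:
  assumes "\<And>i. i \<in> I \<Longrightarrow> u i \<in> L2_space S"
  shows "L2_norm S (\<lambda>x. \<Sum>i\<in>I. u i x) \<le> (\<Sum>i\<in>I. L2_norm S (u i))"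
  using assms
proof (induction I rule: infinite_finite_induct)
  case (insert i I)
  have "L2_norm S (\<lambda>x. u i x + (\<Sum>i\<in>I. u i x)) \<le> L2_norm S (u i) + L2_norm S (\<lambda>x. \<Sum>i\<in>I. u i x)"
    using insert by (intro L2_norm_triangle L2_sum) auto
  then show ?case using insert by force
qed auto

lemma L2_bounded:
  assumes "S \<in> lmeasurable" "v \<in> borel_measurable (lebesgue_on S)"
    and "AE x in lebesgue_on S. norm (v x) \<le> C"
  shows "v \<in> L2_space S"
proof -
  have "(\<lambda>x. 1) \<in> L2_space S"
    using finite_measure.integrable_const[OF finite_measure_lebesgue_on[OF assms(1)]]
    by (auto simp: L2_space_def)
  then show ?thesis
    by (rule L2_bounded_by[OF _ assms(2), where C=C]) (use assms(3) in simp)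
qed

lemma L2_norm_bounded:
  assumes "S \<in> lmeasurable" "v \<in> borel_measurable (lebesgue_on S)" "0 \<le> C"
    and "AE x in lebesgue_on S. norm (v x) \<le> C"
  shows "L2_norm S v \<le> C * sqrt (measure lebesgue S)"
proof -
  have 1: "(\<lambda>x. 1) \<in> L2_space S"
    using finite_measure.integrable_const[OF finite_measure_lebesgue_on[OF assms(1)]]
    by (auto simp: L2_space_def)
  have "L2_norm S (\<lambda>x. 1) = sqrt (measure lebesgue S)"
    using assms(1) by (simp add: L2_norm_eq measure_restrict_space fmeasurableD)
  then show ?thesis
    using L2_norm_mono[OF 1 L2_bounded[OF assms(1,2,4)] assms(3)] assms(4) by simp
qed

lemma L2_integrable:
  assumes "S \<in> lmeasurable" "v \<in> L2_space S"
  shows "integrable (lebesgue_on S) v"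
proof -
  have "(\<lambda>x. 1) \<in> L2_space S"
    using finite_measure.integrable_const[OF finite_measure_lebesgue_on[OF assms(1)]]
    by (auto simp: L2_space_def)
  from L2_integrable_mult[OF assms(2) this] show ?thesis by simp
qed

section \<open>Test functions\<close>

text \<open>Finite order smoothness, recursing into the derivative. In this form the closure
  properties follow by induction on the order with the function generalized; a test function is
  smooth when \<open>diffn n\<close> holds for every n.\<close>

primrec diffn :: "nat \<Rightarrow> (real \<Rightarrow> complex) \<Rightarrow> bool" where
  "diffn 0 f = True"
| "diffn (Suc n) f = ((\<forall>x. f differentiable (at x)) \<and> diffn n (\<lambda>x. vector_derivative f (at x)))"

lemma vderiv_iter_0 [simp]: "vderiv_iter 0 f = f"
  by (simp add: vderiv_iter_def)

lemma vderiv_iter_Suc: "vderiv_iter (Suc k) f = vderiv_iter k (\<lambda>x. vector_derivative f (at x))"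
  by (simp add: vderiv_iter_def funpow_Suc_right del: funpow.simps)

lemma vderiv_iter_1 [simp]: "vderiv_iter (Suc 0) f = (\<lambda>x. vector_derivative f (at x))"
  by (simp add: vderiv_iter_Suc)

lemma diffn_iff: "diffn n f \<longleftrightarrow> (\<forall>k<n. \<forall>x. vderiv_iter k f differentiable (at x))"
proof (induction n arbitrary: f)
  case (Suc n)
  show ?case
    unfolding diffn.simps Suc
    by (auto simp: less_Suc_eq_0_disj vderiv_iter_Suc)
qed simp

lemma test_fun_iff:
  "test_fun S \<phi> \<longleftrightarrow> (\<forall>n. diffn n \<phi>) \<and> (\<exists>C. compact C \<and> C \<subseteq> S \<and> (\<forall>x. x \<notin> C \<longrightarrow> \<phi> x = 0))"
  unfolding test_fun_def diffn_iff by auto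

lemma diffn_SucI:
  assumes "\<And>x. (f has_vector_derivative f' x) (at x)" "diffn n f'"
  shows "diffn (Suc n) f"
proof -
  have "(\<lambda>x. vector_derivative f (at x)) = f'"
    using assms(1) vector_derivative_at by blast
  then show ?thesis
    using assms differentiableI_vector by auto
qed

lemma diffn_SucE:
  assumes "diffn (Suc n) f"
  obtains f' where "\<And>x. (f has_vector_derivative f' x) (at x)" "diffn n f'"
  using assms that[of "\<lambda>x. vector_derivative f (at x)"] by (auto simp: vector_derivative_works)

lemma diffn_antimono: "diffn n f \<Longrightarrow> m \<le> n \<Longrightarrow> diffn m f"
  by (auto simp: diffn_iff)

lemma diffn_const [simp]: "diffn n (\<lambda>x. c)"
proof (induction n arbitrary: c)
  case (Suc n)
  show ?case by (rule diffn_SucI[where f'="\<lambda>x. 0"]) (auto intro: Suc)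
qed simp

lemma diffn_add: "diffn n f \<Longrightarrow> diffn n g \<Longrightarrow> diffn n (\<lambda>x. f x + g x)"
proof (induction n arbitrary: f g)
  case (Suc n)
  obtain f' where f': "\<And>x. (f has_vector_derivative f' x) (at x)" "diffn n f'"
    using diffn_SucE[OF Suc.prems(1)] by metis
  obtain g' where g': "\<And>x. (g has_vector_derivative g' x) (at x)" "diffn n g'"
    using diffn_SucE[OF Suc.prems(2)] by metis
  show ?case
    by (rule diffn_SucI[where f'="\<lambda>x. f' x + g' x"])
       (auto intro!: Suc.IH f' g' derivative_eq_intros)
qed simp

lemma diffn_mult: "diffn n f \<Longrightarrow> diffn n g \<Longrightarrow> diffn n (\<lambda>x. f x * g x)"
proof (induction n arbitrary: f g)
  case (Suc n)
  obtain f' where f': "\<And>x. (f has_vector_derivative f' x) (at x)" "diffn n f'"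
    using diffn_SucE[OF Suc.prems(1)] by metis
  obtain g' where g': "\<And>x. (g has_vector_derivative g' x) (at x)" "diffn n g'"
    using diffn_SucE[OF Suc.prems(2)] by metis
  \<comment> \<open>The product rule keeps one factor undifferentiated, so the induction hypothesis
    is needed for \<open>f\<close> and \<open>g\<close> themselves at the lower order.\<close>
  have "diffn n f" "diffn n g"
    using Suc.prems diffn_antimono by (meson Suc_n_not_le_n nat_le_linear)+
  then show ?case
    by (intro diffn_SucI[where f'="\<lambda>x. f x * g' x + f' x * g x"] diffn_add Suc.IH f' g')
       (auto intro!: has_vector_derivative_mult f' g')
qed simp

lemma diffn_affine: "diffn n f \<Longrightarrow> diffn n (\<lambda>x. f (c * x + d))"
proof (induction n arbitrary: f)
  case (Suc n)
  obtain f' where f': "\<And>x. (f has_vector_derivative f' x) (at x)" "diffn n f'"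
    using diffn_SucE[OF Suc.prems(1)] by metis
  have "((f \<circ> (\<lambda>x. c * x + d)) has_vector_derivative c *\<^sub>R f' (c * x + d)) (at x)" for x
    by (rule vector_diff_chain_at) (auto intro!: derivative_eq_intros f')
  then show ?case
    by (intro diffn_SucI[where f'="\<lambda>x. of_real c * f' (c * x + d)"] diffn_mult diffn_const Suc.IH f')
       (auto simp: o_def scaleR_conv_of_real)
qed simp

text \<open>This family is closed under differentiation, which makes all its members smooth.\<close>

definition exp_flat :: "real poly \<Rightarrow> real \<Rightarrow> real" where
  "exp_flat P u = (if 0 < u then poly P (1 / u) * exp (- (1 / u)) else 0)"

lemma poly_exp_minus_tendsto_0: "((\<lambda>w::real. poly P w * exp (- w)) \<longlongrightarrow> 0) at_top"
proof -
  have "((\<lambda>w. \<Sum>i\<le>degree P. coeff P i * (w ^ i / exp w)) \<longlongrightarrow> (\<Sum>i\<le>degree P. coeff P i * 0)) at_top"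
    by (intro tendsto_intros tendsto_power_div_exp_0)
  then show ?thesis
    by (simp add: poly_altdef sum_distrib_right exp_minus field_simps sum_divide_distrib)
qed

text \<open>With w = 1/u the derivative of P(w) exp(-w) is w^2 (P - P')(w) exp(-w); the factor w^2
  is the polynomial \<open>[:0, 0, 1:]\<close>. At 0 the right difference quotient is w P(w)
  exp(-w), which is the same family with \<open>pCons 0 P\<close> and tends to 0.\<close>

lemma exp_flat_deriv:
  "(exp_flat P has_real_derivative exp_flat ([:0, 0, 1:] * (P - pderiv P)) u) (at u)"
proof (cases rule: linorder_cases[of u 0])
  case less
  have "(exp_flat P has_real_derivative 0) (at u)"
    by (rule has_field_derivative_transform_within_open[of "\<lambda>x. 0" _ _ "{..<0}"])
       (use less in \<open>auto simp: exp_flat_def\<close>)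
  then show ?thesis using less by (simp add: exp_flat_def)
next
  case greater
  have inv: "((\<lambda>u::real. 1 / u) has_real_derivative - (1 / u) * (1 / u)) (at u)"
    using greater by (auto intro!: derivative_eq_intros)
  have "((\<lambda>u. poly P (1 / u) * exp (- (1 / u))) has_real_derivative
      (poly (pderiv P) (1 / u) * (- (1 / u) * (1 / u))) * exp (- (1 / u))
       + (exp (- (1 / u)) * - (- (1 / u) * (1 / u))) * poly P (1 / u)) (at u)"
    by (intro DERIV_mult DERIV_chain2[OF poly_DERIV inv] DERIV_chain2[OF DERIV_exp] DERIV_minus inv)
  also have "(poly (pderiv P) (1 / u) * (- (1 / u) * (1 / u))) * exp (- (1 / u))
       + (exp (- (1 / u)) * - (- (1 / u) * (1 / u))) * poly P (1 / u)
      = exp_flat ([:0, 0, 1:] * (P - pderiv P)) u"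
    using greater by (simp add: exp_flat_def algebra_simps)
  finally show ?thesis
    by (rule has_field_derivative_transform_within_open[where S = "{0<..}"])
       (use greater in \<open>auto simp: exp_flat_def\<close>)
next
  case equal
  have "((\<lambda>h. exp_flat P h / h) \<longlongrightarrow> 0) (at_left 0)"
    by (rule tendsto_eventually) (auto simp: exp_flat_def eventually_at_filter)
  moreover have "((\<lambda>h. exp_flat P h / h) \<longlongrightarrow> 0) (at_right 0)"
  proof -
    have "((\<lambda>h. poly (pCons 0 P) (inverse h) * exp (- (inverse h))) \<longlongrightarrow> 0) (at_right (0::real))"
      by (rule filterlim_compose[OF poly_exp_minus_tendsto_0 filterlim_inverse_at_top_right])
    moreover have "eventually (\<lambda>h. poly (pCons 0 P) (inverse h) * exp (- (inverse h)) = exp_flat P h / h)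
       (at_right (0::real))"
      by (auto simp: exp_flat_def eventually_at_filter field_simps)
    ultimately show ?thesis by (rule Lim_transform_eventually)
  qed
  ultimately have "((\<lambda>h. exp_flat P h / h) \<longlongrightarrow> 0) (at 0)"
    by (simp add: filterlim_split_at_real)
  then show ?thesis using equal by (simp add: DERIV_def exp_flat_def)
qed

lemma diffn_exp_flat: "diffn n (\<lambda>u. complex_of_real (exp_flat P u))"
proof (induction n arbitrary: P)
  case (Suc n)
  show ?case
    by (rule diffn_SucI[OF _ Suc[of "[:0, 0, 1:] * (P - pderiv P)"]])
       (intro has_vector_derivative_of_real exp_flat_deriv)
qed simp

text \<open>On (c,d) this is exp(-1/(n(x-c))) exp(-1/(n(d-x))). The index n is a steepness: the
  functions are bounded by 1 and converge to the indicator of the open interval, ready for dominated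
  convergence. The arguments are spelled as affine maps to match
  \<open>diffn_affine\<close>.\<close>

definition bump :: "real \<Rightarrow> real \<Rightarrow> nat \<Rightarrow> real \<Rightarrow> complex" where
  "bump c d n x = of_real (exp_flat 1 (real n * x + - (real n * c)) * exp_flat 1 (- real n * x + real n * d))"

lemma bump_diffn: "diffn m (bump c d n)"
proof -
  have "bump c d n = (\<lambda>x. of_real (exp_flat 1 (real n * x + - (real n * c))) *
      of_real (exp_flat 1 ((- real n) * x + real n * d)))"
    by (auto simp: bump_def)
  then show ?thesis
    using diffn_mult[OF diffn_affine[OF diffn_exp_flat[of m 1], of "real n" "- (real n * c)"]
        diffn_affine[OF diffn_exp_flat[of m 1], of "- real n" "real n * d"]] by (simp only:)
qed

lemma bump_outside:
  assumes "x \<le> c \<or> d \<le> x"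
  shows "bump c d n x = 0"
proof -
  have "real n * x \<le> real n * c \<or> real n * d \<le> real n * x"
    using assms by (auto intro: mult_left_mono)
  then have "exp_flat 1 (real n * x + - (real n * c)) = 0 \<or> exp_flat 1 (- real n * x + real n * d) = 0"
    by (auto simp: exp_flat_def)
  then show ?thesis by (auto simp: bump_def)
qed

lemma bump_test_fun:
  assumes "{c..d} \<subseteq> S"
  shows "test_fun S (bump c d n)"
  unfolding test_fun_iff
proof (intro conjI allI exI[of _ "{c..d}"] impI)
  show "bump c d n x = 0" if "x \<notin> {c..d}" for x
    using that by (intro bump_outside) auto
qed (use assms in \<open>auto intro: bump_diffn\<close>)

lemma exp_flat_1_bounds: "0 \<le> exp_flat 1 u" "exp_flat 1 u \<le> 1"
  by (auto simp: exp_flat_def)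

lemma bump_bounded: "norm (bump c d n x) \<le> 1"
  unfolding bump_def
  by (simp add: abs_mult exp_flat_1_bounds mult_le_one abs_of_nonneg del: of_real_mult)

lemma exp_flat_scaled_tendsto:
  assumes "0 < u"
  shows "(\<lambda>n. exp_flat 1 (real n * u)) \<longlonglongrightarrow> 1"
proof -
  have "(\<lambda>n. exp (- ((1 / u) * (1 / real n)))) \<longlonglongrightarrow> exp (- ((1 / u) * 0))"
    by (intro tendsto_intros lim_1_over_n)
  moreover have "eventually (\<lambda>n. exp (- ((1 / u) * (1 / real n))) = exp_flat 1 (real n * u)) sequentially"
    using eventually_gt_at_top[of 0] by eventually_elim (use assms in \<open>auto simp: exp_flat_def field_simps\<close>)
  ultimately show ?thesis
    using Lim_transform_eventually by fastforce
qed

lemma bump_tendsto: "(\<lambda>n. bump c d n x) \<longlonglongrightarrow> indicator {c<..<d} x"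
proof (cases "x \<in> {c<..<d}")
  case True
  then have "(\<lambda>n. complex_of_real (exp_flat 1 (real n * (x - c)) * exp_flat 1 (real n * (d - x))))
      \<longlonglongrightarrow> of_real (1 * 1)"
    by (intro tendsto_of_real tendsto_mult exp_flat_scaled_tendsto) auto
  then show ?thesis using True
    by (simp add: bump_def algebra_simps)
qed (auto simp: bump_outside)

lemma test_fun_Ioo_support:
  assumes "test_fun {a<..<b} \<phi>" "a < b"
  obtains c d where "a < c" "c < d" "d < b" "\<And>x. x \<notin> {c..d} \<Longrightarrow> \<phi> x = 0"
proof -
  obtain C where C: "compact C" "C \<subseteq> {a<..<b}" "\<And>x. x \<notin> C \<Longrightarrow> \<phi> x = 0"
    using assms(1) unfolding test_fun_def by blast
  have "\<exists>c d. a < c \<and> c < d \<and> d < b \<and> C \<subseteq> {c..d}"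
  proof (cases "C = {}")
    case True
    then show ?thesis using assms(2) by (intro exI[of _ "a + (b - a) / 3"] exI[of _ "a + (b - a) / 2"]) (auto simp: field_simps)
  next
    case False
    obtain c where c: "c \<in> C" "\<forall>x\<in>C. c \<le> x" using compact_attains_inf[OF C(1) False] by auto
    obtain d where d: "d \<in> C" "\<forall>x\<in>C. x \<le> d" using compact_attains_sup[OF C(1) False] by auto
    have "d < b" using C(2) d(1) by auto
    \<comment> \<open>The right end is moved strictly beyond the support, which keeps the interval
      nondegenerate even when the support is a single point.\<close>
    then obtain d' where "d < d'" "d' < b" using dense by blast
    moreover have "a < c" "c \<le> d" using C(2) c d by auto
    moreover have "C \<subseteq> {c..d'}" using c(2) d(2) \<open>d < d'\<close> by force
    ultimately show ?thesis
      by (intro exI[of _ c] exI[of _ d'] conjI) linarith+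
  qed
  then show ?thesis using C(3) that by blast
qed

lemma test_funI:
  assumes "\<And>n. diffn n \<phi>" "{c..d} \<subseteq> S" "\<And>x. x \<notin> {c..d} \<Longrightarrow> \<phi> x = 0"
  shows "test_fun S \<phi>"
  unfolding test_fun_iff using assms by (intro conjI exI[of _ "{c..d}"]) auto

lemma test_fun_add:
  assumes "test_fun S \<phi>" "test_fun S \<psi>"
  shows "test_fun S (\<lambda>x. \<phi> x + \<psi> x)"
proof -
  obtain C where C: "compact C" "C \<subseteq> S" "\<And>x. x \<notin> C \<Longrightarrow> \<phi> x = 0"
    using assms(1) unfolding test_fun_def by blast
  obtain D where D: "compact D" "D \<subseteq> S" "\<And>x. x \<notin> D \<Longrightarrow> \<psi> x = 0"
    using assms(2) unfolding test_fun_def by blast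
  show ?thesis unfolding test_fun_iff
    using assms C D by (intro conjI exI[of _ "C \<union> D"]) (auto simp: test_fun_iff diffn_add)
qed

lemma test_fun_cmult:
  assumes "test_fun S \<phi>"
  shows "test_fun S (\<lambda>x. k * \<phi> x)"
  unfolding test_fun_iff
proof
  show "\<forall>n. diffn n (\<lambda>x. k * \<phi> x)"
    using assms by (auto simp: test_fun_iff intro: diffn_mult)
  show "\<exists>C. compact C \<and> C \<subseteq> S \<and> (\<forall>x. x \<notin> C \<longrightarrow> k * \<phi> x = 0)"
    using assms unfolding test_fun_iff by force
qed

lemma test_fun_zero: "test_fun S (\<lambda>x. 0)"
  unfolding test_fun_iff by auto

lemma test_fun_diff:
  assumes "test_fun S \<phi>" "test_fun S \<psi>"
  shows "test_fun S (\<lambda>x. \<phi> x - \<psi> x)"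
  using test_fun_add[OF assms(1) test_fun_cmult[OF assms(2), of "-1"]] by simp

lemma test_fun_has_deriv:
  assumes "test_fun S \<phi>"
  shows "(\<phi> has_vector_derivative vector_derivative \<phi> (at x)) (at x)"
proof -
  have "diffn 1 \<phi>" using assms by (auto simp: test_fun_iff)
  then show ?thesis by (simp add: vector_derivative_works)
qed

lemma test_fun_continuous:
  assumes "test_fun S \<phi>"
  shows "continuous_on A \<phi>"
  using test_fun_has_deriv[OF assms]
  by (intro continuous_at_imp_continuous_on ballI)
     (meson has_vector_derivative_continuous)

lemma vector_derivative_eq_0_outside:
  fixes \<phi> :: "real \<Rightarrow> complex"
  assumes "closed C" "\<And>x. x \<notin> C \<Longrightarrow> \<phi> x = 0" "x \<notin> C"
  shows "vector_derivative \<phi> (at x) = 0"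
proof (rule vector_derivative_at)
  show "(\<phi> has_vector_derivative 0) (at x)"
    by (rule has_vector_derivative_transform_within_open[of "\<lambda>y. 0" _ _ "- C"])
       (use assms in auto)
qed

lemma test_fun_vector_derivative:
  assumes "test_fun S \<phi>"
  shows "test_fun S (\<lambda>x. vector_derivative \<phi> (at x))"
proof -
  obtain C where C: "compact C" "C \<subseteq> S" "\<And>x. x \<notin> C \<Longrightarrow> \<phi> x = 0"
    using assms(1) unfolding test_fun_def by blast
  have "diffn n (\<lambda>x. vector_derivative \<phi> (at x))" for n
    using assms diffn.simps(2)[of n \<phi>] by (metis test_fun_iff)
  then show ?thesis unfolding test_fun_iff
    using C vector_derivative_eq_0_outside[OF compact_imp_closed[OF C(1)] C(3)] by auto
qed

lemma test_fun_vderiv_iter: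
  assumes "test_fun S \<phi>"
  shows "test_fun S (vderiv_iter k \<phi>)"
  using assms
  by (induction k arbitrary: \<phi>) (auto simp: vderiv_iter_Suc intro: test_fun_vector_derivative)

lemma test_fun_bounded:
  assumes "test_fun S \<phi>"
  obtains B where "0 < B" "\<And>x. norm (\<phi> x) \<le> B"
proof -
  obtain C where C: "compact C" "C \<subseteq> S" "\<And>x. x \<notin> C \<Longrightarrow> \<phi> x = 0"
    using assms(1) unfolding test_fun_def by blast
  have "compact (\<phi> ` C)"
    using C(1) test_fun_continuous[OF assms] by (rule compact_continuous_image[rotated])
  then obtain B where "0 < B" "\<forall>y\<in>\<phi> ` C. norm y \<le> B"
    using compact_imp_bounded bounded_pos by metis
  then have "norm (\<phi> x) \<le> B" for x
    using C(3)[of x] by (cases "x \<in> C") auto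
  then show ?thesis using that \<open>0 < B\<close> by blast
qed

lemma test_fun_measurable [measurable_dest]: "test_fun S \<phi> \<Longrightarrow> \<phi> \<in> borel_measurable borel"
  by (intro borel_measurable_continuous_onI test_fun_continuous)

lemma test_fun_measurable_on: "test_fun S \<phi> \<Longrightarrow> \<phi> \<in> borel_measurable (lebesgue_on A)"
  using test_fun_measurable by (simp add: measurable_completion measurable_restrict_space1)

lemma test_fun_L2:
  assumes "test_fun S \<phi>" "A \<in> lmeasurable"
  shows "\<phi> \<in> L2_space A"
proof -
  obtain B where "0 < B" "\<And>x. norm (\<phi> x) \<le> B" using test_fun_bounded[OF assms(1)] by metis
  then show ?thesis
    by (intro L2_bounded[OF assms(2) test_fun_measurable_on[OF assms(1)], of B]) auto
qed

lemma test_fun_integral_vector_derivative: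
  assumes "test_fun S \<phi>" "c \<le> d"
  shows "((\<lambda>x. vector_derivative \<phi> (at x)) has_integral \<phi> d - \<phi> c) {c..d}"
  by (intro fundamental_theorem_of_calculus assms(2)
        has_vector_derivative_at_within[OF test_fun_has_deriv[OF assms(1)]])

text \<open>The zero mean is what makes the primitive vanish to the right of the support as well as
  to the left; smoothness is inherited because the derivative of the primitive is
  \<open>\<phi>\<close> itself. Differentiability at points up to \<open>a\<close> is argued from
  local vanishing, since there the integral starts no earlier than the point.\<close>

lemma test_fun_antiderivative:
  assumes "test_fun {a<..<b} \<phi>" "a < b" "integral {a..b} \<phi> = 0"
  shows "test_fun {a<..<b} (\<lambda>x. integral {a..x} \<phi>)"
    and "vector_derivative (\<lambda>x. integral {a..x} \<phi>) (at x) = \<phi> x"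
proof -
  obtain c d where cd: "a < c" "c < d" "d < b" "\<And>x. x \<notin> {c..d} \<Longrightarrow> \<phi> x = 0"
    using test_fun_Ioo_support[OF assms(1,2)] by metis
  have cont: "continuous_on A \<phi>" for A
    by (rule test_fun_continuous[OF assms(1)])
  have int: "\<phi> integrable_on {s..t}" for s t
    by (rule integrable_continuous_real[OF cont])
  have zero: "integral {a..x} \<phi> = 0" if "x \<notin> {c..d}" for x
  proof (cases "x < c")
    case True
    then have "integral {a..x} \<phi> = integral {a..x} (\<lambda>x. 0)"
      by (intro integral_cong cd(4)) auto
    then show ?thesis by simp
  next
    case False
    then have x: "d < x" using that by auto
    have 1: "integral {y..z} \<phi> = 0" if "d < y" for y z
    proof -
      have "integral {y..z} \<phi> = integral {y..z} (\<lambda>x. 0)"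
        using that by (intro integral_cong cd(4)) auto
      then show ?thesis by simp
    qed
    show ?thesis
    proof (cases "x \<le> b")
      case True
      then have "integral {a..x} \<phi> + integral {x..b} \<phi> = integral {a..b} \<phi>"
        using x cd by (intro Henstock_Kurzweil_Integration.integral_combine int) auto
      then show ?thesis using 1[OF x] assms(3) by simp
    next
      case False
      then have "integral {a..b} \<phi> + integral {b..x} \<phi> = integral {a..x} \<phi>"
        using x cd by (intro Henstock_Kurzweil_Integration.integral_combine int) auto
      then show ?thesis using 1[of b x] cd assms(3) by simp
    qed
  qed
  have deriv: "((\<lambda>x. integral {a..x} \<phi>) has_vector_derivative \<phi> x) (at x)" for x
  proof (cases "x \<le> a")
    case False
    have "((\<lambda>u. integral {a..u} \<phi>) has_vector_derivative \<phi> x) (at x within {a..x + 1})"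
      using False by (intro integral_has_vector_derivative cont) auto
    then have "((\<lambda>u. integral {a..u} \<phi>) has_vector_derivative \<phi> x) (at x within {a<..<x + 1})"
      by (rule has_vector_derivative_within_subset) auto
    then show ?thesis using False
      by (subst (asm) has_vector_derivative_within_open) auto
  next
    case True
    have "((\<lambda>x. integral {a..x} \<phi>) has_vector_derivative 0) (at x)"
      by (rule has_vector_derivative_transform_within_open[of "\<lambda>y. 0" _ _ "{..<c}"])
         (use zero cd True in auto)
    moreover have "\<phi> x = 0" using cd True by auto
    ultimately show ?thesis by simp
  qed
  show "vector_derivative (\<lambda>x. integral {a..x} \<phi>) (at x) = \<phi> x"
    by (rule vector_derivative_at[OF deriv])
  have "diffn n (\<lambda>x. integral {a..x} \<phi>)" for n
  proof (cases n)
    case (Suc m)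
    have "diffn m \<phi>" using assms(1) by (simp add: test_fun_iff)
    then show ?thesis using Suc diffn_SucI[OF deriv] by simp
  qed simp
  then show "test_fun {a<..<b} (\<lambda>x. integral {a..x} \<phi>)"
    using zero cd by (intro test_funI[where c=c and d=d]) auto
qed

section \<open>Weak derivatives and Sobolev spaces\<close>

lemma integrable_lebesgue_on_support:
  fixes f :: "real \<Rightarrow> complex"
  assumes "C \<subseteq> S" "C \<in> sets lebesgue" "S \<in> sets lebesgue" "\<And>x. x \<in> S \<Longrightarrow> x \<notin> C \<Longrightarrow> f x = 0"
  shows "integrable (lebesgue_on S) f \<longleftrightarrow> integrable (lebesgue_on C) f"
proof -
  have "(\<lambda>x. if x \<in> S then f x else 0) = (\<lambda>x. if x \<in> C then f x else 0)"
    by (intro ext) (use assms in auto)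
  then show ?thesis
    using assms(2,3) by (metis Lebesgue_Measure.integrable_restrict_UNIV)
qed

lemma integral_lebesgue_on_support:
  fixes f :: "real \<Rightarrow> complex"
  assumes "C \<subseteq> S" "C \<in> sets lebesgue" "S \<in> sets lebesgue" "\<And>x. x \<in> S \<Longrightarrow> x \<notin> C \<Longrightarrow> f x = 0"
  shows "integral\<^sup>L (lebesgue_on S) f = integral\<^sup>L (lebesgue_on C) f"
proof -
  have "(\<lambda>x. if x \<in> S then f x else 0) = (\<lambda>x. if x \<in> C then f x else 0)"
    by (intro ext) (use assms in auto)
  then show ?thesis
    using assms(2,3) by (metis Lebesgue_Measure.integral_restrict_UNIV)
qed

text \<open>Lebesgue differentiation: forward averages of g converge to g almost everywhere, and all
  of them vanish. As g is integrable on compact subintervals only, the argument runs on the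
  exhaustion by the intervals from \<open>lo n\<close> to \<open>hi n\<close>, with g cut off
  outside, and k is kept so small that the averaging interval stays inside.\<close>

lemma AE_zero_if_integral_zero_Icc:
  fixes g :: "real \<Rightarrow> complex"
  assumes g: "\<And>c d. a < c \<Longrightarrow> c < d \<Longrightarrow> d < b \<Longrightarrow> g integrable_on {c..d} \<and> integral {c..d} g = 0"
  shows "AE x in lebesgue_on {a<..<b}. g x = 0"
proof -
  define lo hi where "lo n = a + 1 / real (Suc n)" and "hi n = b - 1 / real (Suc n)" for n
  have step: "AE x in lebesgue. x \<in> {lo n<..<hi n} \<longrightarrow> g x = 0" for n
  proof (cases "lo n < hi n")
    case True
    define h where "h x = (if x \<in> {lo n..hi n} then g x else 0)" for x
    have ab: "a < lo n" "hi n < b" by (auto simp: lo_def hi_def)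
    have "h integrable_on UNIV"
      unfolding h_def using g[OF ab(1) True ab(2)]
      by (subst Henstock_Kurzweil_Integration.integrable_restrict_UNIV) auto
    then have "h integrable_on cbox s t" for s t
      using integrable_on_subcbox by blast
    then obtain N where N: "negligible N"
      "\<And>x e. \<lbrakk>x \<notin> N; 0 < e\<rbrakk> \<Longrightarrow> \<exists>d>0. \<forall>k. 0 < k \<and> k < d \<longrightarrow>
           norm (integral (cbox x (x + k *\<^sub>R One)) h /\<^sub>R k ^ DIM(real) - h x) < e"
      using integrable_ccontinuous_explicit[of h] by metis
    have "g x = 0" if x: "x \<in> {lo n<..<hi n}" "x \<notin> N" for x
    proof (rule ccontr)
      assume "g x \<noteq> 0"
      then have "0 < norm (h x)" using x by (auto simp: h_def)
      then obtain \<delta> where \<delta>: "\<delta> > 0" "\<And>k. 0 < k \<Longrightarrow> k < \<delta> \<Longrightarrow>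
           norm (integral (cbox x (x + k *\<^sub>R One)) h /\<^sub>R k ^ DIM(real) - h x) < norm (h x)"
        using N(2)[OF x(2), of "norm (h x)"] by auto
      define k where "k = min (\<delta> / 2) ((hi n - x) / 2)"
      have k: "0 < k" "k < \<delta>" "x + k < hi n"
        using \<delta>(1) x by (auto simp: k_def min_def field_simps)
      have "integral {x..x + k} h = integral {x..x + k} g"
        using x k by (intro integral_cong) (auto simp: h_def)
      also have "\<dots> = 0"
        using g[of x "x + k"] x k ab by auto
      finally show False using \<delta>(2)[OF k(1,2)] by simp
    qed
    moreover have "AE x in lebesgue. x \<notin> N"
      using N(1) by (simp add: AE_not_in negligible_iff_null_sets)
    ultimately show ?thesis by (auto elim!: eventually_mono)
  qed auto
  then have "AE x in lebesgue. \<forall>n. x \<in> {lo n<..<hi n} \<longrightarrow> g x = 0"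
    unfolding AE_all_countable by blast
  then have "AE x in lebesgue. x \<in> {a<..<b} \<longrightarrow> g x = 0"
  proof eventually_elim
    case (elim x)
    show ?case
    proof
      assume x: "x \<in> {a<..<b}"
      obtain n where n: "1 / real (Suc n) < min (x - a) (b - x)"
        using x nat_approx_posE[of "min (x - a) (b - x)"] by auto
      then have "x \<in> {lo n<..<hi n}" by (auto simp: lo_def hi_def)
      then show "g x = 0" using elim by blast
    qed
  qed
  then show ?thesis by (simp add: AE_restrict_space_iff)
qed

lemma locally_integrable_mult_test_fun:
  assumes "locally_integrable S g" "test_fun S \<phi>" "S \<in> sets lebesgue"
  shows "integrable (lebesgue_on S) (\<lambda>x. g x * \<phi> x)"
proof -
  obtain C where C: "compact C" "C \<subseteq> S" "\<And>x. x \<notin> C \<Longrightarrow> \<phi> x = 0"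
    using assms(2) unfolding test_fun_def by blast
  obtain B where B: "0 < B" "\<And>x. norm (\<phi> x) \<le> B"
    using test_fun_bounded[OF assms(2)] by metis
  have g: "integrable (lebesgue_on C) g"
    using assms(1) C by (auto simp: locally_integrable_def)
  have meas: "C \<in> sets lebesgue" using C(1) by (simp add: compact_imp_closed)
  have "integrable (lebesgue_on C) (\<lambda>x. g x * \<phi> x)"
  proof (rule Bochner_Integration.integrable_bound)
    show "integrable (lebesgue_on C) (\<lambda>x. of_real B * g x)" using g by simp
    show "(\<lambda>x. g x * \<phi> x) \<in> borel_measurable (lebesgue_on C)"
      using g test_fun_measurable_on[OF assms(2)] by (intro borel_measurable_times) auto
    show "AE x in lebesgue_on C. norm (g x * \<phi> x) \<le> norm (of_real B * g x)"
      using B by (intro AE_I2) (auto simp: norm_mult mult.commute intro!: mult_right_mono)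
  qed
  then show ?thesis
    using C meas assms(3) by (subst integrable_lebesgue_on_support[of C]) auto
qed

lemma locally_integrable_add:
  "locally_integrable S f \<Longrightarrow> locally_integrable S g \<Longrightarrow> locally_integrable S (\<lambda>x. f x + g x)"
  by (auto simp: locally_integrable_def)

lemma locally_integrable_cmult:
  "locally_integrable S f \<Longrightarrow> locally_integrable S (\<lambda>x. c * f x)"
  by (auto simp: locally_integrable_def)

lemma locally_integrable_diff:
  "locally_integrable S f \<Longrightarrow> locally_integrable S g \<Longrightarrow> locally_integrable S (\<lambda>x. f x - g x)"
  by (auto simp: locally_integrable_def)

lemma integrable_lebesgue_on_mono:
  fixes f :: "real \<Rightarrow> 'b::{banach, second_countable_topology}"
  assumes "integrable (lebesgue_on S) f" "A \<subseteq> S" "A \<in> sets lebesgue" "S \<in> sets lebesgue"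
  shows "integrable (lebesgue_on A) f"
proof -
  have "set_integrable lebesgue S f"
    using assms(1,4) by (simp add: set_integrable_def integrable_restrict_space)
  then have "set_integrable lebesgue A f"
    by (rule set_integrable_subset[OF _ assms(3,2)])
  then show ?thesis
    using assms(3) by (simp add: set_integrable_def integrable_restrict_space)
qed

lemma L2_subset:
  assumes "v \<in> L2_space S" "A \<subseteq> S" "A \<in> sets lebesgue" "S \<in> sets lebesgue"
  shows "v \<in> L2_space A"
proof -
  have "v \<in> borel_measurable (lebesgue_on A)"
    using measurable_restrict_mono[OF L2_spaceD(1)[OF assms(1)] assms(2)] .
  moreover have "integrable (lebesgue_on A) (\<lambda>x. (norm (v x))\<^sup>2)"
    by (rule integrable_lebesgue_on_mono[OF L2_spaceD(2)[OF assms(1)] assms(2-4)])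
  ultimately show ?thesis by (simp add: L2_space_def)
qed

lemma L2_locally_integrable:
  assumes "v \<in> L2_space S" "S \<in> sets lebesgue"
  shows "locally_integrable S v"
  unfolding locally_integrable_def
proof (intro allI impI)
  fix C assume C: "compact C \<and> C \<subseteq> S"
  then have "C \<in> lmeasurable" by (simp add: lmeasurable_compact)
  then show "integrable (lebesgue_on C) v"
    using L2_subset[OF assms(1) _ _ assms(2)] C by (intro L2_integrable) (auto dest: fmeasurableD)
qed

text \<open>The fundamental lemma of the calculus of variations. Bump functions converge boundedly
  to the indicator of (c,d), so the integral of g over every compact subinterval is zero.\<close>

lemma test_fun_orthogonal_imp_AE_zero:
  assumes "a < b" "locally_integrable {a<..<b} g"
    and "\<And>\<phi>. test_fun {a<..<b} \<phi> \<Longrightarrow> (LINT x|lebesgue_on {a<..<b}. g x * \<phi> x) = 0"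
  shows "AE x in lebesgue_on {a<..<b}. g x = 0"
proof (rule AE_zero_if_integral_zero_Icc)
  fix c d assume cd: "a < c" "c < d" "d < b"
  have g: "integrable (lebesgue_on {c..d}) g"
  proof -
    have "compact {c..d} \<and> {c..d} \<subseteq> {a<..<b}" using cd by auto
    then show ?thesis using assms(2) unfolding locally_integrable_def by blast
  qed
  have tf: "test_fun {a<..<b} (bump c d n)" for n
    using cd by (intro bump_test_fun) auto
  have "(\<lambda>n. LINT x|lebesgue_on {c..d}. g x * bump c d n x)
      \<longlonglongrightarrow> (LINT x|lebesgue_on {c..d}. g x * indicator {c<..<d} x)"
  proof (rule integral_dominated_convergence[where w="\<lambda>x. norm (g x)"])
    have "indicator {c<..<d} \<in> borel_measurable (lebesgue_on {c..d})"
      by (intro borel_measurable_indicator) (auto simp: sets_restrict_space_iff)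
    then show "(\<lambda>x. g x * indicator {c<..<d} x) \<in> borel_measurable (lebesgue_on {c..d})"
      using g by (intro borel_measurable_times) auto
    show "(\<lambda>x. g x * bump c d n x) \<in> borel_measurable (lebesgue_on {c..d})" for n
      using g test_fun_measurable_on[OF tf] by (intro borel_measurable_times) auto
    show "AE x in lebesgue_on {c..d}. (\<lambda>n. g x * bump c d n x) \<longlonglongrightarrow> g x * indicator {c<..<d} x"
      by (intro AE_I2 tendsto_intros bump_tendsto)
    show "AE x in lebesgue_on {c..d}. norm (g x * bump c d n x) \<le> norm (g x)" for n
      using bump_bounded by (intro AE_I2) (auto simp: norm_mult mult_left_le)
  qed (use g in auto)
  moreover have "(LINT x|lebesgue_on {c..d}. g x * bump c d n x) = 0" for n
  proof -
    have "(LINT x|lebesgue_on {a<..<b}. g x * bump c d n x) = (LINT x|lebesgue_on {c..d}. g x * bump c d n x)"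
      using cd by (intro integral_lebesgue_on_support) (auto simp: bump_outside)
    then show ?thesis using assms(3)[OF tf] by simp
  qed
  ultimately have "(\<lambda>n. 0) \<longlonglongrightarrow> (LINT x|lebesgue_on {c..d}. g x * indicator {c<..<d} x)"
    by simp
  then have 0: "(LINT x|lebesgue_on {c..d}. g x * indicator {c<..<d} x) = 0"
    by (simp add: LIMSEQ_const_iff)
  have "integral {c..d} g = integral {c..d} (\<lambda>x. g x * indicator {c<..<d} x)"
    by (rule integral_spike[of "{c, d}"]) auto
  also have "\<dots> = (LINT x|lebesgue_on {c..d}. g x * indicator {c<..<d} x)"
  proof (rule lebesgue_integral_eq_integral[symmetric])
    have "indicator {c<..<d} \<in> borel_measurable (lebesgue_on {c..d})"
      by (intro borel_measurable_indicator) (auto simp: sets_restrict_space_iff)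
    then have "(\<lambda>x. g x * indicator {c<..<d} x) \<in> borel_measurable (lebesgue_on {c..d})"
      using g by (intro borel_measurable_times) auto
    then show "integrable (lebesgue_on {c..d}) (\<lambda>x. g x * indicator {c<..<d} x)"
      by (rule Bochner_Integration.integrable_bound[OF g]) (auto simp: indicator_def)
  qed auto
  finally show "g integrable_on {c..d} \<and> integral {c..d} g = 0"
    using 0 integrable_on_lebesgue_on[OF g] by simp
qed

lemma has_weak_deriv_AE_unique:
  assumes "a < b" "has_weak_deriv {a<..<b} k v g" "has_weak_deriv {a<..<b} k v g'"
  shows "AE x in lebesgue_on {a<..<b}. g x = g' x"
proof -
  have loc: "locally_integrable {a<..<b} g" "locally_integrable {a<..<b} g'"
    using assms by (auto simp: has_weak_deriv_def)
  have "AE x in lebesgue_on {a<..<b}. g x - g' x = 0"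
  proof (rule test_fun_orthogonal_imp_AE_zero[OF assms(1) locally_integrable_diff[OF loc]])
    fix \<phi> assume \<phi>: "test_fun {a<..<b} \<phi>"
    have "(LINT x|lebesgue_on {a<..<b}. v x * vderiv_iter k \<phi> x)
        = (- 1) ^ k * (LINT x|lebesgue_on {a<..<b}. g x * \<phi> x)"
      using assms(2) \<phi> unfolding has_weak_deriv_def by blast
    moreover have "(LINT x|lebesgue_on {a<..<b}. v x * vderiv_iter k \<phi> x)
        = (- 1) ^ k * (LINT x|lebesgue_on {a<..<b}. g' x * \<phi> x)"
      using assms(3) \<phi> unfolding has_weak_deriv_def by blast
    ultimately have "(LINT x|lebesgue_on {a<..<b}. g x * \<phi> x) = (LINT x|lebesgue_on {a<..<b}. g' x * \<phi> x)"
      by simp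
    then show "(LINT x|lebesgue_on {a<..<b}. (g x - g' x) * \<phi> x) = 0"
      using locally_integrable_mult_test_fun[OF loc(1) \<phi>] locally_integrable_mult_test_fun[OF loc(2) \<phi>]
      by (simp add: left_diff_distrib)
  qed
  then show ?thesis by simp
qed

lemma has_weak_deriv_0:
  "locally_integrable S v \<Longrightarrow> has_weak_deriv S 0 v v"
  by (simp add: has_weak_deriv_def)

lemma has_weak_deriv_add:
  assumes "has_weak_deriv S k u g" "has_weak_deriv S k v h" "S \<in> sets lebesgue"
  shows "has_weak_deriv S k (\<lambda>x. u x + v x) (\<lambda>x. g x + h x)"
  unfolding has_weak_deriv_def
proof (intro conjI allI impI)
  have loc: "locally_integrable S u" "locally_integrable S v" "locally_integrable S g" "locally_integrable S h"
    using assms by (auto simp: has_weak_deriv_def)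
  then show "locally_integrable S (\<lambda>x. u x + v x)" "locally_integrable S (\<lambda>x. g x + h x)"
    by (auto intro: locally_integrable_add)
  fix \<phi> assume \<phi>: "test_fun S \<phi>"
  then have \<phi>': "test_fun S (vderiv_iter k \<phi>)" by (rule test_fun_vderiv_iter)
  show "(LINT x|lebesgue_on S. (u x + v x) * vderiv_iter k \<phi> x)
      = (- 1) ^ k * (LINT x|lebesgue_on S. (g x + h x) * \<phi> x)"
    using assms(1,2) \<phi> locally_integrable_mult_test_fun[OF loc(1) \<phi>' assms(3)]
      locally_integrable_mult_test_fun[OF loc(2) \<phi>' assms(3)]
      locally_integrable_mult_test_fun[OF loc(3) \<phi> assms(3)]
      locally_integrable_mult_test_fun[OF loc(4) \<phi> assms(3)]
    by (simp add: has_weak_deriv_def distrib_right distrib_left)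
qed

lemma has_weak_deriv_cmult:
  assumes "has_weak_deriv S k u g"
  shows "has_weak_deriv S k (\<lambda>x. c * u x) (\<lambda>x. c * g x)"
  using assms unfolding has_weak_deriv_def
  by (auto simp: mult.assoc mult.left_commute intro: locally_integrable_cmult)

lemma has_weak_deriv_diff:
  assumes "has_weak_deriv S k u g" "has_weak_deriv S k v h" "S \<in> sets lebesgue"
  shows "has_weak_deriv S k (\<lambda>x. u x - v x) (\<lambda>x. g x - h x)"
  using has_weak_deriv_add[OF assms(1) has_weak_deriv_cmult[OF assms(2), of "-1"] assms(3)] by simp

text \<open>Completeness of Lebesgue measure. It lets the representative picked by
  \<open>weak_deriv\<close> inherit measurability from any known weak derivative.\<close>

lemma borel_measurable_lebesgue_on_AE:
  fixes f g :: "real \<Rightarrow> complex"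
  assumes "f \<in> borel_measurable (lebesgue_on S)" "AE x in lebesgue_on S. f x = g x" "S \<in> sets lebesgue"
  shows "g \<in> borel_measurable (lebesgue_on S)"
proof -
  have "(\<lambda>x. if x \<in> S then f x else 0) \<in> borel_measurable lebesgue"
    using assms(1,3) by (simp add: borel_measurable_if)
  moreover have "AE x in lebesgue. (if x \<in> S then f x else 0) = (if x \<in> S then g x else 0)"
    using assms(2,3) by (auto simp: AE_restrict_space_iff elim!: eventually_mono)
  ultimately have "(\<lambda>x. if x \<in> S then g x else 0) \<in> borel_measurable lebesgue"
    by (rule borel_measurable_AE)
  then show ?thesis using assms(3) by (simp add: borel_measurable_if)
qed

lemma locally_integrable_cong_AE:
  assumes "locally_integrable S f" "AE x in lebesgue_on S. f x = g x" "S \<in> sets lebesgue"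
  shows "locally_integrable S g"
  unfolding locally_integrable_def
proof (intro allI impI)
  fix C assume C: "compact C \<and> C \<subseteq> S"
  have f: "integrable (lebesgue_on C) f"
    using assms(1) C by (auto simp: locally_integrable_def)
  have Cm: "C \<in> sets lebesgue" using C by (simp add: compact_imp_closed)
  have ae: "AE x in lebesgue_on C. f x = g x"
    using assms(2,3) C Cm by (auto simp: AE_restrict_space_iff elim!: eventually_mono)
  have "g \<in> borel_measurable (lebesgue_on C)"
    using borel_measurable_lebesgue_on_AE[OF _ ae Cm] f by auto
  then show "integrable (lebesgue_on C) g"
    by (rule integrable_cong_AE_imp[OF f _ ae])
qed

lemma LINT_mult_test_fun_cong_AE:
  assumes "locally_integrable S f" "AE x in lebesgue_on S. f x = g x" "S \<in> sets lebesgue" "test_fun S \<phi>"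
  shows "(LINT x|lebesgue_on S. f x * \<phi> x) = (LINT x|lebesgue_on S. g x * \<phi> x)"
proof (rule integral_cong_AE)
  show "(\<lambda>x. f x * \<phi> x) \<in> borel_measurable (lebesgue_on S)"
    using locally_integrable_mult_test_fun[OF assms(1,4,3)] by auto
  show "(\<lambda>x. g x * \<phi> x) \<in> borel_measurable (lebesgue_on S)"
    using locally_integrable_mult_test_fun[OF locally_integrable_cong_AE[OF assms(1-3)] assms(4,3)] by auto
  show "AE x in lebesgue_on S. f x * \<phi> x = g x * \<phi> x"
    using assms(2) by eventually_elim simp
qed

lemma has_weak_deriv_cong_AE:
  assumes "has_weak_deriv S k u g" "AE x in lebesgue_on S. u x = v x" "AE x in lebesgue_on S. g x = h x"
    and "S \<in> sets lebesgue"
  shows "has_weak_deriv S k v h"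
  unfolding has_weak_deriv_def
proof (intro conjI allI impI)
  have loc: "locally_integrable S u" "locally_integrable S g"
    using assms by (auto simp: has_weak_deriv_def)
  show "locally_integrable S v" "locally_integrable S h"
    using locally_integrable_cong_AE assms loc by auto
  fix \<phi> assume \<phi>: "test_fun S \<phi>"
  show "(LINT x|lebesgue_on S. v x * vderiv_iter k \<phi> x) = (- 1) ^ k * (LINT x|lebesgue_on S. h x * \<phi> x)"
    using assms(1) \<phi> LINT_mult_test_fun_cong_AE[OF loc(1) assms(2,4) test_fun_vderiv_iter[OF \<phi>], of k]
      LINT_mult_test_fun_cong_AE[OF loc(2) assms(3,4) \<phi>]
    by (simp add: has_weak_deriv_def)
qed

lemma has_weak_deriv_weak_deriv:
  "has_weak_deriv S k v g \<Longrightarrow> has_weak_deriv S k v (weak_deriv S k v)"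
  unfolding weak_deriv_def by (rule someI[of "has_weak_deriv S k v"])

lemma weak_deriv_AE_eq:
  assumes "a < b" "has_weak_deriv {a<..<b} k v g"
  shows "AE x in lebesgue_on {a<..<b}. weak_deriv {a<..<b} k v x = g x"
  using has_weak_deriv_AE_unique[OF assms(1) has_weak_deriv_weak_deriv[OF assms(2)] assms(2)] .

lemma weak_deriv_L2:
  assumes "a < b" "has_weak_deriv {a<..<b} k v g" "g \<in> L2_space {a<..<b}"
  shows "weak_deriv {a<..<b} k v \<in> L2_space {a<..<b}"
proof -
  have ae: "AE x in lebesgue_on {a<..<b}. g x = weak_deriv {a<..<b} k v x"
    using weak_deriv_AE_eq[OF assms(1,2)] by (auto elim: eventually_mono)
  show ?thesis
    by (rule L2_cong_AE[OF assms(3) ae borel_measurable_lebesgue_on_AE[OF L2_spaceD(1)[OF assms(3)] ae]]) simp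
qed

lemma L2_norm_weak_deriv:
  assumes "a < b" "has_weak_deriv {a<..<b} k v g" "g \<in> L2_space {a<..<b}"
  shows "L2_norm {a<..<b} (weak_deriv {a<..<b} k v) = L2_norm {a<..<b} g"
  by (rule L2_norm_cong_AE[OF L2_spaceD(1)[OF weak_deriv_L2[OF assms]] L2_spaceD(1)[OF assms(3)]
        weak_deriv_AE_eq[OF assms(1,2)]])

lemma sobolevD:
  assumes "v \<in> sobolev {a<..<b} q" "a < b" "k \<le> q"
  shows "has_weak_deriv {a<..<b} k v (weak_deriv {a<..<b} k v)"
    and "weak_deriv {a<..<b} k v \<in> L2_space {a<..<b}"
proof -
  obtain g where g: "g \<in> L2_space {a<..<b}" "has_weak_deriv {a<..<b} k v g"
    using assms by (auto simp: sobolev_def)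
  then show "has_weak_deriv {a<..<b} k v (weak_deriv {a<..<b} k v)"
    "weak_deriv {a<..<b} k v \<in> L2_space {a<..<b}"
    using has_weak_deriv_weak_deriv weak_deriv_L2[OF assms(2)] by auto
qed

lemma sobolev_L2: "v \<in> sobolev S q \<Longrightarrow> v \<in> L2_space S"
  by (simp add: sobolev_def)

lemma sobolev_mono: "v \<in> sobolev S q \<Longrightarrow> r \<le> q \<Longrightarrow> v \<in> sobolev S r"
  by (auto simp: sobolev_def)

text \<open>Read as the Euclidean norm of a finite vector of L2 norms, the Sobolev norm obtains its
  triangle inequality from Minkowski's inequality for sums, and its duality estimate from
  Cauchy-Schwarz for sums.\<close>

lemma sobolev_norm_L2_set: "sobolev_norm S q v = L2_set (\<lambda>k. L2_norm S (weak_deriv S k v)) {..q}"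
  by (simp add: sobolev_norm_def L2_set_def)

lemma sobolev_norm_nonneg [simp]: "0 \<le> sobolev_norm S q v"
  by (simp add: sobolev_norm_def sum_nonneg)

lemma L2_norm_weak_deriv_le_sobolev_norm:
  assumes "k \<le> q"
  shows "L2_norm S (weak_deriv S k v) \<le> sobolev_norm S q v"
  unfolding sobolev_norm_L2_set using assms by (intro member_le_L2_set) auto

lemma sobolev_norm_mono: "r \<le> q \<Longrightarrow> sobolev_norm S r v \<le> sobolev_norm S q v"
  unfolding sobolev_norm_def by (intro real_sqrt_le_mono sum_mono2) auto

lemma sobolev_add:
  assumes "u \<in> sobolev {a<..<b} q" "v \<in> sobolev {a<..<b} q" "a < b"
  shows "(\<lambda>x. u x + v x) \<in> sobolev {a<..<b} q"
    and "sobolev_norm {a<..<b} q (\<lambda>x. u x + v x) \<le> sobolev_norm {a<..<b} q u + sobolev_norm {a<..<b} q v"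
proof -
  let ?S = "{a<..<b}"
  have d: "has_weak_deriv ?S k (\<lambda>x. u x + v x) (\<lambda>x. weak_deriv ?S k u x + weak_deriv ?S k v x)"
          "(\<lambda>x. weak_deriv ?S k u x + weak_deriv ?S k v x) \<in> L2_space ?S" if "k \<le> q" for k
    using sobolevD[OF assms(1,3) that] sobolevD[OF assms(2,3) that]
    by (auto intro: has_weak_deriv_add L2_add)
  then show "(\<lambda>x. u x + v x) \<in> sobolev ?S q"
    using L2_add[OF sobolev_L2[OF assms(1)] sobolev_L2[OF assms(2)]] by (auto simp: sobolev_def)
  have "sobolev_norm ?S q (\<lambda>x. u x + v x)
      \<le> L2_set (\<lambda>k. L2_norm ?S (weak_deriv ?S k u) + L2_norm ?S (weak_deriv ?S k v)) {..q}"
    unfolding sobolev_norm_L2_set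
  proof (rule L2_set_mono)
    fix k assume "k \<in> {..q}"
    then have k: "k \<le> q" by simp
    show "L2_norm ?S (weak_deriv ?S k (\<lambda>x. u x + v x))
        \<le> L2_norm ?S (weak_deriv ?S k u) + L2_norm ?S (weak_deriv ?S k v)"
      unfolding L2_norm_weak_deriv[OF assms(3) d[OF k]]
      by (intro L2_norm_triangle sobolevD[OF assms(1,3) k] sobolevD[OF assms(2,3) k])
  qed auto
  also have "\<dots> \<le> sobolev_norm ?S q u + sobolev_norm ?S q v"
    unfolding sobolev_norm_L2_set by (rule L2_set_triangle_ineq)
  finally show "sobolev_norm ?S q (\<lambda>x. u x + v x) \<le> sobolev_norm ?S q u + sobolev_norm ?S q v" .
qed

lemma sobolev_cmult:
  assumes "v \<in> sobolev {a<..<b} q" "a < b"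
  shows "(\<lambda>x. c * v x) \<in> sobolev {a<..<b} q"
    and "sobolev_norm {a<..<b} q (\<lambda>x. c * v x) = norm c * sobolev_norm {a<..<b} q v"
proof -
  let ?S = "{a<..<b}"
  have d: "has_weak_deriv ?S k (\<lambda>x. c * v x) (\<lambda>x. c * weak_deriv ?S k v x)"
          "(\<lambda>x. c * weak_deriv ?S k v x) \<in> L2_space ?S" if "k \<le> q" for k
    using sobolevD[OF assms that] by (auto intro: has_weak_deriv_cmult L2_cmult)
  then show "(\<lambda>x. c * v x) \<in> sobolev ?S q"
    using L2_cmult[OF sobolev_L2[OF assms(1)]] by (auto simp: sobolev_def)
  have "sobolev_norm ?S q (\<lambda>x. c * v x) = L2_set (\<lambda>k. norm c * L2_norm ?S (weak_deriv ?S k v)) {..q}"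
    unfolding sobolev_norm_L2_set
    by (intro L2_set_cong refl) (simp add: L2_norm_weak_deriv[OF assms(2) d] L2_norm_cmult)
  also have "\<dots> = norm c * sobolev_norm ?S q v"
    unfolding sobolev_norm_L2_set by (simp add: L2_set_right_distrib)
  finally show "sobolev_norm ?S q (\<lambda>x. c * v x) = norm c * sobolev_norm ?S q v" .
qed

lemma sobolev_diff:
  assumes "u \<in> sobolev {a<..<b} q" "v \<in> sobolev {a<..<b} q" "a < b"
  shows "(\<lambda>x. u x - v x) \<in> sobolev {a<..<b} q"
  using sobolev_add(1)[OF assms(1) sobolev_cmult(1)[OF assms(2,3), of "-1"] assms(3)] by simp

lemma sobolev_zero:
  assumes "a < b"
  shows "(\<lambda>x. 0) \<in> sobolev {a<..<b} q" "sobolev_norm {a<..<b} q (\<lambda>x. 0) = 0"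
proof -
  have d: "has_weak_deriv {a<..<b} k (\<lambda>x. 0) (\<lambda>x. 0)" for k
    by (auto simp: has_weak_deriv_def locally_integrable_def)
  then show "(\<lambda>x. 0) \<in> sobolev {a<..<b} q"
    unfolding sobolev_def using L2_zero by blast
  show "sobolev_norm {a<..<b} q (\<lambda>x. 0) = 0"
    unfolding sobolev_norm_def by (simp add: L2_norm_weak_deriv[OF assms d])
qed

lemma sobolev_sum:
  assumes "\<And>i. i \<in> I \<Longrightarrow> v i \<in> sobolev {a<..<b} q" "a < b"
  shows "(\<lambda>x. \<Sum>i\<in>I. v i x) \<in> sobolev {a<..<b} q
    \<and> sobolev_norm {a<..<b} q (\<lambda>x. \<Sum>i\<in>I. v i x) \<le> (\<Sum>i\<in>I. sobolev_norm {a<..<b} q (v i))"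
  using assms(1)
proof (induction I rule: infinite_finite_induct)
  case (insert i I)
  then have IH: "(\<lambda>x. \<Sum>i\<in>I. v i x) \<in> sobolev {a<..<b} q"
    "sobolev_norm {a<..<b} q (\<lambda>x. \<Sum>i\<in>I. v i x) \<le> (\<Sum>i\<in>I. sobolev_norm {a<..<b} q (v i))"
    by auto
  show ?case
    using sobolev_add[of "v i" a b q, OF _ IH(1) assms(2)] insert IH(2) by force
qed (auto simp: sobolev_zero assms)

lemma sobolev_cong_AE:
  assumes "v \<in> sobolev {a<..<b} q" "a < b" "AE x in lebesgue_on {a<..<b}. v x = w x"
  shows "w \<in> sobolev {a<..<b} q" "sobolev_norm {a<..<b} q w = sobolev_norm {a<..<b} q v"
proof -
  let ?S = "{a<..<b}"
  have d: "has_weak_deriv ?S k w (weak_deriv ?S k v)" if "k \<le> q" for k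
    by (rule has_weak_deriv_cong_AE[OF sobolevD(1)[OF assms(1,2) that] assms(3)]) auto
  have "w \<in> L2_space ?S"
    by (rule L2_cong_AE[OF sobolev_L2[OF assms(1)] assms(3)
          borel_measurable_lebesgue_on_AE[OF L2_spaceD(1)[OF sobolev_L2[OF assms(1)]] assms(3)]]) auto
  then show "w \<in> sobolev ?S q"
    using d sobolevD(2)[OF assms(1,2)] by (auto simp: sobolev_def)
  show "sobolev_norm ?S q w = sobolev_norm ?S q v"
    unfolding sobolev_norm_L2_set
    by (intro L2_set_cong refl) (simp add: L2_norm_weak_deriv[OF assms(2) d sobolevD(2)[OF assms(1,2)]])
qed

lemma L2_norm_weak_deriv_0:
  assumes "v \<in> L2_space {a<..<b}" "a < b"
  shows "L2_norm {a<..<b} (weak_deriv {a<..<b} 0 v) = L2_norm {a<..<b} v"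
  by (rule L2_norm_weak_deriv[OF assms(2) has_weak_deriv_0[OF L2_locally_integrable[OF assms(1)]] assms(1)]) simp

section \<open>Density of the test functions\<close>

lemma L2_norm_dominated_convergence:
  assumes "w \<in> L2_space S" "f \<in> borel_measurable (lebesgue_on S)"
    and "\<And>n. s n \<in> borel_measurable (lebesgue_on S)"
    and "AE x in lebesgue_on S. (\<lambda>n. s n x) \<longlonglongrightarrow> f x"
    and "\<And>n. AE x in lebesgue_on S. norm (s n x) \<le> norm (w x)"
  shows "(\<lambda>n. L2_norm S (\<lambda>x. f x - s n x)) \<longlonglongrightarrow> 0"
proof -
  note [measurable] = assms(2,3)
  have "(\<lambda>n. LINT x|lebesgue_on S. (norm (f x - s n x))\<^sup>2) \<longlonglongrightarrow> (LINT x|lebesgue_on S. 0)"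
  proof (rule integral_dominated_convergence[where w="\<lambda>x. 4 * (norm (w x))\<^sup>2"])
    show "integrable (lebesgue_on S) (\<lambda>x. 4 * (norm (w x))\<^sup>2)"
      using L2_spaceD(2)[OF assms(1)] by simp
    show "AE x in lebesgue_on S. (\<lambda>n. (norm (f x - s n x))\<^sup>2) \<longlonglongrightarrow> 0"
      using assms(4)
    proof eventually_elim
      case (elim x)
      have "(\<lambda>n. (norm (f x - s n x))\<^sup>2) \<longlonglongrightarrow> (norm (f x - f x))\<^sup>2"
        by (intro tendsto_intros elim)
      then show ?case by simp
    qed
    have bounds: "AE x in lebesgue_on S. \<forall>n. norm (s n x) \<le> norm (w x)"
      using assms(5) by (simp add: AE_all_countable)
    show "AE x in lebesgue_on S. norm ((norm (f x - s n x))\<^sup>2) \<le> 4 * (norm (w x))\<^sup>2" for n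
      using bounds assms(4)
    proof eventually_elim
      case (elim x)
      have "norm (f x) \<le> norm (w x)"
        using elim by (intro Lim_norm_ubound[OF _ elim(2)]) auto
      then have "norm (f x - s n x) \<le> 2 * norm (w x)"
        using elim(1) norm_triangle_ineq4[of "f x" "s n x"] by (smt (verit))
      then have "(norm (f x - s n x))\<^sup>2 \<le> (2 * norm (w x))\<^sup>2"
        by (intro power_mono) auto
      then show ?case by (simp add: power_mult_distrib)
    qed
  qed measurable
  then have "(\<lambda>n. sqrt (LINT x|lebesgue_on S. (norm (f x - s n x))\<^sup>2)) \<longlonglongrightarrow> sqrt 0"
    by (intro tendsto_intros) simp
  then show ?thesis by (simp add: L2_norm_eq)
qed

text \<open>Density is proved by enlarging this set: it is a linear space closed under dominated
  limits, and it is shown to contain, in turn, the indicators of intervals and of Borel sets and the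
  Borel functions in L2.\<close>

definition L2_test_closure :: "real set \<Rightarrow> (real \<Rightarrow> complex) set" where
  "L2_test_closure S = {f \<in> L2_space S. \<forall>e>0. \<exists>\<phi>. test_fun S \<phi> \<and> L2_norm S (\<lambda>x. f x - \<phi> x) < e}"

lemma L2_test_closure_limit:
  assumes "S \<in> lmeasurable" "\<And>n. s n \<in> L2_test_closure S" "f \<in> L2_space S"
    and "(\<lambda>n. L2_norm S (\<lambda>x. f x - s n x)) \<longlonglongrightarrow> 0"
  shows "f \<in> L2_test_closure S"
  unfolding L2_test_closure_def
proof (intro CollectI conjI allI impI assms(3))
  fix e :: real assume e: "0 < e"
  then have "eventually (\<lambda>n. L2_norm S (\<lambda>x. f x - s n x) < e / 2) sequentially"
    using order_tendstoD(2)[OF assms(4), of "e / 2"] by simp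
  then obtain n where n: "L2_norm S (\<lambda>x. f x - s n x) < e / 2"
    unfolding eventually_sequentially by blast
  have sn: "s n \<in> L2_space S" "\<exists>\<phi>. test_fun S \<phi> \<and> L2_norm S (\<lambda>x. s n x - \<phi> x) < e / 2"
    using assms(2)[of n] half_gt_zero[OF e] unfolding L2_test_closure_def by blast+
  then obtain \<phi> where \<phi>: "test_fun S \<phi>" "L2_norm S (\<lambda>x. s n x - \<phi> x) < e / 2" by blast
  have "L2_norm S (\<lambda>x. (f x - s n x) + (s n x - \<phi> x))
      \<le> L2_norm S (\<lambda>x. f x - s n x) + L2_norm S (\<lambda>x. s n x - \<phi> x)"
    using sn(1) assms(3) test_fun_L2[OF \<phi>(1) assms(1)] by (intro L2_norm_triangle L2_diff)
  then show "\<exists>\<phi>. test_fun S \<phi> \<and> L2_norm S (\<lambda>x. f x - \<phi> x) < e"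
    using n \<phi> by (intro exI[of _ \<phi>]) auto
qed

lemma L2_test_closure_test_fun:
  assumes "S \<in> lmeasurable" "test_fun S \<phi>"
  shows "\<phi> \<in> L2_test_closure S"
  unfolding L2_test_closure_def using assms
  by (auto intro!: test_fun_L2 exI[of _ \<phi>])

lemma L2_test_closure_add:
  assumes "S \<in> lmeasurable" "f \<in> L2_test_closure S" "g \<in> L2_test_closure S"
  shows "(\<lambda>x. f x + g x) \<in> L2_test_closure S"
  unfolding L2_test_closure_def
proof (intro CollectI conjI allI impI)
  have L: "f \<in> L2_space S" "g \<in> L2_space S" using assms by (auto simp: L2_test_closure_def)
  then show "(\<lambda>x. f x + g x) \<in> L2_space S" by (rule L2_add)
  fix e :: real assume e: "0 < e"
  then obtain \<phi> \<psi> where \<phi>: "test_fun S \<phi>" "L2_norm S (\<lambda>x. f x - \<phi> x) < e / 2"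
    and \<psi>: "test_fun S \<psi>" "L2_norm S (\<lambda>x. g x - \<psi> x) < e / 2"
    using assms(2,3) half_gt_zero unfolding L2_test_closure_def by blast
  have "L2_norm S (\<lambda>x. (f x - \<phi> x) + (g x - \<psi> x))
      \<le> L2_norm S (\<lambda>x. f x - \<phi> x) + L2_norm S (\<lambda>x. g x - \<psi> x)"
    using L test_fun_L2[OF \<phi>(1) assms(1)] test_fun_L2[OF \<psi>(1) assms(1)]
    by (intro L2_norm_triangle L2_diff)
  moreover have "(\<lambda>x. (f x - \<phi> x) + (g x - \<psi> x)) = (\<lambda>x. f x + g x - (\<phi> x + \<psi> x))"
    by (auto simp: algebra_simps)
  ultimately show "\<exists>\<phi>. test_fun S \<phi> \<and> L2_norm S (\<lambda>x. f x + g x - \<phi> x) < e"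
    using \<phi> \<psi> by (intro exI[of _ "\<lambda>x. \<phi> x + \<psi> x"]) (auto intro: test_fun_add)
qed

lemma L2_test_closure_cmult:
  assumes "f \<in> L2_test_closure S"
  shows "(\<lambda>x. c * f x) \<in> L2_test_closure S"
  unfolding L2_test_closure_def
proof (intro CollectI conjI allI impI)
  show "(\<lambda>x. c * f x) \<in> L2_space S"
    using assms by (auto simp: L2_test_closure_def intro: L2_cmult)
  fix e :: real assume e: "0 < e"
  then have "0 < e / (norm c + 1)" by (simp add: add_nonneg_pos)
  then obtain \<phi> where \<phi>: "test_fun S \<phi>" "L2_norm S (\<lambda>x. f x - \<phi> x) < e / (norm c + 1)"
    using assms unfolding L2_test_closure_def by blast
  have "L2_norm S (\<lambda>x. c * (f x - \<phi> x)) \<le> (norm c + 1) * L2_norm S (\<lambda>x. f x - \<phi> x)"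
    unfolding L2_norm_cmult by (intro mult_right_mono) auto
  also have "\<dots> < (norm c + 1) * (e / (norm c + 1))"
    using \<phi>(2) by (intro mult_strict_left_mono) (simp_all add: add_nonneg_pos)
  also have "\<dots> = e" using norm_ge_zero[of c] by (simp add: add_nonneg_eq_0_iff)
  finally show "\<exists>\<phi>. test_fun S \<phi> \<and> L2_norm S (\<lambda>x. c * f x - \<phi> x) < e"
    using \<phi>(1) by (intro exI[of _ "\<lambda>x. c * \<phi> x"]) (auto intro: test_fun_cmult simp: algebra_simps)
qed

lemma L2_test_closure_sum:
  assumes "S \<in> lmeasurable" "\<And>i. i \<in> I \<Longrightarrow> f i \<in> L2_test_closure S"
  shows "(\<lambda>x. \<Sum>i\<in>I. f i x) \<in> L2_test_closure S"
  using assms(2)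
  by (induction I rule: infinite_finite_induct)
     (auto intro: L2_test_closure_add assms(1) L2_test_closure_test_fun test_fun_zero)

lemma L2_test_closure_dominated_limit:
  assumes "S \<in> lmeasurable" "\<And>n. s n \<in> L2_test_closure S" "f \<in> borel_measurable (lebesgue_on S)"
    and "w \<in> L2_space S" "\<And>x. x \<in> S \<Longrightarrow> (\<lambda>n. s n x) \<longlonglongrightarrow> f x"
    and "\<And>n x. x \<in> S \<Longrightarrow> norm (s n x) \<le> norm (w x)"
  shows "f \<in> L2_test_closure S"
proof (rule L2_test_closure_limit[OF assms(1,2)])
  have "norm (f x) \<le> norm (w x)" if "x \<in> S" for x
    by (rule Lim_norm_ubound[OF _ assms(5)[OF that]]) (use assms(6) that in auto)
  then show "f \<in> L2_space S"
    by (intro L2_bounded_by[OF assms(4,3), of 1] AE_I2) auto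
  show "(\<lambda>n. L2_norm S (\<lambda>x. f x - s n x)) \<longlonglongrightarrow> 0"
    using assms(2,5,6) by (intro L2_norm_dominated_convergence[OF assms(4,3)] AE_I2)
      (auto simp: L2_test_closure_def L2_space_def)
qed

text \<open>Two limits are taken in succession. The support of a test function must be a compact
  part of (a,b), so the interval is shrunk by 1/(n+1) from the ends of (a,b) and the steepness goes
  to infinity for fixed n; then the margin goes to zero. No relation between the two intervals is
  assumed, whence \<open>max\<close> and \<open>min\<close>.\<close>

lemma indicator_Ioo_L2_test_closure:
  "indicator {c<..<d} \<in> L2_test_closure {a<..<b}"
proof -
  define s where "s n = bump (max c (a + 1 / real (Suc n))) (min d (b - 1 / real (Suc n)))" for n
  let ?S = "{a<..<b}"
  have inner: "indicator {max c (a + 1 / real (Suc n))<..<min d (b - 1 / real (Suc n))} \<in> L2_test_closure ?S" for n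
  proof (rule L2_test_closure_dominated_limit[where s="s n" and w="\<lambda>x. 1"])
    have sub: "{max c (a + 1 / real (Suc n))..min d (b - 1 / real (Suc n))} \<subseteq> ?S"
    proof
      fix x assume "x \<in> {max c (a + 1 / real (Suc n))..min d (b - 1 / real (Suc n))}"
      moreover have "0 < 1 / real (Suc n)" by simp
      ultimately show "x \<in> ?S" unfolding atLeastAtMost_iff greaterThanLessThan_iff by linarith
    qed
    show "s n m \<in> L2_test_closure ?S" for m
      unfolding s_def by (intro L2_test_closure_test_fun bump_test_fun sub) simp
    show "(\<lambda>m. s n m x) \<longlonglongrightarrow> indicator {max c (a + 1 / real (Suc n))<..<min d (b - 1 / real (Suc n))} x" for x
      unfolding s_def by (rule bump_tendsto)
    show "indicator {max c (a + 1 / real (Suc n))<..<min d (b - 1 / real (Suc n))} \<in> borel_measurable (lebesgue_on ?S)"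
      by (intro measurable_restrict_space1 borel_measurable_indicator) auto
    show "norm (s n m x) \<le> norm (1::complex)" for m x
      unfolding s_def using bump_bounded by simp
  qed (auto intro: L2_bounded[where C=1])
  show ?thesis
  proof (rule L2_test_closure_dominated_limit[where w="\<lambda>x. 1"])
    show "indicator {max c (a + 1 / real (Suc n))<..<min d (b - 1 / real (Suc n))} \<in> L2_test_closure ?S" for n
      by (rule inner)
    show "indicator {c<..<d} \<in> borel_measurable (lebesgue_on ?S)"
      by (intro measurable_restrict_space1 borel_measurable_indicator) auto
    fix x assume x: "x \<in> ?S"
    obtain N where N: "1 / real (Suc N) < min (x - a) (b - x)"
      using x nat_approx_posE[of "min (x - a) (b - x)"] by auto
    have "indicator {max c (a + 1 / real (Suc n))<..<min d (b - 1 / real (Suc n))} x = (indicator {c<..<d} x :: complex)"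
      if "n \<ge> N" for n
    proof -
      have "1 / real (Suc n) \<le> 1 / real (Suc N)"
        using that by (intro divide_left_mono) auto
      then have "1 / real (Suc n) < x - a" "1 / real (Suc n) < b - x" using N by auto
      then show ?thesis by (auto simp: indicator_def)
    qed
    then show "(\<lambda>n. indicator {max c (a + 1 / real (Suc n))<..<min d (b - 1 / real (Suc n))} x :: complex)
        \<longlonglongrightarrow> indicator {c<..<d} x"
      by (intro tendsto_eventually) (auto simp: eventually_sequentially)
  qed (auto intro: L2_bounded[where C=1] simp: indicator_def)
qed

text \<open>Dynkin's argument: open intervals, the empty one included, form an intersection stable
  generator of the Borel sets; complements are handled by linearity and disjoint unions by dominated
  convergence of partial sums.\<close>

lemma indicator_borel_L2_test_closure:
  assumes "A \<in> sets borel"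
  shows "indicator A \<in> L2_test_closure {a<..<b}"
proof -
  let ?S = "{a<..<b}"
  let ?G = "range (\<lambda>(c, d). {c<..<d::real})"
  have "borel = sigma UNIV ?G"
    using borel_eq_box[where 'a=real] by (simp add: box_real case_prod_unfold)
  then have "sets borel = sets (sigma UNIV ?G)" by (rule arg_cong)
  then have G: "sets borel = sigma_sets UNIV ?G"
    by (subst (asm) sets_measure_of) auto
  have A: "A \<in> sigma_sets UNIV ?G"
    using assms G by simp
  have "Int_stable ?G"
  proof (rule Int_stableI)
    fix X Y assume "X \<in> ?G" "Y \<in> ?G"
    then obtain c d c' d' where "X = {c<..<d}" "Y = {c'<..<d'}" by auto
    then have "X \<inter> Y = {max c c'<..<min d d'}" by auto
    then show "X \<inter> Y \<in> ?G" by auto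
  qed
  moreover have "?G \<subseteq> Pow UNIV" by auto
  ultimately show ?thesis using A
  proof (induction rule: sigma_sets_induct_disjoint)
    case (basic X)
    then show ?case using indicator_Ioo_L2_test_closure by auto
  next
    case empty
    have "indicator {} = (\<lambda>x::real. 0 :: complex)" by auto
    then show ?case by (simp add: L2_test_closure_test_fun test_fun_zero)
  next
    case (compl X)
    \<comment> \<open>The constant 1 is no test function, but on the domain it coincides with the
      indicator of the whole interval, and only values there count.\<close>
    have one: "(\<lambda>x. 1) \<in> L2_test_closure ?S"
    proof (rule L2_test_closure_limit[where s="\<lambda>n. indicator ?S"])
      show "indicator ?S \<in> L2_test_closure ?S" by (rule indicator_Ioo_L2_test_closure)
      show "(\<lambda>x. 1) \<in> L2_space ?S" by (intro L2_bounded[where C=1]) auto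
      have "L2_norm ?S (\<lambda>x. 1 - indicator ?S x) = L2_norm ?S (\<lambda>x. 0)"
        by (rule L2_norm_cong) auto
      then show "(\<lambda>n. L2_norm ?S (\<lambda>x. 1 - indicator ?S x)) \<longlonglongrightarrow> 0" by simp
    qed auto
    have "indicator (UNIV - X) = (\<lambda>x. 1 + (- 1) * indicator X x :: complex)"
      by (auto simp: indicator_def)
    then show ?case
      using L2_test_closure_add[OF _ one L2_test_closure_cmult[OF compl.IH, of "-1"]] by simp
  next
    case (union X)
    have X: "X i \<in> sets borel" for i
      using union.hyps(2) G by auto
    show ?case
    proof (rule L2_test_closure_dominated_limit[where w="\<lambda>x. 1"])
      show "(\<lambda>x. \<Sum>i<n. indicator (X i) x) \<in> L2_test_closure ?S" for n
        by (intro L2_test_closure_sum union.IH) auto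
      show "indicator (\<Union>i. X i) \<in> borel_measurable (lebesgue_on ?S)"
        using X by (intro measurable_restrict_space1 measurable_completion borel_measurable_indicator) auto
      have eq: "(\<Sum>i<n. indicator (X i) x) = (indicator (\<Union>i<n. X i) x :: complex)" for n x
      proof -
        have "disjoint_family_on X {..<n}"
          using union.hyps(1) by (auto simp: disjoint_family_on_def)
        then show ?thesis by (simp add: indicator_UN_disjoint)
      qed
      show "norm (\<Sum>i<n. indicator (X i) x :: complex) \<le> norm (1::complex)" for n x
        unfolding eq by (auto simp: indicator_def)
      show "(\<lambda>n. \<Sum>i<n. indicator (X i) x :: complex) \<longlonglongrightarrow> indicator (\<Union>i. X i) x" for x
        unfolding eq by (rule LIMSEQ_indicator_UN)
    qed (auto intro: L2_bounded[where C=1])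
  qed
qed

lemma borel_L2_test_closure:
  assumes g: "g \<in> borel_measurable borel" "g \<in> L2_space {a<..<b}"
  shows "g \<in> L2_test_closure {a<..<b}"
proof -
  let ?S = "{a<..<b}"
  obtain s where s: "\<And>i. simple_function borel (s i)" "\<And>x. (\<lambda>i. s i x) \<longlonglongrightarrow> g x"
      "\<And>i x. dist (s i x) 0 \<le> 2 * dist (g x) 0"
    using borel_measurable_implies_sequence_metric[OF g(1), of 0] by (auto simp: space_borel)
  show ?thesis
  proof (rule L2_test_closure_dominated_limit[where s=s and w="\<lambda>x. 2 * g x"])
    show "s n \<in> L2_test_closure ?S" for n
    proof -
      have fin: "finite (range (s n))" using s(1)[of n] by (simp add: simple_function_def space_borel)
      have "s n = (\<lambda>x. \<Sum>y\<in>range (s n). y * indicator (s n -` {y}) x)"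
      proof
        fix x
        have "(\<Sum>y\<in>range (s n). y * indicator (s n -` {y}) x) = (\<Sum>y\<in>{s n x}. y * indicator (s n -` {y}) x)"
          using fin by (intro sum.mono_neutral_right) (auto simp: indicator_def)
        then show "s n x = (\<Sum>y\<in>range (s n). y * indicator (s n -` {y}) x)" by simp
      qed
      moreover have "(\<lambda>x. \<Sum>y\<in>range (s n). y * indicator (s n -` {y}) x) \<in> L2_test_closure ?S"
        using s(1)[of n]
        by (intro L2_test_closure_sum L2_test_closure_cmult indicator_borel_L2_test_closure)
           (auto simp: simple_function_def space_borel)
      ultimately show ?thesis by simp
    qed
    show "g \<in> borel_measurable (lebesgue_on ?S)" by (rule L2_spaceD(1)[OF g(2)])
    show "(\<lambda>x. 2 * g x) \<in> L2_space ?S" by (rule L2_cmult[OF g(2)])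
    show "norm (s n x) \<le> norm (2 * g x)" for n x
      using s(3)[of n x] by (simp add: norm_mult)
  qed (use s(2) in auto)
qed

lemma lebesgue_ex_borel_complex:
  fixes f :: "real \<Rightarrow> complex"
  assumes "f \<in> borel_measurable lebesgue"
  obtains g where "g \<in> borel_measurable borel" "AE x in lebesgue. f x = g x"
proof -
  have "(\<lambda>x. Re (f x)) \<in> borel_measurable (completion lborel)" "(\<lambda>x. Im (f x)) \<in> borel_measurable (completion lborel)"
    using assms by auto
  then obtain r i where r: "r \<in> borel_measurable lborel" "AE x in lborel. Re (f x) = r x"
    and i: "i \<in> borel_measurable lborel" "AE x in lborel. Im (f x) = i x"
    using completion_ex_borel_measurable_real by metis
  have "AE x in lborel. f x = Complex (r x) (i x)"
    using r(2) i(2) by eventually_elim (simp add: complex_eq_iff)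
  then have "AE x in lebesgue. f x = Complex (r x) (i x)"
    by (rule AE_completion)
  moreover have "(\<lambda>x. of_real (r x) + \<i> * of_real (i x)) \<in> borel_measurable borel"
    using r(1) i(1) by (intro borel_measurable_add borel_measurable_times borel_measurable_of_real) auto
  ultimately show ?thesis using that by (auto simp: Complex_eq)
qed

text \<open>The generation argument reaches Borel functions; a Lebesgue measurable function is first
  replaced by a Borel one that differs from it on a null set.\<close>

theorem test_fun_dense_L2:
  assumes "f \<in> L2_space {a<..<b}" "0 < e"
  obtains \<phi> where "test_fun {a<..<b} \<phi>" "L2_norm {a<..<b} (\<lambda>x. f x - \<phi> x) < e"
proof -
  let ?S = "{a<..<b}"
  have "(\<lambda>x. if x \<in> ?S then f x else 0) \<in> borel_measurable lebesgue"
    by (rule borel_measurable_if_I[OF L2_spaceD(1)[OF assms(1)]]) simp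
  then obtain g where g: "g \<in> borel_measurable borel" "AE x in lebesgue. (if x \<in> ?S then f x else 0) = g x"
    by (rule lebesgue_ex_borel_complex)
  have ae: "AE x in lebesgue_on ?S. f x = g x"
    using g(2) by (auto simp: AE_restrict_space_iff elim!: eventually_mono)
  have gm: "g \<in> borel_measurable (lebesgue_on ?S)"
    using g(1) by (intro measurable_restrict_space1 measurable_completion) auto
  then have gL: "g \<in> L2_space ?S" by (rule L2_cong_AE[OF assms(1) ae])
  then obtain \<phi> where \<phi>: "test_fun ?S \<phi>" "L2_norm ?S (\<lambda>x. g x - \<phi> x) < e"
    using borel_L2_test_closure[OF g(1) gL] assms(2) by (auto simp: L2_test_closure_def)
  have \<phi>L: "\<phi> \<in> L2_space ?S" by (rule test_fun_L2[OF \<phi>(1)]) simp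
  have "L2_norm ?S (\<lambda>x. f x - \<phi> x) = L2_norm ?S (\<lambda>x. g x - \<phi> x)"
    using ae by (intro L2_norm_cong_AE L2_spaceD(1)[OF L2_diff] assms gL \<phi>L) (auto elim: eventually_mono)
  then show ?thesis using that \<phi> by metis
qed

section \<open>Indefinite integrals\<close>

lemma L2_LINT_mult_le:
  assumes "u \<in> L2_space S" "v \<in> L2_space S"
  shows "norm (LINT x|lebesgue_on S. u x * v x) \<le> L2_norm S u * L2_norm S v"
proof -
  have "norm (LINT x|lebesgue_on S. u x * v x) \<le> (LINT x|lebesgue_on S. norm (u x * v x))"
    by (rule integral_norm_bound)
  then show ?thesis
    using L2_norm_mult_integral_le[OF assms] by (simp add: norm_mult)
qed

lemma L2_norm_const: "S \<in> lmeasurable \<Longrightarrow> L2_norm S (\<lambda>x. c) = norm c * sqrt (measure lebesgue S)"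
  by (simp add: L2_norm_eq measure_restrict_space fmeasurableD real_sqrt_mult)

lemma L2_const: "S \<in> lmeasurable \<Longrightarrow> (\<lambda>x. c) \<in> L2_space S"
  by (rule L2_bounded[where C="norm c"]) auto

text \<open>A bridge between two integrals: the norms use the Lebesgue integral on the open
  interval, while the fundamental theorem of calculus and additivity over adjacent intervals are
  used for the gauge integral on the closed one.\<close>

lemma L2_Ioo_integral:
  assumes "g \<in> L2_space {s<..<t}"
  shows "g absolutely_integrable_on {s..t}"
    and "integral {s..t} g = (LINT x|lebesgue_on {s<..<t}. g x)"
proof -
  have i: "integrable (lebesgue_on {s<..<t}) g" by (rule L2_integrable[OF _ assms]) simp
  then have "g absolutely_integrable_on {s<..<t}"
    by (simp add: set_integrable_def integrable_restrict_space)
  then show "g absolutely_integrable_on {s..t}"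
    by (simp add: absolutely_integrable_on_Icc_iff_Ioo)
  have "integral {s..t} g = integral {s<..<t} g"
    by (simp add: integral_open_interval_real)
  then show "integral {s..t} g = (LINT x|lebesgue_on {s<..<t}. g x)"
    using lebesgue_integral_eq_integral[OF i] by simp
qed

lemma L2_Ioo_integral_norm_le:
  assumes "g \<in> L2_space {s<..<t}" "s \<le> t"
  shows "norm (integral {s..t} g) \<le> sqrt (t - s) * L2_norm {s<..<t} g"
proof -
  have "norm (LINT x|lebesgue_on {s<..<t}. g x * 1) \<le> L2_norm {s<..<t} g * L2_norm {s<..<t} (\<lambda>x. 1)"
    by (intro L2_LINT_mult_le assms L2_const) simp
  then show ?thesis
    using assms(2) by (simp add: L2_Ioo_integral(2)[OF assms(1)] L2_norm_const mult.commute)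
qed

lemma L2_Ioo_subinterval:
  assumes "g \<in> L2_space {a<..<b}" "a \<le> s" "t \<le> b"
  shows "g \<in> L2_space {s<..<t}"
  using assms by (intro L2_subset[OF assms(1)]) auto

lemma L2_Ioo_integrable_on:
  assumes "g \<in> L2_space {a<..<b}" "a \<le> s" "t \<le> b"
  shows "g integrable_on {s..t}"
  using L2_Ioo_integral(1)[OF L2_Ioo_subinterval[OF assms]] set_lebesgue_integral_eq_integral(1) by blast

lemma L2_norm_Ioo_power2:
  assumes "g \<in> L2_space {s<..<t}"
  shows "(L2_norm {s<..<t} g)\<^sup>2 = integral {s..t} (\<lambda>x. (norm (g x))\<^sup>2)"
    and "(\<lambda>x. (norm (g x))\<^sup>2) integrable_on {s..t}"
proof -
  have i: "integrable (lebesgue_on {s<..<t}) (\<lambda>x. (norm (g x))\<^sup>2)" by (rule L2_spaceD[OF assms])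
  show "(L2_norm {s<..<t} g)\<^sup>2 = integral {s..t} (\<lambda>x. (norm (g x))\<^sup>2)"
    unfolding L2_norm_power2
    using lebesgue_integral_eq_integral[OF i] by (simp add: integral_open_interval_real)
  show "(\<lambda>x. (norm (g x))\<^sup>2) integrable_on {s..t}"
    using integrable_on_lebesgue_on[OF i] by (simp add: integrable_on_open_interval_real)
qed

lemma L2_norm_Ioo_split:
  assumes "g \<in> L2_space {s<..<t}" "s \<le> m" "m \<le> t"
  shows "(L2_norm {s<..<t} g)\<^sup>2 = (L2_norm {s<..<m} g)\<^sup>2 + (L2_norm {m<..<t} g)\<^sup>2"
proof -
  have 1: "g \<in> L2_space {s<..<m}" "g \<in> L2_space {m<..<t}"
    using assms by (auto intro: L2_Ioo_subinterval)
  show ?thesis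
    unfolding L2_norm_Ioo_power2(1)[OF assms(1)] L2_norm_Ioo_power2(1)[OF 1(1)] L2_norm_Ioo_power2(1)[OF 1(2)]
    using Henstock_Kurzweil_Integration.integral_combine[OF assms(2,3) L2_norm_Ioo_power2(2)[OF assms(1)]] by simp
qed

lemma L2_norm_Ioo_mono:
  assumes "g \<in> L2_space {a<..<b}" "a \<le> s" "t \<le> b"
  shows "L2_norm {s<..<t} g \<le> L2_norm {a<..<b} g"
proof (rule power2_le_imp_le)
  have 1: "g \<in> L2_space {s<..<t}" using assms by (rule L2_Ioo_subinterval)
  show "(L2_norm {s<..<t} g)\<^sup>2 \<le> (L2_norm {a<..<b} g)\<^sup>2"
    unfolding L2_norm_Ioo_power2(1)[OF assms(1)] L2_norm_Ioo_power2(1)[OF 1]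
    using assms(2,3) by (intro integral_subset_le L2_norm_Ioo_power2(2) assms(1) 1) auto
qed simp

lemma indefinite_integral_norm_le:
  assumes "g \<in> L2_space {a<..<b}" "x \<in> {a..b}"
  shows "norm (integral {a..x} g) \<le> sqrt (b - a) * L2_norm {a<..<b} g"
proof -
  have "norm (integral {a..x} g) \<le> sqrt (x - a) * L2_norm {a<..<x} g"
    using assms by (intro L2_Ioo_integral_norm_le L2_Ioo_subinterval[OF assms(1)]) auto
  also have "\<dots> \<le> sqrt (b - a) * L2_norm {a<..<b} g"
    using assms by (intro mult_mono L2_norm_Ioo_mono) auto
  finally show ?thesis .
qed

lemma indefinite_integral_measurable:
  assumes "g \<in> L2_space {a<..<b}"
  shows "(\<lambda>x. integral {a..x} g) \<in> borel_measurable (lebesgue_on {a<..<b})"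
proof -
  have "continuous_on {a..b} (\<lambda>x. integral {a..x} g)"
    by (intro indefinite_integral_continuous_1 L2_Ioo_integrable_on[OF assms]) auto
  then have "continuous_on {a<..<b} (\<lambda>x. integral {a..x} g)"
    by (rule continuous_on_subset) auto
  then show ?thesis
    by (intro continuous_imp_measurable_on_sets_lebesgue) auto
qed

lemma indefinite_integral_L2:
  assumes "g \<in> L2_space {a<..<b}" "a \<le> b"
  shows "(\<lambda>x. integral {a..x} g) \<in> L2_space {a<..<b}"
    and "L2_norm {a<..<b} (\<lambda>x. integral {a..x} g) \<le> (b - a) * L2_norm {a<..<b} g"
proof -
  have bd: "AE x in lebesgue_on {a<..<b}. norm (integral {a..x} g) \<le> sqrt (b - a) * L2_norm {a<..<b} g"
    by (intro AE_I2 indefinite_integral_norm_le[OF assms(1)]) auto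
  show "(\<lambda>x. integral {a..x} g) \<in> L2_space {a<..<b}"
    by (rule L2_bounded[OF _ indefinite_integral_measurable[OF assms(1)] bd]) simp
  have "L2_norm {a<..<b} (\<lambda>x. integral {a..x} g) \<le> sqrt (b - a) * L2_norm {a<..<b} g * sqrt (measure lebesgue {a<..<b})"
    using assms(2) by (intro L2_norm_bounded[OF _ indefinite_integral_measurable[OF assms(1)] _ bd]) auto
  also have "\<dots> = (sqrt (b - a))\<^sup>2 * L2_norm {a<..<b} g"
    using assms(2) by (simp add: power2_eq_square)
  finally show "L2_norm {a<..<b} (\<lambda>x. integral {a..x} g) \<le> (b - a) * L2_norm {a<..<b} g"
    using assms(2) by simp
qed

lemma indefinite_integral_diff:
  assumes "g \<in> L2_space {a<..<b}" "h \<in> L2_space {a<..<b}" "x \<le> b"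
  shows "integral {a..x} (\<lambda>x. g x - h x) = integral {a..x} g - integral {a..x} h"
  using assms by (intro Henstock_Kurzweil_Integration.integral_diff L2_Ioo_integrable_on[of _ a b]) auto

text \<open>Integration by parts holds for smooth integrands and extends by density.\<close>

lemma has_weak_deriv_indefinite_integral:
  assumes g: "g \<in> L2_space {a<..<b}" and ab: "a < b"
  shows "has_weak_deriv {a<..<b} 1 (\<lambda>x. c + integral {a..x} g) g"
proof -
  let ?S = "{a<..<b}"
  have L2u: "(\<lambda>x. c + integral {a..x} h) \<in> L2_space ?S" if "h \<in> L2_space ?S" for h
    using that ab by (intro L2_add L2_const indefinite_integral_L2) auto
  have "(LINT x|lebesgue_on ?S. (c + integral {a..x} g) * vderiv_iter 1 \<phi> x)
      = (- 1) ^ 1 * (LINT x|lebesgue_on ?S. g x * \<phi> x)" if \<phi>: "test_fun ?S \<phi>" for \<phi>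
  proof -
    define \<phi>' where "\<phi>' = (\<lambda>x. vector_derivative \<phi> (at x))"
    have \<phi>': "test_fun ?S \<phi>'" unfolding \<phi>'_def by (rule test_fun_vector_derivative[OF \<phi>])
    have \<phi>L: "\<phi> \<in> L2_space ?S" "\<phi>' \<in> L2_space ?S"
      using test_fun_L2[OF \<phi>] test_fun_L2[OF \<phi>'] by auto
    \<comment> \<open>\<open>I h\<close> is the defect in the integration by parts formula when h
      takes the place of the derivative; it has to vanish at h = g.\<close>
    define I where "I h = (LINT x|lebesgue_on ?S. (c + integral {a..x} h) * \<phi>' x)
      + (LINT x|lebesgue_on ?S. h x * \<phi> x)" for h
    have zero: "I \<psi> = 0" if \<psi>: "test_fun ?S \<psi>" for \<psi>
    proof -
      have \<psi>L: "\<psi> \<in> L2_space ?S" using test_fun_L2[OF \<psi>] by simp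
      define u where "u x = c + integral {a..x} \<psi>" for x
      have u': "(u has_vector_derivative \<psi> x) (at x within {a..b})" if "x \<in> {a..b}" for x
        unfolding u_def
        by (auto intro!: derivative_eq_intros integral_has_vector_derivative that test_fun_continuous[OF \<psi>])
      have "((\<lambda>x. u x * \<phi>' x + \<psi> x * \<phi> x) has_integral u b * \<phi> b - u a * \<phi> a) {a..b}"
        unfolding \<phi>'_def
        using ab by (intro fundamental_theorem_of_calculus has_vector_derivative_mult u'
          has_vector_derivative_at_within[OF test_fun_has_deriv[OF \<phi>]]) auto
      moreover have "\<phi> a = 0" "\<phi> b = 0"
        using \<phi> unfolding test_fun_def by auto
      ultimately have i0: "integral {a..b} (\<lambda>x. u x * \<phi>' x + \<psi> x * \<phi> x) = 0"
        by (auto intro: integral_unique)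
      have int: "integrable (lebesgue_on ?S) (\<lambda>x. u x * \<phi>' x)" "integrable (lebesgue_on ?S) (\<lambda>x. \<psi> x * \<phi> x)"
        unfolding u_def by (intro L2_integrable_mult L2u \<phi>L \<psi>L)+
      have "I \<psi> = (LINT x|lebesgue_on ?S. u x * \<phi>' x + \<psi> x * \<phi> x)"
        unfolding I_def u_def[symmetric] using int by simp
      also have "\<dots> = integral ?S (\<lambda>x. u x * \<phi>' x + \<psi> x * \<phi> x)"
        using int by (intro lebesgue_integral_eq_integral) auto
      also have "\<dots> = 0" using i0 by (simp add: integral_open_interval_real)
      finally show ?thesis .
    qed
    \<comment> \<open>The Lipschitz constant of \<open>I\<close> in the L2 norm: the primitive
      contributes b - a, and Cauchy-Schwarz the norms of \<open>\<phi>'\<close> and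
      \<open>\<phi>\<close>. Dividing by K + 1 below avoids a case distinction for K = 0.\<close>
    define K where "K = (b - a) * L2_norm ?S \<phi>' + L2_norm ?S \<phi>"
    have K: "0 \<le> K" using ab by (simp add: K_def)
    have "norm (I g) \<le> 0 + e" if "0 < e" for e
    proof -
      have "0 < e / (K + 1)" using that K by simp
      then obtain \<psi> where \<psi>: "test_fun ?S \<psi>" "L2_norm ?S (\<lambda>x. g x - \<psi> x) < e / (K + 1)"
        using test_fun_dense_L2[OF g] by metis
      have \<psi>L: "\<psi> \<in> L2_space ?S" using test_fun_L2[OF \<psi>(1)] by simp
      let ?h = "\<lambda>x. g x - \<psi> x"
      have hL: "?h \<in> L2_space ?S" by (rule L2_diff[OF g \<psi>L])
      have "I g - I \<psi> = (LINT x|lebesgue_on ?S. (c + integral {a..x} g) * \<phi>' x - (c + integral {a..x} \<psi>) * \<phi>' x)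
         + (LINT x|lebesgue_on ?S. g x * \<phi> x - \<psi> x * \<phi> x)"
        unfolding I_def
        using L2_integrable_mult[OF L2u[OF g] \<phi>L(2)] L2_integrable_mult[OF L2u[OF \<psi>L] \<phi>L(2)]
          L2_integrable_mult[OF g \<phi>L(1)] L2_integrable_mult[OF \<psi>L \<phi>L(1)]
        by (simp add: Bochner_Integration.integral_diff)
      also have "\<dots> = (LINT x|lebesgue_on ?S. integral {a..x} ?h * \<phi>' x) + (LINT x|lebesgue_on ?S. ?h x * \<phi> x)"
        by (intro arg_cong2[where f="(+)"] Bochner_Integration.integral_cong refl)
           (auto simp: indefinite_integral_diff[OF g \<psi>L] algebra_simps)
      finally have "norm (I g - I \<psi>) \<le> norm (LINT x|lebesgue_on ?S. integral {a..x} ?h * \<phi>' x)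
          + norm (LINT x|lebesgue_on ?S. ?h x * \<phi> x)"
        using norm_triangle_ineq by metis
      also have "\<dots> \<le> L2_norm ?S (\<lambda>x. integral {a..x} ?h) * L2_norm ?S \<phi>' + L2_norm ?S ?h * L2_norm ?S \<phi>"
        using ab by (intro add_mono L2_LINT_mult_le indefinite_integral_L2 hL \<phi>L) auto
      also have "\<dots> \<le> ((b - a) * L2_norm ?S ?h) * L2_norm ?S \<phi>' + L2_norm ?S ?h * L2_norm ?S \<phi>"
        using ab by (intro add_mono mult_right_mono indefinite_integral_L2 hL) auto
      also have "\<dots> = K * L2_norm ?S ?h" by (simp add: K_def algebra_simps)
      also have "\<dots> \<le> (K + 1) * (e / (K + 1))"
        using \<psi>(2) K that by (intro mult_mono) auto
      also have "\<dots> = e" using K by simp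
      finally show ?thesis using zero[OF \<psi>(1)] by simp
    qed
    then have "norm (I g) \<le> 0" by (rule field_le_epsilon)
    then show ?thesis unfolding I_def \<phi>'_def by (simp add: eq_neg_iff_add_eq_0)
  qed
  then show ?thesis
    unfolding has_weak_deriv_def
    using L2_locally_integrable[OF L2u[OF g]] L2_locally_integrable[OF g] by auto
qed

lemma test_fun_weak_deriv:
  assumes "test_fun {a<..<b} \<phi>" "a < b"
  shows "has_weak_deriv {a<..<b} 1 \<phi> (\<lambda>x. vector_derivative \<phi> (at x))"
    and "\<And>x. x \<in> {a..b} \<Longrightarrow> \<phi> x = integral {a..x} (\<lambda>x. vector_derivative \<phi> (at x))"
proof -
  have "\<phi> a = 0" using assms(1) unfolding test_fun_def by auto
  then show eq: "\<phi> x = integral {a..x} (\<lambda>x. vector_derivative \<phi> (at x))" if "x \<in> {a..b}" for x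
    using test_fun_integral_vector_derivative[OF assms(1), of a x] that by (auto dest: integral_unique)
  have L: "(\<lambda>x. vector_derivative \<phi> (at x)) \<in> L2_space {a<..<b}"
    by (rule test_fun_L2[OF test_fun_vector_derivative[OF assms(1)]]) simp
  show "has_weak_deriv {a<..<b} 1 \<phi> (\<lambda>x. vector_derivative \<phi> (at x))"
    by (rule has_weak_deriv_cong_AE[OF has_weak_deriv_indefinite_integral[OF L assms(2), of 0]])
       (auto simp flip: eq intro!: AE_I2)
qed

text \<open>Density supplies a test function closer to the constant 1 than sqrt(b - a). Its integral
  is nonzero, since by Cauchy-Schwarz every function of zero mean has distance at least sqrt(b - a)
  from 1; then it is normalized.\<close>

lemma test_fun_unit_integral:
  assumes "a < b"
  obtains \<phi>0 where "test_fun {a<..<b} \<phi>0" "integral {a..b} \<phi>0 = 1"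
proof -
  let ?S = "{a<..<b}"
  have one: "(\<lambda>x. 1) \<in> L2_space ?S" by (rule L2_const) simp
  then obtain \<phi> where \<phi>: "test_fun ?S \<phi>" "L2_norm ?S (\<lambda>x. 1 - \<phi> x) < sqrt (b - a)"
    using test_fun_dense_L2[OF one, of "sqrt (b - a)"] assms by auto
  have \<phi>L: "\<phi> \<in> L2_space ?S" using test_fun_L2[OF \<phi>(1)] by simp
  have "integral {a..b} \<phi> \<noteq> 0"
  proof
    assume 0: "integral {a..b} \<phi> = 0"
    have "integral {a..b} (\<lambda>x. 1 - \<phi> x) = integral {a..b} (\<lambda>x. 1) - integral {a..b} \<phi>"
      using assms by (intro indefinite_integral_diff[where b=b] one \<phi>L) auto
    then have "norm (integral {a..b} (\<lambda>x. 1 - \<phi> x)) = b - a"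
      using 0 assms by simp
    moreover have "norm (integral {a..b} (\<lambda>x. 1 - \<phi> x)) \<le> sqrt (b - a) * L2_norm ?S (\<lambda>x. 1 - \<phi> x)"
      using assms by (intro L2_Ioo_integral_norm_le L2_diff one \<phi>L) auto
    moreover have "sqrt (b - a) * L2_norm ?S (\<lambda>x. 1 - \<phi> x) < sqrt (b - a) * sqrt (b - a)"
      using \<phi>(2) assms by (intro mult_strict_left_mono) auto
    ultimately show False using assms by simp
  qed
  then show ?thesis
    using that[of "\<lambda>x. (1 / integral {a..b} \<phi>) * \<phi> x"] test_fun_cmult[OF \<phi>(1), of "1 / integral {a..b} \<phi>"] by simp
qed

text \<open>Du Bois-Reymond's lemma. Subtracting the right multiple of \<open>\<phi>0\<close> gives
  any test function zero mean, hence a primitive that is a test function, which u annihilates after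
  differentiation. What remains says that u acts like the constant C, its integral against
  \<open>\<phi>0\<close>.\<close>

lemma weak_deriv_zero_imp_AE_const:
  assumes "has_weak_deriv {a<..<b} 1 u (\<lambda>x. 0)" "a < b"
  obtains C where "AE x in lebesgue_on {a<..<b}. u x = C"
proof -
  let ?S = "{a<..<b}"
  have loc: "locally_integrable ?S u" using assms(1) by (simp add: has_weak_deriv_def)
  have IL: "integral {a..b} \<phi> = (LINT x|lebesgue_on ?S. \<phi> x)" if "test_fun ?S \<phi>" for \<phi>
    using test_fun_L2[OF that, of ?S] by (intro L2_Ioo_integral) auto
  obtain \<phi>0 where \<phi>0: "test_fun ?S \<phi>0" "integral {a..b} \<phi>0 = 1"
    using test_fun_unit_integral[OF assms(2)] by metis
  define C where "C = (LINT x|lebesgue_on ?S. u x * \<phi>0 x)"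
  have "AE x in lebesgue_on ?S. u x - C = 0"
  proof (rule test_fun_orthogonal_imp_AE_zero[OF assms(2)])
    have c: "locally_integrable ?S (\<lambda>x. C)" by (intro L2_locally_integrable L2_const) auto
    then show "locally_integrable ?S (\<lambda>x. u x - C)" by (rule locally_integrable_diff[OF loc])
    fix \<phi> assume \<phi>: "test_fun ?S \<phi>"
    define m where "m = integral {a..b} \<phi>"
    define \<psi> where "\<psi> x = \<phi> x - m * \<phi>0 x" for x
    have \<psi>: "test_fun ?S \<psi>"
      unfolding \<psi>_def by (intro test_fun_diff test_fun_cmult \<phi> \<phi>0)
    have "integral {a..b} \<psi> = m - m * 1"
      unfolding \<psi>_def m_def \<phi>0(2)[symmetric]
      by (subst Henstock_Kurzweil_Integration.integral_diff)
         (auto intro!: integrable_continuous_real test_fun_continuous[OF \<phi>] continuous_intros test_fun_continuous[OF \<phi>0(1)])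
    then have \<psi>0: "integral {a..b} \<psi> = 0" by simp
    have "(LINT x|lebesgue_on ?S. u x * vderiv_iter 1 (\<lambda>x. integral {a..x} \<psi>) x) = 0"
      using assms(1) test_fun_antiderivative(1)[OF \<psi> assms(2) \<psi>0] by (simp add: has_weak_deriv_def)
    then have "(LINT x|lebesgue_on ?S. u x * \<psi> x) = 0"
      by (simp add: test_fun_antiderivative(2)[OF \<psi> assms(2) \<psi>0])
    moreover have "(LINT x|lebesgue_on ?S. u x * \<psi> x) = (LINT x|lebesgue_on ?S. u x * \<phi> x - m * (u x * \<phi>0 x))"
      by (simp add: \<psi>_def algebra_simps)
    moreover have "\<dots> = (LINT x|lebesgue_on ?S. u x * \<phi> x) - m * C"
      using locally_integrable_mult_test_fun[OF loc \<phi>] locally_integrable_mult_test_fun[OF loc \<phi>0(1)]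
      by (simp add: C_def)
    moreover have "(LINT x|lebesgue_on ?S. (u x - C) * \<phi> x) = (LINT x|lebesgue_on ?S. u x * \<phi> x) - C * m"
      using locally_integrable_mult_test_fun[OF loc \<phi>] locally_integrable_mult_test_fun[OF c \<phi>]
      by (simp add: m_def IL[OF \<phi>] left_diff_distrib)
    ultimately show "(LINT x|lebesgue_on ?S. (u x - C) * \<phi> x) = 0"
      by (simp add: mult.commute)
  qed
  then show ?thesis using that[of C] by simp
qed

text \<open>The absolutely continuous representative: the function minus the primitive of its weak
  derivative has weak derivative zero.\<close>

lemma weak_deriv_imp_indefinite_integral:
  assumes "has_weak_deriv {a<..<b} 1 v g" "g \<in> L2_space {a<..<b}" "a < b"
  obtains c where "AE x in lebesgue_on {a<..<b}. v x = c + integral {a..x} g"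
proof -
  have "has_weak_deriv {a<..<b} 1 (\<lambda>x. v x - (0 + integral {a..x} g)) (\<lambda>x. g x - g x)"
    using has_weak_deriv_diff[OF assms(1) has_weak_deriv_indefinite_integral[OF assms(2,3), of 0]] by simp
  then have "has_weak_deriv {a<..<b} 1 (\<lambda>x. v x - integral {a..x} g) (\<lambda>x. 0)" by simp
  then obtain c where "AE x in lebesgue_on {a<..<b}. v x - integral {a..x} g = c"
    using weak_deriv_zero_imp_AE_const[OF _ assms(3)] by metis
  then show ?thesis using that[of c] by (auto simp: algebra_simps)
qed

text \<open>Sobolev embedding in one dimension. In v = c + primitive of g, the L2 norm of the
  constant c is at most the sum of those of v and of the primitive, which after division by sqrt(b -
  a) yields 1 / sqrt(b - a) and one sqrt(b - a); the second sqrt(b - a) bounds the primitive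
  pointwise.\<close>

lemma sobolev_1_AE_bounded:
  assumes "v \<in> sobolev {a<..<b} 1" "a < b"
  shows "AE x in lebesgue_on {a<..<b}. norm (v x) \<le> (1 / sqrt (b - a) + 2 * sqrt (b - a)) * sobolev_norm {a<..<b} 1 v"
proof -
  let ?S = "{a<..<b}"
  define g where "g = weak_deriv ?S 1 v"
  have g: "has_weak_deriv ?S 1 v g" "g \<in> L2_space ?S"
    unfolding g_def using sobolevD[OF assms, of 1] by auto
  obtain c where c: "AE x in lebesgue_on ?S. v x = c + integral {a..x} g"
    using weak_deriv_imp_indefinite_integral[OF g assms(2)] by metis
  note vL = sobolev_L2[OF assms(1)]
  note iL = indefinite_integral_L2[OF g(2)]
  have "norm c * sqrt (b - a) = L2_norm ?S (\<lambda>x. c)"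
    using assms(2) by (simp add: L2_norm_const)
  also have "\<dots> = L2_norm ?S (\<lambda>x. v x - integral {a..x} g)"
    using c vL iL(1) assms(2)
    by (intro L2_norm_cong_AE L2_spaceD(1)[OF L2_const] L2_spaceD(1)[OF L2_diff])
       (auto elim!: eventually_mono)
  also have "\<dots> \<le> L2_norm ?S v + L2_norm ?S (\<lambda>x. integral {a..x} g)"
    using vL iL(1) assms(2) by (intro L2_norm_triangle_diff) auto
  also have "\<dots> \<le> L2_norm ?S v + (b - a) * L2_norm ?S g"
    using iL(2) assms(2) by simp
  finally have "norm c * sqrt (b - a) \<le> L2_norm ?S v + (b - a) * L2_norm ?S g" .
  then have "norm c \<le> L2_norm ?S v / sqrt (b - a) + (b - a) / sqrt (b - a) * L2_norm ?S g"
    using assms(2) by (simp add: field_simps)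
  also have "(b - a) / sqrt (b - a) = sqrt (b - a)"
    using assms(2) by (simp add: real_div_sqrt)
  finally have cb: "norm c \<le> L2_norm ?S v / sqrt (b - a) + sqrt (b - a) * L2_norm ?S g" .
  have "AE x in lebesgue_on ?S. norm (integral {a..x} g) \<le> sqrt (b - a) * L2_norm ?S g"
    by (intro AE_I2 indefinite_integral_norm_le[OF g(2)]) auto
  with c show ?thesis
  proof eventually_elim
    case (elim x)
    have "norm (v x) \<le> norm c + norm (integral {a..x} g)"
      unfolding elim(1) by (rule norm_triangle_ineq)
    also have "\<dots> \<le> L2_norm ?S v / sqrt (b - a) + 2 * sqrt (b - a) * L2_norm ?S g"
      using cb elim(2) by simp
    also have "\<dots> \<le> sobolev_norm ?S 1 v / sqrt (b - a) + 2 * sqrt (b - a) * sobolev_norm ?S 1 v"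
    proof (intro add_mono divide_right_mono mult_left_mono)
      show "L2_norm ?S v \<le> sobolev_norm ?S 1 v"
        using L2_norm_weak_deriv_le_sobolev_norm[of 0 1 ?S v] L2_norm_weak_deriv_0[OF vL assms(2)] by simp
      show "L2_norm ?S g \<le> sobolev_norm ?S 1 v"
        unfolding g_def by (rule L2_norm_weak_deriv_le_sobolev_norm) simp
    qed (use assms(2) in auto)
    finally show ?case by (simp add: algebra_simps)
  qed
qed

section \<open>Vanishing boundary values\<close>

lemma H1_zero_sobolev: "v \<in> H1_zero S \<Longrightarrow> v \<in> sobolev S 1"
  by (simp add: H1_zero_def)

text \<open>The substitute for the traces v(a) = 0 and v(b) = 0 of a function that has no point
  values: the constant of integration is zero, and the weak derivative has mean zero. Both hold for
  test functions and are continuous in the first order Sobolev norm.\<close>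

lemma H1_zeroD:
  assumes v: "v \<in> H1_zero {a<..<b}" and ab: "a < b"
  shows "AE x in lebesgue_on {a<..<b}. v x = integral {a..x} (weak_deriv {a<..<b} 1 v)"
    and "integral {a..b} (weak_deriv {a<..<b} 1 v) = 0"
proof -
  let ?S = "{a<..<b}"
  define g where "g = weak_deriv ?S 1 v"
  note vs = H1_zero_sobolev[OF v]
  have g: "has_weak_deriv ?S 1 v g" "g \<in> L2_space ?S"
    unfolding g_def using sobolevD[OF vs ab, of 1] by auto
  obtain c where c: "AE x in lebesgue_on ?S. v x = c + integral {a..x} g"
    using weak_deriv_imp_indefinite_integral[OF g ab] by metis
  \<comment> \<open>Comparison with a test function at distance less than e; the constant c and the
    mean of g are seen through the difference v - \<open>\<phi>\<close>, whose derivative is g -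
    \<open>\<phi>'\<close>.\<close>
  have approx: "norm (integral {a..b} g) \<le> sqrt (b - a) * e \<and> norm c * sqrt (b - a) \<le> (1 + (b - a)) * e"
    if e: "0 < e" for e
  proof -
    obtain \<phi> where \<phi>: "test_fun ?S \<phi>" "sobolev_norm ?S 1 (\<lambda>x. v x - \<phi> x) < e"
      using v e unfolding H1_zero_def by blast
    define \<phi>' where "\<phi>' = (\<lambda>x. vector_derivative \<phi> (at x))"
    have \<phi>': "has_weak_deriv ?S 1 \<phi> \<phi>'" "\<And>x. x \<in> {a..b} \<Longrightarrow> \<phi> x = integral {a..x} \<phi>'" "\<phi>' \<in> L2_space ?S"
      unfolding \<phi>'_def using test_fun_weak_deriv[OF \<phi>(1) ab]
        test_fun_L2[OF test_fun_vector_derivative[OF \<phi>(1)]] by auto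
    have vL: "v \<in> L2_space ?S" and \<phi>L: "\<phi> \<in> L2_space ?S"
      using sobolev_L2[OF vs] test_fun_L2[OF \<phi>(1)] by auto
    let ?h = "\<lambda>x. g x - \<phi>' x"
    have hL: "?h \<in> L2_space ?S" by (rule L2_diff[OF g(2) \<phi>'(3)])
    have "has_weak_deriv ?S 1 (\<lambda>x. v x - \<phi> x) ?h"
      by (rule has_weak_deriv_diff[OF g(1) \<phi>'(1)]) simp
    from L2_norm_weak_deriv[OF ab this hL]
    have h: "L2_norm ?S ?h \<le> e"
      using \<phi>(2) L2_norm_weak_deriv_le_sobolev_norm[of 1 1 ?S "\<lambda>x. v x - \<phi> x"] by simp
    have v\<phi>: "L2_norm ?S (\<lambda>x. v x - \<phi> x) \<le> e"
      using \<phi>(2) L2_norm_weak_deriv_le_sobolev_norm[of 0 1 ?S "\<lambda>x. v x - \<phi> x"]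
        L2_norm_weak_deriv_0[OF L2_diff[OF vL \<phi>L] ab] by simp
    have "\<phi> b = 0" using \<phi>(1) unfolding test_fun_def by auto
    then have "integral {a..b} ?h = integral {a..b} g"
      using indefinite_integral_diff[OF g(2) \<phi>'(3), of b] \<phi>'(2)[of b] ab by simp
    then have "norm (integral {a..b} g) \<le> sqrt (b - a) * L2_norm ?S ?h"
      using L2_Ioo_integral_norm_le[OF hL] ab by simp
    also have "\<dots> \<le> sqrt (b - a) * e" using h ab by (intro mult_left_mono) auto
    finally have 1: "norm (integral {a..b} g) \<le> sqrt (b - a) * e" .
    have iL: "(\<lambda>x. integral {a..x} ?h) \<in> L2_space ?S"
      and ib: "L2_norm ?S (\<lambda>x. integral {a..x} ?h) \<le> (b - a) * L2_norm ?S ?h"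
      using indefinite_integral_L2[OF hL] ab by auto
    have "norm c * sqrt (b - a) = L2_norm ?S (\<lambda>x. c)"
      using ab by (simp add: L2_norm_const)
    also have "\<dots> = L2_norm ?S (\<lambda>x. (v x - \<phi> x) - integral {a..x} ?h)"
    proof (rule L2_norm_cong_AE)
      have "AE x in lebesgue_on ?S. x \<in> ?S" by (intro AE_I2) simp
      with c show "AE x in lebesgue_on ?S. c = (v x - \<phi> x) - integral {a..x} ?h"
      proof eventually_elim
        case (elim x)
        then show ?case
          using indefinite_integral_diff[OF g(2) \<phi>'(3), of x] \<phi>'(2)[of x] by simp
      qed
    qed (use iL vL \<phi>L in \<open>auto intro!: L2_spaceD(1)[OF L2_diff] L2_diff\<close>)
    also have "\<dots> \<le> L2_norm ?S (\<lambda>x. v x - \<phi> x) + L2_norm ?S (\<lambda>x. integral {a..x} ?h)"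
      by (intro L2_norm_triangle_diff L2_diff vL \<phi>L iL)
    also have "\<dots> \<le> e + (b - a) * e"
      using v\<phi> ib mult_left_mono[OF h, of "b - a"] ab by linarith
    finally show ?thesis using 1 by (simp add: algebra_simps)
  qed
  have "norm (integral {a..b} g) \<le> 0 + e" if "0 < e" for e
  proof -
    have "0 < e / sqrt (b - a)" using that ab by simp
    from approx[OF this] show ?thesis using ab by simp
  qed
  then have "norm (integral {a..b} g) \<le> 0" by (rule field_le_epsilon)
  then show "integral {a..b} (weak_deriv ?S 1 v) = 0" by (simp add: g_def)
  have "norm c * sqrt (b - a) \<le> 0 + e" if "0 < e" for e
  proof -
    have "0 < e / (1 + (b - a))" using that ab by simp
    from approx[OF this] show ?thesis using ab by simp
  qed
  then have "norm c * sqrt (b - a) \<le> 0" by (rule field_le_epsilon)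
  then have "c = 0" using ab by (simp add: mult_le_0_iff)
  then show "AE x in lebesgue_on ?S. v x = integral {a..x} (weak_deriv ?S 1 v)"
    using c by (simp add: g_def)
qed

lemma has_weak_deriv_AE_indefinite_integral:
  assumes "g \<in> L2_space {a<..<b}" "a < b" "AE x in lebesgue_on {a<..<b}. v x = integral {a..x} g"
  shows "has_weak_deriv {a<..<b} 1 v g" "v \<in> L2_space {a<..<b}" "v \<in> sobolev {a<..<b} 1"
proof -
  let ?S = "{a<..<b}"
  have ae: "AE x in lebesgue_on ?S. 0 + integral {a..x} g = v x"
    using assms(3) by (auto elim: eventually_mono)
  show d: "has_weak_deriv ?S 1 v g"
    by (rule has_weak_deriv_cong_AE[OF has_weak_deriv_indefinite_integral[OF assms(1,2), of 0] ae]) auto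
  have iL: "(\<lambda>x. 0 + integral {a..x} g) \<in> L2_space ?S"
    using indefinite_integral_L2[OF assms(1)] assms(2) by simp
  show vL: "v \<in> L2_space ?S"
    by (rule L2_cong_AE[OF iL ae borel_measurable_lebesgue_on_AE[OF L2_spaceD(1)[OF iL] ae]]) simp
  have "\<exists>g\<in>L2_space ?S. has_weak_deriv ?S k v g" if "k \<le> 1" for k
  proof (cases "k = 0")
    case True
    then show ?thesis using vL has_weak_deriv_0[OF L2_locally_integrable[OF vL]] by auto
  next
    case False
    then have "k = 1" using that by simp
    then show ?thesis using d assms(1) by blast
  qed
  then show "v \<in> sobolev ?S 1" using vL by (simp add: sobolev_def)
qed

text \<open>The weak derivative g is approximated by a test function, whose mean m is removed with a
  multiple of \<open>\<phi>0\<close> so that its primitive is again a test function. As g has mean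
  zero, m is as small as the approximation error. In K the first factor pays for this correction and
  the second for passing from the derivative to the full norm.\<close>

lemma H1_zeroI:
  assumes g: "g \<in> L2_space {a<..<b}" and ab: "a < b"
    and ae: "AE x in lebesgue_on {a<..<b}. v x = integral {a..x} g"
    and g0: "integral {a..b} g = 0"
  shows "v \<in> H1_zero {a<..<b}"
proof -
  let ?S = "{a<..<b}"
  note v = has_weak_deriv_AE_indefinite_integral[OF g ab ae]
  obtain \<phi>0 where \<phi>0: "test_fun ?S \<phi>0" "integral {a..b} \<phi>0 = 1"
    using test_fun_unit_integral[OF ab] by metis
  have \<phi>0L: "\<phi>0 \<in> L2_space ?S" using test_fun_L2[OF \<phi>0(1)] by simp
  define K where "K = (1 + sqrt (b - a) * L2_norm ?S \<phi>0) * (1 + (b - a))"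
  have K: "0 < K" using ab by (auto simp: K_def intro!: mult_pos_pos add_pos_nonneg mult_nonneg_nonneg)
  have "\<exists>\<phi>. test_fun ?S \<phi> \<and> sobolev_norm ?S 1 (\<lambda>x. v x - \<phi> x) < e" if e: "0 < e" for e
  proof -
    obtain \<psi> where \<psi>: "test_fun ?S \<psi>" "L2_norm ?S (\<lambda>x. g x - \<psi> x) < e / K"
      using test_fun_dense_L2[OF g] e K by (metis divide_pos_pos)
    have \<psi>L: "\<psi> \<in> L2_space ?S" using test_fun_L2[OF \<psi>(1)] by simp
    define m where "m = integral {a..b} \<psi>"
    define \<zeta> where "\<zeta> x = \<psi> x - m * \<phi>0 x" for x
    have \<zeta>: "test_fun ?S \<zeta>" unfolding \<zeta>_def by (intro test_fun_diff test_fun_cmult \<psi> \<phi>0)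
    have \<zeta>L: "\<zeta> \<in> L2_space ?S" using test_fun_L2[OF \<zeta>] by simp
    have "integral {a..b} \<zeta> = m - m * 1"
      unfolding \<zeta>_def m_def \<phi>0(2)[symmetric]
      by (subst Henstock_Kurzweil_Integration.integral_diff)
         (auto intro!: integrable_continuous_real test_fun_continuous[OF \<psi>(1)] continuous_intros test_fun_continuous[OF \<phi>0(1)])
    then have \<zeta>0: "integral {a..b} \<zeta> = 0" by simp
    define \<phi> where "\<phi> x = integral {a..x} \<zeta>" for x
    have \<phi>: "test_fun ?S \<phi>" unfolding \<phi>_def by (rule test_fun_antiderivative[OF \<zeta> ab \<zeta>0])
    let ?h = "\<lambda>x. g x - \<zeta> x"
    have hL: "?h \<in> L2_space ?S" by (rule L2_diff[OF g \<zeta>L])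
    have "norm m = norm (integral {a..b} (\<lambda>x. g x - \<psi> x))"
      using indefinite_integral_diff[OF g \<psi>L, of b] g0 by (simp add: m_def)
    also have "\<dots> \<le> sqrt (b - a) * L2_norm ?S (\<lambda>x. g x - \<psi> x)"
      using ab by (intro L2_Ioo_integral_norm_le L2_diff g \<psi>L) auto
    finally have m: "norm m \<le> sqrt (b - a) * L2_norm ?S (\<lambda>x. g x - \<psi> x)" .
    have "L2_norm ?S ?h = L2_norm ?S (\<lambda>x. (g x - \<psi> x) + m * \<phi>0 x)"
      by (rule L2_norm_cong) (simp add: \<zeta>_def)
    also have "\<dots> \<le> L2_norm ?S (\<lambda>x. g x - \<psi> x) + norm m * L2_norm ?S \<phi>0"
      using L2_norm_triangle[OF L2_diff[OF g \<psi>L] L2_cmult[OF \<phi>0L, of m]] by (simp add: L2_norm_cmult)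
    also have "\<dots> \<le> L2_norm ?S (\<lambda>x. g x - \<psi> x) + (sqrt (b - a) * L2_norm ?S (\<lambda>x. g x - \<psi> x)) * L2_norm ?S \<phi>0"
      using m by (intro add_left_mono mult_right_mono) auto
    also have "\<dots> = (1 + sqrt (b - a) * L2_norm ?S \<phi>0) * L2_norm ?S (\<lambda>x. g x - \<psi> x)"
      by (simp add: algebra_simps)
    finally have h: "L2_norm ?S ?h \<le> (1 + sqrt (b - a) * L2_norm ?S \<phi>0) * L2_norm ?S (\<lambda>x. g x - \<psi> x)" .
    have aeh: "AE x in lebesgue_on ?S. v x - \<phi> x = integral {a..x} ?h"
    proof -
      have "AE x in lebesgue_on ?S. x \<in> ?S" by (intro AE_I2) simp
      with ae show ?thesis
        by eventually_elim (simp add: \<phi>_def indefinite_integral_diff[OF g \<zeta>L])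
    qed
    note vh = has_weak_deriv_AE_indefinite_integral[OF hL ab aeh]
    have "sobolev_norm ?S 1 (\<lambda>x. v x - \<phi> x)
        \<le> L2_norm ?S (weak_deriv ?S 0 (\<lambda>x. v x - \<phi> x)) + L2_norm ?S (weak_deriv ?S 1 (\<lambda>x. v x - \<phi> x))"
      unfolding sobolev_norm_L2_set
      by (rule order_trans[OF L2_set_le_sum]) (auto simp: atMost_Suc)
    also have "\<dots> = L2_norm ?S (\<lambda>x. v x - \<phi> x) + L2_norm ?S ?h"
      using L2_norm_weak_deriv_0[OF vh(2) ab] L2_norm_weak_deriv[OF ab vh(1) hL] by simp
    also have "L2_norm ?S (\<lambda>x. v x - \<phi> x) = L2_norm ?S (\<lambda>x. integral {a..x} ?h)"
      using ab by (intro L2_norm_cong_AE aeh L2_spaceD(1)[OF vh(2)] L2_spaceD(1)[OF indefinite_integral_L2(1)[OF hL]]) auto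
    also have "\<dots> + L2_norm ?S ?h \<le> (1 + (b - a)) * L2_norm ?S ?h"
      using indefinite_integral_L2(2)[OF hL] ab by (simp add: algebra_simps)
    also have "\<dots> \<le> (1 + (b - a)) * ((1 + sqrt (b - a) * L2_norm ?S \<phi>0) * L2_norm ?S (\<lambda>x. g x - \<psi> x))"
      using h ab by (intro mult_left_mono) auto
    also have "\<dots> = K * L2_norm ?S (\<lambda>x. g x - \<psi> x)" by (simp add: K_def)
    also have "\<dots> < K * (e / K)" using \<psi>(2) K by (intro mult_strict_left_mono)
    also have "\<dots> = e" using K by simp
    finally show ?thesis using \<phi> by blast
  qed
  then show ?thesis using v(3) by (simp add: H1_zero_def)
qed

lemma H1_zero_add:
  assumes "u \<in> H1_zero {a<..<b}" "v \<in> H1_zero {a<..<b}" "a < b"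
  shows "(\<lambda>x. u x + v x) \<in> H1_zero {a<..<b}"
  unfolding H1_zero_def
proof (intro CollectI conjI allI impI)
  show "(\<lambda>x. u x + v x) \<in> sobolev {a<..<b} 1"
    using assms by (intro sobolev_add H1_zero_sobolev)
  fix e :: real assume "0 < e"
  then obtain \<phi> \<psi> where \<phi>: "test_fun {a<..<b} \<phi>" "sobolev_norm {a<..<b} 1 (\<lambda>x. u x - \<phi> x) < e / 2"
    and \<psi>: "test_fun {a<..<b} \<psi>" "sobolev_norm {a<..<b} 1 (\<lambda>x. v x - \<psi> x) < e / 2"
    using assms(1,2) half_gt_zero unfolding H1_zero_def by blast
  have s: "\<zeta> \<in> sobolev {a<..<b} 1" if \<zeta>: "test_fun {a<..<b} \<zeta>" for \<zeta>
  proof (rule has_weak_deriv_AE_indefinite_integral(3)[OF _ assms(3)])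
    show "(\<lambda>x. vector_derivative \<zeta> (at x)) \<in> L2_space {a<..<b}"
      by (rule test_fun_L2[OF test_fun_vector_derivative[OF \<zeta>]]) simp
    show "AE x in lebesgue_on {a<..<b}. \<zeta> x = integral {a..x} (\<lambda>x. vector_derivative \<zeta> (at x))"
      by (intro AE_I2 test_fun_weak_deriv(2)[OF \<zeta> assms(3)]) auto
  qed
  have "sobolev_norm {a<..<b} 1 (\<lambda>x. (u x - \<phi> x) + (v x - \<psi> x))
      \<le> sobolev_norm {a<..<b} 1 (\<lambda>x. u x - \<phi> x) + sobolev_norm {a<..<b} 1 (\<lambda>x. v x - \<psi> x)"
    using assms by (intro sobolev_add sobolev_diff s \<phi> \<psi> H1_zero_sobolev)
  moreover have "(\<lambda>x. (u x - \<phi> x) + (v x - \<psi> x)) = (\<lambda>x. u x + v x - (\<phi> x + \<psi> x))"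
    by (auto simp: algebra_simps)
  ultimately show "\<exists>\<phi>. test_fun {a<..<b} \<phi> \<and> sobolev_norm {a<..<b} 1 (\<lambda>x. u x + v x - \<phi> x) < e"
    using \<phi> \<psi> by (intro exI[of _ "\<lambda>x. \<phi> x + \<psi> x"]) (auto intro: test_fun_add)
qed

lemma H1_zero_cmult:
  assumes "v \<in> H1_zero {a<..<b}" "a < b"
  shows "(\<lambda>x. c * v x) \<in> H1_zero {a<..<b}"
proof (rule H1_zeroI[where g="\<lambda>x. c * weak_deriv {a<..<b} 1 v x"])
  have L: "weak_deriv {a<..<b} 1 v \<in> L2_space {a<..<b}"
    using sobolevD[OF H1_zero_sobolev[OF assms(1)] assms(2), of 1] by simp
  then show "(\<lambda>x. c * weak_deriv {a<..<b} 1 v x) \<in> L2_space {a<..<b}" by (rule L2_cmult)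
  show "AE x in lebesgue_on {a<..<b}. c * v x = integral {a..x} (\<lambda>x. c * weak_deriv {a<..<b} 1 v x)"
    using H1_zeroD(1)[OF assms] by (auto elim: eventually_mono)
  show "integral {a..b} (\<lambda>x. c * weak_deriv {a<..<b} 1 v x) = 0"
    using H1_zeroD(2)[OF assms] by simp
qed (rule assms)

lemma H1_zero_diff:
  assumes "u \<in> H1_zero {a<..<b}" "v \<in> H1_zero {a<..<b}" "a < b"
  shows "(\<lambda>x. u x - v x) \<in> H1_zero {a<..<b}"
  using H1_zero_add[OF assms(1) H1_zero_cmult[OF assms(2,3), of "-1"] assms(3)] by simp

lemma H1_zero_zero: "a < b \<Longrightarrow> (\<lambda>x. 0) \<in> H1_zero {a<..<b}"
  by (rule H1_zeroI[where g="\<lambda>x. 0"]) auto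

text \<open>From an endpoint where a function vanishes, Cauchy-Schwarz gives a bound on its square
  growing linearly with the distance; integrating the linear weight gives (t - s)^2 / 2. The
  disjunction serves the two halves of an interval, each of which starts from its own
  endpoint.\<close>

lemma L2_norm_le_half_square:
  assumes "u \<in> L2_space {s<..<t}" "s \<le> t"
    and "(AE x in lebesgue_on {s<..<t}. (norm (u x))\<^sup>2 \<le> (x - s) * A)
      \<or> (AE x in lebesgue_on {s<..<t}. (norm (u x))\<^sup>2 \<le> (t - x) * A)"
  shows "(L2_norm {s<..<t} u)\<^sup>2 \<le> (t - s)\<^sup>2 / 2 * A"
proof -
  have aux: "(L2_norm {s<..<t} u)\<^sup>2 \<le> (t - s)\<^sup>2 / 2 * A"
    if ae: "AE x in lebesgue_on {s<..<t}. (norm (u x))\<^sup>2 \<le> f x * A"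
      and F: "\<And>x. (F has_vector_derivative f x) (at x within {s..t})" "F t - F s = (t - s)\<^sup>2 / 2"
      and f: "continuous_on {s..t} f" for f F :: "real \<Rightarrow> real"
  proof -
    have fi: "integrable (lebesgue_on {s<..<t}) (\<lambda>x. f x * A)"
    proof (rule integrable_lebesgue_on_mono[of "{s..t}"])
      have "continuous_on {s..t} (\<lambda>x. f x * A)" using f by (intro continuous_intros)
      then show "integrable (lebesgue_on {s..t}) (\<lambda>x. f x * A)"
        by (intro absolutely_integrable_imp_integrable absolutely_integrable_continuous_real) auto
    qed auto
    have "(L2_norm {s<..<t} u)\<^sup>2 \<le> (LINT x|lebesgue_on {s<..<t}. f x * A)"
      unfolding L2_norm_power2 by (rule integral_mono_AE[OF L2_spaceD(2)[OF assms(1)] fi ae])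
    also have "\<dots> = integral {s..t} (\<lambda>x. f x * A)"
      using lebesgue_integral_eq_integral[OF fi] by (simp add: integral_open_interval_real)
    also have "((\<lambda>x. f x * A) has_integral F t * A - F s * A) {s..t}"
      using F(1) assms(2) by (intro fundamental_theorem_of_calculus) (auto intro!: derivative_eq_intros)
    then have "integral {s..t} (\<lambda>x. f x * A) = F t * A - F s * A"
      by (rule integral_unique)
    also have "\<dots> = (t - s)\<^sup>2 / 2 * A"
      unfolding F(2)[symmetric] by (simp add: left_diff_distrib)
    finally show ?thesis .
  qed
  from assms(3) show ?thesis
  proof
    assume "AE x in lebesgue_on {s<..<t}. (norm (u x))\<^sup>2 \<le> (x - s) * A"
    then show ?thesis
      by (rule aux[where F="\<lambda>x. (x - s)\<^sup>2 / 2"])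
         (auto intro!: derivative_eq_intros continuous_intros
           simp flip: has_real_derivative_iff_has_vector_derivative)
  next
    assume "AE x in lebesgue_on {s<..<t}. (norm (u x))\<^sup>2 \<le> (t - x) * A"
    then show ?thesis
      by (rule aux[where F="\<lambda>x. t * x - x\<^sup>2 / 2"])
         (auto intro!: derivative_eq_intros continuous_intros
           simp: power2_diff field_simps power2_eq_square
           simp flip: has_real_derivative_iff_has_vector_derivative)
  qed
qed

text \<open>The optimal constant is \<open>(b - a)\<^sup>2 / pi\<^sup>2\<close>; estimating from the nearer endpoint
  loses less than a factor of two.\<close>

lemma H1_zero_poincare:
  assumes v: "v \<in> H1_zero {a<..<b}" and ab: "a < b"
  shows "(L2_norm {a<..<b} v)\<^sup>2 \<le> (b - a)\<^sup>2 / 8 * (H1_seminorm {a<..<b} v)\<^sup>2"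
proof -
  let ?S = "{a<..<b}"
  define g where "g = weak_deriv ?S 1 v"
  define m where "m = (a + b) / 2"
  have m: "a < m" "m < b" "m - a = (b - a) / 2" "b - m = (b - a) / 2" using ab by (auto simp: m_def field_simps)
  have g: "g \<in> L2_space ?S"
    unfolding g_def using sobolevD[OF H1_zero_sobolev[OF v] ab, of 1] by simp
  have vL: "v \<in> L2_space ?S" by (rule sobolev_L2[OF H1_zero_sobolev[OF v]])
  have gi: "g integrable_on {s..t}" if "a \<le> s" "t \<le> b" for s t
    by (rule L2_Ioo_integrable_on[OF g that])
  have ae: "AE x in lebesgue. x \<in> ?S \<longrightarrow> v x = integral {a..x} g"
    using H1_zeroD(1)[OF v ab] by (simp add: AE_restrict_space_iff g_def)
  have left: "(L2_norm {a<..<m} v)\<^sup>2 \<le> (m - a)\<^sup>2 / 2 * (L2_norm {a<..<m} g)\<^sup>2"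
  proof (rule L2_norm_le_half_square)
    have "(norm (v x))\<^sup>2 \<le> (x - a) * (L2_norm {a<..<m} g)\<^sup>2"
      if "v x = integral {a..x} g" "x \<in> {a<..<m}" for x
    proof -
      have "norm (v x) \<le> sqrt (x - a) * L2_norm {a<..<x} g"
        unfolding that(1) using that m by (intro L2_Ioo_integral_norm_le L2_Ioo_subinterval[OF g]) auto
      also have "\<dots> \<le> sqrt (x - a) * L2_norm {a<..<m} g"
        using that m by (intro mult_left_mono L2_norm_Ioo_mono L2_Ioo_subinterval[OF g]) auto
      finally have "(norm (v x))\<^sup>2 \<le> (sqrt (x - a) * L2_norm {a<..<m} g)\<^sup>2"
        by (intro power_mono) auto
      then show ?thesis using that by (simp add: power_mult_distrib)
    qed
    then show "(AE x in lebesgue_on {a<..<m}. (norm (v x))\<^sup>2 \<le> (x - a) * (L2_norm {a<..<m} g)\<^sup>2)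
        \<or> (AE x in lebesgue_on {a<..<m}. (norm (v x))\<^sup>2 \<le> (m - x) * (L2_norm {a<..<m} g)\<^sup>2)"
      using ae m by (intro disjI1) (auto simp: AE_restrict_space_iff elim!: eventually_mono)
  qed (use m L2_Ioo_subinterval[OF vL] in auto)
  have right: "(L2_norm {m<..<b} v)\<^sup>2 \<le> (b - m)\<^sup>2 / 2 * (L2_norm {m<..<b} g)\<^sup>2"
  proof (rule L2_norm_le_half_square)
    have "(norm (v x))\<^sup>2 \<le> (b - x) * (L2_norm {m<..<b} g)\<^sup>2"
      if "v x = integral {a..x} g" "x \<in> {m<..<b}" for x
    proof -
      \<comment> \<open>On the right half the function is measured from b: as the derivative has
        mean zero, v is minus the integral from x to b.\<close>
      have "integral {a..x} g + integral {x..b} g = integral {a..b} g"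
        using that m by (intro Henstock_Kurzweil_Integration.integral_combine gi) auto
      then have "v x = - integral {x..b} g"
        using that H1_zeroD(2)[OF v ab] by (simp add: g_def add_eq_0_iff)
      then have "norm (v x) \<le> sqrt (b - x) * L2_norm {x<..<b} g"
        using that m by (simp add: L2_Ioo_integral_norm_le L2_Ioo_subinterval[OF g])
      also have "\<dots> \<le> sqrt (b - x) * L2_norm {m<..<b} g"
        using that m by (intro mult_left_mono L2_norm_Ioo_mono L2_Ioo_subinterval[OF g]) auto
      finally have "(norm (v x))\<^sup>2 \<le> (sqrt (b - x) * L2_norm {m<..<b} g)\<^sup>2"
        by (intro power_mono) auto
      then show ?thesis using that by (simp add: power_mult_distrib)
    qed
    then show "(AE x in lebesgue_on {m<..<b}. (norm (v x))\<^sup>2 \<le> (x - m) * (L2_norm {m<..<b} g)\<^sup>2)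
        \<or> (AE x in lebesgue_on {m<..<b}. (norm (v x))\<^sup>2 \<le> (b - x) * (L2_norm {m<..<b} g)\<^sup>2)"
      using ae m by (intro disjI2) (auto simp: AE_restrict_space_iff elim!: eventually_mono)
  qed (use m L2_Ioo_subinterval[OF vL] in auto)
  have "(L2_norm ?S v)\<^sup>2 = (L2_norm {a<..<m} v)\<^sup>2 + (L2_norm {m<..<b} v)\<^sup>2"
    using m by (intro L2_norm_Ioo_split vL) auto
  also have "\<dots> \<le> ((b - a) / 2)\<^sup>2 / 2 * (L2_norm {a<..<m} g)\<^sup>2 + ((b - a) / 2)\<^sup>2 / 2 * (L2_norm {m<..<b} g)\<^sup>2"
    using left right unfolding m(3,4) by linarith
  also have "\<dots> = ((b - a) / 2)\<^sup>2 / 2 * (L2_norm ?S g)\<^sup>2"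
    using L2_norm_Ioo_split[OF g, of m] m by (simp add: distrib_left)
  also have "\<dots> = (b - a)\<^sup>2 / 8 * (H1_seminorm ?S v)\<^sup>2"
    by (simp add: H1_seminorm_def g_def power_divide)
  finally show ?thesis .
qed

text \<open>Weak lower semicontinuity, by testing against smooth approximations of the weak derivatives of
  the limit.\<close>

lemma sobolev_norm_limit_le:
  assumes ab: "a < b" and s: "\<And>n. s n \<in> sobolev {a<..<b} q" "\<And>n. sobolev_norm {a<..<b} q (s n) \<le> B"
    and lim: "\<And>x. x \<in> {a<..<b} \<Longrightarrow> (\<lambda>n. s n x) \<longlonglongrightarrow> d x"
    and bd: "\<And>n. AE x in lebesgue_on {a<..<b}. norm (s n x) \<le> M"
    and d: "d \<in> sobolev {a<..<b} q"
  shows "sobolev_norm {a<..<b} q d \<le> B"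
proof -
  let ?S = "{a<..<b}"
  define D where "D k = weak_deriv ?S k d" for k
  define N where "N = sobolev_norm ?S q d"
  have N: "N = L2_set (\<lambda>k. L2_norm ?S (D k)) {..q}" "0 \<le> N"
    by (simp_all add: N_def D_def sobolev_norm_L2_set)
  have DL: "D k \<in> L2_space ?S" and Dd: "has_weak_deriv ?S k d (D k)" if "k \<le> q" for k
    unfolding D_def using sobolevD[OF d ab that] by auto
  have B: "0 \<le> B" using s(2)[of 0] sobolev_norm_nonneg order_trans by blast
  \<comment> \<open>All orders of derivatives are tested together, each against its own function, so
    that Cauchy-Schwarz over the orders produces the bound B on the whole Sobolev norm with no loss
    of a factor. Each pairing converges because the derivatives can be moved to the test
    function.\<close>
  have test: "norm (\<Sum>k\<le>q. LINT x|lebesgue_on ?S. D k x * \<psi> k x) \<le> B * L2_set (\<lambda>k. L2_norm ?S (\<psi> k)) {..q}"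
    if \<psi>: "\<And>k. test_fun ?S (\<psi> k)" for \<psi>
  proof (rule Lim_norm_ubound[OF sequentially_bot])
    have \<psi>L: "\<psi> k \<in> L2_space ?S" for k using test_fun_L2[OF \<psi>] by simp
    have conv: "(\<lambda>n. LINT x|lebesgue_on ?S. weak_deriv ?S k (s n) x * \<psi> k x)
        \<longlonglongrightarrow> (LINT x|lebesgue_on ?S. D k x * \<psi> k x)" if k: "k \<le> q" for k
    proof -
      let ?\<psi> = "vderiv_iter k (\<psi> k)"
      have \<psi>': "test_fun ?S ?\<psi>" by (rule test_fun_vderiv_iter[OF \<psi>])
      obtain C where C: "0 < C" "\<And>x. norm (?\<psi> x) \<le> C" using test_fun_bounded[OF \<psi>'] by metis
      have "(\<lambda>n. LINT x|lebesgue_on ?S. s n x * ?\<psi> x) \<longlonglongrightarrow> (LINT x|lebesgue_on ?S. d x * ?\<psi> x)"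
      proof (rule integral_dominated_convergence[where w="\<lambda>x. M * C"])
        show "(\<lambda>x. d x * ?\<psi> x) \<in> borel_measurable (lebesgue_on ?S)"
          by (intro borel_measurable_times L2_spaceD(1)[OF sobolev_L2[OF d]] test_fun_measurable_on[OF \<psi>'])
        show "(\<lambda>x. s n x * ?\<psi> x) \<in> borel_measurable (lebesgue_on ?S)" for n
          by (intro borel_measurable_times L2_spaceD(1)[OF sobolev_L2[OF s(1)]] test_fun_measurable_on[OF \<psi>'])
        show "integrable (lebesgue_on ?S) (\<lambda>x. M * C)"
          by (intro finite_measure.integrable_const finite_measure_lebesgue_on) simp
        show "AE x in lebesgue_on ?S. (\<lambda>n. s n x * ?\<psi> x) \<longlonglongrightarrow> d x * ?\<psi> x"
          by (intro AE_I2 tendsto_intros lim) simp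
        show "AE x in lebesgue_on ?S. norm (s n x * ?\<psi> x) \<le> M * C" for n
          using bd[of n]
        proof eventually_elim
          case (elim x)
          then have "0 \<le> M" using norm_ge_zero order_trans by blast
          then show ?case using elim C by (auto simp: norm_mult intro!: mult_mono)
        qed
      qed
      then have "(\<lambda>n. (- 1) ^ k * (LINT x|lebesgue_on ?S. s n x * ?\<psi> x))
          \<longlonglongrightarrow> (- 1) ^ k * (LINT x|lebesgue_on ?S. d x * ?\<psi> x)"
        by (intro tendsto_intros)
      moreover have "(LINT x|lebesgue_on ?S. d x * ?\<psi> x) = (- 1) ^ k * (LINT x|lebesgue_on ?S. D k x * \<psi> k x)"
        using Dd[OF k] \<psi>[of k] by (simp add: has_weak_deriv_def)
      moreover have "(LINT x|lebesgue_on ?S. s n x * ?\<psi> x)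
          = (- 1) ^ k * (LINT x|lebesgue_on ?S. weak_deriv ?S k (s n) x * \<psi> k x)" for n
        using sobolevD(1)[OF s(1) ab k] \<psi>[of k] by (simp add: has_weak_deriv_def)
      ultimately show ?thesis by (simp flip: mult.assoc power_add)
    qed
    show "(\<lambda>n. \<Sum>k\<le>q. LINT x|lebesgue_on ?S. weak_deriv ?S k (s n) x * \<psi> k x)
        \<longlonglongrightarrow> (\<Sum>k\<le>q. LINT x|lebesgue_on ?S. D k x * \<psi> k x)"
      by (intro tendsto_sum conv) simp
    show "\<forall>\<^sub>F n in sequentially. norm (\<Sum>k\<le>q. LINT x|lebesgue_on ?S. weak_deriv ?S k (s n) x * \<psi> k x)
        \<le> B * L2_set (\<lambda>k. L2_norm ?S (\<psi> k)) {..q}"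
    proof (intro always_eventually allI)
      fix n
      have "norm (\<Sum>k\<le>q. LINT x|lebesgue_on ?S. weak_deriv ?S k (s n) x * \<psi> k x)
          \<le> (\<Sum>k\<le>q. \<bar>L2_norm ?S (weak_deriv ?S k (s n))\<bar> * \<bar>L2_norm ?S (\<psi> k)\<bar>)"
        using sobolevD(2)[OF s(1) ab] \<psi>L by (intro sum_norm_le) (auto intro!: L2_LINT_mult_le)
      also have "\<dots> \<le> sobolev_norm ?S q (s n) * L2_set (\<lambda>k. L2_norm ?S (\<psi> k)) {..q}"
        unfolding sobolev_norm_L2_set by (rule L2_set_mult_ineq)
      also have "\<dots> \<le> B * L2_set (\<lambda>k. L2_norm ?S (\<psi> k)) {..q}"
        by (intro mult_right_mono s) auto
      finally show "norm (\<Sum>k\<le>q. LINT x|lebesgue_on ?S. weak_deriv ?S k (s n) x * \<psi> k x)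
        \<le> B * L2_set (\<lambda>k. L2_norm ?S (\<psi> k)) {..q}" .
    qed
  qed
  define K where "K = B * sqrt (real (q + 1)) + (\<Sum>k\<le>q. L2_norm ?S (D k))"
  have K: "0 \<le> K" using B by (auto simp: K_def intro!: add_nonneg_nonneg sum_nonneg)
  \<comment> \<open>The test functions are taken close to the conjugates of the derivatives of the
    limit, which turns the pairing into N^2 up to errors proportional to e. Letting e go to zero
    leaves N^2 <= B N.\<close>
  have est: "N\<^sup>2 \<le> B * N + e * K" if e: "0 < e" for e
  proof -
    have "\<exists>\<psi>. test_fun ?S \<psi> \<and> (k \<le> q \<longrightarrow> L2_norm ?S (\<lambda>x. cnj (D k x) - \<psi> x) < e)" for k
    proof (cases "k \<le> q")
      case True
      show ?thesis using test_fun_dense_L2[OF L2_cnj[OF DL[OF True]] e] by metis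
    qed (use test_fun_zero in blast)
    then obtain \<psi> where \<psi>: "\<And>k. test_fun ?S (\<psi> k)" "\<And>k. k \<le> q \<Longrightarrow> L2_norm ?S (\<lambda>x. cnj (D k x) - \<psi> k x) < e"
      by metis
    have \<psi>L: "\<psi> k \<in> L2_space ?S" for k using test_fun_L2[OF \<psi>(1)] by simp
    have split: "complex_of_real ((L2_norm ?S (D k))\<^sup>2)
        = (LINT x|lebesgue_on ?S. D k x * \<psi> k x) + (LINT x|lebesgue_on ?S. D k x * (cnj (D k x) - \<psi> k x))"
      if k: "k \<le> q" for k
      using L2_integrable_mult[OF DL[OF k] \<psi>L[of k]] L2_integrable_inner[OF DL[OF k] DL[OF k]]
      unfolding L2_inner_self[symmetric] L2_inner_def by (simp add: right_diff_distrib)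
    have "complex_of_real (N\<^sup>2) = (\<Sum>k\<le>q. complex_of_real ((L2_norm ?S (D k))\<^sup>2))"
      by (simp add: N(1) L2_set_def sum_nonneg)
    also have "\<dots> = (\<Sum>k\<le>q. LINT x|lebesgue_on ?S. D k x * \<psi> k x)
        + (\<Sum>k\<le>q. LINT x|lebesgue_on ?S. D k x * (cnj (D k x) - \<psi> k x))"
      by (subst sum.distrib[symmetric]) (intro sum.cong refl split, simp)
    finally have eq: "complex_of_real (N\<^sup>2) = (\<Sum>k\<le>q. LINT x|lebesgue_on ?S. D k x * \<psi> k x)
        + (\<Sum>k\<le>q. LINT x|lebesgue_on ?S. D k x * (cnj (D k x) - \<psi> k x))" .
    have "norm (complex_of_real (N\<^sup>2)) \<le> norm (\<Sum>k\<le>q. LINT x|lebesgue_on ?S. D k x * \<psi> k x)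
        + norm (\<Sum>k\<le>q. LINT x|lebesgue_on ?S. D k x * (cnj (D k x) - \<psi> k x))"
      unfolding eq by (rule norm_triangle_ineq)
    also have "\<dots> \<le> B * L2_set (\<lambda>k. L2_norm ?S (\<psi> k)) {..q} + (\<Sum>k\<le>q. L2_norm ?S (D k) * e)"
    proof (rule add_mono[OF test[OF \<psi>(1)] sum_norm_le])
      fix k assume "k \<in> {..q}"
      then have k: "k \<le> q" by simp
      have "norm (LINT x|lebesgue_on ?S. D k x * (cnj (D k x) - \<psi> k x))
          \<le> L2_norm ?S (D k) * L2_norm ?S (\<lambda>x. cnj (D k x) - \<psi> k x)"
        by (intro L2_LINT_mult_le DL k L2_diff L2_cnj \<psi>L)
      also have "\<dots> \<le> L2_norm ?S (D k) * e"
        using \<psi>(2)[OF k] by (intro mult_left_mono) auto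
      finally show "norm (LINT x|lebesgue_on ?S. D k x * (cnj (D k x) - \<psi> k x)) \<le> L2_norm ?S (D k) * e" .
    qed
    also have "L2_set (\<lambda>k. L2_norm ?S (\<psi> k)) {..q} \<le> L2_set (\<lambda>k. L2_norm ?S (D k) + e) {..q}"
    proof (rule L2_set_mono)
      fix k assume "k \<in> {..q}"
      then have k: "k \<le> q" by simp
      have "L2_norm ?S (\<lambda>x. cnj (D k x) - (cnj (D k x) - \<psi> k x))
          \<le> L2_norm ?S (\<lambda>x. cnj (D k x)) + L2_norm ?S (\<lambda>x. cnj (D k x) - \<psi> k x)"
        by (intro L2_norm_triangle_diff DL k L2_diff L2_cnj \<psi>L)
      then show "L2_norm ?S (\<psi> k) \<le> L2_norm ?S (D k) + e"
        using \<psi>(2)[OF k] by (simp add: L2_norm_eq)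
    qed auto
    also have "L2_set (\<lambda>k. L2_norm ?S (D k) + e) {..q} \<le> N + L2_set (\<lambda>k. e) {..q}"
      unfolding N(1) by (rule L2_set_triangle_ineq)
    also have "L2_set (\<lambda>k. e) {..q} = sqrt (real (q + 1)) * e"
      using e by (simp add: L2_set_def real_sqrt_mult)
    finally have "norm (complex_of_real (N\<^sup>2)) \<le> B * (N + sqrt (real (q + 1)) * e) + (\<Sum>k\<le>q. L2_norm ?S (D k) * e)"
      using B by (simp add: mult_left_mono)
    then show ?thesis
      by (simp add: K_def distrib_left sum_distrib_left sum_distrib_right mult_ac norm_power)
  qed
  have "N\<^sup>2 \<le> B * N + e" if "0 < e" for e
  proof -
    have "e / (K + 1) * K \<le> e" using K that by (simp add: field_simps)
    then show ?thesis using est[of "e / (K + 1)"] K that by fastforce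
  qed
  then have "N\<^sup>2 \<le> B * N" by (rule field_le_epsilon)
  then have "N \<le> B" using N(2) B by (cases "N = 0") (auto simp: power2_eq_square)
  then show ?thesis by (simp add: N_def)
qed

section \<open>Increments in time measured in Sobolev norms\<close>

lemma riemann_sum_tendsto:
  fixes F :: "real \<Rightarrow> complex"
  assumes "s \<le> t" "\<And>x. x \<in> {s..t} \<Longrightarrow> (F has_vector_derivative f x) (at x within {s..t})"
    and cont: "continuous_on {s..t} f"
  shows "(\<lambda>n. \<Sum>i<Suc n. of_real ((t - s) / real (Suc n)) * f (s + (t - s) * (real i / real (Suc n)))) \<longlonglongrightarrow> F t - F s"
proof (rule LIMSEQ_I)
  fix e :: real assume e: "0 < e"
  \<comment> \<open>The tolerance for the oscillation of f on one cell: the total error is at most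
    (t - s) e', and the summand 1 in the denominator covers s = t.\<close>
  define e' where "e' = e / 2 / (t - s + 1)"
  have e': "0 < e'" using e assms(1) by (simp add: e'_def)
  have "uniformly_continuous_on {s..t} f"
    by (rule compact_uniformly_continuous[OF cont]) simp
  then obtain \<delta> where \<delta>: "0 < \<delta>" "\<And>x y. x \<in> {s..t} \<Longrightarrow> y \<in> {s..t} \<Longrightarrow> dist x y < \<delta> \<Longrightarrow> dist (f x) (f y) < e'"
    using e' unfolding uniformly_continuous_on_def by metis
  obtain n0 where n0: "(t - s) / \<delta> < real n0" using reals_Archimedean2 by blast
  show "\<exists>no. \<forall>n\<ge>no. norm ((\<Sum>i<Suc n. of_real ((t - s) / real (Suc n)) * f (s + (t - s) * (real i / real (Suc n)))) - (F t - F s)) < e"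
  proof (intro exI allI impI)
    fix n assume n: "n0 \<le> n"
    define h where "h = (t - s) / real (Suc n)"
    define p where "p i = s + h * real i" for i
    have h: "0 \<le> h" "h < \<delta>" "h * real (Suc n) = t - s"
    proof -
      show "0 \<le> h" using assms(1) by (simp add: h_def)
      have "(t - s) / \<delta> < real (Suc n)" using n0 n by linarith
      then show "h < \<delta>" using \<delta>(1) by (simp add: h_def field_simps)
      show "h * real (Suc n) = t - s" by (simp add: h_def)
    qed
    have p_in: "p i \<in> {s..t}" if "i \<le> Suc n" for i
    proof -
      have "h * real i \<le> h * real (Suc n)" using that h(1) by (intro mult_left_mono) auto
      then show ?thesis using h by (auto simp: p_def)
    qed
    have step: "norm (of_real h * f (p i) - (F (p (Suc i)) - F (p i))) \<le> h * e'" if i: "i < Suc n" for i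
    proof -
      have pi: "p i \<in> {s..t}" "p (Suc i) \<in> {s..t}" "p (Suc i) = p i + h"
        using p_in[of i] p_in[of "Suc i"] i by (auto simp: p_def algebra_simps)
      have sub: "{p i..p (Suc i)} \<subseteq> {s..t}" using pi by auto
      have "norm (F (p (Suc i)) - F (p i) - (p (Suc i) - p i) *\<^sub>R f (p i)) \<le> norm (p (Suc i) - p i) * e'"
      proof (rule vector_differentiable_bound_linearization[where S="{p i..p (Suc i)}" and f'=f])
        show "(F has_vector_derivative f x) (at x within {p i..p (Suc i)})" if "x \<in> {p i..p (Suc i)}" for x
          using has_vector_derivative_within_subset[OF assms(2) sub] sub that by blast
        show "closed_segment (p i) (p (Suc i)) \<subseteq> {p i..p (Suc i)}"
          using pi(3) h(1) by (simp add: closed_segment_eq_real_ivl)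
        show "norm (f x - f (p i)) \<le> e'" if "x \<in> {p i..p (Suc i)}" for x
        proof -
          have "dist x (p i) < \<delta>" using that pi(3) h(2) by (auto simp: dist_real_def)
          then show ?thesis using \<delta>(2)[of x "p i"] that sub pi(1) by (force simp: dist_norm)
        qed
        show "p i \<in> {p i..p (Suc i)}" using pi(3) h(1) by simp
      qed
      then show ?thesis using pi(3) h(1)
        by (simp add: scaleR_conv_of_real norm_minus_commute)
    qed
    have "(\<Sum>i<Suc n. F (p (Suc i)) - F (p i)) = F (p (Suc n)) - F (p 0)"
      by (rule sum_lessThan_telescope)
    then have tele: "F t - F s = (\<Sum>i<Suc n. F (p (Suc i)) - F (p i))"
      using h(3) by (simp add: p_def)
    have "norm ((\<Sum>i<Suc n. of_real h * f (p i)) - (F t - F s)) \<le> (\<Sum>i<Suc n. h * e')"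
      unfolding tele sum_subtractf[symmetric] by (intro sum_norm_le step) auto
    also have "\<dots> = (h * real (Suc n)) * e'" by (simp only: sum_constant card_lessThan mult_ac)
    also have "\<dots> = (t - s) * e'" by (simp only: h(3))
    also have "\<dots> \<le> (t - s + 1) * e'" using e' by (intro mult_right_mono) auto
    also have "\<dots> = e / 2"
    proof -
      have "c * (e / 2 / c) = e / 2" if "0 < c" for c using that by simp
      from this[of "t - s + 1"] show ?thesis using assms(1) unfolding e'_def by simp
    qed
    also have "\<dots> < e" using e by simp
    finally show "norm ((\<Sum>i<Suc n. of_real ((t - s) / real (Suc n)) * f (s + (t - s) * (real i / real (Suc n)))) - (F t - F s)) < e"
      by (simp only: h_def p_def times_divide_eq_right times_divide_eq_left mult.commute)
  qed
qed

text \<open>The increment is, for each x, the limit of left Riemann sums of the time derivative. At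
  fixed nodes such a sum is a finite combination of Sobolev functions, with norm at most (t - s)
  times the supremum, and lower semicontinuity transfers this bound to the limit. The uniform almost
  everywhere bound required there comes from the one dimensional embedding, which is where q >= 1
  enters.\<close>

lemma sobolev_norm_time_increment:
  assumes ab: "a < b" and q: "1 \<le> q"
    and C1: "\<forall>x\<in>{a<..<b}. (\<forall>t\<in>{0..T}. G x differentiable (at t within {0..T})) \<and>
                 continuous_on {0..T} (time_deriv T G x)"
    and Gt: "\<forall>t\<in>{0..T}. (\<lambda>x. time_deriv T G x t) \<in> sobolev {a<..<b} q"
    and bdd: "bdd_above ((\<lambda>t. sobolev_norm {a<..<b} q (\<lambda>x. time_deriv T G x t)) ` {0..T})"
    and st: "0 \<le> s" "s \<le> t" "t \<le> T"
    and G: "(\<lambda>x. G x s) \<in> sobolev {a<..<b} q" "(\<lambda>x. G x t) \<in> sobolev {a<..<b} q"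
  shows "sobolev_norm {a<..<b} q (\<lambda>x. G x t - G x s) \<le> (t - s) * sup_sobolev_norm {a<..<b} T q (time_deriv T G)"
proof -
  let ?S = "{a<..<b}"
  define B where "B = sup_sobolev_norm ?S T q (time_deriv T G)"
  define C where "C = 1 / sqrt (b - a) + 2 * sqrt (b - a)"
  have C: "0 \<le> C" using ab by (simp add: C_def)
  have up: "sobolev_norm ?S q (\<lambda>x. time_deriv T G x r) \<le> B" if "r \<in> {0..T}" for r
    unfolding B_def sup_sobolev_norm_def by (rule cSUP_upper[OF that bdd])
  define p where "p n i = s + (t - s) * (real i / real (Suc n))" for n i
  define S where "S n x = (\<Sum>i<Suc n. of_real ((t - s) / real (Suc n)) * time_deriv T G x (p n i))" for n x
  have p: "p n i \<in> {0..T}" if "i < Suc n" for n i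
  proof -
    define w where "w = (t - s) * (real i / real (Suc n))"
    have "w \<le> (t - s) * 1"
      unfolding w_def using that st by (intro mult_left_mono) auto
    moreover have "0 \<le> w" unfolding w_def using st by simp
    moreover have "p n i = s + w" by (simp add: p_def w_def)
    ultimately show ?thesis using st by auto
  qed
  have Ssob: "S n \<in> sobolev ?S q \<and> sobolev_norm ?S q (S n) \<le> (\<Sum>i<Suc n. (t - s) / real (Suc n) * B)" for n
  proof -
    have summand: "(\<lambda>x. of_real ((t - s) / real (Suc n)) * time_deriv T G x (p n i)) \<in> sobolev ?S q"
      "sobolev_norm ?S q (\<lambda>x. of_real ((t - s) / real (Suc n)) * time_deriv T G x (p n i)) \<le> (t - s) / real (Suc n) * B"
      if i: "i < Suc n" for i
    proof -
      have i': "(\<lambda>x. time_deriv T G x (p n i)) \<in> sobolev ?S q" using Gt p[OF i] by blast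
      show "(\<lambda>x. of_real ((t - s) / real (Suc n)) * time_deriv T G x (p n i)) \<in> sobolev ?S q"
        by (rule sobolev_cmult(1)[OF i' ab])
      show "sobolev_norm ?S q (\<lambda>x. of_real ((t - s) / real (Suc n)) * time_deriv T G x (p n i)) \<le> (t - s) / real (Suc n) * B"
        unfolding sobolev_cmult(2)[OF i' ab] norm_of_real using up[OF p[OF i]] st
        by (intro mult_mono) auto
    qed
    have "S n \<in> sobolev ?S q \<and> sobolev_norm ?S q (S n)
        \<le> (\<Sum>i<Suc n. sobolev_norm ?S q (\<lambda>x. of_real ((t - s) / real (Suc n)) * time_deriv T G x (p n i)))"
      unfolding S_def by (rule sobolev_sum[OF _ ab]) (use summand(1) in auto)
    then show ?thesis
      using sum_mono[of "{..<Suc n}", OF summand(2)] by force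
  qed
  have "sobolev_norm ?S q (\<lambda>x. G x t - G x s) \<le> (t - s) * B"
  proof (rule sobolev_norm_limit_le[OF ab, where s=S and M="(t - s) * (C * B)"])
    show "S n \<in> sobolev ?S q" for n using Ssob by blast
    show "sobolev_norm ?S q (S n) \<le> (t - s) * B" for n
      using Ssob[of n] by simp
    show "(\<lambda>n. S n x) \<longlonglongrightarrow> G x t - G x s" if x: "x \<in> ?S" for x
      unfolding S_def p_def
    proof (rule riemann_sum_tendsto[OF st(2)])
      have sub: "{s..t} \<subseteq> {0..T}" using st by auto
      show "continuous_on {s..t} (time_deriv T G x)"
        using C1 x continuous_on_subset[OF _ sub] by blast
      fix r assume r: "r \<in> {s..t}"
      have "(G x has_vector_derivative time_deriv T G x r) (at r within {0..T})"
        using C1 x r sub by (auto simp: time_deriv_def vector_derivative_works)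
      then show "(G x has_vector_derivative time_deriv T G x r) (at r within {s..t})"
        by (rule has_vector_derivative_within_subset[OF _ sub])
    qed
    show "AE x in lebesgue_on ?S. norm (S n x) \<le> (t - s) * (C * B)" for n
    proof -
      have "AE x in lebesgue_on ?S. i < Suc n \<longrightarrow> norm (time_deriv T G x (p n i)) \<le> C * B" for i
      proof (cases "i < Suc n")
        case True
        have i': "(\<lambda>x. time_deriv T G x (p n i)) \<in> sobolev ?S 1"
          using Gt p[OF True] sobolev_mono[OF _ q] by blast
        have "C * sobolev_norm ?S 1 (\<lambda>x. time_deriv T G x (p n i)) \<le> C * B"
          using sobolev_norm_mono[OF q] up[OF p[OF True]] C by (meson mult_left_mono order_trans)
        then show ?thesis
          using sobolev_1_AE_bounded[OF i' ab] unfolding C_def[symmetric]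
          by (auto elim!: eventually_mono)
      qed simp
      then have "AE x in lebesgue_on ?S. \<forall>i. i < Suc n \<longrightarrow> norm (time_deriv T G x (p n i)) \<le> C * B"
        unfolding AE_all_countable by blast
      then show ?thesis
      proof eventually_elim
        case (elim x)
        have "norm (S n x) \<le> (\<Sum>i<Suc n. (t - s) / real (Suc n) * (C * B))"
          unfolding S_def
        proof (rule sum_norm_le)
          fix i assume "i \<in> {..<Suc n}"
          then show "norm (of_real ((t - s) / real (Suc n)) * time_deriv T G x (p n i)) \<le> (t - s) / real (Suc n) * (C * B)"
            unfolding norm_mult norm_of_real using elim st by (intro mult_mono) auto
        qed
        then show ?case by simp
      qed
    qed
    show "(\<lambda>x. G x t - G x s) \<in> sobolev ?S q"
      by (rule sobolev_diff[OF G(2,1) ab])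
  qed
  then show ?thesis by (simp add: B_def)
qed

section \<open>The discrete fractional derivative and stability\<close>

lemma g_coeff_0 [simp]: "g_coeff gam 0 = 1"
  by (simp add: g_coeff_def)

lemma g_coeff_Suc: "g_coeff gam (Suc k) = g_coeff gam k * (real k - gam) / real (Suc k)"
proof -
  have "real (Suc k) * (gam gchoose Suc k) = (gam - real k) * (gam gchoose k)"
    using gbinomial_mult_1[of gam k] by (simp add: algebra_simps)
  then have "(gam gchoose Suc k) = (gam - real k) * (gam gchoose k) / real (Suc k)"
    by (simp add: field_simps)
  then show ?thesis by (simp add: g_coeff_def algebra_simps)
qed

text \<open>These sums are the coefficients of (1 - z)^(gam - 1). In contrast to the
  \<open>g_coeff\<close> they are all positive, and they are the weights left by summation by
  parts.\<close>

definition g_partial :: "real \<Rightarrow> nat \<Rightarrow> real" where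
  "g_partial gam n = (\<Sum>k=0..n. g_coeff gam k)"

lemma g_partial_0 [simp]: "g_partial gam 0 = 1"
  by (simp add: g_partial_def)

text \<open>The coefficient form of the identity that the derivative of (1 - z)^gam is -gam (1 -
  z)^(gam - 1). It reduces the sign of the coefficients to the positivity of the partial
  sums.\<close>

lemma g_coeff_g_partial: "g_coeff gam (Suc n) = - gam / real (Suc n) * g_partial gam n"
proof (induction n)
  case 0
  then show ?case by (simp add: g_coeff_Suc)
next
  case (Suc n)
  have "g_partial gam (Suc n) = g_partial gam n + g_coeff gam (Suc n)"
    by (simp add: g_partial_def)
  also have "\<dots> = g_partial gam n * (real (Suc n) - gam) / real (Suc n)"
    unfolding Suc by (simp add: field_simps)
  finally have P: "g_partial gam (Suc n) = g_partial gam n * (real (Suc n) - gam) / real (Suc n)" .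
  show ?case
    unfolding g_coeff_Suc[of gam "Suc n"] Suc P by (simp add: field_simps)
qed

lemma g_partial_Suc: "g_partial gam (Suc n) = g_partial gam n * (1 - gam / real (Suc n))"
proof -
  have "g_partial gam (Suc n) = g_partial gam n + g_coeff gam (Suc n)"
    by (simp add: g_partial_def)
  then show ?thesis unfolding g_coeff_g_partial by (simp add: field_simps)
qed

lemma one_minus_mult_le_powr_minus:
  fixes x gam :: real
  assumes "0 \<le> gam" "0 \<le> x"
  shows "1 - gam * x \<le> (1 + x) powr (- gam)"
proof -
  have "gam * ln (1 + x) \<le> gam * x"
    using assms ln_add_one_self_le_self[of x] by (intro mult_left_mono) auto
  then have "1 - gam * x \<le> 1 + (- gam * ln (1 + x))" by simp
  also have "\<dots> \<le> exp (- gam * ln (1 + x))" by (rule exp_ge_add_one_self)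
  also have "\<dots> = (1 + x) powr (- gam)" using assms by (simp add: powr_def)
  finally show ?thesis .
qed

text \<open>By the recursion the partial sum is the product of the factors 1 - gam/k, each positive
  and at most (1 + 1/k)^(-gam); the product of these upper bounds telescopes.\<close>

lemma g_partial_bounds:
  assumes "0 < gam" "gam < 1"
  shows "0 < g_partial gam n" "g_partial gam n \<le> real (Suc n) powr (- gam)"
proof -
  have "0 < g_partial gam n \<and> g_partial gam n \<le> real (Suc n) powr (- gam)"
  proof (induction n)
    case (Suc n)
    have "gam / real (Suc n) < 1" using assms by simp
    then have f: "0 < 1 - gam / real (Suc n)" by simp
    have "g_partial gam (Suc n) \<le> real (Suc n) powr (- gam) * (1 + 1 / real (Suc n)) powr (- gam)"
      unfolding g_partial_Suc
      using Suc f one_minus_mult_le_powr_minus[of gam "1 / real (Suc n)"] assms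
      by (intro mult_mono) auto
    also have "\<dots> = (real (Suc n) * (1 + 1 / real (Suc n))) powr (- gam)"
      by (simp add: powr_mult)
    also have "real (Suc n) * (1 + 1 / real (Suc n)) = real (Suc (Suc n))"
      by (simp add: field_simps)
    finally show ?case using Suc f by (simp add: g_partial_Suc)
  qed simp
  then show "0 < g_partial gam n" "g_partial gam n \<le> real (Suc n) powr (- gam)" by auto
qed

lemma g_coeff_nonpos:
  assumes "0 < gam" "gam < 1" "1 \<le> k"
  shows "g_coeff gam k \<le> 0"
proof -
  obtain n where "k = Suc n" using assms(3) by (cases k) auto
  then show ?thesis
    using g_partial_bounds(1)[OF assms(1,2), of n] assms(1)
    by (simp add: g_coeff_g_partial divide_nonpos_pos mult_nonpos_nonneg)
qed

text \<open>The discrete form of the integral of s^(-gam), by induction. The step \<open>key\<close>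
  is the tangent inequality of the concave power 1 - gam at n + 1, obtained from the weighted mean
  inequality for n/(n+1) and 1.\<close>

lemma sum_powr_minus_le:
  assumes "0 < gam" "gam < 1"
  shows "(\<Sum>k<n. real (Suc k) powr (- gam)) \<le> real n powr (1 - gam) / (1 - gam)"
proof (induction n)
  case (Suc n)
  let ?m = "real (Suc n)"
  have key: "real n powr (1 - gam) \<le> ?m powr (1 - gam) * (1 - (1 - gam) / ?m)"
  proof (cases "n = 0")
    case True
    then show ?thesis using assms by simp
  next
    case False
    have "(real n / ?m) powr (1 - gam) * 1 powr gam \<le> (1 - gam) * (real n / ?m) + gam * 1"
      using False assms by (intro Youngs_inequality_0) auto
    also have "\<dots> = 1 - (1 - gam) / ?m" by (simp add: field_simps)
    finally have "(real n / ?m) powr (1 - gam) \<le> 1 - (1 - gam) / ?m" by simp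
    then have "?m powr (1 - gam) * (real n / ?m) powr (1 - gam) \<le> ?m powr (1 - gam) * (1 - (1 - gam) / ?m)"
      by (intro mult_left_mono) auto
    then show ?thesis by (simp add: powr_divide)
  qed
  have "?m powr (1 - gam) / ?m = ?m powr (- gam)"
    using powr_diff[of ?m "1 - gam" 1] by simp
  moreover have "P * (1 - c / m) = P - c * (P / m)" for P c m :: real
    by (simp add: algebra_simps)
  ultimately have eq: "?m powr (1 - gam) * (1 - (1 - gam) / ?m) = ?m powr (1 - gam) - (1 - gam) * ?m powr (- gam)"
    by (simp only:)
  have "(\<Sum>k<Suc n. real (Suc k) powr (- gam)) \<le> real n powr (1 - gam) / (1 - gam) + ?m powr (- gam)"
    using Suc by simp
  also have "\<dots> \<le> ?m powr (1 - gam) / (1 - gam)"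
  proof -
    have "P / c + R \<le> Q / c" if "P \<le> Q - c * R" "0 < c" for P Q R c :: real
    proof -
      have "(P + c * R) / c \<le> Q / c" using that by (intro divide_right_mono) auto
      then show ?thesis using that by (simp add: add_divide_distrib)
    qed
    from this[OF key[unfolded eq]] show ?thesis using assms by simp
  qed
  finally show ?case .
qed simp

lemma g_sum_constant_exists:
  assumes "0 < gam" "gam < 1" "0 < T"
  shows "g_sum_constant gam T (1 / (1 - gam))"
  unfolding g_sum_constant_def
proof (intro allI impI ballI)
  fix N n :: nat assume N: "1 \<le> N" and n: "n \<in> {1..N}"
  have "{0..n - 1} = {..<n}" using n by auto
  then have "(\<Sum>k=0..n - 1. \<Sum>j=0..k. g_coeff gam j) = (\<Sum>k<n. g_partial gam k)"
    by (simp add: g_partial_def)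
  also have "\<dots> \<le> (\<Sum>k<n. real (Suc k) powr (- gam))"
    by (intro sum_mono g_partial_bounds assms)
  also have "\<dots> \<le> real n powr (1 - gam) / (1 - gam)"
    by (rule sum_powr_minus_le[OF assms(1,2)])
  finally have "(T / real N) powr (1 - gam) * (\<Sum>k=0..n - 1. \<Sum>j=0..k. g_coeff gam j)
      \<le> (T / real N) powr (1 - gam) * (real n powr (1 - gam) / (1 - gam))"
    by (intro mult_left_mono) auto
  also have "\<dots> = (T / real N * real n) powr (1 - gam) / (1 - gam)"
    by (subst powr_mult) (use assms in auto)
  also have "\<dots> \<le> T powr (1 - gam) / (1 - gam)"
  proof (intro divide_right_mono powr_mono2)
    show "T / real N * real n \<le> T" using n N assms(3) by (auto simp: field_simps)
  qed (use assms in auto)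
  finally show "(T / real N) powr (1 - gam) * (\<Sum>k=0..n - 1. \<Sum>j=0..k. g_coeff gam j)
      \<le> 1 / (1 - gam) * T powr (1 - gam)" by simp
qed

text \<open>With r = exp(-lam tau) the left side is 1 minus a partial sum of the series of (1 -
  r)^gam, and these partial sums lie above the limit as the later terms are nonpositive. The
  diagonal coefficient is 1 - (lam tau r)^gam, so the claim reduces to lam tau r <= 1 - r, that is,
  1 + y <= exp y at y = lam tau. For lam = 0 the point r = 1 lies on the circle of convergence, and
  positivity of the partial sums is used directly.\<close>

lemma d_coeff_dominance:
  assumes "0 < gam" "gam < 1" "0 \<le> lam" "0 < \<tau>"
  shows "(\<Sum>k=1..n. \<bar>d_coeff gam lam \<tau> k\<bar>) \<le> d_coeff gam lam \<tau> 0"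
    and "d_coeff gam lam \<tau> 0 \<le> 1"
proof -
  define r where "r = exp (- (lam * \<tau>))"
  have r: "0 < r" "r \<le> 1" using assms by (auto simp: r_def)
  have abs: "\<bar>d_coeff gam lam \<tau> k\<bar> = - (g_coeff gam k * r ^ k)" if "1 \<le> k" for k
  proof -
    have "exp (- (real k * lam * \<tau>)) = r ^ k"
      by (simp add: r_def exp_of_nat_mult[symmetric] mult.assoc)
    then show ?thesis using that g_coeff_nonpos[OF assms(1,2) that] zero_le_power[of r k] r
      by (simp add: d_coeff_def tempered_g_coeff_def abs_mult mult.commute)
  qed
  have d0: "d_coeff gam lam \<tau> 0 = 1 - (lam * \<tau> * r) powr gam"
    using assms by (simp add: d_coeff_def r_def powr_mult exp_powr_real mult_ac)
  show "d_coeff gam lam \<tau> 0 \<le> 1" unfolding d0 by simp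
  have sum: "(\<Sum>k=1..n. \<bar>d_coeff gam lam \<tau> k\<bar>) = 1 - (\<Sum>k=0..n. g_coeff gam k * r ^ k)"
  proof -
    have "(\<Sum>k=0..n. g_coeff gam k * r ^ k) = g_coeff gam 0 * r ^ 0 + (\<Sum>k=1..n. g_coeff gam k * r ^ k)"
      by (simp add: sum.atLeast_Suc_atMost)
    moreover have "(\<Sum>k=1..n. \<bar>d_coeff gam lam \<tau> k\<bar>) = (\<Sum>k=1..n. - (g_coeff gam k * r ^ k))"
      by (intro sum.cong refl abs) auto
    ultimately show ?thesis by (simp add: sum_negf)
  qed
  show "(\<Sum>k=1..n. \<bar>d_coeff gam lam \<tau> k\<bar>) \<le> d_coeff gam lam \<tau> 0"
  proof (cases "lam = 0")
    case True
    then have "r = 1" by (simp add: r_def)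
    then show ?thesis
      unfolding sum d0 using True g_partial_bounds(1)[OF assms(1,2), of n] by (simp add: g_partial_def)
  next
    case False
    then have "r < 1" using assms by (simp add: r_def)
    then have s: "(\<lambda>k. g_coeff gam k * r ^ k) sums (1 - r) powr gam"
      using r by (intro g_coeff_generating_function) auto
    have "(1 - r) powr gam \<le> (\<Sum>k<Suc n. g_coeff gam k * r ^ k)"
    proof (rule LIMSEQ_le_const2)
      show "(\<lambda>m. \<Sum>k<m. g_coeff gam k * r ^ k) \<longlonglongrightarrow> (1 - r) powr gam"
        using s by (simp add: sums_def)
      show "\<exists>N. \<forall>m\<ge>N. (\<Sum>k<m. g_coeff gam k * r ^ k) \<le> (\<Sum>k<Suc n. g_coeff gam k * r ^ k)"
      proof (intro exI allI impI)
        fix m assume m: "Suc n \<le> m"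
        have "(\<Sum>k<m. g_coeff gam k * r ^ k)
            = (\<Sum>k<Suc n. g_coeff gam k * r ^ k) + (\<Sum>k=Suc n..<m. g_coeff gam k * r ^ k)"
          using m by (metis atLeast0LessThan sum.atLeastLessThan_concat zero_le)
        moreover have "(\<Sum>k=Suc n..<m. g_coeff gam k * r ^ k) \<le> 0"
          using r g_coeff_nonpos[OF assms(1,2)] by (intro sum_nonpos mult_nonpos_nonneg) auto
        ultimately show "(\<Sum>k<m. g_coeff gam k * r ^ k) \<le> (\<Sum>k<Suc n. g_coeff gam k * r ^ k)" by simp
      qed
    qed
    moreover have "(lam * \<tau> * r) powr gam \<le> (1 - r) powr gam"
    proof (rule powr_mono2)
      have "1 + lam * \<tau> \<le> exp (lam * \<tau>)" by (rule exp_ge_add_one_self)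
      then have "(1 + lam * \<tau>) * r \<le> exp (lam * \<tau>) * r" using r by (intro mult_right_mono) auto
      also have "\<dots> = 1" by (simp add: r_def flip: exp_add)
      finally show "lam * \<tau> * r \<le> 1 - r" by (simp add: algebra_simps)
    qed (use assms r in auto)
    ultimately show ?thesis unfolding sum d0 by (simp add: lessThan_Suc_atMost atLeast0AtMost)
  qed
qed

lemma sum_convolution_swap:
  fixes D x :: "nat \<Rightarrow> real"
  shows "(\<Sum>n=1..N. \<Sum>k=1..n. D k * x (n - k)) = (\<Sum>m<N. x m * (\<Sum>k=1..N - m. D k))"
proof (induction N)
  case (Suc N)
  have "(\<Sum>k=1..Suc N. D k * x (Suc N - k)) = (\<Sum>m<Suc N. x m * D (Suc N - m))"
    by (rule sum.reindex_bij_witness[of _ "\<lambda>m. Suc N - m" "\<lambda>k. Suc N - k"]) auto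
  moreover have "(\<Sum>m<Suc N. x m * (\<Sum>k=1..Suc N - m. D k))
      = (\<Sum>m<Suc N. x m * (\<Sum>k=1..N - m. D k) + x m * D (Suc N - m))"
    by (intro sum.cong refl) (auto simp: Suc_diff_le distrib_left)
  ultimately show ?case using Suc by (simp add: sum.distrib)
qed simp

text \<open>The quadratic form of the scheme, with \<open>D k = \<bar>d\<^sub>k\<bar>\<close>.\<close>

lemma convolution_quadratic_form_lower_bound:
  fixes D y :: "nat \<Rightarrow> real"
  assumes D: "\<And>k. 0 \<le> D k" "\<And>n. (\<Sum>k=1..n. D k) \<le> d0"
  shows "- (d0 / 2) * (y 0)\<^sup>2 \<le> (\<Sum>n=1..N. d0 * (y n)\<^sup>2 - (\<Sum>k=1..n. D k * y (n - k) * y n))"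
proof -
  have d0: "0 \<le> d0" using D(2)[of 0] by simp
  have "(\<Sum>n=1..N. \<Sum>k=1..n. D k * y (n - k) * y n)
      \<le> (\<Sum>n=1..N. \<Sum>k=1..n. D k * ((y (n - k))\<^sup>2 / 2) + D k * ((y n)\<^sup>2 / 2))"
  proof (intro sum_mono)
    fix n k
    have "y (n - k) * y n \<le> (y (n - k))\<^sup>2 / 2 + (y n)\<^sup>2 / 2"
      using sum_squares_bound[of "y (n - k)" "y n"] by simp
    from mult_left_mono[OF this D(1)[of k]]
    show "D k * y (n - k) * y n \<le> D k * ((y (n - k))\<^sup>2 / 2) + D k * ((y n)\<^sup>2 / 2)"
      by (simp add: algebra_simps)
  qed
  also have "\<dots> = (\<Sum>n=1..N. \<Sum>k=1..n. D k * ((y (n - k))\<^sup>2 / 2)) + (\<Sum>n=1..N. (\<Sum>k=1..n. D k) * ((y n)\<^sup>2 / 2))"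
    by (simp add: sum.distrib sum_distrib_right sum_divide_distrib)
  also have "(\<Sum>n=1..N. (\<Sum>k=1..n. D k) * ((y n)\<^sup>2 / 2)) \<le> (\<Sum>n=1..N. d0 * ((y n)\<^sup>2 / 2))"
    by (intro sum_mono mult_right_mono D) auto
  also have "(\<Sum>n=1..N. \<Sum>k=1..n. D k * ((y (n - k))\<^sup>2 / 2)) = (\<Sum>m<N. ((y m)\<^sup>2 / 2) * (\<Sum>k=1..N - m. D k))"
    by (rule sum_convolution_swap)
  also have "\<dots> \<le> (\<Sum>m<N. ((y m)\<^sup>2 / 2) * d0)"
    by (intro sum_mono mult_left_mono D) auto
  \<comment> \<open>The term m = N is added so that the contributions as a past value and as a
    current value combine to the full \<open>d0 * (y n)\<^sup>2\<close> for n >= 1. The index 0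
    occurs as a past value only, which leaves half of its square in the bound.\<close>
  also have "\<dots> \<le> (\<Sum>m<Suc N. ((y m)\<^sup>2 / 2) * d0)"
    using d0 by simp
  also have "\<dots> = (\<Sum>n=0..N. d0 * ((y n)\<^sup>2 / 2))"
    by (simp add: lessThan_Suc_atMost atLeast0AtMost mult.commute)
  also have "\<dots> = d0 * ((y 0)\<^sup>2 / 2) + (\<Sum>n=1..N. d0 * ((y n)\<^sup>2 / 2))"
    by (simp add: sum.atLeast_Suc_atMost)
  finally have "(\<Sum>n=1..N. \<Sum>k=1..n. D k * y (n - k) * y n)
      \<le> d0 * ((y 0)\<^sup>2 / 2) + 2 * (\<Sum>n=1..N. d0 * ((y n)\<^sup>2 / 2))" by simp
  also have "2 * (\<Sum>n=1..N. d0 * ((y n)\<^sup>2 / 2)) = (\<Sum>n=1..N. d0 * (y n)\<^sup>2)"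
    by (simp add: sum_distrib_left)
  finally show ?thesis by (simp add: sum_subtractf)
qed

lemma quadratic_le_imp_le:
  fixes X y z :: real
  assumes "X\<^sup>2 \<le> z\<^sup>2 + y * X" "0 \<le> X" "0 \<le> y" "0 \<le> z"
  shows "X \<le> z + y"
proof (rule ccontr)
  assume "\<not> X \<le> z + y"
  then have "z + y < X" "z \<le> X" "0 < X" using assms by auto
  then have "(z + y) * X < X * X" "z * z \<le> z * X"
    using assms by (auto intro: mult_left_mono)
  then show False using assms(1) by (simp add: power2_eq_square algebra_simps)
qed

section \<open>Energy estimate and stability of the scheme\<close>

locale fk_setting =
  fixes a b gam lam K T :: real and p :: complex and U :: "real \<Rightarrow> real"
  assumes gam: "0 < gam" "gam < 1" and lam: "0 \<le> lam" and K: "0 < K" and T: "0 < T" and ab: "a < b"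
    and p: "0 < Re p"
    and U_nonneg: "\<And>x. x \<in> {a<..<b} \<Longrightarrow> 0 \<le> U x"
    and U_measurable: "U \<in> borel_measurable (lebesgue_on {a<..<b})"
begin

abbreviation "\<Omega> \<equiv> {a<..<b}"

abbreviation "dderiv \<equiv> discrete_deriv gam lam p U"

text \<open>Multiplication by this factor is a contraction of L2, because Re p > 0 and U >= 0; the
  energy estimate is therefore the same with and without it. At k = 0 it is 1.\<close>

definition damp :: "real \<Rightarrow> nat \<Rightarrow> real \<Rightarrow> complex" where
  "damp \<tau> k x = exp (- (p * of_real (U x * real k * \<tau>)))"

lemma damp_measurable: "damp \<tau> k \<in> borel_measurable (lebesgue_on \<Omega>)"
proof -
  note [measurable] = U_measurable
  show ?thesis unfolding damp_def by measurable
qed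

lemma damp_norm_le:
  assumes "0 \<le> \<tau>" "x \<in> \<Omega>"
  shows "norm (damp \<tau> k x) \<le> 1"
  using assms U_nonneg[OF assms(2)] p by (simp add: damp_def norm_exp_eq_Re)

lemma damp_L2: "0 \<le> \<tau> \<Longrightarrow> v \<in> L2_space \<Omega> \<Longrightarrow> (\<lambda>x. damp \<tau> k x * v x) \<in> L2_space \<Omega>"
  using damp_norm_le by (intro L2_mult_bounded[OF _ damp_measurable]) auto

lemma damp_L2_norm: "0 \<le> \<tau> \<Longrightarrow> v \<in> L2_space \<Omega> \<Longrightarrow> L2_norm \<Omega> (\<lambda>x. damp \<tau> k x * v x) \<le> L2_norm \<Omega> v"
  using L2_norm_mult_bounded[OF _ damp_measurable, of v 1 \<tau> k] damp_norm_le by simp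

lemma dderiv_eq:
  "dderiv \<tau> v n = (\<lambda>x. of_real (1 / \<tau> powr gam) *
     (\<Sum>k=0..n. of_real (d_coeff gam lam \<tau> k) * (damp \<tau> k x * v (n - k) x)))"
  by (simp add: discrete_deriv_def damp_def mult.assoc fun_eq_iff)

lemma dderiv_L2:
  assumes "0 \<le> \<tau>" "\<And>k. k \<le> n \<Longrightarrow> v k \<in> L2_space \<Omega>"
  shows "dderiv \<tau> v n \<in> L2_space \<Omega>"
  unfolding dderiv_eq using assms by (intro L2_cmult L2_sum damp_L2) auto

lemma dderiv_diff: "dderiv \<tau> (\<lambda>n x. v n x - w n x) n x = dderiv \<tau> v n x - dderiv \<tau> w n x"
  by (simp add: discrete_deriv_def right_diff_distrib sum_subtractf)

text \<open>The term k = 0 carries no damping and gives an exact square. In the others the phase of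
  the damping is unknown, so they are estimated by Cauchy-Schwarz and contraction, which brings in
  the absolute values of the coefficients.\<close>

lemma Re_dderiv_inner_ge:
  assumes \<tau>: "0 < \<tau>" and v: "\<And>k. k \<le> n \<Longrightarrow> v k \<in> L2_space \<Omega>"
  shows "(1 / \<tau> powr gam) * (d_coeff gam lam \<tau> 0 * (L2_norm \<Omega> (v n))\<^sup>2
      - (\<Sum>k=1..n. \<bar>d_coeff gam lam \<tau> k\<bar> * L2_norm \<Omega> (v (n - k)) * L2_norm \<Omega> (v n)))
    \<le> Re (L2_inner \<Omega> (dderiv \<tau> v n) (v n))"
proof -
  let ?d = "d_coeff gam lam \<tau>"
  have L: "(\<lambda>x. damp \<tau> k x * v (n - k) x) \<in> L2_space \<Omega>" if "k \<le> n" for k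
    using \<tau> v by (intro damp_L2) auto
  have "L2_inner \<Omega> (dderiv \<tau> v n) (v n) = of_real (1 / \<tau> powr gam) *
      (\<Sum>k=0..n. of_real (?d k) * L2_inner \<Omega> (\<lambda>x. damp \<tau> k x * v (n - k) x) (v n))"
    unfolding dderiv_eq L2_inner_cmult_left
    using L v by (subst L2_inner_sum_left) (auto intro: L2_cmult simp: L2_inner_cmult_left)
  then have "Re (L2_inner \<Omega> (dderiv \<tau> v n) (v n)) = (1 / \<tau> powr gam) *
      (\<Sum>k=0..n. ?d k * Re (L2_inner \<Omega> (\<lambda>x. damp \<tau> k x * v (n - k) x) (v n)))"
    by simp
  also have "(\<Sum>k=0..n. ?d k * Re (L2_inner \<Omega> (\<lambda>x. damp \<tau> k x * v (n - k) x) (v n)))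
      = ?d 0 * Re (L2_inner \<Omega> (\<lambda>x. damp \<tau> 0 x * v n x) (v n))
       + (\<Sum>k=1..n. ?d k * Re (L2_inner \<Omega> (\<lambda>x. damp \<tau> k x * v (n - k) x) (v n)))"
    by (simp add: sum.atLeast_Suc_atMost)
  also have "(\<lambda>x. damp \<tau> 0 x * v n x) = v n" by (simp add: damp_def)
  also have "Re (L2_inner \<Omega> (v n) (v n)) = (L2_norm \<Omega> (v n))\<^sup>2"
    by (simp only: L2_inner_self Re_complex_of_real)
  finally have eq: "Re (L2_inner \<Omega> (dderiv \<tau> v n) (v n)) = (1 / \<tau> powr gam) *
      (?d 0 * (L2_norm \<Omega> (v n))\<^sup>2
       + (\<Sum>k=1..n. ?d k * Re (L2_inner \<Omega> (\<lambda>x. damp \<tau> k x * v (n - k) x) (v n))))" .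
  have "(\<Sum>k=1..n. - (?d k * Re (L2_inner \<Omega> (\<lambda>x. damp \<tau> k x * v (n - k) x) (v n))))
      \<le> (\<Sum>k=1..n. \<bar>?d k\<bar> * L2_norm \<Omega> (v (n - k)) * L2_norm \<Omega> (v n))"
  proof (rule sum_mono)
    fix k assume "k \<in> {1..n}"
    then have k: "k \<le> n" by simp
    have "\<bar>Re (L2_inner \<Omega> (\<lambda>x. damp \<tau> k x * v (n - k) x) (v n))\<bar>
        \<le> L2_norm \<Omega> (\<lambda>x. damp \<tau> k x * v (n - k) x) * L2_norm \<Omega> (v n)"
      using L2_cauchy_schwarz[OF L[OF k] v[of n]] abs_Re_le_cmod order_trans by blast
    also have "\<dots> \<le> L2_norm \<Omega> (v (n - k)) * L2_norm \<Omega> (v n)"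
      using \<tau> v[of "n - k"] by (intro mult_right_mono damp_L2_norm) auto
    finally have "\<bar>?d k\<bar> * \<bar>Re (L2_inner \<Omega> (\<lambda>x. damp \<tau> k x * v (n - k) x) (v n))\<bar>
        \<le> \<bar>?d k\<bar> * (L2_norm \<Omega> (v (n - k)) * L2_norm \<Omega> (v n))"
      by (rule mult_left_mono) simp
    then show "- (?d k * Re (L2_inner \<Omega> (\<lambda>x. damp \<tau> k x * v (n - k) x) (v n)))
        \<le> \<bar>?d k\<bar> * L2_norm \<Omega> (v (n - k)) * L2_norm \<Omega> (v n)"
      by (simp add: abs_mult[symmetric] mult.assoc abs_le_iff)
  qed
  then show ?thesis
    unfolding eq by (intro mult_left_mono) (auto simp: sum_negf)
qed

text \<open>Summation over the time levels discards the quadratic form up to the initial value;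
  multiplying by tau turns the prefactor into tau^(1 - gam) <= T^(1 - gam), so the constants do not
  depend on the step. With Cauchy-Schwarz in time the result has the shape X^2 <= z^2 + y X. The
  sequences s and F are abstract since both stability and the error estimate are instances, with s
  the seminorm of the tested function.\<close>

lemma energy_estimate:
  assumes N: "1 \<le> N" and \<tau>: "\<tau> = T / real N" and v: "\<And>n. n \<le> N \<Longrightarrow> v n \<in> L2_space \<Omega>"
    and est: "\<And>n. n \<in> {1..N} \<Longrightarrow> Re (L2_inner \<Omega> (dderiv \<tau> v n) (v n)) + K * (s n)\<^sup>2 \<le> F n * s n"
    and s: "\<And>n. 0 \<le> s n" and F: "\<And>n. 0 \<le> F n"
  shows "sqrt (\<Sum>n=1..N. (s n)\<^sup>2 * \<tau>) \<le> sqrt (T powr (1 - gam) / (2 * K)) * L2_norm \<Omega> (v 0)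
    + (1 / K) * sqrt (\<Sum>n=1..N. (F n)\<^sup>2 * \<tau>)"
proof -
  let ?d = "d_coeff gam lam \<tau>"
  let ?X = "sqrt (\<Sum>n=1..N. (s n)\<^sup>2 * \<tau>)" and ?F = "sqrt (\<Sum>n=1..N. (F n)\<^sup>2 * \<tau>)"
  have \<tau>0: "0 < \<tau>" "\<tau> \<le> T" using N T by (auto simp: \<tau> field_simps)
  define Q where "Q n = ?d 0 * (L2_norm \<Omega> (v n))\<^sup>2
      - (\<Sum>k=1..n. \<bar>?d k\<bar> * L2_norm \<Omega> (v (n - k)) * L2_norm \<Omega> (v n))" for n
  have dom: "(\<Sum>k=1..n. \<bar>?d k\<bar>) \<le> ?d 0" "?d 0 \<le> 1" for n
    using d_coeff_dominance[OF gam lam \<tau>0(1)] by auto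
  have Q: "- (?d 0 / 2) * (L2_norm \<Omega> (v 0))\<^sup>2 \<le> (\<Sum>n=1..N. Q n)"
    unfolding Q_def by (rule convolution_quadratic_form_lower_bound) (use dom in auto)
  have "(\<Sum>n=1..N. (1 / \<tau> powr gam) * Q n + K * (s n)\<^sup>2) \<le> (\<Sum>n=1..N. F n * s n)"
  proof (rule sum_mono)
    fix n assume n: "n \<in> {1..N}"
    then have "(1 / \<tau> powr gam) * Q n \<le> Re (L2_inner \<Omega> (dderiv \<tau> v n) (v n))"
      unfolding Q_def using v by (intro Re_dderiv_inner_ge \<tau>0) auto
    then show "(1 / \<tau> powr gam) * Q n + K * (s n)\<^sup>2 \<le> F n * s n" using est[OF n] by simp
  qed
  then have "(1 / \<tau> powr gam) * (\<Sum>n=1..N. Q n) + K * (\<Sum>n=1..N. (s n)\<^sup>2) \<le> (\<Sum>n=1..N. F n * s n)"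
    by (simp add: sum.distrib sum_distrib_left)
  then have "(1 / \<tau> powr gam) * (- (?d 0 / 2) * (L2_norm \<Omega> (v 0))\<^sup>2) + K * (\<Sum>n=1..N. (s n)\<^sup>2) \<le> (\<Sum>n=1..N. F n * s n)"
    using mult_left_mono[OF Q, of "1 / \<tau> powr gam"] by simp
  then have "\<tau> * ((1 / \<tau> powr gam) * (- (?d 0 / 2) * (L2_norm \<Omega> (v 0))\<^sup>2) + K * (\<Sum>n=1..N. (s n)\<^sup>2))
      \<le> \<tau> * (\<Sum>n=1..N. F n * s n)"
    using \<tau>0 by (intro mult_left_mono) auto
  moreover have "\<tau> * (1 / \<tau> powr gam) = \<tau> powr (1 - gam)"
    using \<tau>0 by (simp add: powr_diff)
  moreover have "\<tau> * (A * (- (?d 0 / 2) * V) + K * Y) = - (\<tau> * A * (?d 0 / 2) * V) + K * (\<tau> * Y)" for A V Y :: real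
    by (simp add: algebra_simps)
  ultimately have main: "K * (\<tau> * (\<Sum>n=1..N. (s n)\<^sup>2)) \<le> \<tau> powr (1 - gam) * (?d 0 / 2) * (L2_norm \<Omega> (v 0))\<^sup>2 + \<tau> * (\<Sum>n=1..N. F n * s n)"
    by (simp only:)
  have X2: "?X\<^sup>2 = \<tau> * (\<Sum>n=1..N. (s n)\<^sup>2)"
    using \<tau>0 by (simp add: sum_nonneg sum_distrib_left mult.commute)
  have "(\<Sum>n=1..N. \<bar>F n * sqrt \<tau>\<bar> * \<bar>s n * sqrt \<tau>\<bar>) \<le> L2_set (\<lambda>n. F n * sqrt \<tau>) {1..N} * L2_set (\<lambda>n. s n * sqrt \<tau>) {1..N}"
    by (rule L2_set_mult_ineq)
  moreover have "(\<Sum>n=1..N. \<bar>F n * sqrt \<tau>\<bar> * \<bar>s n * sqrt \<tau>\<bar>) = \<tau> * (\<Sum>n=1..N. F n * s n)"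
  proof -
    have sqrt2: "sqrt \<tau> * (sqrt \<tau> * z) = \<tau> * z" for z
      using \<tau>0 by (simp flip: mult.assoc)
    show ?thesis using \<tau>0 F s by (simp add: sum_distrib_left abs_mult mult_ac sqrt2)
  qed
  moreover have "L2_set (\<lambda>n. F n * sqrt \<tau>) {1..N} = ?F" "L2_set (\<lambda>n. s n * sqrt \<tau>) {1..N} = ?X"
    using \<tau>0 by (simp_all add: L2_set_def power_mult_distrib)
  ultimately have FX: "\<tau> * (\<Sum>n=1..N. F n * s n) \<le> ?F * ?X" by simp
  have "\<tau> powr (1 - gam) * (?d 0 / 2) * (L2_norm \<Omega> (v 0))\<^sup>2 \<le> T powr (1 - gam) * (1 / 2) * (L2_norm \<Omega> (v 0))\<^sup>2"
    using \<tau>0 gam dom(2) dom(1)[of 0] by (intro mult_right_mono mult_mono powr_mono2) auto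
  with main FX have "K * ?X\<^sup>2 \<le> T powr (1 - gam) / 2 * (L2_norm \<Omega> (v 0))\<^sup>2 + ?F * ?X"
    unfolding X2 by simp
  then have "?X\<^sup>2 \<le> T powr (1 - gam) / (2 * K) * (L2_norm \<Omega> (v 0))\<^sup>2 + (1 / K) * ?F * ?X"
    using K by (simp add: field_simps)
  also have "T powr (1 - gam) / (2 * K) * (L2_norm \<Omega> (v 0))\<^sup>2 = (sqrt (T powr (1 - gam) / (2 * K)) * L2_norm \<Omega> (v 0))\<^sup>2"
    using K by (simp add: power_mult_distrib)
  finally show ?thesis
  proof (rule quadratic_le_imp_le)
    show "0 \<le> ?X" "0 \<le> 1 / K * ?F"
      using \<tau>0 K by (auto intro!: sum_nonneg divide_nonneg_nonneg)
    show "0 \<le> sqrt (T powr (1 - gam) / (2 * K)) * L2_norm \<Omega> (v 0)" using K by simp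
  qed
qed

lemma fe_space_H1: "v \<in> fe_space a b M l \<Longrightarrow> v \<in> H1_zero \<Omega>"
  by (simp add: fe_space_def)

lemma fe_space_diff:
  assumes "u \<in> fe_space a b M l" "v \<in> fe_space a b M l"
  shows "(\<lambda>x. u x - v x) \<in> fe_space a b M l"
  unfolding fe_space_def
proof (intro CollectI conjI ballI)
  show "(\<lambda>x. u x - v x) \<in> H1_zero \<Omega>" using assms by (intro H1_zero_diff fe_space_H1 ab)
  show "continuous_on {a..b} (\<lambda>x. u x - v x)" using assms by (auto simp: fe_space_def intro!: continuous_intros)
  fix m assume m: "m \<in> {1..M}"
  let ?I = "{a + (real m - 1) * ((b - a) / real M)<..<a + real m * ((b - a) / real M)}"
  obtain P Q where "degree P \<le> l" "\<forall>x\<in>?I. u x = poly P (of_real x)" "degree Q \<le> l" "\<forall>x\<in>?I. v x = poly Q (of_real x)"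
    using assms m unfolding fe_space_def by blast
  then show "\<exists>P. degree P \<le> l \<and> (\<forall>x\<in>?I. u x - v x = poly P (of_real x))"
    by (intro exI[of _ "P - Q"]) (auto intro: degree_diff_le)
qed

lemma H1_zero_L2: "v \<in> H1_zero \<Omega> \<Longrightarrow> v \<in> L2_space \<Omega>"
  using H1_zero_sobolev sobolev_L2 by blast

lemma H1_zero_weak_deriv_L2: "v \<in> H1_zero \<Omega> \<Longrightarrow> weak_deriv \<Omega> 1 v \<in> L2_space \<Omega>"
  using sobolevD(2)[OF H1_zero_sobolev ab, of v 1] by simp

lemma weak_deriv_diff_AE:
  assumes "u \<in> sobolev \<Omega> q" "v \<in> sobolev \<Omega> q" "k \<le> q"
  shows "AE x in lebesgue_on \<Omega>. weak_deriv \<Omega> k (\<lambda>x. u x - v x) x = weak_deriv \<Omega> k u x - weak_deriv \<Omega> k v x"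
  by (rule weak_deriv_AE_eq[OF ab has_weak_deriv_diff[OF sobolevD(1)[OF assms(1) ab assms(3)] sobolevD(1)[OF assms(2) ab assms(3)]]]) simp

lemma inner_weak_deriv_diff:
  assumes "u \<in> H1_zero \<Omega>" "v \<in> H1_zero \<Omega>" "w \<in> L2_space \<Omega>"
  shows "L2_inner \<Omega> (weak_deriv \<Omega> 1 (\<lambda>x. u x - v x)) w
    = L2_inner \<Omega> (weak_deriv \<Omega> 1 u) w - L2_inner \<Omega> (weak_deriv \<Omega> 1 v) w"
proof -
  have "L2_inner \<Omega> (weak_deriv \<Omega> 1 (\<lambda>x. u x - v x)) w
      = L2_inner \<Omega> (\<lambda>x. weak_deriv \<Omega> 1 u x - weak_deriv \<Omega> 1 v x) w"
    using weak_deriv_diff_AE[OF H1_zero_sobolev[OF assms(1)] H1_zero_sobolev[OF assms(2)], of 1]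
    by (intro L2_inner_cong_AE L2_spaceD(1) H1_zero_weak_deriv_L2 H1_zero_diff L2_diff assms ab) auto
  also have "\<dots> = L2_inner \<Omega> (weak_deriv \<Omega> 1 u) w - L2_inner \<Omega> (weak_deriv \<Omega> 1 v) w"
    by (rule L2_inner_diff_left[OF H1_zero_weak_deriv_L2[OF assms(1)] H1_zero_weak_deriv_L2[OF assms(2)] assms(3)])
  finally show ?thesis .
qed

lemma poincare:
  assumes "v \<in> H1_zero \<Omega>"
  shows "L2_norm \<Omega> v \<le> (b - a) / sqrt 8 * H1_seminorm \<Omega> v"
proof (rule power2_le_imp_le)
  show "(L2_norm \<Omega> v)\<^sup>2 \<le> ((b - a) / sqrt 8 * H1_seminorm \<Omega> v)\<^sup>2"
    using H1_zero_poincare[OF assms ab] by (simp add: power_mult_distrib power_divide)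
qed (use ab in \<open>simp add: H1_seminorm_def\<close>)

text \<open>The constant is the larger of the two factors in the energy estimate, the one of the
  source being enlarged by Poincare's constant, which converts the L2 norm of the test function into
  its seminorm. Neither factor contains M or N.\<close>

theorem stability: "unconditionally_stable a b gam lam K p U T l"
  unfolding unconditionally_stable_def
proof (intro exI allI impI)
  fix M N F F' v v'
  assume N: "1 \<le> N" and FL: "\<forall>n\<in>{1..N}. F n \<in> L2_space \<Omega> \<and> F' n \<in> L2_space \<Omega>"
    and v: "fe_scheme a b gam lam K p U T l M N F v" and v': "fe_scheme a b gam lam K p U T l M N F' v'"
  define \<tau> where "\<tau> = T / real N"
  have \<tau>0: "0 < \<tau>" using N T by (simp add: \<tau>_def)
  define w where "w n x = v n x - v' n x" for n x
  define cp where "cp = (b - a) / sqrt 8"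
  have cp: "0 \<le> cp" using ab by (simp add: cp_def)
  define C where "C = max (sqrt (T powr (1 - gam) / (2 * K))) (cp / K)"
  have fe: "v n \<in> fe_space a b M l" "v' n \<in> fe_space a b M l" if "n \<le> N" for n
    using v v' that by (auto simp: fe_scheme_def)
  have w: "w n \<in> fe_space a b M l" if "n \<le> N" for n
    using fe_space_diff[OF fe[OF that]] by (simp add: w_def[abs_def])
  have L: "u \<in> L2_space \<Omega>" if "u \<in> fe_space a b M l" for u
    using H1_zero_L2[OF fe_space_H1[OF that]] .
  have "sqrt (\<Sum>n=1..N. (H1_seminorm \<Omega> (w n))\<^sup>2 * \<tau>)
      \<le> sqrt (T powr (1 - gam) / (2 * K)) * L2_norm \<Omega> (w 0)
       + (1 / K) * sqrt (\<Sum>n=1..N. (cp * L2_norm \<Omega> (\<lambda>x. F n x - F' n x))\<^sup>2 * \<tau>)"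
  proof (rule energy_estimate[OF N \<tau>_def])
    show "w n \<in> L2_space \<Omega>" if "n \<le> N" for n using L[OF w[OF that]] .
    fix n assume n: "n \<in> {1..N}"
    then have n': "n \<le> N" by simp
    have dL: "dderiv \<tau> v n \<in> L2_space \<Omega>" "dderiv \<tau> v' n \<in> L2_space \<Omega>"
      using \<tau>0 n by (intro dderiv_L2 L fe; simp)+
    have dw: "dderiv \<tau> w n = (\<lambda>x. dderiv \<tau> v n x - dderiv \<tau> v' n x)"
      unfolding w_def[abs_def] by (rule ext) (rule dderiv_diff)
    have "L2_inner \<Omega> (dderiv \<tau> w n) (w n) + of_real K * L2_inner \<Omega> (weak_deriv \<Omega> 1 (w n)) (weak_deriv \<Omega> 1 (w n))
       = (L2_inner \<Omega> (dderiv \<tau> v n) (w n) + of_real K * L2_inner \<Omega> (weak_deriv \<Omega> 1 (v n)) (weak_deriv \<Omega> 1 (w n)))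
       - (L2_inner \<Omega> (dderiv \<tau> v' n) (w n) + of_real K * L2_inner \<Omega> (weak_deriv \<Omega> 1 (v' n)) (weak_deriv \<Omega> 1 (w n)))"
    proof -
      have 1: "L2_inner \<Omega> (weak_deriv \<Omega> 1 (w n)) (weak_deriv \<Omega> 1 (w n))
          = L2_inner \<Omega> (weak_deriv \<Omega> 1 (v n)) (weak_deriv \<Omega> 1 (w n)) - L2_inner \<Omega> (weak_deriv \<Omega> 1 (v' n)) (weak_deriv \<Omega> 1 (w n))"
        using inner_weak_deriv_diff[OF fe_space_H1[OF fe(1)[OF n']] fe_space_H1[OF fe(2)[OF n']] H1_zero_weak_deriv_L2[OF fe_space_H1[OF w[OF n']]]]
        by (simp add: w_def[abs_def])
      have 2: "L2_inner \<Omega> (dderiv \<tau> w n) (w n) = L2_inner \<Omega> (dderiv \<tau> v n) (w n) - L2_inner \<Omega> (dderiv \<tau> v' n) (w n)"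
        unfolding dw by (rule L2_inner_diff_left[OF dL L[OF w[OF n']]])
      show ?thesis unfolding 1 2 by (simp add: algebra_simps)
    qed
    also have "\<dots> = L2_inner \<Omega> (F n) (w n) - L2_inner \<Omega> (F' n) (w n)"
      using v v' n w[OF n'] unfolding fe_scheme_def \<tau>_def by simp
    also have "\<dots> = L2_inner \<Omega> (\<lambda>x. F n x - F' n x) (w n)"
      using FL n L[OF w[OF n']] by (simp add: L2_inner_diff_left)
    finally have "Re (L2_inner \<Omega> (dderiv \<tau> w n) (w n) + of_real K * L2_inner \<Omega> (weak_deriv \<Omega> 1 (w n)) (weak_deriv \<Omega> 1 (w n)))
        = Re (L2_inner \<Omega> (\<lambda>x. F n x - F' n x) (w n))" by simp
    also have "\<dots> \<le> L2_norm \<Omega> (\<lambda>x. F n x - F' n x) * L2_norm \<Omega> (w n)"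
      using FL n L[OF w[OF n']] by (intro order_trans[OF complex_Re_le_cmod L2_cauchy_schwarz] L2_diff) auto
    also have "\<dots> \<le> L2_norm \<Omega> (\<lambda>x. F n x - F' n x) * (cp * H1_seminorm \<Omega> (w n))"
      unfolding cp_def by (intro mult_left_mono poincare fe_space_H1[OF w[OF n']]) auto
    finally show "Re (L2_inner \<Omega> (dderiv \<tau> w n) (w n)) + K * (H1_seminorm \<Omega> (w n))\<^sup>2
        \<le> cp * L2_norm \<Omega> (\<lambda>x. F n x - F' n x) * H1_seminorm \<Omega> (w n)"
      by (simp add: L2_inner_self H1_seminorm_def mult_ac flip: of_real_power)
  qed (use cp in \<open>auto simp: H1_seminorm_def\<close>)
  also have "sqrt (\<Sum>n=1..N. (cp * L2_norm \<Omega> (\<lambda>x. F n x - F' n x))\<^sup>2 * \<tau>)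
      = cp * grid_norm_0 \<Omega> \<tau> N (\<lambda>n x. F n x - F' n x)"
    using cp by (simp add: grid_norm_0_def power_mult_distrib mult.assoc real_sqrt_mult flip: sum_distrib_left)
  also have "sqrt (T powr (1 - gam) / (2 * K)) * L2_norm \<Omega> (w 0) + (1 / K) * (cp * grid_norm_0 \<Omega> \<tau> N (\<lambda>n x. F n x - F' n x))
      \<le> C * L2_norm \<Omega> (w 0) + C * grid_norm_0 \<Omega> \<tau> N (\<lambda>n x. F n x - F' n x)"
    unfolding mult.assoc[symmetric]
    using \<tau>0 by (intro add_mono mult_right_mono) (auto simp: C_def grid_norm_0_def sum_nonneg)
  finally show "grid_norm_1 \<Omega> (T / real N) N (\<lambda>n x. v n x - v' n x)
      \<le> max (sqrt (T powr (1 - gam) / (2 * K))) ((b - a) / sqrt 8 / K) * (L2_norm \<Omega> (\<lambda>x. v 0 x - v' 0 x)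
               + grid_norm_0 \<Omega> (T / real N) N (\<lambda>n x. F n x - F' n x))"
    by (simp add: grid_norm_1_def \<tau>_def w_def[abs_def] C_def cp_def distrib_left)
qed

end

section \<open>Fourier representation of the discrete derivative\<close>

lemma gaussian_integrable:
  fixes n :: real
  assumes "0 < n"
  shows "integrable lborel (\<lambda>\<omega>. exp (- (\<omega> / n)\<^sup>2 / 2))"
proof -
  have "exp (- (\<omega> / n)\<^sup>2 / 2) = sqrt (2 * pi * n\<^sup>2) * normal_density 0 n \<omega>" for \<omega>
    using assms by (simp add: normal_density_def power_divide)
  then show ?thesis
    using integrable_normal_density[OF assms, of 0] by simp
qed

text \<open>The characteristic function of the standard normal law after the substitution omega = n
  x. The right side is written as 2 pi times a kernel of unit mass, the form in which it acts as an
  approximate identity.\<close>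

lemma gaussian_fourier:
  assumes n: "0 < n"
  shows "(CLINT \<omega>|lborel. of_real (exp (- (\<omega> / n)\<^sup>2 / 2)) * iexp (\<omega> * u))
    = of_real (2 * pi * (n * std_normal_density (n * u)))"
proof -
  have ch: "(CLINT x|lborel. std_normal_density x *\<^sub>R iexp (t * x)) = of_real (exp (- t\<^sup>2 / 2))" for t
    using fun_cong[OF char_std_normal_distribution, of t]
    by (simp add: char_def integral_density)
  have "(CLINT \<omega>|lborel. of_real (exp (- (\<omega> / n)\<^sup>2 / 2)) * iexp (\<omega> * u))
      = \<bar>n\<bar> *\<^sub>R (CLINT x|lborel. of_real (exp (- ((0 + n * x) / n)\<^sup>2 / 2)) * iexp ((0 + n * x) * u))"
    using n by (intro lborel_integral_real_affine) auto
  also have "(CLINT x|lborel. of_real (exp (- ((0 + n * x) / n)\<^sup>2 / 2)) * iexp ((0 + n * x) * u))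
      = (CLINT x|lborel. of_real (sqrt (2 * pi)) * (std_normal_density x *\<^sub>R iexp ((n * u) * x)))"
    using n by (intro Bochner_Integration.integral_cong refl)
      (simp add: std_normal_density_def scaleR_conv_of_real mult_ac)
  also have "\<dots> = of_real (sqrt (2 * pi)) * of_real (exp (- (n * u)\<^sup>2 / 2))"
    by (simp only: integral_mult_right_zero ch)
  also have "\<bar>n\<bar> *\<^sub>R \<dots> = of_real (n * (sqrt (2 * pi) * exp (- (n * u)\<^sup>2 / 2)))"
    using n by (simp add: scaleR_conv_of_real)
  also have "n * (sqrt (2 * pi) * exp (- (n * u)\<^sup>2 / 2)) = 2 * pi * (n * std_normal_density (n * u))"
    by (simp add: std_normal_density_def real_div_sqrt field_simps)
  finally show ?thesis .
qed

text \<open>From exp(-y) <= 1/y at y = (n \<open>\<delta>\<close>)^2 / 2. The resulting decay 1/n is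
  far from the truth but uniform in u, which is enough.\<close>

lemma gaussian_kernel_tail:
  assumes "0 < n" "0 < \<delta>" "\<delta> \<le> \<bar>u\<bar>"
  shows "n * std_normal_density (n * u) \<le> 2 / \<delta>\<^sup>2 * (1 / n)"
proof -
  have "std_normal_density (n * u) \<le> exp (- (n * u)\<^sup>2 / 2)"
  proof -
    have "1 \<le> sqrt (2 * pi)" using pi_gt3 by (simp add: real_le_rsqrt)
    then have "1 / sqrt (2 * pi) \<le> 1" by simp
    then show ?thesis unfolding std_normal_density_def by (intro mult_left_le_one_le) auto
  qed
  also have "\<dots> \<le> exp (- (n * \<delta>)\<^sup>2 / 2)"
    using assms by (auto simp: power_mult_distrib abs_le_square_iff[symmetric] intro!: mult_left_mono)
  also have "\<dots> = 1 / exp ((n * \<delta>)\<^sup>2 / 2)" by (simp add: exp_minus field_simps)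
  also have "\<dots> \<le> 1 / ((n * \<delta>)\<^sup>2 / 2)"
  proof (rule divide_left_mono)
    have "y \<le> exp y" for y :: real using exp_ge_add_one_self[of y] by linarith
    then show "(n * \<delta>)\<^sup>2 / 2 \<le> exp ((n * \<delta>)\<^sup>2 / 2)" .
  qed (use assms in auto)
  finally have "n * std_normal_density (n * u) \<le> n * (1 / ((n * \<delta>)\<^sup>2 / 2))"
    using assms by (intro mult_left_mono) auto
  also have "\<dots> = 2 / \<delta>\<^sup>2 * (1 / n)" using assms by (simp add: power2_eq_square)
  finally show ?thesis .
qed

text \<open>V is integrable and continuous at t but may be unbounded elsewhere, so it is split at
  distance \<open>\<delta>\<close> from t. The near part is bounded by |V t| + 1 and treated by
  scaling and dominated convergence; on the far part the kernel is uniformly small and is multiplied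
  by the L1 norm of V.\<close>

lemma gaussian_approximate_identity:
  fixes V :: "real \<Rightarrow> complex"
  assumes V: "integrable lborel V" and cont: "isCont V t"
  shows "(\<lambda>j. CLINT s|lborel. V s * of_real (real (Suc j) * std_normal_density (real (Suc j) * (t - s)))) \<longlonglongrightarrow> V t"
proof -
  have Vm [measurable]: "V \<in> borel_measurable borel" using V by auto
  obtain \<delta> where \<delta>: "0 < \<delta>" "\<And>s. \<bar>s - t\<bar> < \<delta> \<Longrightarrow> norm (V s - V t) < 1"
    using cont unfolding isCont_def LIM_def dist_norm real_norm_def by (metis diff_self norm_zero zero_less_one)
  define V1 where "V1 s = (if \<bar>s - t\<bar> < \<delta> then V s else 0)" for s
  define V2 where "V2 s = (if \<bar>s - t\<bar> < \<delta> then 0 else V s)" for s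
  have [measurable]: "V1 \<in> borel_measurable borel" "V2 \<in> borel_measurable borel"
    unfolding V1_def[abs_def] V2_def[abs_def] by measurable
  let ?k = "\<lambda>j s. real (Suc j) * std_normal_density (real (Suc j) * (t - s))"
  have bd: "norm (V1 s) \<le> norm (V t) + 1" for s
    using \<delta>(2)[of s] norm_triangle_ineq[of "V s - V t" "V t"]
    by (cases "\<bar>s - t\<bar> < \<delta>") (auto simp: V1_def add_nonneg_nonneg)
  have near_eq: "(CLINT s|lborel. V1 s * of_real (?k j s))
      = (CLINT y|lborel. V1 (t - y / real (Suc j)) * of_real (std_normal_density y))" for j
  proof -
    have "(CLINT s|lborel. V1 s * of_real (?k j s))
      = \<bar>- 1 / real (Suc j)\<bar> *\<^sub>R (CLINT y|lborel. V1 (t + (- 1 / real (Suc j)) * y) * of_real (?k j (t + (- 1 / real (Suc j)) * y)))"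
      by (rule lborel_integral_real_affine) simp
    also have "(CLINT y|lborel. V1 (t + (- 1 / real (Suc j)) * y) * of_real (?k j (t + (- 1 / real (Suc j)) * y)))
      = (CLINT y|lborel. of_real (real (Suc j)) * (V1 (t - y / real (Suc j)) * of_real (std_normal_density y)))"
      by (intro Bochner_Integration.integral_cong refl) (simp del: of_nat_Suc add: mult_ac)
    also have "\<dots> = of_real (real (Suc j)) * (CLINT y|lborel. V1 (t - y / real (Suc j)) * of_real (std_normal_density y))"
      by simp
    finally show ?thesis by (simp del: of_nat_Suc add: scaleR_conv_of_real)
  qed
  have near: "(\<lambda>j. CLINT s|lborel. V1 s * of_real (?k j s)) \<longlonglongrightarrow> V t"
  proof -
    have "(\<lambda>j. CLINT y|lborel. V1 (t - y / real (Suc j)) * of_real (std_normal_density y))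
        \<longlonglongrightarrow> (CLINT y|lborel. V t * of_real (std_normal_density y))"
    proof (rule integral_dominated_convergence[where w="\<lambda>y. (norm (V t) + 1) * std_normal_density y"])
      show "integrable lborel (\<lambda>y. (norm (V t) + 1) * std_normal_density y)"
        by (intro integrable_mult_right integrable_normal_density) simp
      show "AE y in lborel. norm (V1 (t - y / real (Suc j)) * of_real (std_normal_density y)) \<le> (norm (V t) + 1) * std_normal_density y" for j
        unfolding norm_mult using bd by (intro AE_I2 mult_mono) auto
      show "AE y in lborel. (\<lambda>j. V1 (t - y / real (Suc j)) * of_real (std_normal_density y)) \<longlonglongrightarrow> V t * of_real (std_normal_density y)"
      proof (intro AE_I2 tendsto_intros)
        fix y
        have "(\<lambda>j. y * (1 / real (Suc j))) \<longlonglongrightarrow> y * 0"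
          by (intro tendsto_intros lim_1_over_n[THEN LIMSEQ_Suc])
        then have y0: "(\<lambda>j. y / real (Suc j)) \<longlonglongrightarrow> 0" by simp
        then have "(\<lambda>j. t - y / real (Suc j)) \<longlonglongrightarrow> t - 0" by (intro tendsto_intros)
        then have "(\<lambda>j. V (t - y / real (Suc j))) \<longlonglongrightarrow> V t"
          using isCont_tendsto_compose[OF cont] by simp
        moreover have "eventually (\<lambda>j. V (t - y / real (Suc j)) = V1 (t - y / real (Suc j))) sequentially"
          using tendstoD[OF y0 \<delta>(1)] by eventually_elim (simp add: V1_def dist_real_def)
        ultimately show "(\<lambda>j. V1 (t - y / real (Suc j))) \<longlonglongrightarrow> V t"
          by (rule Lim_transform_eventually)
      qed
    qed measurable
    moreover have "(CLINT y|lborel. V t * of_real (std_normal_density y)) = V t"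
      using integral_normal_density[of 1 0] by simp
    ultimately show ?thesis unfolding near_eq by simp
  qed
  have ptw: "norm (V2 s * of_real (?k j s)) \<le> (2 / \<delta>\<^sup>2 * (1 / real (Suc j))) * norm (V s)" for s j
  proof (cases "\<bar>s - t\<bar> < \<delta>")
    case False
    then have "?k j s \<le> 2 / \<delta>\<^sup>2 * (1 / real (Suc j))"
      using \<delta>(1) by (intro gaussian_kernel_tail) auto
    then have "norm (V s) * ?k j s \<le> norm (V s) * (2 / \<delta>\<^sup>2 * (1 / real (Suc j)))"
      by (intro mult_left_mono) auto
    then show ?thesis using False by (simp add: V2_def norm_mult abs_mult mult_ac del: of_nat_Suc)
  qed (simp add: V2_def)
  have V2i: "integrable lborel (\<lambda>s. V2 s * of_real (?k j s))" for j
  proof (rule Bochner_Integration.integrable_bound)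
    show "integrable lborel (\<lambda>s. (2 / \<delta>\<^sup>2 * (1 / real (Suc j))) * norm (V s))"
      using V by (intro integrable_mult_right integrable_norm)
    show "AE s in lborel. norm (V2 s * of_real (?k j s)) \<le> norm ((2 / \<delta>\<^sup>2 * (1 / real (Suc j))) * norm (V s))"
      by (intro AE_I2 order_trans[OF ptw]) simp
  qed measurable
  have far: "(\<lambda>j. CLINT s|lborel. V2 s * of_real (?k j s)) \<longlonglongrightarrow> 0"
  proof (rule Lim_null_comparison[OF always_eventually[OF allI]])
    fix j
    have "norm (CLINT s|lborel. V2 s * of_real (?k j s)) \<le> (LINT s|lborel. norm (V2 s * of_real (?k j s)))"
      by (rule integral_norm_bound)
    also have "\<dots> \<le> (LINT s|lborel. (2 / \<delta>\<^sup>2 * (1 / real (Suc j))) * norm (V s))"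
      by (intro integral_mono ptw integrable_norm V2i integrable_mult_right V)
    also have "\<dots> = (2 / \<delta>\<^sup>2 * (LINT s|lborel. norm (V s))) * (1 / real (Suc j))" by simp
    finally show "norm (CLINT s|lborel. V2 s * of_real (?k j s)) \<le> (2 / \<delta>\<^sup>2 * (LINT s|lborel. norm (V s))) * (1 / real (Suc j))" .
    have "(\<lambda>j. (2 / \<delta>\<^sup>2 * (LINT s|lborel. norm (V s))) * (1 / real (Suc j))) \<longlonglongrightarrow> (2 / \<delta>\<^sup>2 * (LINT s|lborel. norm (V s))) * 0"
      by (intro tendsto_intros lim_1_over_n[THEN LIMSEQ_Suc])
    then show "(\<lambda>j. (2 / \<delta>\<^sup>2 * (LINT s|lborel. norm (V s))) * (1 / real (Suc j))) \<longlonglongrightarrow> 0" by simp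
  qed
  have V1i: "integrable lborel (\<lambda>s. V1 s * of_real (?k j s))" for j
  proof (rule Bochner_Integration.integrable_bound)
    show "integrable lborel (\<lambda>s. (norm (V t) + 1) * (real (Suc j) * std_normal_density (real (Suc j) * (t - s))))"
      using lborel_integrable_real_affine[OF integrable_normal_density[of 1 0], of "- real (Suc j)" "real (Suc j) * t"]
      by (intro integrable_mult_right) (simp add: algebra_simps)
    show "AE s in lborel. norm (V1 s * of_real (?k j s)) \<le> norm ((norm (V t) + 1) * (real (Suc j) * std_normal_density (real (Suc j) * (t - s))))"
      unfolding norm_mult[of "V1 _"] norm_of_real using bd by (intro AE_I2) (simp add: abs_mult mult_right_mono del: of_nat_Suc)
  qed measurable
  have "(\<lambda>j. (CLINT s|lborel. V1 s * of_real (?k j s)) + (CLINT s|lborel. V2 s * of_real (?k j s))) \<longlonglongrightarrow> V t + 0"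
    by (intro tendsto_add near far)
  moreover have "(CLINT s|lborel. V s * of_real (?k j s))
      = (CLINT s|lborel. V1 s * of_real (?k j s)) + (CLINT s|lborel. V2 s * of_real (?k j s))" for j
    unfolding Bochner_Integration.integral_add[OF V1i V2i, symmetric]
    by (intro Bochner_Integration.integral_cong refl) (simp add: V1_def V2_def)
  ultimately show ?thesis by simp
qed

text \<open>A Gaussian weight makes the double integral absolutely convergent, so Fubini applies and
  the inner integral becomes the approximate identity. As the weight tends to 1 the other side
  converges by dominated convergence, the transform being integrable.\<close>

theorem fourier_inversion_at:
  fixes V :: "real \<Rightarrow> complex"
  assumes V: "integrable lborel V" and cont: "isCont V t"
    and F: "\<And>\<omega>. F \<omega> = (CLINT s|lborel. iexp (- (\<omega> * s)) * V s)" "integrable lborel F"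
  shows "of_real (2 * pi) * V t = (CLINT \<omega>|lborel. F \<omega> * iexp (\<omega> * t))"
proof -
  have Vm [measurable]: "V \<in> borel_measurable borel" using V by auto
  have Fm [measurable]: "F \<in> borel_measurable borel" using F(2) by auto
  define w where "w j \<omega> = exp (- (\<omega> / real (Suc j))\<^sup>2 / 2)" for j \<omega>
  have w: "0 \<le> w j \<omega>" "w j \<omega> \<le> 1" for j \<omega> by (auto simp: w_def)
  have wi: "integrable lborel (w j)" for j
    unfolding w_def[abs_def] by (rule gaussian_integrable) simp
  have [measurable]: "w j \<in> borel_measurable borel" for j using wi[of j] by auto
  have 1: "(\<lambda>j. CLINT \<omega>|lborel. F \<omega> * iexp (\<omega> * t) * of_real (w j \<omega>)) \<longlonglongrightarrow> (CLINT \<omega>|lborel. F \<omega> * iexp (\<omega> * t))"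
  proof (rule integral_dominated_convergence[where w="\<lambda>\<omega>. norm (F \<omega>)"])
    show "AE \<omega> in lborel. norm (F \<omega> * iexp (\<omega> * t) * of_real (w j \<omega>)) \<le> norm (F \<omega>)" for j
      using w by (intro AE_I2) (simp add: norm_mult mult_left_le)
    show "AE \<omega> in lborel. (\<lambda>j. F \<omega> * iexp (\<omega> * t) * of_real (w j \<omega>)) \<longlonglongrightarrow> F \<omega> * iexp (\<omega> * t)"
    proof (intro AE_I2)
      fix \<omega>
      have "(\<lambda>j. exp (- (\<omega> * (1 / real (Suc j)))\<^sup>2 / 2)) \<longlonglongrightarrow> exp (- (\<omega> * 0)\<^sup>2 / 2)"
        by (intro tendsto_intros lim_1_over_n[THEN LIMSEQ_Suc]) auto
      then have "(\<lambda>j. w j \<omega>) \<longlonglongrightarrow> 1" by (simp add: w_def)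
      then have "(\<lambda>j. F \<omega> * iexp (\<omega> * t) * of_real (w j \<omega>)) \<longlonglongrightarrow> F \<omega> * iexp (\<omega> * t) * of_real 1"
        by (intro tendsto_intros)
      then show "(\<lambda>j. F \<omega> * iexp (\<omega> * t) * of_real (w j \<omega>)) \<longlonglongrightarrow> F \<omega> * iexp (\<omega> * t)" by simp
    qed
    show "integrable lborel (\<lambda>\<omega>. norm (F \<omega>))" using F(2) by simp
  qed measurable
  have 2: "(CLINT \<omega>|lborel. F \<omega> * iexp (\<omega> * t) * of_real (w j \<omega>))
      = of_real (2 * pi) * (CLINT s|lborel. V s * of_real (real (Suc j) * std_normal_density (real (Suc j) * (t - s))))" for j
  proof -
    let ?f = "\<lambda>s \<omega>. V s * (of_real (w j \<omega>) * iexp (\<omega> * (t - s)))"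
    have "integrable (lborel \<Otimes>\<^sub>M lborel) (case_prod ?f)"
    proof (rule lborel_pair.Fubini_integrable)
      show "case_prod ?f \<in> borel_measurable (lborel \<Otimes>\<^sub>M lborel)" by measurable
      have "(LINT \<omega>|lborel. norm (case_prod ?f (s, \<omega>))) = norm (V s) * (LINT \<omega>|lborel. w j \<omega>)" for s
        using w by (simp add: norm_mult)
      then show "integrable lborel (\<lambda>s. LINT \<omega>|lborel. norm (case_prod ?f (s, \<omega>)))"
        using V by simp
      have "integrable lborel (\<lambda>\<omega>. ?f s \<omega>)" for s
      proof (rule Bochner_Integration.integrable_bound)
        show "integrable lborel (\<lambda>\<omega>. norm (V s) * w j \<omega>)" using wi by simp
        show "AE \<omega> in lborel. norm (?f s \<omega>) \<le> norm (norm (V s) * w j \<omega>)"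
          by (intro AE_I2) (simp add: norm_mult)
      qed measurable
      then show "AE s in lborel. integrable lborel (\<lambda>\<omega>. case_prod ?f (s, \<omega>))" by simp
    qed
    from lborel_pair.Fubini_integral[OF this]
    have "(CLINT \<omega>|lborel. CLINT s|lborel. ?f s \<omega>) = (CLINT s|lborel. CLINT \<omega>|lborel. ?f s \<omega>)" .
    moreover have "(CLINT s|lborel. ?f s \<omega>) = F \<omega> * iexp (\<omega> * t) * of_real (w j \<omega>)" for \<omega>
    proof -
      have "(CLINT s|lborel. ?f s \<omega>) = (CLINT s|lborel. (iexp (\<omega> * t) * of_real (w j \<omega>)) * (iexp (- (\<omega> * s)) * V s))"
        by (intro Bochner_Integration.integral_cong refl) (simp add: right_diff_distrib exp_diff exp_minus field_simps)
      also have "\<dots> = (iexp (\<omega> * t) * of_real (w j \<omega>)) * F \<omega>"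
        by (simp only: integral_mult_right_zero F(1))
      finally show ?thesis by (simp add: mult_ac)
    qed
    moreover have "(CLINT \<omega>|lborel. ?f s \<omega>)
        = of_real (2 * pi) * (V s * of_real (real (Suc j) * std_normal_density (real (Suc j) * (t - s))))" for s
    proof -
      have "(CLINT \<omega>|lborel. ?f s \<omega>) = V s * (CLINT \<omega>|lborel. of_real (exp (- (\<omega> / real (Suc j))\<^sup>2 / 2)) * iexp (\<omega> * (t - s)))"
        by (simp add: w_def)
      also have "\<dots> = V s * of_real (2 * pi * (real (Suc j) * std_normal_density (real (Suc j) * (t - s))))"
        by (subst gaussian_fourier) simp_all
      finally show ?thesis by (simp add: mult_ac)
    qed
    ultimately show ?thesis by (simp only: integral_mult_right_zero)
  qed
  have "(\<lambda>j. of_real (2 * pi) * (CLINT s|lborel. V s * of_real (real (Suc j) * std_normal_density (real (Suc j) * (t - s)))))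
      \<longlonglongrightarrow> of_real (2 * pi) * V t"
    by (intro tendsto_mult tendsto_const gaussian_approximate_identity V cont)
  with 1 show ?thesis unfolding 2 by (rule LIMSEQ_unique[symmetric])
qed

section \<open>The symbol of the difference quotient\<close>

lemma g_coeff_abs_summable:
  assumes "0 < gam" "gam < 1"
  shows "summable (\<lambda>k. \<bar>g_coeff gam k\<bar>)" "(\<Sum>k<m. \<bar>g_coeff gam k\<bar>) \<le> 2"
proof -
  have bd: "(\<Sum>k<m. \<bar>g_coeff gam k\<bar>) \<le> 2" for m
  proof -
    have "(\<Sum>k<m. \<bar>g_coeff gam k\<bar>) \<le> (\<Sum>k\<le>m. \<bar>g_coeff gam k\<bar>)"
      by (intro sum_mono2) auto
    also have "\<dots> = 1 + (\<Sum>k=1..m. \<bar>g_coeff gam k\<bar>)"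
      by (simp add: sum.atLeast_Suc_atMost flip: atLeast0AtMost)
    \<comment> \<open>At lam = 0 and tau = 1 the coefficients of the scheme are the plain
      \<open>g_coeff\<close> for k >= 1 and the diagonal one is 1, so the dominance of the diagonal
      bounds the absolute sum.\<close>
    also have "(\<Sum>k=1..m. \<bar>g_coeff gam k\<bar>) = (\<Sum>k=1..m. \<bar>d_coeff gam 0 1 k\<bar>)"
      by (intro sum.cong refl) (auto simp: d_coeff_def tempered_g_coeff_def)
    also have "\<dots> \<le> d_coeff gam 0 1 0" by (rule d_coeff_dominance[OF assms]) auto
    also have "\<dots> = 1" by (simp add: d_coeff_def)
    finally show ?thesis by simp
  qed
  then show "(\<Sum>k<m. \<bar>g_coeff gam k\<bar>) \<le> 2" .
  show "summable (\<lambda>k. \<bar>g_coeff gam k\<bar>)"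
    by (rule summableI_nonneg_bounded[OF _ bd]) simp
qed

text \<open>The binomial series on its circle of convergence: absolute summability of the
  coefficients permits the radial limit under the sum. Off z = 1 the base 1 - z has positive real
  part, where the principal power is continuous. At z = 1 the power is 0 by convention, and the
  partial sums tend to 0 by their explicit bound.\<close>

lemma g_coeff_symbol_sums:
  fixes z :: complex
  assumes gam: "0 < gam" "gam < 1" and z: "norm z = 1"
  shows "(\<lambda>k. of_real (g_coeff gam k) * z ^ k) sums (1 - z) powr of_real gam"
proof (cases "z = 1")
  case True
  have "(\<lambda>n. g_partial gam n) \<longlonglongrightarrow> 0"
  proof (rule tendsto_sandwich[OF always_eventually[OF allI] always_eventually[OF allI] tendsto_const])
    show "0 \<le> g_partial gam n" "g_partial gam n \<le> real (Suc n) powr (- gam)" for n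
      using g_partial_bounds[OF gam, of n] by auto
    show "(\<lambda>n. real (Suc n) powr (- gam)) \<longlonglongrightarrow> 0"
      using gam by (intro LIMSEQ_Suc[of "\<lambda>n. real n powr (- gam)"] tendsto_neg_powr filterlim_real_sequentially) auto
  qed
  then have "(\<lambda>n. \<Sum>k<Suc n. g_coeff gam k) \<longlonglongrightarrow> 0"
    by (simp add: g_partial_def lessThan_Suc_atMost atLeast0AtMost del: sum.lessThan_Suc)
  then have "(\<lambda>k. g_coeff gam k) sums 0"
    unfolding sums_def by (rule LIMSEQ_imp_Suc)
  then have "(\<lambda>k. complex_of_real (g_coeff gam k)) sums of_real 0" by (rule sums_of_real)
  then show ?thesis using True by simp
next
  case False
  have Re: "Re z < 1"
  proof (rule ccontr)
    assume "\<not> Re z < 1"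
    then have "Re z = 1" using complex_Re_le_cmod[of z] z by simp
    moreover from this have "Im z = 0" using z by (simp add: cmod_def)
    ultimately show False using False by (simp add: complex_eq_iff)
  qed
  then have nz: "1 - z \<notin> \<real>\<^sub>\<le>\<^sub>0" by (auto simp: complex_nonpos_Reals_iff)
  define r where "r j = 1 - 1 / real (Suc (Suc j))" for j
  have r: "0 < r j" "r j < 1" for j by (auto simp: r_def)
  have "(\<lambda>j. 1 - 1 / real (Suc (Suc j))) \<longlonglongrightarrow> 1 - 0"
    by (intro tendsto_intros lim_1_over_n[THEN LIMSEQ_Suc, THEN LIMSEQ_Suc])
  then have r1: "r \<longlonglongrightarrow> 1" by (simp add: r_def[abs_def])
  define A where "A k j = complex_of_real (g_coeff gam k) * (of_real (r j) * z) ^ k" for k j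
  have A: "(\<lambda>k. A k j) sums (1 - of_real (r j) * z) powr of_real gam" for j
  proof -
    have "norm (- (of_real (r j) * z)) < 1" using r[of j] z by (simp add: norm_mult)
    from gen_binomial_complex[OF this, of "of_real gam"]
    have "(\<lambda>n. (of_real gam gchoose n) * (- (of_real (r j) * z)) ^ n) sums (1 - of_real (r j) * z) powr of_real gam"
      by simp
    moreover have "(complex_of_real gam gchoose k) * (- (of_real (r j) * z)) ^ k = A k j" for k
      unfolding A_def g_coeff_def power_minus[of "of_real (r j) * z"]
      by (simp add: gbinomial_prod_rev mult_ac)
    ultimately show ?thesis by simp
  qed
  have T: "summable (\<lambda>n. norm (complex_of_real (g_coeff gam n) * z ^ n)) \<and>
    ((\<lambda>j. \<Sum>k. A k j) \<longlonglongrightarrow> (\<Sum>k. complex_of_real (g_coeff gam k) * z ^ k))"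
  proof (rule conjunct2[OF tannerys_theorem[where M="\<lambda>k. \<bar>g_coeff gam k\<bar>"]])
    show "(\<lambda>j. A k j) \<longlonglongrightarrow> complex_of_real (g_coeff gam k) * z ^ k" for k
    proof -
      have "(\<lambda>j. complex_of_real (g_coeff gam k) * (of_real (r j) * z) ^ k) \<longlonglongrightarrow> complex_of_real (g_coeff gam k) * (of_real 1 * z) ^ k"
        by (intro tendsto_intros r1)
      then show ?thesis by (simp add: A_def)
    qed
    have "norm (A k j) \<le> \<bar>g_coeff gam k\<bar>" for k j
      using r[of j] z by (auto simp: A_def norm_mult norm_power power_le_one intro!: mult_left_le)
    then show "\<forall>\<^sub>F (k, j) in sequentially \<times>\<^sub>F sequentially. norm (A k j) \<le> \<bar>g_coeff gam k\<bar>"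
      by (intro always_eventually) auto
  qed (use g_coeff_abs_summable[OF gam] in auto)
  have "(\<lambda>j. (1 - of_real (r j) * z) powr of_real gam) \<longlonglongrightarrow> (1 - of_real 1 * z) powr of_real gam"
    using nz by (intro tendsto_powr_complex tendsto_intros r1) auto
  moreover have "(\<Sum>k. A k j) = (1 - of_real (r j) * z) powr of_real gam" for j
    using A[of j] by (simp add: sums_iff)
  ultimately have "(\<lambda>j. \<Sum>k. A k j) \<longlonglongrightarrow> (1 - z) powr of_real gam" by simp
  then have "(\<Sum>k. complex_of_real (g_coeff gam k) * z ^ k) = (1 - z) powr of_real gam"
    by (rule LIMSEQ_unique[OF conjunct2[OF T]])
  then show ?thesis
    using summable_norm_cancel[OF conjunct1[OF T]] by (simp add: sums_iff)
qed

text \<open>For |\<open>\<theta>\<close>| > 1 the two terms are bounded separately. For small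
  \<open>\<theta>\<close> the base points differ by at most \<open>\<theta>\<close>^2 / 2, and the
  derivative of the power along the segment between them is of order |\<open>\<theta>\<close>|^(gam
  - 1); the product is of order |\<open>\<theta>\<close>|^(1 + gam).\<close>

lemma powr_symbol_estimate:
  assumes gam: "0 < gam" "gam < 1"
  shows "norm ((1 - iexp (- \<theta>)) powr of_real gam - (\<i> * of_real \<theta>) powr of_real gam) \<le> 3 * \<bar>\<theta>\<bar> powr (1 + gam)"
proof (cases "\<bar>\<theta>\<bar> \<le> 1")
  case False
  have "norm ((1 - iexp (- \<theta>)) powr of_real gam) = norm (1 - iexp (- \<theta>)) powr gam"
    by (subst norm_powr_real_powr') auto
  also have "\<dots> \<le> 2 powr gam"
    using norm_triangle_ineq4[of 1 "iexp (- \<theta>)"] gam by (intro powr_mono2) auto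
  also have "\<dots> \<le> 2 powr 1" using gam by (intro powr_mono) auto
  also have "\<dots> \<le> 2 * \<bar>\<theta>\<bar> powr (1 + gam)"
    using False gam by (simp add: ge_one_powr_ge_zero)
  finally have 1: "norm ((1 - iexp (- \<theta>)) powr of_real gam) \<le> 2 * \<bar>\<theta>\<bar> powr (1 + gam)" .
  have "norm ((\<i> * of_real \<theta>) powr of_real gam) = \<bar>\<theta>\<bar> powr gam"
    by (subst norm_powr_real_powr') (auto simp: norm_mult)
  also have "\<dots> \<le> \<bar>\<theta>\<bar> powr (1 + gam)" using False by (intro powr_mono) auto
  finally show ?thesis using 1 norm_triangle_ineq4[of "(1 - iexp (- \<theta>)) powr of_real gam" "(\<i> * of_real \<theta>) powr of_real gam"] by linarith
next
  case True
  show ?thesis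
  proof (cases "\<theta> = 0")
    case False
    define w where "w = \<i> * complex_of_real \<theta>"
    define z where "z = 1 - iexp (- \<theta>)"
    have zw: "norm (z - w) \<le> \<theta>\<^sup>2 / 2"
    proof -
      have "norm (iexp (- \<theta>) - (\<Sum>k\<le>1. (\<i> * of_real (- \<theta>)) ^ k / fact k)) \<le> \<bar>- \<theta>\<bar> ^ Suc 1 / fact (Suc 1)"
        by (rule iexp_approx1)
      then have "norm (iexp (- \<theta>) - (1 - w)) \<le> \<theta>\<^sup>2 / 2"
        by (simp add: w_def numeral_2_eq_2)
      moreover have "z - w = - (iexp (- \<theta>) - (1 - w))" by (simp add: z_def)
      ultimately show ?thesis by (metis norm_minus_cancel)
    qed
    \<comment> \<open>The segment stays away from the branch point, and in the closed right half
      plane, away from the cut. Its length is at most half of the distance |\<open>\<theta>\<close>|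
      of its start from 0, because \<open>\<theta>\<close>^2 <= |\<open>\<theta>\<close>|.\<close>
    have far: "\<bar>\<theta>\<bar> / 2 \<le> norm u" "0 \<le> Re u" if u: "u \<in> closed_segment w z" for u
    proof -
      have "dist w u \<le> dist w z" using dist_in_closed_segment[OF u] by (simp add: dist_commute)
      then have "norm w - norm u \<le> \<theta>\<^sup>2 / 2"
        using zw norm_triangle_ineq2[of w u] by (simp add: dist_norm norm_minus_commute)
      moreover have "norm w = \<bar>\<theta>\<bar>" by (simp add: w_def norm_mult)
      moreover have "\<bar>\<theta>\<bar> * \<bar>\<theta>\<bar> \<le> \<bar>\<theta>\<bar> * 1" using True by (intro mult_left_mono) auto
      then have "\<theta>\<^sup>2 \<le> \<bar>\<theta>\<bar>" by (simp add: power2_eq_square)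
      ultimately show "\<bar>\<theta>\<bar> / 2 \<le> norm u" by linarith
      obtain s where s: "0 \<le> s" "s \<le> 1" "u = (1 - s) *\<^sub>R w + s *\<^sub>R z"
        using u by (auto simp: closed_segment_def)
      then show "0 \<le> Re u" by (simp add: w_def z_def Re_exp)
    qed
    have "norm (z powr of_real gam - w powr of_real gam) \<le> (gam * (\<bar>\<theta>\<bar> / 2) powr (gam - 1)) * norm (z - w)"
    proof (rule field_differentiable_bound[OF convex_closed_segment])
      fix u assume u: "u \<in> closed_segment w z"
      have u0: "0 < norm u" using far(1)[OF u] False by linarith
      have nR: "u \<notin> \<real>\<^sub>\<le>\<^sub>0"
      proof
        assume "u \<in> \<real>\<^sub>\<le>\<^sub>0"
        then have "Re u \<le> 0" "Im u = 0" by (auto simp: complex_nonpos_Reals_iff)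
        then have "u = 0" using far(2)[OF u] by (simp add: complex_eq_iff)
        then show False using u0 by simp
      qed
      show "((\<lambda>z. z powr of_real gam) has_field_derivative of_real gam * u powr (of_real gam - 1)) (at u within closed_segment w z)"
        by (rule DERIV_subset[OF has_field_derivative_powr[OF nR]]) simp
      have "norm (u powr (of_real gam - 1)) = norm u powr (gam - 1)"
        by (subst norm_powr_real_powr') auto
      also have "\<dots> \<le> (\<bar>\<theta>\<bar> / 2) powr (gam - 1)"
        using far(1)[OF u] False gam by (intro powr_mono2') auto
      finally show "norm (of_real gam * u powr (of_real gam - 1)) \<le> gam * (\<bar>\<theta>\<bar> / 2) powr (gam - 1)"
        using gam by (simp add: norm_mult mult_left_mono)
    qed auto
    also have "\<dots> \<le> (gam * (\<bar>\<theta>\<bar> / 2) powr (gam - 1)) * (\<theta>\<^sup>2 / 2)"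
      using zw gam by (intro mult_left_mono) auto
    also have "\<dots> \<le> (1 * ((\<bar>\<theta>\<bar> / 2) powr (gam - 1))) * (\<theta>\<^sup>2 / 2)"
      using gam by (intro mult_right_mono) auto
    also have "(\<bar>\<theta>\<bar> / 2) powr (gam - 1) = \<bar>\<theta>\<bar> powr (gam - 1) * 2 powr (1 - gam)"
      by (simp add: powr_divide powr_diff field_simps)
    also have "(1 * (\<bar>\<theta>\<bar> powr (gam - 1) * 2 powr (1 - gam))) * (\<theta>\<^sup>2 / 2)
        = (2 powr (1 - gam) / 2) * (\<bar>\<theta>\<bar> powr (gam - 1) * \<bar>\<theta>\<bar> powr 2)"
      using False by (simp add: powr_numeral)
    also have "\<bar>\<theta>\<bar> powr (gam - 1) * \<bar>\<theta>\<bar> powr 2 = \<bar>\<theta>\<bar> powr (1 + gam)"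
      unfolding powr_add[symmetric] by (simp add: add.commute)
    also have "(2 powr (1 - gam) / 2) * \<bar>\<theta>\<bar> powr (1 + gam) \<le> 3 * \<bar>\<theta>\<bar> powr (1 + gam)"
    proof (rule mult_right_mono)
      have "2 powr (1 - gam) \<le> 2 powr (1::real)" using gam by (intro powr_mono) auto
      then show "2 powr (1 - gam) / 2 \<le> (3::real)" by simp
    qed simp
    finally show ?thesis by (simp add: z_def w_def)
  qed simp
qed

text \<open>The Fourier multiplier of \<open>gl_sum\<close>.\<close>

definition gl_symbol :: "real \<Rightarrow> real \<Rightarrow> real \<Rightarrow> complex" where
  "gl_symbol gam \<tau> \<omega> = of_real (\<tau> powr (- gam)) * (1 - iexp (- (\<omega> * \<tau>))) powr of_real gam"

lemma gl_symbol_estimate: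
  assumes gam: "0 < gam" "gam < 1" and \<tau>: "0 < \<tau>"
  shows "norm (gl_symbol gam \<tau> \<omega> - (\<i> * of_real \<omega>) powr of_real gam) \<le> 3 * \<tau> * \<bar>\<omega>\<bar> powr (1 + gam)"
proof -
  have "(of_real \<tau> * (\<i> * of_real \<omega>)) powr of_real gam = of_real (\<tau> powr gam) * (\<i> * of_real \<omega>) powr (complex_of_real gam)"
    using \<tau> by (subst powr_times_real_left) (auto simp: powr_of_real)
  then have eq: "(\<i> * of_real \<omega>) powr of_real gam = of_real (\<tau> powr (- gam)) * (\<i> * of_real (\<omega> * \<tau>)) powr (complex_of_real gam)"
    using \<tau> by (simp add: powr_minus field_simps)
  have "norm (gl_symbol gam \<tau> \<omega> - (\<i> * of_real \<omega>) powr of_real gam)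
      = \<tau> powr (- gam) * norm ((1 - iexp (- (\<omega> * \<tau>))) powr of_real gam - (\<i> * of_real (\<omega> * \<tau>)) powr of_real gam)"
    unfolding gl_symbol_def eq right_diff_distrib[symmetric] norm_mult by simp
  also have "\<dots> \<le> \<tau> powr (- gam) * (3 * \<bar>\<omega> * \<tau>\<bar> powr (1 + gam))"
    by (intro mult_left_mono powr_symbol_estimate gam) auto
  also have "\<dots> = 3 * (\<tau> powr (- gam) * \<tau> powr (1 + gam)) * \<bar>\<omega>\<bar> powr (1 + gam)"
    using \<tau> by (simp add: abs_mult powr_mult)
  also have "\<tau> powr (- gam) * \<tau> powr (1 + gam) = \<tau>"
    using \<tau> by (simp flip: powr_add)
  finally show ?thesis .
qed

text \<open>The Gruenwald-Letnikov quotient at time n tau. The sum over the whole past is cut at k =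
  n, for functions that vanish up to time 0.\<close>

definition gl_sum :: "real \<Rightarrow> (real \<Rightarrow> complex) \<Rightarrow> real \<Rightarrow> nat \<Rightarrow> complex" where
  "gl_sum gam V \<tau> n = of_real (\<tau> powr (- gam)) *
     (\<Sum>k=0..n. of_real (g_coeff gam k) * V (real n * \<tau> - real k * \<tau>))"

text \<open>A shift by k tau multiplies the integrand by the k-th power of exp(-i omega tau), so the
  shifts add up to the binomial series of the symbol. Its partial sums are bounded by 2, which
  allows the exchange with the integral; terms beyond n contribute nothing since V vanishes
  there.\<close>

lemma gl_sum_fourier:
  assumes gam: "0 < gam" "gam < 1" and \<tau>: "0 < \<tau>"
    and F: "integrable lborel F"
    and V: "\<And>s. s \<le> real n * \<tau> \<Longrightarrow> of_real (2 * pi) * V s = (CLINT \<omega>|lborel. F \<omega> * iexp (\<omega> * s))"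
    and V0: "\<And>s. s \<le> 0 \<Longrightarrow> V s = 0"
  shows "of_real (2 * pi) * gl_sum gam V \<tau> n = (CLINT \<omega>|lborel. F \<omega> * iexp (\<omega> * (real n * \<tau>)) * gl_symbol gam \<tau> \<omega>)"
    and "integrable lborel (\<lambda>\<omega>. F \<omega> * iexp (\<omega> * (real n * \<tau>)) * gl_symbol gam \<tau> \<omega>)"
proof -
  have Fm [measurable]: "F \<in> borel_measurable borel" using F by auto
  let ?t = "real n * \<tau>"
  define S where "S m \<omega> = (\<Sum>k<m. complex_of_real (g_coeff gam k) * iexp (- (\<omega> * \<tau>)) ^ k)" for m \<omega>
  have [measurable]: "S m \<in> borel_measurable borel" for m unfolding S_def[abs_def] by measurable
  have Slim: "(\<lambda>m. S m \<omega>) \<longlonglongrightarrow> (1 - iexp (- (\<omega> * \<tau>))) powr of_real gam" for \<omega>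
    using g_coeff_symbol_sums[OF gam, of "iexp (- (\<omega> * \<tau>))"] by (simp add: S_def sums_def)
  \<comment> \<open>The principal power is discontinuous on its cut, so measurability is taken from
    the continuous partial sums that converge to it.\<close>
  have symm [measurable]: "(\<lambda>\<omega>. (1 - iexp (- (\<omega> * \<tau>))) powr of_real gam) \<in> borel_measurable borel"
    by (rule borel_measurable_LIMSEQ_metric[where f=S]) (use Slim in auto)
  have Sbd: "norm (S m \<omega>) \<le> 2" for m \<omega>
  proof -
    have "norm (S m \<omega>) \<le> (\<Sum>k<m. \<bar>g_coeff gam k\<bar>)"
      unfolding S_def by (rule sum_norm_le) (simp add: norm_mult norm_power)
    then show ?thesis using g_coeff_abs_summable(2)[OF gam, of m] by linarith
  qed
  have dom: "integrable lborel (\<lambda>\<omega>. 2 * norm (F \<omega>))" using F by simp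
  have ae1: "AE \<omega> in lborel. (\<lambda>m. F \<omega> * iexp (\<omega> * ?t) * S m \<omega>) \<longlonglongrightarrow> F \<omega> * iexp (\<omega> * ?t) * (1 - iexp (- (\<omega> * \<tau>))) powr of_real gam"
    by (intro AE_I2 tendsto_intros Slim)
  have ae2: "AE \<omega> in lborel. norm (F \<omega> * iexp (\<omega> * ?t) * S m \<omega>) \<le> 2 * norm (F \<omega>)" for m
  proof (intro AE_I2)
    fix \<omega>
    have "norm (F \<omega>) * norm (S m \<omega>) \<le> norm (F \<omega>) * 2" by (intro mult_left_mono Sbd) simp
    then show "norm (F \<omega> * iexp (\<omega> * ?t) * S m \<omega>) \<le> 2 * norm (F \<omega>)"
      by (simp add: norm_mult mult.commute)
  qed
  have m1: "(\<lambda>\<omega>. F \<omega> * iexp (\<omega> * ?t) * (1 - iexp (- (\<omega> * \<tau>))) powr of_real gam) \<in> borel_measurable lborel"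
    and m2: "(\<lambda>\<omega>. F \<omega> * iexp (\<omega> * ?t) * S m \<omega>) \<in> borel_measurable lborel" for m
    by measurable
  have lim: "(\<lambda>m. CLINT \<omega>|lborel. F \<omega> * iexp (\<omega> * ?t) * S m \<omega>)
      \<longlonglongrightarrow> (CLINT \<omega>|lborel. F \<omega> * iexp (\<omega> * ?t) * (1 - iexp (- (\<omega> * \<tau>))) powr of_real gam)"
    by (rule integral_dominated_convergence[OF m1 m2 dom ae1 ae2])
  have int: "integrable lborel (\<lambda>\<omega>. F \<omega> * iexp (\<omega> * ?t) * (1 - iexp (- (\<omega> * \<tau>))) powr of_real gam)"
    by (rule integrable_dominated_convergence[OF m1 m2 dom ae1 ae2])
  have fin: "(CLINT \<omega>|lborel. F \<omega> * iexp (\<omega> * ?t) * S m \<omega>)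
      = of_real (2 * pi) * (\<Sum>k=0..n. of_real (g_coeff gam k) * V (?t - real k * \<tau>))" if m: "n < m" for m
  proof -
    have e: "iexp (\<omega> * ?t) * iexp (- (\<omega> * \<tau>)) ^ k = iexp (\<omega> * (?t - real k * \<tau>))" for \<omega> k
      by (simp add: exp_of_nat_mult[symmetric] exp_add[symmetric] algebra_simps)
    have i: "integrable lborel (\<lambda>\<omega>. F \<omega> * iexp (\<omega> * s))" for s
    proof (rule Bochner_Integration.integrable_bound[OF F])
      show "(\<lambda>\<omega>. F \<omega> * iexp (\<omega> * s)) \<in> borel_measurable lborel" by measurable
    qed (simp add: norm_mult)
    have "(CLINT \<omega>|lborel. F \<omega> * iexp (\<omega> * ?t) * S m \<omega>)
        = (CLINT \<omega>|lborel. \<Sum>k<m. of_real (g_coeff gam k) * (F \<omega> * iexp (\<omega> * (?t - real k * \<tau>))))"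
      unfolding S_def sum_distrib_left e[symmetric]
      by (intro Bochner_Integration.integral_cong sum.cong refl) (simp add: mult_ac)
    also have "\<dots> = (\<Sum>k<m. CLINT \<omega>|lborel. of_real (g_coeff gam k) * (F \<omega> * iexp (\<omega> * (?t - real k * \<tau>))))"
      by (intro Bochner_Integration.integral_sum integrable_mult_right i)
    also have "\<dots> = (\<Sum>k<m. of_real (g_coeff gam k) * (CLINT \<omega>|lborel. F \<omega> * iexp (\<omega> * (?t - real k * \<tau>))))"
      by (simp only: integral_mult_right_zero)
    also have "\<dots> = (\<Sum>k<m. of_real (g_coeff gam k) * (of_real (2 * pi) * V (?t - real k * \<tau>)))"
    proof (intro sum.cong refl arg_cong2[where f="(*)"])
      fix k
      have "0 \<le> real k * \<tau>" using \<tau> by simp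
      then show "(CLINT \<omega>|lborel. F \<omega> * iexp (\<omega> * (?t - real k * \<tau>))) = of_real (2 * pi) * V (?t - real k * \<tau>)"
        by (intro V[symmetric]) linarith
    qed
    also have "\<dots> = (\<Sum>k=0..n. of_real (g_coeff gam k) * (of_real (2 * pi) * V (?t - real k * \<tau>)))"
    proof (rule sum.mono_neutral_right)
      show "\<forall>k\<in>{..<m} - {0..n}. of_real (g_coeff gam k) * (of_real (2 * pi) * V (?t - real k * \<tau>)) = 0"
      proof
        fix k assume "k \<in> {..<m} - {0..n}"
        then have "real n * \<tau> \<le> real k * \<tau>" using \<tau> by (intro mult_right_mono) auto
        then show "of_real (g_coeff gam k) * (of_real (2 * pi) * V (?t - real k * \<tau>)) = 0"
          using V0 by simp
      qed
    qed (use m in auto)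
    finally show ?thesis by (simp add: sum_distrib_left mult_ac)
  qed
  have "(\<lambda>m. CLINT \<omega>|lborel. F \<omega> * iexp (\<omega> * ?t) * S m \<omega>)
      \<longlonglongrightarrow> of_real (2 * pi) * (\<Sum>k=0..n. of_real (g_coeff gam k) * V (?t - real k * \<tau>))"
    using fin by (intro tendsto_eventually eventually_mono[OF eventually_gt_at_top[of n]]) auto
  from LIMSEQ_unique[OF this lim]
  show "of_real (2 * pi) * gl_sum gam V \<tau> n = (CLINT \<omega>|lborel. F \<omega> * iexp (\<omega> * ?t) * gl_symbol gam \<tau> \<omega>)"
    unfolding gl_sum_def gl_symbol_def
    by (simp add: mult.left_commute[of _ "complex_of_real (\<tau> powr (- gam))"])
  show "integrable lborel (\<lambda>\<omega>. F \<omega> * iexp (\<omega> * ?t) * gl_symbol gam \<tau> \<omega>)"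
    unfolding gl_symbol_def using int by (simp add: mult.left_commute[of _ "complex_of_real (\<tau> powr (- gam))"])
qed

text \<open>Inversion holds pointwise only at points of continuity, while \<open>V\<close> is arbitrary beyond \<open>T\<close>.\<close>

lemma fourier_space_representation:
  assumes V: "V \<in> fourier_space r" and r: "0 \<le> r" and V0: "\<And>t. t \<le> 0 \<Longrightarrow> V t = 0"
    and cont: "continuous_on {..T} V"
  obtains F where "integrable lborel F" "integrable lborel (\<lambda>\<omega>. (1 + \<bar>\<omega>\<bar>) powr r * norm (F \<omega>))"
    "fourier_space_norm r V = (LINT \<omega>|lborel. (1 + \<bar>\<omega>\<bar>) powr r * norm (F \<omega>))"
    "\<And>s. s \<le> T \<Longrightarrow> of_real (2 * pi) * V s = (CLINT \<omega>|lborel. F \<omega> * iexp (\<omega> * s))"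
proof -
  have Vi: "integrable lebesgue V" and Fi: "integrable lebesgue (\<lambda>\<omega>. (1 + \<bar>\<omega>\<bar>) powr r * norm (fourier V \<omega>))"
    using V by (auto simp: fourier_space_def)
  obtain V0 where V0: "V0 \<in> borel_measurable borel" "AE x in lebesgue. V x = V0 x"
    using Vi by (auto elim: lebesgue_ex_borel_complex[OF borel_measurable_integrable])
  \<comment> \<open>A Borel function that agrees with V everywhere below T, not just almost
    everywhere, so that the points of continuity survive; the Borel version \<open>V0\<close> is
    used only from T on.\<close>
  define W where "W s = (if s < T then V s else V0 s)" for s
  have cI: "continuous_on {..<T} V" by (rule continuous_on_subset[OF cont]) auto
  have Wm [measurable]: "W \<in> borel_measurable borel"
  proof -
    have "(\<lambda>s. indicator {..<T} s *\<^sub>R V s) \<in> borel_measurable borel"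
      by (rule borel_measurable_continuous_on_indicator[OF _ cI]) simp
    moreover have "W = (\<lambda>s. if s < T then indicator {..<T} s *\<^sub>R V s else V0 s)"
      by (auto simp: W_def)
    ultimately show ?thesis using V0(1) by simp
  qed
  have WV: "AE s in lebesgue. V s = W s"
    using V0(2) by eventually_elim (simp add: W_def)
  have Wmc: "W \<in> borel_measurable (completion lborel)"
    by (intro measurable_completion) simp
  have Wi: "integrable lborel W"
  proof -
    have "integrable lebesgue W" by (rule integrable_cong_AE_imp[OF Vi Wmc WV])
    then show ?thesis by (subst (asm) integrable_completion) auto
  qed
  define F where "F = fourier V"
  have FW: "F \<omega> = (CLINT s|lborel. iexp (- (\<omega> * s)) * W s)" for \<omega>
  proof -
    have em: "(\<lambda>t. exp (- (\<i> * of_real (\<omega> * t)))) \<in> borel_measurable (completion lborel)"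
      by (intro measurable_completion) measurable
    have "F \<omega> = (CLINT t|lebesgue. exp (- (\<i> * of_real (\<omega> * t))) * W t)"
      unfolding F_def fourier_def
    proof (rule integral_cong_AE)
      show "(\<lambda>t. exp (- (\<i> * of_real (\<omega> * t))) * V t) \<in> borel_measurable lebesgue"
        using em Vi by (intro borel_measurable_times) auto
      show "(\<lambda>t. exp (- (\<i> * of_real (\<omega> * t))) * W t) \<in> borel_measurable lebesgue"
        using em Wmc by (intro borel_measurable_times) auto
      show "AE t in lebesgue. exp (- (\<i> * of_real (\<omega> * t))) * V t = exp (- (\<i> * of_real (\<omega> * t))) * W t"
        using WV by eventually_elim simp
    qed
    also have "\<dots> = (CLINT t|lborel. exp (- (\<i> * of_real (\<omega> * t))) * W t)"
      by (rule integral_completion) measurable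
    finally show ?thesis by simp
  qed
  have Fm [measurable]: "F \<in> borel_measurable borel"
  proof -
    have "(\<lambda>\<omega>. CLINT s|lborel. iexp (- (\<omega> * s)) * W s) \<in> borel_measurable borel"
      by (rule lborel.borel_measurable_lebesgue_integral) measurable
    then show ?thesis by (simp add: FW[abs_def])
  qed
  have FWi: "integrable lborel (\<lambda>\<omega>. (1 + \<bar>\<omega>\<bar>) powr r * norm (F \<omega>))"
    using Fi unfolding F_def[symmetric] by (subst (asm) integrable_completion) auto
  have Fint: "integrable lborel F"
  proof (rule Bochner_Integration.integrable_bound[OF FWi])
    have "1 \<le> (1 + \<bar>\<omega>\<bar>) powr r" for \<omega> using r by (intro ge_one_powr_ge_zero) auto
    then have "1 * norm (F \<omega>) \<le> (1 + \<bar>\<omega>\<bar>) powr r * norm (F \<omega>)" for \<omega>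
      by (intro mult_right_mono) auto
    then show "AE \<omega> in lborel. norm (F \<omega>) \<le> norm ((1 + \<bar>\<omega>\<bar>) powr r * norm (F \<omega>))" by simp
  qed simp
  have nrm: "fourier_space_norm r V = (LINT \<omega>|lborel. (1 + \<bar>\<omega>\<bar>) powr r * norm (F \<omega>))"
    unfolding fourier_space_norm_def F_def[symmetric] by (rule integral_completion) measurable
  have lt: "of_real (2 * pi) * V s = (CLINT \<omega>|lborel. F \<omega> * iexp (\<omega> * s))" if "s < T" for s
  proof -
    have "isCont V s" using cI that by (simp add: continuous_on_eq_continuous_at)
    moreover have "eventually (\<lambda>y. V y = W y) (nhds s)"
      using eventually_nhds_in_open[of "{..<T}" s] that by (auto elim!: eventually_mono simp: W_def)
    ultimately have "isCont W s" using isCont_cong by blast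
    from fourier_inversion_at[OF Wi this FW Fint] show ?thesis using that by (simp add: W_def)
  qed
  \<comment> \<open>At T itself nothing is known about continuity from the right, and W may differ
    from V there. Both sides are continuous from the left, the right one by dominated
    convergence.\<close>
  have eqT: "of_real (2 * pi) * V T = (CLINT \<omega>|lborel. F \<omega> * iexp (\<omega> * T))"
  proof -
    define s where "s j = T - 1 / real (Suc j)" for j
    have "(\<lambda>j. T - 1 / real (Suc j)) \<longlonglongrightarrow> T - 0"
      by (intro tendsto_intros lim_1_over_n[THEN LIMSEQ_Suc])
    then have s: "s \<longlonglongrightarrow> T" by (simp add: s_def[abs_def])
    have sT: "s j < T" for j by (simp add: s_def)
    have "(\<lambda>j. V (s j)) \<longlonglongrightarrow> V T"
      by (rule continuous_on_tendsto_compose[OF cont s]) (use sT in \<open>auto simp: less_imp_le\<close>)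
    then have "(\<lambda>j. of_real (2 * pi) * V (s j)) \<longlonglongrightarrow> of_real (2 * pi) * V T" by (intro tendsto_intros)
    moreover have "(\<lambda>j. CLINT \<omega>|lborel. F \<omega> * iexp (\<omega> * s j)) \<longlonglongrightarrow> (CLINT \<omega>|lborel. F \<omega> * iexp (\<omega> * T))"
    proof (rule integral_dominated_convergence[where w="\<lambda>\<omega>. norm (F \<omega>)"])
      show "AE \<omega> in lborel. (\<lambda>j. F \<omega> * iexp (\<omega> * s j)) \<longlonglongrightarrow> F \<omega> * iexp (\<omega> * T)"
        by (intro AE_I2 tendsto_intros s)
    qed (use Fint in \<open>auto simp: norm_mult\<close>)
    ultimately show ?thesis unfolding lt[OF sT] by (rule LIMSEQ_unique)
  qed
  show ?thesis
    by (rule that[OF Fint FWi nrm]) (use lt eqT in \<open>auto simp: le_less\<close>)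
qed

text \<open>Comparing two grids, instead of a grid and the limit, avoids the Fourier representation of the
  fractional derivative; the limit is identified by a different argument.\<close>

theorem gl_sum_refinement:
  assumes gam: "0 < gam" "gam < 1"
    and V: "V \<in> fourier_space (1 + gam)" "fourier_space_norm (1 + gam) V \<le> B" "\<And>t. t \<le> 0 \<Longrightarrow> V t = 0"
    and cont: "continuous_on {..T} V"
  shows "t \<le> T \<Longrightarrow> norm (V t) \<le> B"
    and "0 < \<tau> \<Longrightarrow> real n * \<tau> \<le> T \<Longrightarrow> 1 \<le> m \<Longrightarrow>
      norm (gl_sum gam V \<tau> n - gl_sum gam V (\<tau> / real m) (m * n)) \<le> \<tau> * B"
proof -
  have r0: "0 \<le> 1 + gam" using gam by simp
  obtain F where F: "integrable lborel F" "integrable lborel (\<lambda>\<omega>. (1 + \<bar>\<omega>\<bar>) powr (1 + gam) * norm (F \<omega>))"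
    "fourier_space_norm (1 + gam) V = (LINT \<omega>|lborel. (1 + \<bar>\<omega>\<bar>) powr (1 + gam) * norm (F \<omega>))"
    and rep: "\<And>s. s \<le> T \<Longrightarrow> of_real (2 * pi) * V s = (CLINT \<omega>|lborel. F \<omega> * iexp (\<omega> * s))"
    using fourier_space_representation[OF V(1) r0 V(3) cont] by blast
  let ?w = "\<lambda>\<omega>. (1 + \<bar>\<omega>\<bar>) powr (1 + gam) * norm (F \<omega>)"
  have B: "(LINT \<omega>|lborel. ?w \<omega>) \<le> B" using F(3) V(2) by simp
  have B0: "0 \<le> B" by (rule order_trans[OF Bochner_Integration.integral_nonneg B]) simp
  have Fm [measurable]: "F \<in> borel_measurable borel" using F(1) by auto
  \<comment> \<open>The number 6 has two sources: it is the sum of two symbol errors with constant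
    3, and it is at most 2 pi, so that the normalization of the inversion formula absorbs
    it.\<close>
  have main: "norm c \<le> A * B"
    if c: "of_real (2 * pi) * c = (CLINT \<omega>|lborel. f \<omega>)" and f: "\<And>\<omega>. norm (f \<omega>) \<le> 6 * A * ?w \<omega>" "integrable lborel f" and A: "0 \<le> A"
    for c f A
  proof -
    have "2 * pi * norm c = norm (CLINT \<omega>|lborel. f \<omega>)"
      unfolding c[symmetric] by (simp add: norm_mult)
    also have "\<dots> \<le> (LINT \<omega>|lborel. norm (f \<omega>))" by (rule integral_norm_bound)
    also have "\<dots> \<le> (LINT \<omega>|lborel. 6 * A * ?w \<omega>)"
      by (rule integral_mono) (use f F(2) in auto)
    also have "\<dots> = 6 * A * (LINT \<omega>|lborel. ?w \<omega>)" by simp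
    also have "\<dots> \<le> 6 * A * B" using A B by (intro mult_left_mono) auto
    also have "\<dots> \<le> 2 * pi * (A * B)"
      using pi_gt3 mult_right_mono[of 6 "2 * pi" "A * B"] A B0 by (simp add: mult.assoc)
    finally show ?thesis using pi_gt_zero by simp
  qed
  have w1: "norm (F \<omega>) \<le> ?w \<omega>" for \<omega>
  proof -
    have "1 \<le> (1 + \<bar>\<omega>\<bar>) powr (1 + gam)" using gam by (intro ge_one_powr_ge_zero) auto
    then show ?thesis using mult_right_mono[of 1 _ "norm (F \<omega>)"] by simp
  qed
  show "norm (V t) \<le> B" if "t \<le> T"
  proof -
    have "norm (V t) \<le> 1 * B"
    proof (rule main[OF rep[OF that]])
      show "norm (F \<omega> * iexp (\<omega> * t)) \<le> 6 * 1 * ?w \<omega>" for \<omega>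
        using order_trans[OF w1[of \<omega>], of "6 * ?w \<omega>"] by (simp add: norm_mult)
      show "integrable lborel (\<lambda>\<omega>. F \<omega> * iexp (\<omega> * t))"
        by (rule Bochner_Integration.integrable_bound[OF F(1)]) (auto simp: norm_mult)
    qed simp
    then show ?thesis by simp
  qed
  show "norm (gl_sum gam V \<tau> n - gl_sum gam V (\<tau> / real m) (m * n)) \<le> \<tau> * B"
    if \<tau>: "0 < \<tau>" and n: "real n * \<tau> \<le> T" and m: "1 \<le> m"
  proof -
    let ?\<sigma> = "\<tau> / real m"
    have \<sigma>: "0 < ?\<sigma>" "?\<sigma> \<le> \<tau>" using \<tau> m by (auto simp: field_simps)
    have tm: "real (m * n) * ?\<sigma> = real n * \<tau>" using m by simp
    have 1: "of_real (2 * pi) * gl_sum gam V \<tau> n = (CLINT \<omega>|lborel. F \<omega> * iexp (\<omega> * (real n * \<tau>)) * gl_symbol gam \<tau> \<omega>)"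
      "integrable lborel (\<lambda>\<omega>. F \<omega> * iexp (\<omega> * (real n * \<tau>)) * gl_symbol gam \<tau> \<omega>)"
      by (rule gl_sum_fourier[OF gam \<tau> F(1) rep V(3)]; use n in simp)+
    have 2: "of_real (2 * pi) * gl_sum gam V ?\<sigma> (m * n) = (CLINT \<omega>|lborel. F \<omega> * iexp (\<omega> * (real n * \<tau>)) * gl_symbol gam ?\<sigma> \<omega>)"
      "integrable lborel (\<lambda>\<omega>. F \<omega> * iexp (\<omega> * (real n * \<tau>)) * gl_symbol gam ?\<sigma> \<omega>)"
      unfolding tm[symmetric] by (rule gl_sum_fourier[OF gam \<sigma>(1) F(1) rep V(3)]; use n tm in simp)+
    show ?thesis
    proof (rule main)
      show "of_real (2 * pi) * (gl_sum gam V \<tau> n - gl_sum gam V ?\<sigma> (m * n))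
        = (CLINT \<omega>|lborel. F \<omega> * iexp (\<omega> * (real n * \<tau>)) * gl_symbol gam \<tau> \<omega>
            - F \<omega> * iexp (\<omega> * (real n * \<tau>)) * gl_symbol gam ?\<sigma> \<omega>)"
        unfolding right_diff_distrib 1(1) 2(1) Bochner_Integration.integral_diff[OF 1(2) 2(2)] ..
      show "integrable lborel (\<lambda>\<omega>. F \<omega> * iexp (\<omega> * (real n * \<tau>)) * gl_symbol gam \<tau> \<omega>
            - F \<omega> * iexp (\<omega> * (real n * \<tau>)) * gl_symbol gam ?\<sigma> \<omega>)"
        by (rule Bochner_Integration.integrable_diff[OF 1(2) 2(2)])
      fix \<omega>
      have "norm (gl_symbol gam \<tau> \<omega> - gl_symbol gam ?\<sigma> \<omega>)
          \<le> norm (gl_symbol gam \<tau> \<omega> - (\<i> * of_real \<omega>) powr of_real gam) + norm (gl_symbol gam ?\<sigma> \<omega> - (\<i> * of_real \<omega>) powr of_real gam)"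
        using norm_triangle_ineq4[of "gl_symbol gam \<tau> \<omega> - (\<i> * of_real \<omega>) powr of_real gam" "gl_symbol gam ?\<sigma> \<omega> - (\<i> * of_real \<omega>) powr of_real gam"]
        by simp
      also have "\<dots> \<le> 3 * \<tau> * \<bar>\<omega>\<bar> powr (1 + gam) + 3 * ?\<sigma> * \<bar>\<omega>\<bar> powr (1 + gam)"
        by (intro add_mono gl_symbol_estimate gam \<tau> \<sigma>)
      also have "\<dots> \<le> 3 * \<tau> * \<bar>\<omega>\<bar> powr (1 + gam) + 3 * \<tau> * \<bar>\<omega>\<bar> powr (1 + gam)"
        using \<sigma> by (intro add_left_mono mult_right_mono) auto
      also have "\<dots> = 6 * \<tau> * \<bar>\<omega>\<bar> powr (1 + gam)" by simp
      also have "\<dots> \<le> 6 * \<tau> * (1 + \<bar>\<omega>\<bar>) powr (1 + gam)"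
        using \<tau> gam by (intro mult_left_mono powr_mono2) auto
      finally have "norm (F \<omega>) * norm (gl_symbol gam \<tau> \<omega> - gl_symbol gam ?\<sigma> \<omega>) \<le> norm (F \<omega>) * (6 * \<tau> * (1 + \<bar>\<omega>\<bar>) powr (1 + gam))"
        by (intro mult_left_mono) auto
      moreover have "F \<omega> * iexp (\<omega> * (real n * \<tau>)) * gl_symbol gam \<tau> \<omega> - F \<omega> * iexp (\<omega> * (real n * \<tau>)) * gl_symbol gam ?\<sigma> \<omega>
          = iexp (\<omega> * (real n * \<tau>)) * (F \<omega> * (gl_symbol gam \<tau> \<omega> - gl_symbol gam ?\<sigma> \<omega>))"
        by (simp add: algebra_simps)
      ultimately show "norm (F \<omega> * iexp (\<omega> * (real n * \<tau>)) * gl_symbol gam \<tau> \<omega> - F \<omega> * iexp (\<omega> * (real n * \<tau>)) * gl_symbol gam ?\<sigma> \<omega>) \<le> 6 * \<tau> * ?w \<omega>"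
        by (simp add: norm_mult mult_ac)
    qed (use \<tau> in simp)
  qed
qed

section \<open>The truncation error\<close>

text \<open>In this form a derivative, possibly one-sided, can be checked along sequences, which is
  how dominated convergence delivers it.\<close>

lemma has_vector_derivative_within_quotient:
  fixes f :: "real \<Rightarrow> complex"
  shows "(f has_vector_derivative D) (at t within S)
    \<longleftrightarrow> ((\<lambda>s. (f s - f t) / of_real (s - t)) \<longlongrightarrow> D) (at t within S)"
proof -
  have "(f has_vector_derivative D) (at t within S)
      \<longleftrightarrow> ((\<lambda>s. (1 / norm (s - t)) *\<^sub>R (f s - (f t + (s - t) *\<^sub>R D))) \<longlongrightarrow> 0) (at t within S)"
    unfolding has_vector_derivative_def has_derivative_within by (simp add: bounded_linear_scaleR_left)
  also have "\<dots> \<longleftrightarrow> ((\<lambda>s. norm ((1 / norm (s - t)) *\<^sub>R (f s - (f t + (s - t) *\<^sub>R D)))) \<longlongrightarrow> 0) (at t within S)"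
    by (rule tendsto_norm_zero_iff[symmetric])
  also have "\<dots> \<longleftrightarrow> ((\<lambda>s. norm ((f s - f t) / of_real (s - t) - D)) \<longlongrightarrow> 0) (at t within S)"
  proof (rule Lim_cong_within[OF refl refl refl])
    fix s assume "s \<noteq> t"
    then have "(f s - f t) / of_real (s - t) - D = (f s - (f t + (s - t) *\<^sub>R D)) / of_real (s - t)"
      by (simp add: field_simps scaleR_conv_of_real)
    then show "norm ((1 / norm (s - t)) *\<^sub>R (f s - (f t + (s - t) *\<^sub>R D))) = norm ((f s - f t) / of_real (s - t) - D)"
      by (simp add: norm_divide flip: of_real_diff)
  qed
  also have "\<dots> \<longleftrightarrow> ((\<lambda>s. (f s - f t) / of_real (s - t) - D) \<longlongrightarrow> 0) (at t within S)"
    by (rule tendsto_norm_zero_iff)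
  also have "\<dots> \<longleftrightarrow> ((\<lambda>s. (f s - f t) / of_real (s - t)) \<longlongrightarrow> D) (at t within S)"
    by (rule LIM_zero_iff)
  finally show ?thesis .
qed

lemma g_summation_by_parts:
  fixes w :: "nat \<Rightarrow> complex"
  shows "(\<Sum>k=0..N. of_real (g_coeff gam k) * w k)
    = (\<Sum>k<N. of_real (g_partial gam k) * (w k - w (Suc k))) + of_real (g_partial gam N) * w N"
proof (induction N)
  case (Suc N)
  have "g_partial gam (Suc N) = g_partial gam N + g_coeff gam (Suc N)"
    by (simp add: g_partial_def)
  then show ?case using Suc by (simp add: algebra_simps)
qed simp

text \<open>The partial sums are signed binomial coefficients of gam - 1, whose asymptotics are
  known. This is where the factor 1 / Gamma(1 - gam) of the fractional derivative comes
  from.\<close>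

lemma g_partial_asymptotic:
  assumes "0 < gam" "gam < 1"
  shows "(\<lambda>n. g_partial gam n * real n powr gam) \<longlonglongrightarrow> 1 / Gamma (1 - gam)"
proof -
  have eq: "g_partial gam n = (- 1) ^ n * ((gam - 1) gchoose n)" for n
  proof (induction n)
    case (Suc n)
    have "g_partial gam (Suc n) = g_coeff (gam - 1) n * (1 - gam / real (Suc n))"
      unfolding g_partial_Suc Suc g_coeff_def ..
    also have "\<dots> = g_coeff (gam - 1) (Suc n)"
      unfolding g_coeff_Suc by (simp add: field_simps)
    finally show ?case by (simp add: g_coeff_def)
  qed simp
  have "(\<lambda>n. ((gam - 1) gchoose n) / ((- 1) ^ n / exp ((gam - 1 + 1) * of_real (ln (real n))))) \<longlonglongrightarrow> inverse (Gamma (- (gam - 1)))"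
    by (rule gbinomial_asymptotic)
  moreover have "eventually (\<lambda>n. ((gam - 1) gchoose n) / ((- 1) ^ n / exp ((gam - 1 + 1) * of_real (ln (real n))))
      = g_partial gam n * real n powr gam) sequentially"
    using eventually_gt_at_top[of 0]
  proof eventually_elim
    case (elim n)
    have "((gam - 1) gchoose n) / ((- 1) ^ n / E) = (- 1) ^ n * ((gam - 1) gchoose n) * E" for E :: real
      by (cases "even n") auto
    then show ?case using elim by (simp add: eq powr_def)
  qed
  ultimately show ?thesis
    using Lim_transform_eventually by (fastforce simp: inverse_eq_divide)
qed

section \<open>The Riemann-Liouville derivative as a limit of difference quotients\<close>

lemma powr_indicator_integrable:
  fixes gam T :: real
  assumes "gam < 1" "0 \<le> T"
  shows "integrable lborel (\<lambda>\<eta>. indicator {0..T} \<eta> * \<eta> powr (- gam))"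
proof -
  have "(\<lambda>x. x powr (- gam)) integrable_on {0..T}"
    using assms integrable_on_powr_from_0[of "- gam" T] by simp
  then have "(\<lambda>x. x powr (- gam)) absolutely_integrable_on {0..T}"
    by (rule nonnegative_absolutely_integrable_1) simp
  then have "integrable lebesgue (\<lambda>\<eta>. indicator {0..T} \<eta> * \<eta> powr (- gam))"
    by (simp add: set_integrable_def)
  then show ?thesis by (subst (asm) integrable_completion) auto
qed

text \<open>Models, at one fixed x, the solution multiplied by exp((lam + p U(x)) t) as a function
  of time.\<close>

locale c1_vanishing =
  fixes gam T :: real and v v' :: "real \<Rightarrow> complex"
  assumes gam: "0 < gam" "gam < 1" and T: "0 < T"
    and deriv: "\<And>t. t \<in> {0..T} \<Longrightarrow> (v has_vector_derivative v' t) (at t within {0..T})"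
    and cont': "continuous_on {0..T} v'"
    and v0: "v 0 = 0"
begin

text \<open>Constant continuation on both sides, which on the left is continuation by zero as v
  starts from 0. It is Lipschitz on the whole line, so that difference quotients are bounded across
  both ends of [0,T].\<close>

definition vc :: "real \<Rightarrow> complex" where "vc r = v (max 0 (min T r))"

lemma cont_v: "continuous_on {0..T} v"
  using deriv by (meson continuous_on_eq_continuous_within has_vector_derivative_continuous)

lemma vc_continuous: "continuous_on UNIV vc"
  unfolding vc_def[abs_def]
  by (rule continuous_on_compose2[OF cont_v]) (use T in \<open>auto intro!: continuous_intros\<close>)

lemma vc_measurable [measurable]: "vc \<in> borel_measurable borel"
  by (rule borel_measurable_continuous_onI[OF vc_continuous])

lemma v'_bound: obtains L where "0 \<le> L" "\<And>t. t \<in> {0..T} \<Longrightarrow> norm (v' t) \<le> L"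
proof -
  have "compact (v' ` {0..T})" by (rule compact_continuous_image[OF cont']) simp
  then obtain L where "0 < L" "\<forall>y\<in>v' ` {0..T}. norm y \<le> L"
    using compact_imp_bounded bounded_pos by metis
  then show ?thesis using that[of L] by auto
qed

lemma v_increment:
  assumes "s \<in> {0..T}" "t \<in> {0..T}" "\<And>t. t \<in> {0..T} \<Longrightarrow> norm (v' t) \<le> L" "0 \<le> L"
  shows "norm (v s - v t) \<le> L * \<bar>s - t\<bar>"
proof -
  have aux: "norm (v t - v s) \<le> L * (t - s)" if "s \<in> {0..T}" "t \<in> {0..T}" "s \<le> t" for s t
  proof -
    have "(v' has_integral v t - v s) {s..t}"
      using that by (intro fundamental_theorem_of_calculus has_vector_derivative_within_subset[OF deriv]) auto
    then have "norm (v t - v s) \<le> L * measure lborel {s..t}"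
      by (rule has_integral_bound_real[OF assms(4) finite.emptyI]) (use that assms(3) in auto)
    then show ?thesis using that by simp
  qed
  show ?thesis
    using aux[OF assms(1,2)] aux[OF assms(2,1)] by (cases "s \<le> t") (auto simp: norm_minus_commute)
qed

lemma vc_deriv_inside:
  assumes "0 < r" "r < T"
  shows "(vc has_vector_derivative v' r) (at r)"
proof (rule has_vector_derivative_transform_within_open[of v _ _ "{0<..<T}"])
  have "(v has_vector_derivative v' r) (at r within {0<..<T})"
    by (rule has_vector_derivative_within_subset[OF deriv]) (use assms in auto)
  then show "(v has_vector_derivative v' r) (at r)"
    using assms by (subst (asm) has_vector_derivative_within_open) auto
qed (use assms in \<open>auto simp: vc_def\<close>)

lemma vc_deriv_negative:
  assumes "r < 0"
  shows "(vc has_vector_derivative 0) (at r)"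
  by (rule has_vector_derivative_transform_within_open[of "\<lambda>x. 0" _ _ "{..<0}"])
     (use assms T v0 in \<open>auto simp: vc_def max_def min_def\<close>)

text \<open>The substitution \<open>\<eta>\<close> = s - \<open>\<xi>\<close> moves the variable s
  out of the singular kernel and out of the domain into the argument of the Lipschitz function
  \<open>vc\<close>; the upper limit may be T because \<open>vc\<close> vanishes for negative
  arguments.\<close>

lemma abel_integral_shift:
  assumes s: "s \<in> {0..T}"
  shows "(LINT \<xi>|lebesgue_on {0..s}. of_real ((s - \<xi>) powr (- gam)) * v \<xi>)
    = (LINT \<eta>|lborel. of_real (indicator {0..T} \<eta> * \<eta> powr (- gam)) * vc (s - \<eta>))"
proof -
  let ?f = "\<lambda>\<xi>. indicator {0..s} \<xi> *\<^sub>R (of_real ((s - \<xi>) powr (- gam)) * vc \<xi>)"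
  have "(LINT \<xi>|lebesgue_on {0..s}. of_real ((s - \<xi>) powr (- gam)) * v \<xi>)
      = (LINT \<xi>|lebesgue_on {0..s}. of_real ((s - \<xi>) powr (- gam)) * vc \<xi>)"
    using s by (intro Bochner_Integration.integral_cong refl) (auto simp: vc_def)
  also have "\<dots> = (LINT \<xi>|lebesgue. ?f \<xi>)"
    by (subst integral_restrict_space) auto
  also have "\<dots> = (LINT \<xi>|lborel. ?f \<xi>)"
    by (rule integral_completion) measurable
  also have "\<dots> = \<bar>- 1\<bar> *\<^sub>R (LINT \<eta>|lborel. ?f (s + (- 1) * \<eta>))"
    by (rule lborel_integral_real_affine) simp
  also have "(LINT \<eta>|lborel. ?f (s + (- 1) * \<eta>)) = (LINT \<eta>|lborel. of_real (indicator {0..T} \<eta> * \<eta> powr (- gam)) * vc (s - \<eta>))"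
  proof (intro Bochner_Integration.integral_cong refl)
    fix \<eta>
    show "?f (s + (- 1) * \<eta>) = of_real (indicator {0..T} \<eta> * \<eta> powr (- gam)) * vc (s - \<eta>)"
    proof (cases "\<eta> \<le> s")
      case True
      then show ?thesis using s by (auto simp: indicator_def)
    next
      case False
      then have "vc (s - \<eta>) = 0" using v0 T by (simp add: vc_def max_def min_def)
      then show ?thesis using False by (simp add: indicator_def)
    qed
  qed
  finally show ?thesis by simp
qed

text \<open>Differentiation under the shifted integral: the quotients of \<open>vc\<close> are
  bounded by its Lipschitz constant and the kernel is integrable. Since v vanishes at 0 no boundary
  term t^(-gam) v(0) appears, and the Riemann-Liouville derivative equals the Caputo form.\<close>

theorem rl_deriv_eq_caputo:
  assumes t: "t \<in> {0<..T}"
  shows "(\<lambda>s. of_real (s powr (- gam)) * v' (t - s)) integrable_on {0..t}"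
    and "rl_deriv gam T v t = of_real (1 / Gamma (1 - gam)) * integral {0..t} (\<lambda>s. of_real (s powr (- gam)) * v' (t - s))"
proof -
  obtain L where L: "0 \<le> L" "\<And>t. t \<in> {0..T} \<Longrightarrow> norm (v' t) \<le> L" using v'_bound by metis
  define w where "w \<eta> = indicator {0..T} \<eta> * \<eta> powr (- gam)" for \<eta>
  have wi: "integrable lborel w" unfolding w_def using gam T by (intro powr_indicator_integrable) auto
  have w0: "0 \<le> w \<eta>" for \<eta> by (simp add: w_def)
  have [measurable]: "w \<in> borel_measurable borel" using wi by auto
  define d where "d \<eta> = (if 0 < \<eta> \<and> \<eta> < t then v' (t - \<eta>) else 0)" for \<eta>
  have [measurable]: "d \<in> borel_measurable borel"
  proof -
    have "continuous_on {0<..<t} (\<lambda>\<eta>. v' (t - \<eta>))"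
      by (rule continuous_on_compose2[OF cont']) (use t in \<open>auto intro!: continuous_intros\<close>)
    then have "(\<lambda>\<eta>. indicator {0<..<t} \<eta> *\<^sub>R v' (t - \<eta>)) \<in> borel_measurable borel"
      by (intro borel_measurable_continuous_on_indicator) auto
    moreover have "(\<lambda>\<eta>. indicator {0<..<t} \<eta> *\<^sub>R v' (t - \<eta>)) = d"
      by (auto simp: d_def indicator_def)
    ultimately show ?thesis by simp
  qed
  have lip: "norm (vc r - vc r') \<le> L * \<bar>r - r'\<bar>" for r r'
  proof -
    have "norm (vc r - vc r') \<le> L * \<bar>max 0 (min T r) - max 0 (min T r')\<bar>"
      unfolding vc_def using T L by (intro v_increment) auto
    also have "\<dots> \<le> L * \<bar>r - r'\<bar>" using L(1) by (intro mult_left_mono) auto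
    finally show ?thesis .
  qed
  have vci: "integrable lborel (\<lambda>\<eta>. of_real (w \<eta>) * vc (s - \<eta>))" for s
  proof (rule Bochner_Integration.integrable_bound)
    show "integrable lborel (\<lambda>\<eta>. w \<eta> * (L * T))" using wi by simp
    have "norm (vc r) \<le> L * T" for r
    proof -
      have "norm (vc r - vc 0) \<le> L * \<bar>max 0 (min T r) - 0\<bar>"
        using v_increment[of "max 0 (min T r)" 0 L] T L by (simp add: vc_def)
      also have "\<dots> \<le> L * T" using L T by (intro mult_left_mono) auto
      finally show ?thesis using v0 T by (simp add: vc_def)
    qed
    then show "AE \<eta> in lborel. norm (of_real (w \<eta>) * vc (s - \<eta>)) \<le> norm (w \<eta> * (L * T))"
      using w0 L T by (intro AE_I2) (simp add: norm_mult mult_left_mono abs_mult)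
  qed measurable
  define I where "I s = (LINT \<xi>|lebesgue_on {0..s}. of_real ((s - \<xi>) powr (- gam)) * v \<xi>)" for s
  have I: "I s = (LINT \<eta>|lborel. of_real (w \<eta>) * vc (s - \<eta>))" if "s \<in> {0..T}" for s
    unfolding I_def w_def by (rule abel_integral_shift[OF that])
  have wd: "integrable lborel (\<lambda>\<eta>. of_real (w \<eta>) * d \<eta>)"
  proof (rule Bochner_Integration.integrable_bound)
    show "integrable lborel (\<lambda>\<eta>. w \<eta> * L)" using wi by simp
    have "norm (d \<eta>) \<le> L" for \<eta> using L t by (auto simp: d_def)
    then show "AE \<eta> in lborel. norm (of_real (w \<eta>) * d \<eta>) \<le> norm (w \<eta> * L)"
      using w0 L by (intro AE_I2) (simp add: norm_mult mult_left_mono abs_mult)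
  qed measurable
  have "(I has_vector_derivative (LINT \<eta>|lborel. of_real (w \<eta>) * d \<eta>)) (at t within {0..T})"
    unfolding has_vector_derivative_within_quotient tendsto_at_iff_sequentially comp_def
  proof (intro allI impI)
    fix X assume X: "\<forall>i. X i \<in> {0..T} - {t}" "X \<longlonglongrightarrow> t"
    have quot: "(I (X i) - I t) / of_real (X i - t)
        = (LINT \<eta>|lborel. of_real (w \<eta>) * ((vc (X i - \<eta>) - vc (t - \<eta>)) / of_real (X i - t)))" for i
    proof -
      have "I (X i) - I t = (LINT \<eta>|lborel. of_real (w \<eta>) * vc (X i - \<eta>) - of_real (w \<eta>) * vc (t - \<eta>))"
        using X(1) t vci by (subst Bochner_Integration.integral_diff) (auto simp: I)
      then have "(I (X i) - I t) / of_real (X i - t)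
          = (LINT \<eta>|lborel. (of_real (w \<eta>) * vc (X i - \<eta>) - of_real (w \<eta>) * vc (t - \<eta>)) / of_real (X i - t))"
        by simp
      also have "\<dots> = (LINT \<eta>|lborel. of_real (w \<eta>) * ((vc (X i - \<eta>) - vc (t - \<eta>)) / of_real (X i - t)))"
        by (intro Bochner_Integration.integral_cong refl) (simp add: diff_divide_distrib right_diff_distrib)
      finally show ?thesis .
    qed
    show "(\<lambda>i. (I (X i) - I t) / of_real (X i - t)) \<longlonglongrightarrow> (LINT \<eta>|lborel. of_real (w \<eta>) * d \<eta>)"
      unfolding quot
    proof (rule integral_dominated_convergence[where w="\<lambda>\<eta>. w \<eta> * L"])
      show "integrable lborel (\<lambda>\<eta>. w \<eta> * L)" using wi by simp
      show "AE \<eta> in lborel. norm (of_real (w \<eta>) * ((vc (X i - \<eta>) - vc (t - \<eta>)) / of_real (X i - t))) \<le> w \<eta> * L" for i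
      proof (intro AE_I2)
        fix \<eta>
        have n: "X i - t \<noteq> 0" using X(1) by auto
        have "norm ((vc (X i - \<eta>) - vc (t - \<eta>)) / of_real (X i - t)) \<le> L"
          using lip[of "X i - \<eta>" "t - \<eta>"] n by (simp add: norm_divide divide_le_eq flip: of_real_diff)
        then have "\<bar>w \<eta>\<bar> * norm ((vc (X i - \<eta>) - vc (t - \<eta>)) / of_real (X i - t)) \<le> \<bar>w \<eta>\<bar> * L"
          by (intro mult_left_mono) auto
        then show "norm (of_real (w \<eta>) * ((vc (X i - \<eta>) - vc (t - \<eta>)) / of_real (X i - t))) \<le> w \<eta> * L"
          unfolding norm_mult norm_of_real using w0[of \<eta>] by simp
      qed
      \<comment> \<open>At \<open>\<eta>\<close> = t the argument of \<open>vc\<close> is 0, and at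
        \<open>\<eta>\<close> = 0 it is t, which may be T; \<open>vc\<close> can have kinks at 0 and
        T, and these two values of \<open>\<eta>\<close> form a null set.\<close>
      have "AE \<eta> in lborel. \<eta> \<noteq> 0" "AE \<eta> in lborel. \<eta> \<noteq> t" by (rule AE_lborel_singleton)+
      then show "AE \<eta> in lborel. (\<lambda>i. of_real (w \<eta>) * ((vc (X i - \<eta>) - vc (t - \<eta>)) / of_real (X i - t))) \<longlonglongrightarrow> of_real (w \<eta>) * d \<eta>"
      proof eventually_elim
        case (elim \<eta>)
        show ?case
        proof (cases "\<eta> < 0")
          case True
          then show ?thesis by (simp add: w_def)
        next
          case False
          then have "(vc has_vector_derivative d \<eta>) (at (t - \<eta>))"
            using elim t vc_deriv_inside[of "t - \<eta>"] vc_deriv_negative[of "t - \<eta>"] by (cases "\<eta> < t") (auto simp: d_def)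
          then have lim: "((\<lambda>s. (vc s - vc (t - \<eta>)) / of_real (s - (t - \<eta>))) \<longlongrightarrow> d \<eta>) (at (t - \<eta>))"
            by (simp add: has_vector_derivative_within_quotient)
          have "(\<lambda>i. X i - \<eta>) \<longlonglongrightarrow> t - \<eta>" by (intro tendsto_intros X)
          then have "filterlim (\<lambda>i. X i - \<eta>) (at (t - \<eta>)) sequentially"
            using X(1) by (auto simp: filterlim_at)
          from filterlim_compose[OF lim this] show ?thesis
            by (intro tendsto_mult tendsto_const) simp
        qed
      qed
    qed measurable
  qed
  then have vd: "vector_derivative I (at t within {0..T}) = (LINT \<eta>|lborel. of_real (w \<eta>) * d \<eta>)"
    using t T by (subst cbox_interval[symmetric], intro vector_derivative_within_cbox) auto
  have hi: "((\<lambda>\<eta>. of_real (w \<eta>) * d \<eta>) has_integral (LINT \<eta>|lborel. of_real (w \<eta>) * d \<eta>)) UNIV"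
    by (rule has_integral_integral_lborel[OF wd])
  have "((\<lambda>\<eta>. if \<eta> \<in> {0..t} then of_real (\<eta> powr (- gam)) * v' (t - \<eta>) else 0) has_integral (LINT \<eta>|lborel. of_real (w \<eta>) * d \<eta>)) UNIV"
    by (rule has_integral_spike_finite[of "{0, t}", OF _ _ hi]) (use t in \<open>auto simp: w_def d_def indicator_def\<close>)
  then have hi2: "((\<lambda>\<eta>. of_real (\<eta> powr (- gam)) * v' (t - \<eta>)) has_integral (LINT \<eta>|lborel. of_real (w \<eta>) * d \<eta>)) {0..t}"
    by (subst (asm) has_integral_restrict_UNIV)
  then show "(\<lambda>s. of_real (s powr (- gam)) * v' (t - s)) integrable_on {0..t}" by blast
  show "rl_deriv gam T v t = of_real (1 / Gamma (1 - gam)) * integral {0..t} (\<lambda>s. of_real (s powr (- gam)) * v' (t - s))"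
    unfolding rl_deriv_def using vd integral_unique[OF hi2] by (simp add: I_def[abs_def])
qed

text \<open>The value at s = 0 is set to 0 to agree with the convention that
  \<open>0 powr (- gam)\<close> is 0, so that domination by, and convergence to a multiple of,
  s^(-gam) hold on the closed interval.\<close>

definition gl_kernel :: "real \<Rightarrow> real \<Rightarrow> real" where
  "gl_kernel \<tau> s = (if s = 0 then 0 else \<tau> powr (- gam) * g_partial gam (nat \<lfloor>s / \<tau>\<rfloor>))"

text \<open>With k the integer part of s / tau the kernel is at most (tau (k + 1))^(-gam), and s <=
  tau (k + 1). The majorant is integrable and does not depend on the step.\<close>

lemma gl_kernel_bound:
  assumes "0 < \<tau>" "0 \<le> s"
  shows "0 \<le> gl_kernel \<tau> s" "gl_kernel \<tau> s \<le> s powr (- gam)"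
proof -
  show "0 \<le> gl_kernel \<tau> s"
    using g_partial_bounds(1)[OF gam, of "nat \<lfloor>s / \<tau>\<rfloor>"] by (simp add: gl_kernel_def)
  show "gl_kernel \<tau> s \<le> s powr (- gam)"
  proof (cases "s = 0")
    case False
    define k where "k = nat \<lfloor>s / \<tau>\<rfloor>"
    have "s / \<tau> \<le> real (Suc k)" unfolding k_def using assms by (simp add: le_nat_floor) linarith
    then have sk: "s \<le> \<tau> * real (Suc k)" using assms by (simp add: field_simps)
    have "gl_kernel \<tau> s \<le> \<tau> powr (- gam) * real (Suc k) powr (- gam)"
      using False g_partial_bounds(2)[OF gam, of k] by (simp add: gl_kernel_def k_def mult_left_mono)
    also have "\<dots> = (\<tau> * real (Suc k)) powr (- gam)" using assms by (simp add: powr_mult)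
    also have "\<dots> \<le> s powr (- gam)" using sk False assms gam by (intro powr_mono2') auto
    finally show ?thesis .
  qed (simp add: gl_kernel_def)
qed

text \<open>For fixed s > 0 the cell index k grows without bound while k times the step tends to s.
  The kernel is k^gam times the k-th partial sum, multiplied by (k tau)^(-gam), and both factors
  converge.\<close>

lemma gl_kernel_tendsto:
  assumes "0 < t" "0 \<le> s"
  shows "(\<lambda>N. gl_kernel (t / real (Suc N)) s) \<longlonglongrightarrow> s powr (- gam) / Gamma (1 - gam)"
proof (cases "s = 0")
  case False
  then have s: "0 < s" using assms by simp
  define \<tau> where "\<tau> N = t / real (Suc N)" for N
  define k where "k N = nat \<lfloor>s / \<tau> N\<rfloor>" for N
  have \<tau>: "0 < \<tau> N" for N using assms by (simp add: \<tau>_def)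
  have "(\<lambda>N. t * (1 / real (Suc N))) \<longlonglongrightarrow> t * 0"
    by (intro tendsto_intros lim_1_over_n[THEN LIMSEQ_Suc])
  then have \<tau>0: "\<tau> \<longlonglongrightarrow> 0" by (simp add: \<tau>_def[abs_def])
  have kb: "s - \<tau> N \<le> real (k N) * \<tau> N" "real (k N) * \<tau> N \<le> s" for N
  proof -
    have "0 \<le> s / \<tau> N" using s \<tau>[of N] by simp
    then have "real (k N) = of_int \<lfloor>s / \<tau> N\<rfloor>" unfolding k_def by simp
    then have "real (k N) \<le> s / \<tau> N" "s / \<tau> N \<le> real (k N) + 1"
      by linarith+
    then show "s - \<tau> N \<le> real (k N) * \<tau> N" "real (k N) * \<tau> N \<le> s"
      using \<tau>[of N] by (simp_all add: field_simps)
  qed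
  have k\<tau>: "(\<lambda>N. real (k N) * \<tau> N) \<longlonglongrightarrow> s"
  proof (rule tendsto_sandwich[OF always_eventually[OF allI] always_eventually[OF allI]])
    show "s - \<tau> N \<le> real (k N) * \<tau> N" "real (k N) * \<tau> N \<le> s" for N by (rule kb)+
    have "(\<lambda>N. s - \<tau> N) \<longlonglongrightarrow> s - 0" by (intro tendsto_intros \<tau>0)
    then show "(\<lambda>N. s - \<tau> N) \<longlonglongrightarrow> s" by simp
  qed simp
  have kinf: "filterlim k at_top sequentially"
    unfolding filterlim_at_top
  proof
    fix Z :: nat
    have "(\<lambda>N. real Z * \<tau> N) \<longlonglongrightarrow> real Z * 0" by (intro tendsto_intros \<tau>0)
    then have "eventually (\<lambda>N. real Z * \<tau> N < s / 2) sequentially"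
      using s by (intro order_tendstoD(2)) auto
    moreover have "eventually (\<lambda>N. s / 2 < real (k N) * \<tau> N) sequentially"
      using s by (intro order_tendstoD(1)[OF k\<tau>]) auto
    ultimately show "eventually (\<lambda>N. Z \<le> k N) sequentially"
    proof eventually_elim
      case (elim N)
      then have "real Z * \<tau> N < real (k N) * \<tau> N" by linarith
      then show ?case using \<tau>[of N] by simp
    qed
  qed
  have "(\<lambda>N. g_partial gam (k N) * real (k N) powr gam) \<longlonglongrightarrow> 1 / Gamma (1 - gam)"
    by (rule filterlim_compose[OF g_partial_asymptotic[OF gam] kinf])
  moreover have "(\<lambda>N. (real (k N) * \<tau> N) powr (- gam)) \<longlonglongrightarrow> s powr (- gam)"
    using s by (intro tendsto_powr k\<tau> tendsto_const) auto
  ultimately have "(\<lambda>N. (g_partial gam (k N) * real (k N) powr gam) * (real (k N) * \<tau> N) powr (- gam)) \<longlonglongrightarrow> (1 / Gamma (1 - gam)) * s powr (- gam)"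
    by (rule tendsto_mult)
  moreover have "eventually (\<lambda>N. (g_partial gam (k N) * real (k N) powr gam) * (real (k N) * \<tau> N) powr (- gam) = gl_kernel (\<tau> N) s) sequentially"
  proof -
    have "eventually (\<lambda>N. 1 \<le> k N) sequentially" using kinf unfolding filterlim_at_top by blast
    then show ?thesis
    proof eventually_elim
      case (elim N)
      then have one: "real (k N) powr gam * real (k N) powr (- gam) = 1" by (simp flip: powr_add)
      have "(g_partial gam (k N) * real (k N) powr gam) * (real (k N) * \<tau> N) powr (- gam)
          = g_partial gam (k N) * (real (k N) powr gam * real (k N) powr (- gam)) * \<tau> N powr (- gam)"
        using \<tau>[of N] by (subst powr_mult) (auto simp only: mult_ac)
      also have "\<dots> = gl_kernel (\<tau> N) s"
        unfolding one using False by (simp add: gl_kernel_def k_def)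
      finally show ?case .
    qed
  qed
  ultimately show ?thesis
    unfolding \<tau>_def[symmetric] using Lim_transform_eventually by fastforce
qed (simp add: gl_kernel_def)

text \<open>On each cell the kernel is constant and the integral of v'(t - s) is a difference of
  neighbouring samples; the cells reproduce the sum after summation by parts, whose boundary term is
  v(0) = 0.\<close>

lemma gl_sum_has_integral:
  assumes \<tau>: "0 < \<tau>" and t: "real N * \<tau> = t" "t \<le> T"
  shows "((\<lambda>s. of_real (gl_kernel \<tau> s) * v' (t - s)) has_integral gl_sum gam v \<tau> N) {0..t}"
proof -
  define w where "w k = v (t - real k * \<tau>)" for k
  have part: "((\<lambda>s. of_real (gl_kernel \<tau> s) * v' (t - s)) has_integral
      (\<Sum>k<n. of_real (\<tau> powr (- gam) * g_partial gam k) * (w k - w (Suc k)))) {0..real n * \<tau>}" if "n \<le> N" for n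
    using that
  proof (induction n)
    case 0
    then show ?case using has_integral_refl(2)[of _ "0::real"] by simp
  next
    case (Suc n)
    let ?a = "real n * \<tau>" and ?b = "real (Suc n) * \<tau>"
    have ab: "0 \<le> ?a" "?a \<le> ?b" "?b \<le> t"
    proof -
      show "?b \<le> t" unfolding t(1)[symmetric] using Suc.prems \<tau> by (intro mult_right_mono) auto
    qed (use \<tau> in \<open>auto simp: algebra_simps\<close>)
    have "((\<lambda>s. - v (t - s)) has_vector_derivative v' (t - s)) (at s within {?a..?b})" if s: "s \<in> {?a..?b}" for s
    proof -
      have "((v \<circ> (\<lambda>s. t - s)) has_vector_derivative (- 1) *\<^sub>R v' (t - s)) (at s within {?a..?b})"
      proof (rule vector_diff_chain_within)
        show "((\<lambda>s. t - s) has_vector_derivative - 1) (at s within {?a..?b})"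
          by (auto intro!: derivative_eq_intros)
        show "(v has_vector_derivative v' (t - s)) (at (t - s) within (\<lambda>s. t - s) ` {?a..?b})"
          by (rule has_vector_derivative_within_subset[OF deriv]) (use s ab t in auto)
      qed
      then show ?thesis by (auto intro!: derivative_eq_intros simp: o_def)
    qed
    then have "((\<lambda>s. v' (t - s)) has_integral - v (t - ?b) - - v (t - ?a)) {?a..?b}"
      using ab by (intro fundamental_theorem_of_calculus) auto
    then have "((\<lambda>s. of_real (\<tau> powr (- gam) * g_partial gam n) * v' (t - s)) has_integral
        of_real (\<tau> powr (- gam) * g_partial gam n) * (w n - w (Suc n))) {?a..?b}"
      by (intro has_integral_mult_right) (simp add: w_def)
    then have "((\<lambda>s. of_real (gl_kernel \<tau> s) * v' (t - s)) has_integral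
        of_real (\<tau> powr (- gam) * g_partial gam n) * (w n - w (Suc n))) {?a..?b}"
    proof (rule has_integral_spike_finite[of "{?a, ?b}", rotated 2])
      fix s assume s: "s \<in> {?a..?b} - {?a, ?b}"
      then have "real n < s / \<tau>" "s / \<tau> < real n + 1" using \<tau> by (auto simp: field_simps)
      then have "\<lfloor>s / \<tau>\<rfloor> = int n" by linarith
      moreover have "s \<noteq> 0" using s ab(1) by auto
      ultimately show "of_real (gl_kernel \<tau> s) * v' (t - s) = of_real (\<tau> powr (- gam) * g_partial gam n) * v' (t - s)"
        by (simp add: gl_kernel_def)
    qed simp
    from has_integral_combine[OF ab(1,2) Suc.IH this] show ?case
      using Suc.prems by simp
  qed
  have "w N = 0" using t v0 by (simp add: w_def)
  have "gl_sum gam v \<tau> N = of_real (\<tau> powr (- gam)) * (\<Sum>k=0..N. of_real (g_coeff gam k) * w k)"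
    by (simp add: gl_sum_def w_def t(1))
  also have "\<dots> = (\<Sum>k<N. of_real (\<tau> powr (- gam) * g_partial gam k) * (w k - w (Suc k)))"
    unfolding g_summation_by_parts using \<open>w N = 0\<close> by (simp add: sum_distrib_left mult_ac)
  finally show ?thesis using part[of N] t(1) by simp
qed

text \<open>By summation by parts the sums are integrals of \<open>v'\<close> against step kernels that converge to the
  kernel of the fractional integral.\<close>

theorem gl_sum_tendsto_rl_deriv:
  assumes t: "t \<in> {0<..T}"
  shows "(\<lambda>N. gl_sum gam v (t / real (Suc N)) (Suc N)) \<longlonglongrightarrow> rl_deriv gam T v t"
proof -
  obtain L where L: "0 \<le> L" "\<And>t. t \<in> {0..T} \<Longrightarrow> norm (v' t) \<le> L" using v'_bound by metis
  let ?f = "\<lambda>N s. of_real (gl_kernel (t / real (Suc N)) s) * v' (t - s)"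
  have hi: "(?f N has_integral gl_sum gam v (t / real (Suc N)) (Suc N)) {0..t}" for N
    using t by (intro gl_sum_has_integral) auto
  have "(\<lambda>N. integral {0..t} (?f N)) \<longlonglongrightarrow> integral {0..t} (\<lambda>s. of_real (s powr (- gam) / Gamma (1 - gam)) * v' (t - s))"
  proof (rule dominated_convergence(2))
    show "?f N integrable_on {0..t}" for N using hi by blast
    show "(\<lambda>s. s powr (- gam) * L) integrable_on {0..t}"
      using gam t by (intro integrable_on_mult_left integrable_on_powr_from_0) auto
    show "norm (?f N s) \<le> s powr (- gam) * L" if "s \<in> {0..t}" for N s
    proof -
      have "0 < t / real (Suc N)" using t by simp
      then have "0 \<le> gl_kernel (t / real (Suc N)) s" "gl_kernel (t / real (Suc N)) s \<le> s powr (- gam)"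
        using gl_kernel_bound that by auto
      then show ?thesis unfolding norm_mult norm_of_real using that t L by (intro mult_mono) auto
    qed
    show "(\<lambda>N. ?f N s) \<longlonglongrightarrow> of_real (s powr (- gam) / Gamma (1 - gam)) * v' (t - s)" if "s \<in> {0..t}" for s
      using that t by (intro tendsto_intros gl_kernel_tendsto) auto
  qed
  moreover have "integral {0..t} (?f N) = gl_sum gam v (t / real (Suc N)) (Suc N)" for N
    by (rule integral_unique[OF hi])
  moreover have "integral {0..t} (\<lambda>s. of_real (s powr (- gam) / Gamma (1 - gam)) * v' (t - s))
      = integral {0..t} (\<lambda>s. of_real (1 / Gamma (1 - gam)) * (of_real (s powr (- gam)) * v' (t - s)))"
    by (intro integral_cong) simp
  moreover have "\<dots> = rl_deriv gam T v t"
    unfolding rl_deriv_eq_caputo(2)[OF t]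
    by (rule integral_unique[OF has_integral_mult_right[OF integrable_integral[OF rl_deriv_eq_caputo(1)[OF t]]]])
  ultimately show ?thesis by simp
qed

end

text \<open>The distance between the sums with steps tau and tau / m at the same time is at most tau
  B for every m. Letting m tend to infinity replaces the finer sum by the fractional
  derivative.\<close>

lemma (in c1_vanishing) gl_sum_error:
  assumes V: "V \<in> fourier_space (1 + gam)" "fourier_space_norm (1 + gam) V \<le> B" "\<And>t. t \<le> 0 \<Longrightarrow> V t = 0"
    and Vv: "\<And>t. t \<in> {0..T} \<Longrightarrow> V t = v t"
    and \<tau>: "0 < \<tau>" "real n * \<tau> \<le> T" "1 \<le> n"
  shows "norm (gl_sum gam V \<tau> n - rl_deriv gam T v (real n * \<tau>)) \<le> \<tau> * B"
    and "\<And>t. t \<in> {0..T} \<Longrightarrow> norm (v t) \<le> B"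
proof -
  have cont: "continuous_on {..T} V"
  proof -
    have "continuous_on {..T} vc" by (rule continuous_on_subset[OF vc_continuous]) simp
    moreover have "vc t = V t" if "t \<in> {..T}" for t
      using that V(3)[of t] Vv[of t] v0 T by (cases "t \<le> 0") (auto simp: vc_def max_def min_def)
    ultimately show ?thesis by (rule continuous_on_eq)
  qed
  show "norm (v t) \<le> B" if "t \<in> {0..T}" for t
    using gl_sum_refinement(1)[OF gam V cont, of t] Vv[OF that] that by simp
  let ?t = "real n * \<tau>"
  have t: "?t \<in> {0<..T}" using \<tau> by simp
  have eqV: "gl_sum gam V \<sigma> N = gl_sum gam v \<sigma> N" if "0 < \<sigma>" "real N * \<sigma> \<le> T" for \<sigma> N
    unfolding gl_sum_def
  proof (intro arg_cong2[where f="(*)"] sum.cong refl)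
    fix k assume "k \<in> {0..N}"
    then have "real k * \<sigma> \<le> real N * \<sigma>" "0 \<le> real k * \<sigma>" using that by (auto intro: mult_right_mono)
    then have "real N * \<sigma> - real k * \<sigma> \<in> {0..T}"
      using that(2) unfolding atLeastAtMost_iff by linarith
    then show "V (real N * \<sigma> - real k * \<sigma>) = v (real N * \<sigma> - real k * \<sigma>)"
      by (rule Vv)
  qed
  \<comment> \<open>The convergence result runs through all subdivisions of [0,t] into
    \<open>Suc N\<close> steps; this subsequence selects those with \<open>Suc m * n\<close> steps,
    whose step is tau / (m + 1).\<close>
  define N where "N m = Suc m * n - 1" for m
  have N: "Suc (N m) = Suc m * n" for m using \<tau>(3) by (simp add: N_def)
  have "strict_mono N"
  proof (rule strict_monoI_Suc)
    fix m
    have "Suc (N m) < Suc (N (Suc m))" unfolding N using \<tau>(3) by simp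
    then show "N m < N (Suc m)" by simp
  qed
  then have "(\<lambda>m. gl_sum gam v (?t / real (Suc (N m))) (Suc (N m))) \<longlonglongrightarrow> rl_deriv gam T v ?t"
    using LIMSEQ_subseq_LIMSEQ[OF gl_sum_tendsto_rl_deriv[OF t]] by (simp add: o_def)
  moreover have "?t / real (Suc (N m)) = \<tau> / real (Suc m)" for m
    unfolding N of_nat_mult mult.commute[of "real (Suc m)"]
    using \<tau>(3) by (intro mult_divide_mult_cancel_left) simp
  ultimately have "(\<lambda>m. gl_sum gam v (\<tau> / real (Suc m)) (Suc m * n)) \<longlonglongrightarrow> rl_deriv gam T v ?t"
    by (simp only: N)
  moreover have "gl_sum gam V (\<tau> / real (Suc m)) (Suc m * n) = gl_sum gam v (\<tau> / real (Suc m)) (Suc m * n)" for m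
  proof (rule eqV)
    have "real (Suc m * n) * (\<tau> / real (Suc m)) = ?t"
      unfolding of_nat_mult by (simp del: of_nat_Suc)
    then show "real (Suc m * n) * (\<tau> / real (Suc m)) \<le> T" using \<tau>(2) by simp
  qed (use \<tau> in simp)
  ultimately have "(\<lambda>m. gl_sum gam V (\<tau> / real (Suc m)) (Suc m * n)) \<longlonglongrightarrow> rl_deriv gam T v ?t" by simp
  then have "(\<lambda>m. gl_sum gam V \<tau> n - gl_sum gam V (\<tau> / real (Suc m)) (Suc m * n)) \<longlonglongrightarrow> gl_sum gam V \<tau> n - rl_deriv gam T v ?t"
    by (intro tendsto_intros)
  then show "norm (gl_sum gam V \<tau> n - rl_deriv gam T v ?t) \<le> \<tau> * B"
    by (rule Lim_norm_ubound[OF sequentially_bot])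
       (simp add: gl_sum_refinement(2)[OF gam V cont \<tau>(1,2)] del: mult_Suc of_nat_Suc)
qed

text \<open>With c = lam + p U(x), tempering and damping together are exp(-c k tau), so the discrete
  derivative of G is exp(-c t) times the Gruenwald sum of exp(c t) G, apart from the correction on
  the diagonal. The first summand of the constant is the error of the sum, the second the error of
  the correction times |G| <= B. Uniformity in x rests on Re c >= 0 and on B being common to all
  x.\<close>

lemma (in fk_setting) truncation_constant_exists:
  assumes C1: "\<forall>x\<in>\<Omega>. (\<forall>t\<in>{0..T}. G x differentiable (at t within {0..T})) \<and> continuous_on {0..T} (time_deriv T G x)"
    and init: "\<forall>x\<in>{a..b}. G x 0 = 0"
    and four: "\<forall>x\<in>\<Omega>. \<exists>V\<in>fourier_space (1 + gam). fourier_space_norm (1 + gam) V \<le> B \<and> (\<forall>t\<le>0. V t = 0) \<and>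
        (\<forall>t\<in>{0..T}. V t = exp ((of_real lam + p * of_real (U x)) * of_real t) * G x t)"
  shows "truncation_constant a b gam lam p U T G (B + lam powr gam * (gam * lam) * B)"
  unfolding truncation_constant_def
proof (intro allI impI ballI)
  fix N n :: nat and x
  assume N: "1 \<le> N" and n: "n \<in> {1..N}" and x: "x \<in> \<Omega>"
  define \<tau> where "\<tau> = T / real N"
  define c where "c = of_real lam + p * of_real (U x)"
  define t where "t = real n * \<tau>"
  have \<tau>: "0 < \<tau>" using N T by (simp add: \<tau>_def)
  have tT: "t \<le> T" unfolding t_def \<tau>_def using n N T by (auto simp: field_simps)
  have t0: "0 < t" using n \<tau> by (simp add: t_def)
  have Rec: "0 \<le> Re c" using lam p U_nonneg[OF x] by (simp add: c_def)
  define v where "v s = exp (c * of_real s) * G x s" for s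
  define v' where "v' s = exp (c * of_real s) * (time_deriv T G x s + c * G x s)" for s
  have Gd: "(G x has_vector_derivative time_deriv T G x s) (at s within {0..T})" if "s \<in> {0..T}" for s
    using C1 x that by (auto simp: time_deriv_def vector_derivative_works)
  interpret c1_vanishing gam T v v'
  proof
    show "(v has_vector_derivative v' s) (at s within {0..T})" if "s \<in> {0..T}" for s
    proof -
      have "((\<lambda>z. exp (c * z)) has_field_derivative exp (c * of_real s) * c) (at (of_real s))"
        by (auto intro!: derivative_eq_intros)
      then have "((\<lambda>s. exp (c * of_real s)) has_vector_derivative exp (c * of_real s) * c) (at s within {0..T})"
        by (rule has_vector_derivative_at_within[OF has_vector_derivative_real_field])
      from has_vector_derivative_mult[OF this Gd[OF that]]
      show ?thesis unfolding v_def[abs_def] v'_def by (simp add: algebra_simps)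
    qed
    have "continuous_on {0..T} (G x)"
      using Gd by (meson continuous_on_eq_continuous_within has_vector_derivative_continuous)
    then show "continuous_on {0..T} v'"
      unfolding v'_def[abs_def] using C1 x by (intro continuous_intros) auto
    show "v 0 = 0" using init x by (simp add: v_def)
  qed (use gam T in auto)
  obtain V where V: "V \<in> fourier_space (1 + gam)" "fourier_space_norm (1 + gam) V \<le> B" "\<And>t. t \<le> 0 \<Longrightarrow> V t = 0"
    "\<And>t. t \<in> {0..T} \<Longrightarrow> V t = v t"
    using four x unfolding v_def c_def by blast
  have err: "norm (gl_sum gam V \<tau> n - rl_deriv gam T v t) \<le> \<tau> * B"
    unfolding t_def using n tT t_def by (intro gl_sum_error V \<tau>) auto
  have Gb: "norm (G x t) \<le> B"
  proof -
    have "norm (v t) \<le> B" using n tT t0 t_def by (intro gl_sum_error(2)[OF V \<tau>, of n]) auto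
    moreover have "norm (G x t) \<le> norm (v t)"
    proof -
      have "1 \<le> norm (exp (c * of_real t))" using Rec t0 by (simp add: norm_exp_eq_Re)
      then show ?thesis unfolding v_def norm_mult using mult_right_mono[of 1 _ "norm (G x t)"] by simp
    qed
    ultimately show ?thesis by simp
  qed
  have B0: "0 \<le> B" using Gb norm_ge_zero order_trans by blast
  \<comment> \<open>The factor with which the diagonal correction of \<open>d_coeff\<close>
    multiplies G(t) once the powers of tau have cancelled. It differs from lam^gam by at most
    lam^gam gam lam tau.\<close>
  define q where "q = exp (- (gam * lam * \<tau>)) * lam powr gam"
  have disc: "dderiv \<tau> (\<lambda>k y. G y (real k * \<tau>)) n x = exp (- (c * of_real t)) * gl_sum gam V \<tau> n - of_real q * G x t"
  proof -
    have summand: "of_real (tempered_g_coeff gam lam \<tau> k) * exp (- (p * of_real (U x * real k * \<tau>))) * G x (real (n - k) * \<tau>)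
        = exp (- (c * of_real t)) * (of_real (g_coeff gam k) * V (real n * \<tau> - real k * \<tau>))" if k: "k \<in> {0..n}" for k
    proof -
      have nk: "real (n - k) * \<tau> = real n * \<tau> - real k * \<tau>" using k by (simp add: algebra_simps of_nat_diff)
      have "0 \<le> real (n - k) * \<tau>" "real (n - k) * \<tau> \<le> t"
        using \<tau> by (auto simp: t_def intro: mult_right_mono)
      then have Vk: "V (real n * \<tau> - real k * \<tau>) = exp (c * of_real (real n * \<tau> - real k * \<tau>)) * G x (real (n - k) * \<tau>)"
        using V(4)[of "real (n - k) * \<tau>"] tT unfolding nk v_def by simp
      have "exp (- (c * of_real t)) * exp (c * of_real (real n * \<tau> - real k * \<tau>)) = exp (- (c * of_real (real k * \<tau>)))"
        by (simp add: t_def exp_add[symmetric] algebra_simps)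
      also have "\<dots> = of_real (exp (- (real k * lam * \<tau>))) * exp (- (p * of_real (U x * real k * \<tau>)))"
        unfolding exp_of_real[symmetric] by (simp add: c_def exp_add[symmetric] algebra_simps)
      finally have "exp (- (c * of_real t)) * exp (c * of_real (real n * \<tau> - real k * \<tau>))
          = of_real (exp (- (real k * lam * \<tau>))) * exp (- (p * of_real (U x * real k * \<tau>)))" .
      moreover have "exp (- (c * of_real t)) * (of_real (g_coeff gam k) * (E * g))
          = of_real (g_coeff gam k) * ((exp (- (c * of_real t)) * E) * g)" for E g
        by (simp add: mult_ac)
      ultimately show ?thesis unfolding Vk tempered_g_coeff_def by (simp add: mult_ac)
    qed
    have d: "d_coeff gam lam \<tau> k = tempered_g_coeff gam lam \<tau> k - (if k = 0 then exp (- (gam * lam * \<tau>)) * (lam * \<tau>) powr gam else 0)" for k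
      by (simp add: d_coeff_def tempered_g_coeff_def)
    have "(\<Sum>k=0..n. of_real (d_coeff gam lam \<tau> k) * exp (- (p * of_real (U x * real k * \<tau>))) * G x (real (n - k) * \<tau>))
        = (\<Sum>k=0..n. of_real (tempered_g_coeff gam lam \<tau> k) * exp (- (p * of_real (U x * real k * \<tau>))) * G x (real (n - k) * \<tau>)
            - (if k = 0 then of_real (exp (- (gam * lam * \<tau>)) * (lam * \<tau>) powr gam) * G x (real n * \<tau>) else 0))"
      by (intro sum.cong refl) (auto simp: d left_diff_distrib)
    also have "\<dots> = (\<Sum>k=0..n. exp (- (c * of_real t)) * (of_real (g_coeff gam k) * V (real n * \<tau> - real k * \<tau>)))
        - of_real (exp (- (gam * lam * \<tau>)) * (lam * \<tau>) powr gam) * G x (real n * \<tau>)"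
      unfolding sum_subtractf by (intro arg_cong2[where f="(-)"] sum.cong refl summand) auto
    finally have S: "(\<Sum>k=0..n. of_real (d_coeff gam lam \<tau> k) * exp (- (p * of_real (U x * real k * \<tau>))) * G x (real (n - k) * \<tau>))
        = exp (- (c * of_real t)) * (\<Sum>k=0..n. of_real (g_coeff gam k) * V (real n * \<tau> - real k * \<tau>))
        - of_real (exp (- (gam * lam * \<tau>)) * (lam * \<tau>) powr gam) * G x t"
      by (simp add: sum_distrib_left t_def)
    have r1: "1 / \<tau> powr gam = \<tau> powr (- gam)" by (simp add: powr_minus inverse_eq_divide)
    have r2: "\<tau> powr (- gam) * (exp (- (gam * lam * \<tau>)) * (lam * \<tau>) powr gam) = q"
    proof -
      have "(lam * \<tau>) powr gam = lam powr gam * \<tau> powr gam" using lam \<tau> by (simp add: powr_mult)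
      moreover have "\<tau> powr (- gam) * \<tau> powr gam = 1" using \<tau> by (simp flip: powr_add)
      ultimately show ?thesis by (simp add: q_def mult.left_commute)
    qed
    show ?thesis
      unfolding discrete_deriv_def S r1 gl_sum_def right_diff_distrib r2[symmetric]
      by (simp add: mult_ac)
  qed
  have tsd: "tempered_subst_deriv gam lam p U T G x t = exp (- (c * of_real t)) * rl_deriv gam T v t"
    by (simp add: tempered_subst_deriv_def c_def v_def[abs_def])
  have q: "\<bar>lam powr gam - q\<bar> \<le> lam powr gam * (gam * lam * \<tau>)"
  proof -
    have g0: "0 \<le> gam * lam * \<tau>" using gam lam \<tau> by simp
    have "lam powr gam - q = lam powr gam * (1 - exp (- (gam * lam * \<tau>)))" by (simp add: q_def algebra_simps)
    moreover have "0 \<le> 1 - exp (- (gam * lam * \<tau>))" using g0 by simp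
    moreover have "1 - exp (- (gam * lam * \<tau>)) \<le> gam * lam * \<tau>"
      using exp_ge_add_one_self[of "- (gam * lam * \<tau>)"] by simp
    ultimately show ?thesis by (simp add: abs_mult mult_left_mono)
  qed
  have "dderiv \<tau> (\<lambda>k y. G y (real k * \<tau>)) n x - (tempered_subst_deriv gam lam p U T G x t - of_real (lam powr gam) * G x t)
      = exp (- (c * of_real t)) * (gl_sum gam V \<tau> n - rl_deriv gam T v t) + of_real (lam powr gam - q) * G x t"
    unfolding disc tsd by (simp add: algebra_simps)
  then have "norm (dderiv \<tau> (\<lambda>k y. G y (real k * \<tau>)) n x - (tempered_subst_deriv gam lam p U T G x t - of_real (lam powr gam) * G x t))
      \<le> norm (exp (- (c * of_real t))) * norm (gl_sum gam V \<tau> n - rl_deriv gam T v t) + \<bar>lam powr gam - q\<bar> * norm (G x t)"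
    by (metis norm_triangle_ineq norm_mult norm_of_real)
  also have "\<dots> \<le> 1 * (\<tau> * B) + (lam powr gam * (gam * lam * \<tau>)) * B"
  proof (intro add_mono mult_mono err q Gb)
    show "norm (exp (- (c * of_real t))) \<le> 1" using Rec t0 by (simp add: norm_exp_eq_Re)
  qed (use gam lam \<tau> in auto)
  also have "\<dots> = (B + lam powr gam * (gam * lam) * B) * \<tau>" by (simp add: algebra_simps)
  finally show "norm (discrete_deriv gam lam p U (T / real N) (\<lambda>k y. G y (real k * (T / real N))) n x
              - (tempered_subst_deriv gam lam p U T G x (real n * (T / real N))
                 - of_real (lam powr gam) * G x (real n * (T / real N))))
        \<le> (B + lam powr gam * (gam * lam) * B) * (T / real N)"
    by (simp only: \<tau>_def t_def)
qed

section \<open>Ritz projections and approximation by finite elements\<close>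

text \<open>Gram-Schmidt by induction. The residual F of f and the residual E of the new function
  are both orthogonal to the old ones, so subtracting the component of F along E keeps the old
  conditions and adds the new one.\<close>

lemma L2_projection_exists:
  assumes "finite I" "\<And>i. i \<in> I \<Longrightarrow> u i \<in> L2_space S" "f \<in> L2_space S"
  shows "\<exists>c. \<forall>i\<in>I. L2_inner S (\<lambda>x. f x - (\<Sum>j\<in>I. c j * u j x)) (u i) = 0"
  using assms
proof (induction I arbitrary: f rule: finite_induct)
  case (insert k I)
  have uL: "u i \<in> L2_space S" if "i \<in> insert k I" for i using insert.prems(1) that by blast
  obtain c where c: "\<And>i. i \<in> I \<Longrightarrow> L2_inner S (\<lambda>x. f x - (\<Sum>j\<in>I. c j * u j x)) (u i) = 0"
    using insert.IH[OF _ insert.prems(2)] uL by blast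
  obtain e where e: "\<And>i. i \<in> I \<Longrightarrow> L2_inner S (\<lambda>x. u k x - (\<Sum>j\<in>I. e j * u j x)) (u i) = 0"
    using insert.IH[of "u k"] uL by blast
  define F where "F x = f x - (\<Sum>j\<in>I. c j * u j x)" for x
  define E where "E x = u k x - (\<Sum>j\<in>I. e j * u j x)" for x
  have FL: "F \<in> L2_space S"
    unfolding F_def[abs_def] using uL insert.prems(2) by (intro L2_diff L2_sum L2_cmult) auto
  have EL: "E \<in> L2_space S"
    unfolding E_def[abs_def] using uL by (intro L2_diff L2_sum L2_cmult) auto
  \<comment> \<open>If E has norm zero the new function is dependent on the others; the coefficient
    0 is then correct, since F is orthogonal to E by Cauchy-Schwarz. No linear independence is
    assumed.\<close>
  define \<beta> where "\<beta> = (if L2_norm S E = 0 then 0 else L2_inner S F E / L2_inner S E E)"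
  define c' where "c' j = (if j = k then \<beta> else c j - \<beta> * e j)" for j
  define R where "R x = F x - \<beta> * E x" for x
  have RL: "R \<in> L2_space S" unfolding R_def[abs_def] by (intro L2_diff L2_cmult FL EL)
  have Req: "f x - (\<Sum>j\<in>insert k I. c' j * u j x) = R x" for x
  proof -
    have "(\<Sum>j\<in>insert k I. c' j * u j x) = \<beta> * u k x + (\<Sum>j\<in>I. (c j - \<beta> * e j) * u j x)"
      using insert.hyps by (auto simp: c'_def intro!: sum.cong)
    also have "(\<Sum>j\<in>I. (c j - \<beta> * e j) * u j x) = (\<Sum>j\<in>I. c j * u j x) - \<beta> * (\<Sum>j\<in>I. e j * u j x)"
      by (simp add: left_diff_distrib sum_subtractf sum_distrib_left mult.assoc)
    finally show ?thesis by (simp add: R_def F_def E_def algebra_simps)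
  qed
  have RI: "L2_inner S R (u i) = 0" if "i \<in> I" for i
  proof -
    have "L2_inner S R (u i) = L2_inner S F (u i) - \<beta> * L2_inner S E (u i)"
      unfolding R_def[abs_def] using that
      by (simp add: L2_inner_diff_left[OF FL L2_cmult[OF EL] uL] L2_inner_cmult_left)
    then show ?thesis using c[OF that] e[OF that] by (simp add: F_def[abs_def] E_def[abs_def])
  qed
  have RE: "L2_inner S R E = 0"
  proof -
    have "L2_inner S R E = L2_inner S F E - \<beta> * L2_inner S E E"
      unfolding R_def[abs_def]
      by (simp add: L2_inner_diff_left[OF FL L2_cmult[OF EL] EL] L2_inner_cmult_left)
    moreover have "L2_inner S F E = 0" if "L2_norm S E = 0"
      using L2_cauchy_schwarz[OF FL EL] that by simp
    ultimately show ?thesis by (auto simp: \<beta>_def L2_inner_self)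
  qed
  have "L2_inner S R (u k) = 0"
  proof -
    have "L2_inner S R (\<lambda>x. \<Sum>j\<in>I. e j * u j x) = cnj (\<Sum>j\<in>I. e j * L2_inner S (u j) R)"
      using uL by (subst L2_inner_commute, subst L2_inner_sum_left)
        (auto intro: L2_cmult RL simp: L2_inner_cmult_left)
    also have "\<dots> = 0"
      using RI by (simp add: L2_inner_commute[of S _ R])
    finally have 0: "L2_inner S R (\<lambda>x. \<Sum>j\<in>I. e j * u j x) = 0" .
    have "(\<lambda>x. \<Sum>j\<in>I. e j * u j x) \<in> L2_space S"
      using uL by (intro L2_sum L2_cmult) auto
    from L2_inner_add_right[OF EL this RL]
    have "L2_inner S R (\<lambda>x. E x + (\<Sum>j\<in>I. e j * u j x)) = 0"
      unfolding RE 0 by simp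
    then show ?thesis by (simp add: E_def)
  qed
  then have "\<forall>i\<in>insert k I. L2_inner S (\<lambda>x. f x - (\<Sum>j\<in>insert k I. c' j * u j x)) (u i) = 0"
    unfolding Req using RI by auto
  then show ?case by blast
qed simp

section \<open>Polynomial approximation on one element\<close>

lemma has_weak_deriv_restrict:
  assumes "has_weak_deriv S k v g" "{c<..<d} \<subseteq> S" "S \<in> sets lebesgue"
  shows "has_weak_deriv {c<..<d} k v g"
  unfolding has_weak_deriv_def
proof (intro conjI allI impI)
  show "locally_integrable {c<..<d} v" "locally_integrable {c<..<d} g"
    using assms(1,2) unfolding has_weak_deriv_def locally_integrable_def by (meson order_trans)+
  fix \<phi> assume \<phi>: "test_fun {c<..<d} \<phi>"
  then have "test_fun S \<phi>" using assms(2) unfolding test_fun_def by (meson order_trans)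
  then have "(LINT x|lebesgue_on S. v x * vderiv_iter k \<phi> x) = (- 1) ^ k * (LINT x|lebesgue_on S. g x * \<phi> x)"
    using assms(1) by (simp add: has_weak_deriv_def)
  moreover have "(LINT x|lebesgue_on S. w x * \<psi> x) = (LINT x|lebesgue_on {c<..<d}. w x * \<psi> x)"
    if "test_fun {c<..<d} \<psi>" for w \<psi>
    using that assms(2,3) unfolding test_fun_def by (intro integral_lebesgue_on_support) auto
  ultimately show "(LINT x|lebesgue_on {c<..<d}. v x * vderiv_iter k \<phi> x)
      = (- 1) ^ k * (LINT x|lebesgue_on {c<..<d}. g x * \<phi> x)"
    using \<phi> test_fun_vderiv_iter[OF \<phi>] by simp
qed

text \<open>\<open>sobolev\<close> relates each order of derivative to v itself. Testing with the
  derivative of a test function links consecutive orders, as an induction on the order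
  requires.\<close>

lemma has_weak_deriv_step:
  assumes "has_weak_deriv S k v g" "has_weak_deriv S (Suc k) v h"
  shows "has_weak_deriv S 1 g h"
  unfolding has_weak_deriv_def
proof (intro conjI allI impI)
  show "locally_integrable S g" "locally_integrable S h"
    using assms by (auto simp: has_weak_deriv_def)
  fix \<phi> assume \<phi>: "test_fun S \<phi>"
  let ?\<phi>' = "\<lambda>x. vector_derivative \<phi> (at x)"
  have "(LINT x|lebesgue_on S. v x * vderiv_iter k ?\<phi>' x) = (- 1) ^ Suc k * (LINT x|lebesgue_on S. h x * \<phi> x)"
    using assms(2) \<phi> unfolding has_weak_deriv_def by (simp add: vderiv_iter_Suc)
  moreover have "(LINT x|lebesgue_on S. v x * vderiv_iter k ?\<phi>' x) = (- 1) ^ k * (LINT x|lebesgue_on S. g x * ?\<phi>' x)"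
    using assms(1) test_fun_vector_derivative[OF \<phi>] unfolding has_weak_deriv_def by simp
  ultimately have "(- 1) ^ k * (LINT x|lebesgue_on S. g x * ?\<phi>' x) = (- 1) ^ k * (- (LINT x|lebesgue_on S. h x * \<phi> x))"
    by simp
  then have "(LINT x|lebesgue_on S. g x * ?\<phi>' x) = - (LINT x|lebesgue_on S. h x * \<phi> x)"
    by (rule mult_left_cancel[THEN iffD1, rotated]) simp
  then show "(LINT x|lebesgue_on S. g x * vderiv_iter 1 \<phi> x) = (- 1) ^ 1 * (LINT x|lebesgue_on S. h x * \<phi> x)"
    by simp
qed

lemma poly_antiderivative_exists:
  fixes P :: "complex poly"
  obtains Q where "pderiv Q = P" "degree Q \<le> Suc (degree P)"
proof
  let ?Q = "\<Sum>i\<le>degree P. monom (coeff P i / of_nat (Suc i)) (Suc i)"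
  have "pderiv ?Q = (\<Sum>i\<le>degree P. monom (coeff P i) i)"
    by (simp add: higher_pderiv_sum[of 1, simplified] pderiv_monom del: of_nat_Suc)
  then show "pderiv ?Q = P" by (simp add: poly_as_sum_of_monoms)
  show "degree ?Q \<le> Suc (degree P)"
    by (intro degree_sum_le) (auto intro: order_trans[OF degree_monom_le])
qed

lemma poly_has_vector_derivative:
  "((\<lambda>x. poly Q (complex_of_real x)) has_vector_derivative poly (pderiv Q) (of_real x)) (at x within A)"
  by (rule has_vector_derivative_at_within[OF has_vector_derivative_real_field[OF poly_DERIV]])

lemma poly_L2:
  "S \<in> lmeasurable \<Longrightarrow> bounded S \<Longrightarrow> (\<lambda>x. poly Q (complex_of_real x)) \<in> L2_space S"
proof -
  assume S: "S \<in> lmeasurable" "bounded S"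
  have cont: "continuous_on A (\<lambda>x. poly Q (complex_of_real x))" for A
    by (intro continuous_intros)
  obtain B where B: "S \<subseteq> {-B..B}"
    using S(2) unfolding bounded_iff by (auto simp: abs_le_iff subset_iff) (metis minus_le_iff)
  have "compact ((\<lambda>x. poly Q (complex_of_real x)) ` {-B..B})"
    by (rule compact_continuous_image[OF cont]) simp
  then obtain C where "\<forall>y\<in>(\<lambda>x. poly Q (complex_of_real x)) ` {-B..B}. norm y \<le> C"
    using compact_imp_bounded bounded_iff by metis
  moreover have "(\<lambda>x. poly Q (complex_of_real x)) \<in> borel_measurable (completion lborel)"
    by (rule measurable_completion) (use borel_measurable_continuous_onI[OF cont] in simp)
  ultimately show ?thesis
    using S(1) B
    by (intro L2_bounded[where C=C] AE_I2) (auto intro!: measurable_restrict_space1)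
qed

lemma poly_has_weak_deriv:
  assumes "s < t"
  shows "has_weak_deriv {s<..<t} 1 (\<lambda>x. poly Q (of_real x)) (\<lambda>x. poly (pderiv Q) (of_real x))"
proof -
  have L: "(\<lambda>x. poly (pderiv Q) (complex_of_real x)) \<in> L2_space {s<..<t}"
    by (rule poly_L2) (auto intro: bounded_Ioo)
  show ?thesis
  proof (rule has_weak_deriv_cong_AE[OF has_weak_deriv_indefinite_integral[OF L assms, of "poly Q (of_real s)"]])
    have "poly Q (of_real s) + integral {s..x} (\<lambda>x. poly (pderiv Q) (of_real x)) = poly Q (of_real x)"
      if "s \<le> x" for x
      using integral_unique[OF fundamental_theorem_of_calculus[OF that poly_has_vector_derivative[of Q]]] by simp
    then show "AE x in lebesgue_on {s<..<t}. poly Q (of_real s) + integral {s..x} (\<lambda>x. poly (pderiv Q) (of_real x)) = poly Q (of_real x)"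
      by (intro AE_I2) auto
  qed auto
qed

text \<open>The number c is the mean of u: the constant of integration c0 plus the mean c1 of the
  primitive H. The centred primitive is orthogonal to constants, so centring does not increase its
  norm, and H is bounded by the length times the norm of g.\<close>

lemma wirtinger:
  assumes u: "u \<in> L2_space {s<..<t}" "has_weak_deriv {s<..<t} 1 u g" "g \<in> L2_space {s<..<t}" and st: "s < t"
  obtains c where "L2_norm {s<..<t} (\<lambda>x. u x - c) \<le> (t - s) * L2_norm {s<..<t} g"
    "integral {s..t} (\<lambda>x. u x - c) = 0"
proof -
  let ?I = "{s<..<t}"
  define H where "H x = integral {s..x} g" for x
  have HL: "H \<in> L2_space ?I" and Hb: "L2_norm ?I H \<le> (t - s) * L2_norm ?I g"
    unfolding H_def[abs_def] using indefinite_integral_L2[OF u(3)] st by auto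
  obtain c0 where c0: "AE x in lebesgue_on ?I. u x = c0 + H x"
    using weak_deriv_imp_indefinite_integral[OF u(2,3) st] unfolding H_def by metis
  define c1 where "c1 = integral {s..t} H / of_real (t - s)"
  have kL: "(\<lambda>x. k) \<in> L2_space ?I" for k by (rule L2_const) simp
  have ortho: "L2_inner ?I (\<lambda>x. H x - c1) (\<lambda>x. 1) = 0"
  proof -
    have "L2_inner ?I (\<lambda>x. H x - c1) (\<lambda>x. 1) = integral {s..t} (\<lambda>x. H x - c1)"
      unfolding L2_inner_def using L2_Ioo_integral(2)[OF L2_diff[OF HL kL]] by simp
    also have "\<dots> = integral {s..t} H - integral {s..t} (\<lambda>x. c1)"
      by (rule indefinite_integral_diff[OF HL kL]) simp
    also have "\<dots> = 0" using st by (simp add: c1_def scaleR_conv_of_real)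
    finally show ?thesis .
  qed
  have "(L2_norm ?I (\<lambda>x. (H x - c1) + c1 * 1))\<^sup>2 = (L2_norm ?I (\<lambda>x. H x - c1))\<^sup>2
      + 2 * Re (L2_inner ?I (\<lambda>x. H x - c1) (\<lambda>x. c1 * 1)) + (L2_norm ?I (\<lambda>x. c1 * 1))\<^sup>2"
    by (intro L2_norm_add_power2 L2_diff HL kL L2_cmult)
  then have "(L2_norm ?I (\<lambda>x. H x - c1))\<^sup>2 \<le> (L2_norm ?I H)\<^sup>2"
    unfolding L2_inner_cmult_right ortho by simp
  then have "L2_norm ?I (\<lambda>x. H x - c1) \<le> L2_norm ?I H"
    by (rule power2_le_imp_le) simp
  also note Hb
  finally have b: "L2_norm ?I (\<lambda>x. H x - c1) \<le> (t - s) * L2_norm ?I g" .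
  have ae: "AE x in lebesgue_on ?I. u x - (c0 + c1) = H x - c1"
    using c0 by eventually_elim simp
  have m: "(\<lambda>x. u x - (c0 + c1)) \<in> borel_measurable (lebesgue_on ?I)" "(\<lambda>x. H x - c1) \<in> borel_measurable (lebesgue_on ?I)"
    by (intro L2_spaceD(1)[OF L2_diff] u kL HL)+
  show ?thesis
  proof (rule that[of "c0 + c1"])
    show "L2_norm ?I (\<lambda>x. u x - (c0 + c1)) \<le> (t - s) * L2_norm ?I g"
      using b unfolding L2_norm_cong_AE[OF m ae] .
    have "integral {s..t} (\<lambda>x. u x - (c0 + c1)) = (LINT x|lebesgue_on ?I. u x - (c0 + c1))"
      by (intro L2_Ioo_integral(2) L2_diff u kL)
    also have "\<dots> = (LINT x|lebesgue_on ?I. H x - c1)"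
      by (rule integral_cong_AE[OF m ae])
    also have "\<dots> = 0" using ortho by (simp add: L2_inner_def)
    finally show "integral {s..t} (\<lambda>x. u x - (c0 + c1)) = 0" .
  qed
qed

text \<open>The vanishing mean of the error makes the piecewise polynomials integrate to functions that agree
  at the nodes.\<close>

lemma polynomial_approximation:
  assumes st: "s < t" and D: "\<And>k. k \<le> Suc n \<Longrightarrow> D k \<in> L2_space {s<..<t}"
    and step: "\<And>k. k \<le> n \<Longrightarrow> has_weak_deriv {s<..<t} 1 (D k) (D (Suc k))"
  shows "\<exists>P. degree P \<le> n \<and> L2_norm {s<..<t} (\<lambda>x. D 0 x - poly P (of_real x)) \<le> (t - s) ^ Suc n * L2_norm {s<..<t} (D (Suc n))
    \<and> integral {s..t} (\<lambda>x. D 0 x - poly P (of_real x)) = 0"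
  using D step
proof (induction n arbitrary: D)
  case 0
  obtain c where "L2_norm {s<..<t} (\<lambda>x. D 0 x - c) \<le> (t - s) * L2_norm {s<..<t} (D 1)"
    "integral {s..t} (\<lambda>x. D 0 x - c) = 0"
    using wirtinger[of "D 0" s t "D 1"] 0 st by auto
  then show ?case by (intro exI[of _ "[:c:]"]) simp
next
  case (Suc n)
  let ?I = "{s<..<t}"
  \<comment> \<open>The derivative is approximated first, by the induction hypothesis for the
    shifted sequence. An antiderivative of its polynomial is then corrected by the mean of the
    error, at the cost of one more factor t - s.\<close>
  obtain P where P: "degree P \<le> n" "L2_norm ?I (\<lambda>x. D 1 x - poly P (of_real x)) \<le> (t - s) ^ Suc n * L2_norm ?I (D (Suc (Suc n)))"
    using Suc.IH[of "\<lambda>k. D (Suc k)"] Suc.prems by auto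
  obtain Q where Q: "pderiv Q = P" "degree Q \<le> Suc (degree P)" using poly_antiderivative_exists by metis
  have pL: "(\<lambda>x. poly R (complex_of_real x)) \<in> L2_space ?I" for R
    by (rule poly_L2) (auto intro: bounded_Ioo)
  have d: "has_weak_deriv ?I 1 (\<lambda>x. D 0 x - poly Q (of_real x)) (\<lambda>x. D 1 x - poly P (of_real x))"
    using has_weak_deriv_diff[OF Suc.prems(2)[of 0] poly_has_weak_deriv[OF st, of Q]] Q by simp
  have L: "(\<lambda>x. D 0 x - poly Q (of_real x)) \<in> L2_space ?I" "(\<lambda>x. D 1 x - poly P (of_real x)) \<in> L2_space ?I"
    using Suc.prems(1)[of 0] Suc.prems(1)[of 1] pL by (auto intro: L2_diff)
  obtain c where c: "L2_norm ?I (\<lambda>x. D 0 x - poly Q (of_real x) - c) \<le> (t - s) * L2_norm ?I (\<lambda>x. D 1 x - poly P (of_real x))"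
    "integral {s..t} (\<lambda>x. D 0 x - poly Q (of_real x) - c) = 0"
    using wirtinger[OF L(1) d L(2) st] by blast
  have "(t - s) * L2_norm ?I (\<lambda>x. D 1 x - poly P (of_real x)) \<le> (t - s) * ((t - s) ^ Suc n * L2_norm ?I (D (Suc (Suc n))))"
    using P(2) st by (intro mult_left_mono) auto
  then have "L2_norm ?I (\<lambda>x. D 0 x - poly (Q + [:c:]) (of_real x)) \<le> (t - s) ^ Suc (Suc n) * L2_norm ?I (D (Suc (Suc n)))"
    using c(1) by (simp add: diff_diff_eq mult.assoc)
  moreover have "degree (Q + [:c:]) \<le> Suc n"
    using P(1) Q(2) by (intro degree_add_le) auto
  ultimately show ?case using c(2) by (intro exI[of _ "Q + [:c:]"]) (simp add: diff_diff_eq)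
qed

section \<open>The finite element space through piecewise polynomial derivatives\<close>

locale fe_mesh =
  fixes a b h :: real and M l :: nat
  assumes ab: "a < b" and M: "1 \<le> M" and l: "1 \<le> l" and h_eq: "h = (b - a) / real M"
begin

abbreviation "node m \<equiv> a + real m * h"

abbreviation "elt m \<equiv> {a + (real m - 1) * h <..< a + real m * h}"

lemma h_pos: "0 < h" using ab M by (simp add: h_eq)

lemma node_M: "node M = b" using M by (simp add: h_eq)

lemma node_mono: "m \<le> n \<Longrightarrow> node m \<le> node n"
  using h_pos by (intro add_left_mono mult_right_mono) auto

lemma node_le_b: "m \<le> M \<Longrightarrow> node m \<le> b"
  using node_mono[of m M] node_M by simp

lemma elt_eq: "1 \<le> m \<Longrightarrow> elt m = {node (m - 1)<..<node m}"
  by (simp add: of_nat_diff)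

lemma elt_subset: "m \<in> {1..M} \<Longrightarrow> elt m \<subseteq> {a<..<b}"
  using node_le_b[of m] node_mono[of 0 "m - 1"] by (subst elt_eq) auto

lemma elt_unique:
  assumes "x \<in> elt m" "x \<in> elt n"
  shows "m = n"
proof -
  have "real m - 1 < (x - a) / h" "(x - a) / h < real m" "real n - 1 < (x - a) / h" "(x - a) / h < real n"
    using assms h_pos by (auto simp: pos_less_divide_eq pos_divide_less_eq)
  then show ?thesis by linarith
qed

lemma AE_elt: "AE x in lebesgue_on {a<..<b}. \<exists>m\<in>{1..M}. x \<in> elt m"
proof -
  have "AE x in lebesgue. x \<notin> node ` {0..M}"
    by (intro AE_not_in) (simp add: negligible_iff_null_sets[symmetric] negligible_finite)
  then have "AE x in lebesgue. x \<in> {a<..<b} \<longrightarrow> (\<exists>m\<in>{1..M}. x \<in> elt m)"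
  proof eventually_elim
    case (elim x)
    show ?case
    proof
      assume x: "x \<in> {a<..<b}"
      define m where "m = nat \<lceil>(x - a) / h\<rceil>"
      have pos: "0 < (x - a) / h" using x h_pos by simp
      then have mr: "real m = of_int \<lceil>(x - a) / h\<rceil>" unfolding m_def by simp
      have "(x - a) / h \<le> real m" "real m < (x - a) / h + 1" unfolding mr by linarith+
      then have 1: "x - a \<le> real m * h" "(real m - 1) * h < x - a"
        using h_pos by (auto simp: pos_divide_le_eq pos_less_divide_eq field_simps)
      have "0 < real m" using pos \<open>(x - a) / h \<le> real m\<close> by linarith
      have "(real m - 1) * h < real M * h" using 1(2) x node_M by (simp only: greaterThanLessThan_iff) linarith
      then have "real m - 1 < real M" using h_pos by simp
      then have mM: "m \<in> {1..M}" using \<open>0 < real m\<close> by auto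
      moreover have "x \<noteq> node m" using elim mM by auto
      ultimately show "\<exists>m\<in>{1..M}. x \<in> elt m" using 1 by (intro bexI[of _ m]) auto
    qed
  qed
  then show ?thesis by (simp add: AE_restrict_space_iff)
qed

text \<open>Piecewise polynomials with no continuity across the nodes, in the role of derivatives of
  finite element functions. The value 0 at the nodes is immaterial, as these form a null
  set.\<close>

definition pwpoly :: "(nat \<Rightarrow> complex poly) \<Rightarrow> real \<Rightarrow> complex" where
  "pwpoly q x = (\<Sum>m=1..M. indicator (elt m) x * poly (q m) (of_real x))"

lemma pwpoly_eq:
  assumes "m \<in> {1..M}" "x \<in> elt m"
  shows "pwpoly q x = poly (q m) (of_real x)"
proof -
  have "pwpoly q x = (\<Sum>k\<in>{m}. indicator (elt k) x * poly (q k) (of_real x))"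
    unfolding pwpoly_def
  proof (intro sum.mono_neutral_right ballI)
    fix k assume "k \<in> {1..M} - {m}"
    then have "x \<notin> elt k" using elt_unique[OF assms(2), of k] by blast
    then show "indicator (elt k) x * poly (q k) (complex_of_real x) = 0" by simp
  qed (use assms in auto)
  also have "\<dots> = indicator (elt m) x * poly (q m) (of_real x)"
    by (subst sum.insert) simp_all
  finally show ?thesis using assms by simp
qed

lemma indicator_poly_L2: "(\<lambda>x. indicator (elt m) x * poly Q (complex_of_real x)) \<in> L2_space {a<..<b}"
proof (rule L2_mult_bounded[OF poly_L2, where C=1])
  show "indicator (elt m) \<in> borel_measurable (lebesgue_on {a<..<b})"
    by (intro measurable_restrict_space1 borel_measurable_indicator) auto
qed (auto simp: indicator_def intro: bounded_Ioo)

lemma pwpoly_L2: "pwpoly q \<in> L2_space {a<..<b}"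
  unfolding pwpoly_def[abs_def] by (intro L2_sum indicator_poly_L2)

lemma L2_norm_elements:
  assumes f: "f \<in> L2_space {a<..<b}"
  shows "(L2_norm {a<..<b} f)\<^sup>2 = (\<Sum>m=1..M. (L2_norm (elt m) f)\<^sup>2)"
proof -
  have "(L2_norm {a<..<node n} f)\<^sup>2 = (\<Sum>m=1..n. (L2_norm (elt m) f)\<^sup>2)" if "n \<le> M" for n
    using that
  proof (induction n)
    case 0
    have "L2_norm {} f = 0" by (simp add: L2_norm_eq)
    then show ?case by simp
  next
    case (Suc n)
    have "(L2_norm {a<..<node (Suc n)} f)\<^sup>2 = (L2_norm {a<..<node n} f)\<^sup>2 + (L2_norm {node n<..<node (Suc n)} f)\<^sup>2"
    proof (rule L2_norm_Ioo_split)
      show "f \<in> L2_space {a<..<node (Suc n)}" using node_le_b[OF Suc.prems] by (intro L2_Ioo_subinterval[OF f]) auto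
      show "a \<le> node n" using h_pos by simp
      show "node n \<le> node (Suc n)" by (rule node_mono) simp
    qed
    then show ?case using Suc elt_eq[of "Suc n"] by simp
  qed
  from this[of M] show ?thesis by (simp only: node_M order_refl)
qed

lemma integral_elements_zero:
  assumes f: "f \<in> L2_space {a<..<b}" and z: "\<And>m. m \<in> {1..M} \<Longrightarrow> integral {node (m - 1)..node m} f = 0"
  shows "integral {a..b} f = 0"
proof -
  have "integral {a..node n} f = 0" if "n \<le> M" for n
    using that
  proof (induction n)
    case (Suc n)
    have "integral {a..node n} f + integral {node n..node (Suc n)} f = integral {a..node (Suc n)} f"
    proof (rule Henstock_Kurzweil_Integration.integral_combine)
      show "a \<le> node n" using h_pos by simp
      show "node n \<le> node (Suc n)" by (rule node_mono) simp
      show "f integrable_on {a..node (Suc n)}" using node_le_b[OF Suc.prems] by (intro L2_Ioo_integrable_on[OF f]) auto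
    qed
    then show ?case using Suc z[of "Suc n"] by simp
  qed simp
  from this[of M] show ?thesis by (simp only: node_M order_refl)
qed

text \<open>The element of the space is already known to be weakly differentiable on the whole
  interval, so no jump terms arise; the derivative is identified on each element by uniqueness and
  assembled off the nodes.\<close>

lemma fe_space_weak_deriv:
  assumes \<eta>: "\<eta> \<in> fe_space a b M l"
  obtains q where "\<And>m. degree (q m) < l" "AE x in lebesgue_on {a<..<b}. weak_deriv {a<..<b} 1 \<eta> x = pwpoly q x"
proof -
  let ?g = "weak_deriv {a<..<b} 1 \<eta>"
  have g: "has_weak_deriv {a<..<b} 1 \<eta> ?g"
    using \<eta> sobolevD(1)[OF H1_zero_sobolev ab, of \<eta> 1] by (simp add: fe_space_def)
  \<comment> \<open>Indices outside the mesh receive the zero polynomial, so that the choice of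
    polynomials is total and the degree bound holds for every index.\<close>
  have "\<exists>P. degree P \<le> l \<and> (m \<in> {1..M} \<longrightarrow> (\<forall>x\<in>elt m. \<eta> x = poly P (of_real x)))" for m
    using \<eta> unfolding fe_space_def h_eq[symmetric] by (cases "m \<in> {1..M}") (auto intro: exI[of _ 0])
  then obtain P where P: "\<And>m. degree (P m) \<le> l" "\<And>m x. m \<in> {1..M} \<Longrightarrow> x \<in> elt m \<Longrightarrow> \<eta> x = poly (P m) (of_real x)"
    by metis
  define q where "q m = pderiv (P m)" for m
  have deg: "degree (q m) < l" for m using P(1)[of m] l by (simp add: q_def degree_pderiv)
  have "AE x in lebesgue_on (elt m). ?g x = poly (q m) (of_real x)" if m: "m \<in> {1..M}" for m
  proof (rule has_weak_deriv_AE_unique)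
    show lt: "a + (real m - 1) * h < a + real m * h" using h_pos by simp
    have "has_weak_deriv (elt m) 1 \<eta> ?g"
      by (rule has_weak_deriv_restrict[OF g elt_subset[OF m]]) simp
    then show "has_weak_deriv (elt m) 1 (\<lambda>x. poly (P m) (of_real x)) ?g"
      by (rule has_weak_deriv_cong_AE) (use P(2)[OF m] in \<open>auto intro!: AE_I2\<close>)
    show "has_weak_deriv (elt m) 1 (\<lambda>x. poly (P m) (of_real x)) (\<lambda>x. poly (q m) (of_real x))"
      unfolding q_def by (rule poly_has_weak_deriv[OF lt])
  qed
  then have "AE x in lebesgue. m \<in> {1..M} \<longrightarrow> x \<in> elt m \<longrightarrow> ?g x = poly (q m) (of_real x)" for m
    by (cases "m \<in> {1..M}") (simp_all add: AE_restrict_space_iff)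
  then have "AE x in lebesgue. \<forall>m. m \<in> {1..M} \<longrightarrow> x \<in> elt m \<longrightarrow> ?g x = poly (q m) (of_real x)"
    unfolding AE_all_countable by blast
  then have "AE x in lebesgue_on {a<..<b}. \<forall>m. m \<in> {1..M} \<longrightarrow> x \<in> elt m \<longrightarrow> ?g x = poly (q m) (of_real x)"
    by (simp add: AE_restrict_space_iff) (auto elim: eventually_mono)
  with AE_elt have "AE x in lebesgue_on {a<..<b}. ?g x = pwpoly q x"
  proof eventually_elim
    case (elim x)
    then obtain m where m: "m \<in> {1..M}" "x \<in> elt m" by blast
    then show ?case using elim(2) pwpoly_eq[OF m] by simp
  qed
  then show ?thesis using that deg by blast
qed

text \<open>The converse direction: integrating from a makes the function continuous at the nodes,
  and the zero mean is the boundary condition at b. Up to null sets, the space consists of the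
  primitives of piecewise polynomials of degree below l with mean zero.\<close>

lemma pwpoly_antiderivative_fe_space:
  assumes deg: "\<And>m. degree (q m) < l" and z: "integral {a..b} (pwpoly q) = 0"
  shows "(\<lambda>x. integral {a..x} (pwpoly q)) \<in> fe_space a b M l"
    and "has_weak_deriv {a<..<b} 1 (\<lambda>x. integral {a..x} (pwpoly q)) (pwpoly q)"
proof -
  let ?r = "\<lambda>x. integral {a..x} (pwpoly q)"
  show "has_weak_deriv {a<..<b} 1 ?r (pwpoly q)"
    by (rule has_weak_deriv_AE_indefinite_integral(1)[OF pwpoly_L2 ab]) simp
  show "?r \<in> fe_space a b M l"
    unfolding fe_space_def h_eq[symmetric]
  proof (intro CollectI conjI ballI)
    show "?r \<in> H1_zero {a<..<b}"
      by (rule H1_zeroI[OF pwpoly_L2 ab _ z]) simp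
    show "continuous_on {a..b} ?r"
      by (intro indefinite_integral_continuous_1 L2_Ioo_integrable_on[OF pwpoly_L2]) auto
    fix m assume m: "m \<in> {1..M}"
    obtain Q where Q: "pderiv Q = q m" "degree Q \<le> Suc (degree (q m))"
      using poly_antiderivative_exists by metis
    define \<alpha> where "\<alpha> = a + (real m - 1) * h"
    have \<alpha>: "a \<le> \<alpha>" using m h_pos by (simp add: \<alpha>_def)
    let ?R = "Q + [: ?r \<alpha> - poly Q (of_real \<alpha>) :]"
    have "?r x = poly ?R (of_real x)" if x: "x \<in> elt m" for x
    proof -
      have xb: "\<alpha> < x" "x < b" using x elt_subset[OF m] by (auto simp: \<alpha>_def)
      have "?r \<alpha> + integral {\<alpha>..x} (pwpoly q) = ?r x"
        using \<alpha> xb by (intro Henstock_Kurzweil_Integration.integral_combine L2_Ioo_integrable_on[OF pwpoly_L2]) auto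
      moreover have "integral {\<alpha>..x} (pwpoly q) = integral {\<alpha>..x} (\<lambda>y. poly (q m) (of_real y))"
      proof (rule integral_spike[of "{\<alpha>}"])
        fix y assume "y \<in> {\<alpha>..x} - {\<alpha>}"
        then have "y \<in> elt m" using x by (auto simp: \<alpha>_def)
        then show "poly (q m) (of_real y) = pwpoly q y" using pwpoly_eq[OF m] by simp
      qed simp
      moreover have "integral {\<alpha>..x} (\<lambda>y. poly (q m) (of_real y)) = poly Q (of_real x) - poly Q (of_real \<alpha>)"
        unfolding Q(1)[symmetric] using xb
        by (intro integral_unique fundamental_theorem_of_calculus poly_has_vector_derivative) auto
      ultimately show ?thesis by (simp add: algebra_simps)
    qed
    moreover have "degree ?R \<le> l"
      using Q(2) deg[of m] l by (intro degree_add_le) auto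
    ultimately show "\<exists>P. degree P \<le> l \<and> (\<forall>x\<in>elt m. ?r x = poly P (of_real x))" by blast
  qed
qed

text \<open>The derivative of v is projected in L2 onto all piecewise polynomials of degree below l,
  spanned by monomials on single elements. As l >= 1 the constants belong to this span, so the
  residual has mean zero, the projection inherits the zero mean of the derivative of v, and its
  primitive lies in the finite element space.\<close>

lemma ritz_projection_exists:
  assumes v: "v \<in> H1_zero {a<..<b}"
  shows "\<exists>r. is_ritz_projection a b M l v r"
proof -
  let ?S = "{a<..<b}"
  let ?g = "weak_deriv ?S 1 v"
  have g: "?g \<in> L2_space ?S" using sobolevD(2)[OF H1_zero_sobolev[OF v] ab, of 1] by simp
  define u where "u i x = indicator (elt (fst i)) x * complex_of_real x ^ snd i" for i x
  let ?I = "{1..M} \<times> {..<l}"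
  have uL: "u i \<in> L2_space ?S" for i
    using indicator_poly_L2[of "fst i" "monom 1 (snd i)"] by (simp add: u_def[abs_def] poly_monom)
  obtain c where c: "\<And>i. i \<in> ?I \<Longrightarrow> L2_inner ?S (\<lambda>x. ?g x - (\<Sum>j\<in>?I. c j * u j x)) (u i) = 0"
    using L2_projection_exists[of ?I u ?S ?g] uL g by blast
  define q where "q m = (\<Sum>j<l. monom (c (m, j)) j)" for m
  have pw: "pwpoly q x = (\<Sum>j\<in>?I. c j * u j x)" for x
    unfolding pwpoly_def q_def u_def
    unfolding sum.cartesian_product' by (intro sum.cong refl) (simp add: poly_sum poly_monom sum_distrib_left sum_distrib_right mult_ac)
  have degq: "degree (q m) < l" for m
  proof -
    have "degree (q m) \<le> l - 1"
      unfolding q_def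
    proof (rule degree_sum_le)
      fix j assume "j \<in> {..<l}"
      then have "j \<le> l - 1" by simp
      then show "degree (monom (c (m, j)) j) \<le> l - 1"
        by (rule order_trans[OF degree_monom_le])
    qed simp
    then show ?thesis using l by simp
  qed
  let ?w = "pwpoly q"
  have dL: "(\<lambda>x. ?g x - ?w x) \<in> L2_space ?S" by (rule L2_diff[OF g pwpoly_L2])
  have orth: "L2_inner ?S (\<lambda>x. ?g x - ?w x) (pwpoly p) = 0" if p: "\<And>m. degree (p m) < l" for p
  proof -
    have "pwpoly p = (\<lambda>x. \<Sum>i\<in>?I. coeff (p (fst i)) (snd i) * u i x)"
    proof
      fix x
      have "poly (p m) (complex_of_real x) = (\<Sum>j<l. coeff (p m) j * complex_of_real x ^ j)" for m
        unfolding poly_altdef using p[of m] by (intro sum.mono_neutral_left) (auto simp: coeff_eq_0)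
      then show "pwpoly p x = (\<Sum>i\<in>?I. coeff (p (fst i)) (snd i) * u i x)"
        unfolding pwpoly_def u_def sum.cartesian_product'
        by (intro sum.cong refl) (simp add: sum_distrib_left sum_distrib_right mult_ac)
    qed
    then have "L2_inner ?S (\<lambda>x. ?g x - ?w x) (pwpoly p)
        = cnj (L2_inner ?S (\<lambda>x. \<Sum>i\<in>?I. coeff (p (fst i)) (snd i) * u i x) (\<lambda>x. ?g x - ?w x))"
      by (subst L2_inner_commute) simp
    also have "L2_inner ?S (\<lambda>x. \<Sum>i\<in>?I. coeff (p (fst i)) (snd i) * u i x) (\<lambda>x. ?g x - ?w x)
        = (\<Sum>i\<in>?I. coeff (p (fst i)) (snd i) * L2_inner ?S (u i) (\<lambda>x. ?g x - ?w x))"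
      by (subst L2_inner_sum_left) (rule dL | rule L2_cmult[OF uL] | simp add: L2_inner_cmult_left)+
    also have "\<dots> = 0"
    proof (rule sum.neutral, rule ballI)
      fix i assume "i \<in> ?I"
      then have "L2_inner ?S (u i) (\<lambda>x. ?g x - ?w x) = 0"
        using c by (subst L2_inner_commute) (simp add: pw)
      then show "coeff (p (fst i)) (snd i) * L2_inner ?S (u i) (\<lambda>x. ?g x - ?w x) = 0" by simp
    qed
    finally show ?thesis by simp
  qed
  have "integral {a..b} (\<lambda>x. ?g x - ?w x) = (LINT x|lebesgue_on ?S. ?g x - ?w x)"
    by (rule L2_Ioo_integral(2)[OF dL])
  also have "\<dots> = L2_inner ?S (\<lambda>x. ?g x - ?w x) (\<lambda>x. 1)" by (simp add: L2_inner_def)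
  also have "\<dots> = L2_inner ?S (\<lambda>x. ?g x - ?w x) (pwpoly (\<lambda>m. [:1:]))"
  proof (rule L2_inner_cong_AE)
    show "AE x in lebesgue_on ?S. 1 = pwpoly (\<lambda>m. [:1:]) x"
      using AE_elt
    proof eventually_elim
      case (elim x)
      then obtain m where "m \<in> {1..M}" "x \<in> elt m" by blast
      from pwpoly_eq[OF this] show ?case by simp
    qed
  qed (rule L2_spaceD(1)[OF dL] L2_spaceD(1)[OF pwpoly_L2] refl | simp)+
  also have "\<dots> = 0" using l by (intro orth) auto
  finally have "integral {a..b} ?w = 0"
    using indefinite_integral_diff[OF g pwpoly_L2, of b q] H1_zeroD(2)[OF v ab] by simp
  note r = pwpoly_antiderivative_fe_space[OF degq this]
  have "is_ritz_projection a b M l v (\<lambda>x. integral {a..x} ?w)"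
    unfolding is_ritz_projection_def
  proof (intro conjI ballI r(1))
    fix \<eta> assume \<eta>: "\<eta> \<in> fe_space a b M l"
    obtain p where p: "\<And>m. degree (p m) < l" "AE x in lebesgue_on ?S. weak_deriv ?S 1 \<eta> x = pwpoly p x"
      using fe_space_weak_deriv[OF \<eta>] by metis
    have \<eta>L: "weak_deriv ?S 1 \<eta> \<in> L2_space ?S"
      using \<eta> sobolevD(2)[OF H1_zero_sobolev ab, of \<eta> 1] by (simp add: fe_space_def)
    have "L2_inner ?S (weak_deriv ?S 1 (\<lambda>x. integral {a..x} ?w)) (weak_deriv ?S 1 \<eta>) = L2_inner ?S ?w (pwpoly p)"
      using weak_deriv_L2[OF ab r(2) pwpoly_L2] \<eta>L
      by (intro L2_inner_cong_AE weak_deriv_AE_eq[OF ab r(2)] p(2) L2_spaceD(1)) (auto intro: pwpoly_L2)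
    also have "\<dots> = L2_inner ?S ?g (pwpoly p)"
      using orth[of p, OF p(1)] by (simp only: L2_inner_diff_left[OF g pwpoly_L2 pwpoly_L2] eq_iff_diff_eq_0[symmetric])
    also have "\<dots> = L2_inner ?S ?g (weak_deriv ?S 1 \<eta>)"
      using p(2) g \<eta>L by (intro L2_inner_cong_AE L2_spaceD(1)) (auto intro: pwpoly_L2 elim: eventually_mono)
    finally show "L2_inner ?S (weak_deriv ?S 1 (\<lambda>x. integral {a..x} ?w)) (weak_deriv ?S 1 \<eta>)
        = L2_inner ?S ?g (weak_deriv ?S 1 \<eta>)" .
  qed
  then show ?thesis by blast
qed

text \<open>The derivative of v is approximated on each element and the result is integrated.
  Writing the exponent as n + 1, polynomials of degree n <= l - 1 are admissible derivatives, and
  the error involves the derivative of v of order n + 2 <= q; this is the origin of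
  \<open>min l (q - 1)\<close>. If the exponent is 0, the zero function will do.\<close>

lemma H1_approximation:
  assumes v: "v \<in> H1_zero {a<..<b}" "v \<in> sobolev {a<..<b} q" and q: "1 \<le> q"
  obtains \<zeta> where "\<zeta> \<in> fe_space a b M l"
    "H1_seminorm {a<..<b} (\<lambda>x. v x - \<zeta> x) \<le> h ^ min l (q - 1) * sobolev_norm {a<..<b} q v"
proof (cases "min l (q - 1)")
  case 0
  have "(\<lambda>x. 0) \<in> fe_space a b M l"
    using H1_zero_zero[OF ab] by (auto simp: fe_space_def intro!: exI[of _ 0])
  moreover have "H1_seminorm {a<..<b} (\<lambda>x. v x - 0) \<le> h ^ min l (q - 1) * sobolev_norm {a<..<b} q v"
    using L2_norm_weak_deriv_le_sobolev_norm[OF q, of "{a<..<b}" v] unfolding 0 by (simp add: H1_seminorm_def)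
  ultimately show ?thesis by (rule that)
next
  case (Suc n)
  let ?S = "{a<..<b}"
  have n: "Suc n \<le> l" "Suc (Suc n) \<le> q" using Suc by linarith+
  define D where "D k = weak_deriv ?S (Suc k) v" for k
  have DL: "D k \<in> L2_space ?S" "has_weak_deriv ?S (Suc k) v (D k)" if "k \<le> Suc n" for k
    unfolding D_def using sobolevD[OF v(2) ab, of "Suc k"] n that by auto
  have step: "has_weak_deriv ?S 1 (D k) (D (Suc k))" if "k \<le> n" for k
    using DL(2)[of k] DL(2)[of "Suc k"] that by (intro has_weak_deriv_step) auto
  \<comment> \<open>\<open>D k\<close> is the weak derivative of order k + 1, so \<open>D 0\<close>
    is the function to be approximated. The estimates are claimed on the M elements only, but the
    degree bound for all indices, as \<open>pwpoly_antiderivative_fe_space\<close> demands.\<close>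
  define good where "good m P \<longleftrightarrow> degree P \<le> n \<and> (m \<in> {1..M} \<longrightarrow>
      L2_norm (elt m) (\<lambda>x. D 0 x - poly P (of_real x)) \<le> h ^ Suc n * L2_norm (elt m) (D (Suc n))
      \<and> integral {node (m - 1)..node m} (\<lambda>x. D 0 x - poly P (of_real x)) = 0)" for m P
  have ex: "\<exists>P. good m P" for m
  proof (cases "m \<in> {1..M}")
    case True
    have e: "elt m = {node (m - 1)<..<node m}" using True by (intro elt_eq) auto
    have len: "node m - node (m - 1) = h" using True by (simp add: of_nat_diff algebra_simps)
    have "\<exists>P. degree P \<le> n \<and> L2_norm {node (m - 1)<..<node m} (\<lambda>x. D 0 x - poly P (of_real x)) \<le> (node m - node (m - 1)) ^ Suc n * L2_norm {node (m - 1)<..<node m} (D (Suc n))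
      \<and> integral {node (m - 1)..node m} (\<lambda>x. D 0 x - poly P (of_real x)) = 0"
    proof (rule polynomial_approximation)
      show "node (m - 1) < node m" using len h_pos by linarith
      show "D k \<in> L2_space {node (m - 1)<..<node m}" if "k \<le> Suc n" for k
        unfolding e[symmetric] by (rule L2_subset[OF DL(1)[OF that] elt_subset[OF True]]) auto
      show "has_weak_deriv {node (m - 1)<..<node m} 1 (D k) (D (Suc k))" if "k \<le> n" for k
        by (rule has_weak_deriv_restrict[OF step[OF that]]) (use elt_subset[OF True] e in auto)
    qed
    then show ?thesis unfolding good_def e len by blast
  qed (auto simp: good_def intro: exI[of _ 0])
  define P where "P m = (SOME P. good m P)" for m
  have "good m (P m)" for m unfolding P_def by (rule someI_ex[OF ex])
  then have P: "\<And>m. degree (P m) \<le> n"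
    "\<And>m. m \<in> {1..M} \<Longrightarrow> L2_norm (elt m) (\<lambda>x. D 0 x - poly (P m) (of_real x)) \<le> h ^ Suc n * L2_norm (elt m) (D (Suc n))"
    "\<And>m. m \<in> {1..M} \<Longrightarrow> integral {node (m - 1)..node m} (\<lambda>x. D 0 x - poly (P m) (of_real x)) = 0"
    unfolding good_def by blast+
  let ?w = "pwpoly P"
  have degP: "degree (P m) < l" for m using P(1)[of m] n by simp
  have D0: "D 0 \<in> L2_space ?S" by (rule DL(1)) simp
  have dL: "(\<lambda>x. D 0 x - ?w x) \<in> L2_space ?S" by (rule L2_diff[OF D0 pwpoly_L2])
  have "integral {a..b} (\<lambda>x. D 0 x - ?w x) = 0"
  proof (rule integral_elements_zero[OF dL])
    fix m assume m: "m \<in> {1..M}"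
    have "integral {node (m - 1)..node m} (\<lambda>x. D 0 x - ?w x) = integral {node (m - 1)..node m} (\<lambda>x. D 0 x - poly (P m) (of_real x))"
    proof (rule integral_spike[of "{node (m - 1), node m}"])
      fix x assume "x \<in> {node (m - 1)..node m} - {node (m - 1), node m}"
      then have "x \<in> elt m" using m by (subst elt_eq) auto
      then show "D 0 x - poly (P m) (of_real x) = D 0 x - ?w x" using pwpoly_eq[OF m] by simp
    qed simp
    then show "integral {node (m - 1)..node m} (\<lambda>x. D 0 x - ?w x) = 0" using P(3)[OF m] by simp
  qed
  moreover have "integral {a..b} (D 0) = 0" using H1_zeroD(2)[OF v(1) ab] by (simp add: D_def)
  ultimately have "integral {a..b} ?w = 0"
    using indefinite_integral_diff[OF D0 pwpoly_L2, of b P] by simp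
  note r = pwpoly_antiderivative_fe_space[OF degP this]
  let ?r = "\<lambda>x. integral {a..x} ?w"
  have "has_weak_deriv ?S 1 (\<lambda>x. v x - ?r x) (\<lambda>x. D 0 x - ?w x)"
    using DL(2)[of 0] by (intro has_weak_deriv_diff r(2)) auto
  then have "H1_seminorm ?S (\<lambda>x. v x - ?r x) = L2_norm ?S (\<lambda>x. D 0 x - ?w x)"
    unfolding H1_seminorm_def by (rule L2_norm_weak_deriv[OF ab _ dL])
  also have "\<dots> \<le> h ^ Suc n * L2_norm ?S (D (Suc n))"
  proof (rule power2_le_imp_le)
    have "(L2_norm ?S (\<lambda>x. D 0 x - ?w x))\<^sup>2 = (\<Sum>m=1..M. (L2_norm (elt m) (\<lambda>x. D 0 x - ?w x))\<^sup>2)"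
      by (rule L2_norm_elements[OF dL])
    also have "\<dots> = (\<Sum>m=1..M. (L2_norm (elt m) (\<lambda>x. D 0 x - poly (P m) (of_real x)))\<^sup>2)"
      using pwpoly_eq by (intro sum.cong refl arg_cong[where f="\<lambda>x. x\<^sup>2"] L2_norm_cong) auto
    also have "\<dots> \<le> (\<Sum>m=1..M. (h ^ Suc n * L2_norm (elt m) (D (Suc n)))\<^sup>2)"
      by (intro sum_mono power_mono P(2)) auto
    also have "\<dots> = (h ^ Suc n)\<^sup>2 * (\<Sum>m=1..M. (L2_norm (elt m) (D (Suc n)))\<^sup>2)"
      unfolding power_mult_distrib sum_distrib_left ..
    also have "\<dots> = (h ^ Suc n)\<^sup>2 * (L2_norm ?S (D (Suc n)))\<^sup>2"
      by (subst L2_norm_elements[OF DL(1)]) auto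
    finally show "(L2_norm ?S (\<lambda>x. D 0 x - ?w x))\<^sup>2 \<le> (h ^ Suc n * L2_norm ?S (D (Suc n)))\<^sup>2"
      unfolding power_mult_distrib .
    show "0 \<le> h ^ Suc n * L2_norm ?S (D (Suc n))" using h_pos by simp
  qed
  also have "\<dots> \<le> h ^ Suc n * sobolev_norm ?S q v"
    unfolding D_def using n h_pos by (intro mult_left_mono L2_norm_weak_deriv_le_sobolev_norm) auto
  finally show ?thesis using that[OF r(1)] Suc by simp
qed

end

section \<open>Errors of the Ritz projection and their discrete derivative\<close>

lemma norm_one_minus_exp_le:
  assumes "0 \<le> Re z"
  shows "norm (1 - exp (- z)) \<le> norm z"
proof -
  have "norm (exp 0 - exp (- z)) \<le> 1 * norm (0 - (- z))"
  proof (rule field_differentiable_bound[of "{w. Re w \<le> 0}"])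
    show "convex {w. Re w \<le> 0}" by (rule convex_halfspace_Re_le)
    show "(exp has_field_derivative exp w) (at w within {w. Re w \<le> 0})" for w :: complex
      by (rule has_field_derivative_at_within[OF DERIV_exp])
  qed (use assms in \<open>auto simp: norm_exp_eq_Re\<close>)
  then show ?thesis by simp
qed

context fk_setting
begin

lemma H1_pythagoras:
  assumes u: "u \<in> H1_zero \<Omega>" and w: "w \<in> H1_zero \<Omega>"
    and orth: "L2_inner \<Omega> (weak_deriv \<Omega> 1 u) (weak_deriv \<Omega> 1 w) = 0"
  shows "(H1_seminorm \<Omega> (\<lambda>x. u x - w x))\<^sup>2 = (H1_seminorm \<Omega> u)\<^sup>2 + (H1_seminorm \<Omega> w)\<^sup>2"
proof -
  let ?u = "weak_deriv \<Omega> 1 u" and ?w = "weak_deriv \<Omega> 1 w"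
  have d: "has_weak_deriv \<Omega> 1 (\<lambda>x. u x - w x) (\<lambda>x. ?u x - ?w x)"
    by (intro has_weak_deriv_diff sobolevD(1)[OF H1_zero_sobolev ab] u w) auto
  have L: "?u \<in> L2_space \<Omega>" "?w \<in> L2_space \<Omega>" by (intro H1_zero_weak_deriv_L2 u w)+
  have "H1_seminorm \<Omega> (\<lambda>x. u x - w x) = L2_norm \<Omega> (\<lambda>x. ?u x - ?w x)"
    unfolding H1_seminorm_def by (rule L2_norm_weak_deriv[OF ab d L2_diff[OF L]])
  moreover have "(L2_norm \<Omega> (\<lambda>x. ?u x - ?w x))\<^sup>2 = (L2_norm \<Omega> ?u)\<^sup>2
      + 2 * Re (L2_inner \<Omega> ?u (\<lambda>x. (-1) * ?w x)) + (L2_norm \<Omega> (\<lambda>x. (-1) * ?w x))\<^sup>2"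
    using L2_norm_add_power2[OF L(1) L2_cmult[OF L(2), of "-1"]]
    by (simp only: mult_minus1 add_uminus_conv_diff)
  moreover have "L2_inner \<Omega> ?u (\<lambda>x. (-1) * ?w x) = cnj (-1) * 0"
    by (simp only: L2_inner_cmult_right orth)
  moreover have "L2_norm \<Omega> (\<lambda>x. (-1) * ?w x) = norm (-1 :: complex) * L2_norm \<Omega> ?w"
    by (rule L2_norm_cmult)
  ultimately show ?thesis by (simp only: H1_seminorm_def) simp
qed

text \<open>The projections at the different time levels are chosen independently. Linearity shows
  that an increment of the projection error is the projection error of an increment of G, to which
  the Ritz estimate applies.\<close>

lemma ritz_diff:
  assumes "u \<in> H1_zero \<Omega>" "v \<in> H1_zero \<Omega>" "is_ritz_projection a b M l u r" "is_ritz_projection a b M l v s"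
  shows "is_ritz_projection a b M l (\<lambda>x. u x - v x) (\<lambda>x. r x - s x)"
  unfolding is_ritz_projection_def
proof (intro conjI ballI)
  have fe: "r \<in> fe_space a b M l" "s \<in> fe_space a b M l"
    using assms by (auto simp: is_ritz_projection_def)
  then show "(\<lambda>x. r x - s x) \<in> fe_space a b M l" by (rule fe_space_diff)
  fix \<eta> assume \<eta>: "\<eta> \<in> fe_space a b M l"
  note L = H1_zero_weak_deriv_L2[OF fe_space_H1[OF \<eta>]]
  show "L2_inner \<Omega> (weak_deriv \<Omega> 1 (\<lambda>x. r x - s x)) (weak_deriv \<Omega> 1 \<eta>)
      = L2_inner \<Omega> (weak_deriv \<Omega> 1 (\<lambda>x. u x - v x)) (weak_deriv \<Omega> 1 \<eta>)"
    unfolding inner_weak_deriv_diff[OF fe_space_H1[OF fe(1)] fe_space_H1[OF fe(2)] L]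
      inner_weak_deriv_diff[OF assms(1,2) L]
    using assms(3,4) \<eta> by (simp only: is_ritz_projection_def)
qed

lemma ritz_orthogonal:
  assumes v: "v \<in> H1_zero \<Omega>" and r: "is_ritz_projection a b M l v r" and \<eta>: "\<eta> \<in> fe_space a b M l"
  shows "L2_inner \<Omega> (weak_deriv \<Omega> 1 (\<lambda>x. v x - r x)) (weak_deriv \<Omega> 1 \<eta>) = 0"
proof -
  have "r \<in> fe_space a b M l" using r by (simp add: is_ritz_projection_def)
  then show ?thesis
    using r \<eta> inner_weak_deriv_diff[OF v fe_space_H1 H1_zero_weak_deriv_L2[OF fe_space_H1[OF \<eta>]]]
    by (simp only: is_ritz_projection_def) simp
qed

text \<open>By orthogonality the projection is the best approximation in the seminorm. The L2 bound
  follows from Poincare's inequality with constant (b - a) / sqrt 8; it has the same power of the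
  mesh size as the seminorm, which is the power in the final rate.\<close>

lemma ritz_error:
  assumes v: "v \<in> H1_zero \<Omega>" "v \<in> sobolev \<Omega> q" and q: "1 \<le> q" and M: "1 \<le> M" and l: "1 \<le> l"
    and r: "is_ritz_projection a b M l v r"
  shows "H1_seminorm \<Omega> (\<lambda>x. v x - r x) \<le> ((b - a) / real M) ^ min l (q - 1) * sobolev_norm \<Omega> q v"
    and "L2_norm \<Omega> (\<lambda>x. v x - r x)
      \<le> (b - a) / sqrt 8 * ((b - a) / real M) ^ min l (q - 1) * sobolev_norm \<Omega> q v"
proof -
  interpret fe_mesh a b "(b - a) / real M" M l by unfold_locales (use ab M l in auto)
  have rfe: "r \<in> fe_space a b M l" using r by (simp add: is_ritz_projection_def)
  obtain \<zeta> where \<zeta>: "\<zeta> \<in> fe_space a b M l"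
    "H1_seminorm \<Omega> (\<lambda>x. v x - \<zeta> x) \<le> ((b - a) / real M) ^ min l (q - 1) * sobolev_norm \<Omega> q v"
    using H1_approximation[OF v q] by blast
  have "(H1_seminorm \<Omega> (\<lambda>x. (v x - r x) - (\<zeta> x - r x)))\<^sup>2
      = (H1_seminorm \<Omega> (\<lambda>x. v x - r x))\<^sup>2 + (H1_seminorm \<Omega> (\<lambda>x. \<zeta> x - r x))\<^sup>2"
    by (intro H1_pythagoras H1_zero_diff v fe_space_H1[OF rfe] fe_space_H1[OF \<zeta>(1)] ab
        ritz_orthogonal[OF v(1) r] fe_space_diff \<zeta>(1) rfe)
  then have "(H1_seminorm \<Omega> (\<lambda>x. v x - r x))\<^sup>2 \<le> (H1_seminorm \<Omega> (\<lambda>x. v x - \<zeta> x))\<^sup>2" by simp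
  then have "H1_seminorm \<Omega> (\<lambda>x. v x - r x) \<le> H1_seminorm \<Omega> (\<lambda>x. v x - \<zeta> x)"
    by (rule power2_le_imp_le) (simp add: H1_seminorm_def)
  with \<zeta>(2) show 1: "H1_seminorm \<Omega> (\<lambda>x. v x - r x) \<le> ((b - a) / real M) ^ min l (q - 1) * sobolev_norm \<Omega> q v"
    by linarith
  have "L2_norm \<Omega> (\<lambda>x. v x - r x) \<le> (b - a) / sqrt 8 * H1_seminorm \<Omega> (\<lambda>x. v x - r x)"
    by (intro poincare H1_zero_diff v fe_space_H1[OF rfe] ab)
  also have "\<dots> \<le> (b - a) / sqrt 8 * (((b - a) / real M) ^ min l (q - 1) * sobolev_norm \<Omega> q v)"
    using 1 ab by (intro mult_left_mono) auto
  finally show "L2_norm \<Omega> (\<lambda>x. v x - r x)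
      \<le> (b - a) / sqrt 8 * ((b - a) / real M) ^ min l (q - 1) * sobolev_norm \<Omega> q v"
    by (simp only: mult.assoc)
qed

text \<open>With e = exp(-(lam + p U) tau), tempering and damping are absorbed into w_k = e^k
  \<open>\<rho>\<close>_(n-k). After summation by parts every increment of w is of order tau: A
  accounts for the increment of \<open>\<rho>\<close>, and (lam + |p| u) B for 1 - e. The boundary
  term contains only \<open>\<rho>\<close> at time 0, which has norm zero. The factor tau together
  with tau^(-gam) gives tau^(1 - gam).\<close>

lemma L2_norm_dderiv_le:
  assumes \<tau>: "0 < \<tau>" and n: "1 \<le> n" and L: "\<And>k. k \<le> n \<Longrightarrow> \<rho> k \<in> L2_space \<Omega>"
    and U_le: "\<And>x. x \<in> \<Omega> \<Longrightarrow> U x \<le> u"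
    and zero: "L2_norm \<Omega> (\<rho> 0) = 0" and B: "\<And>k. k \<le> n \<Longrightarrow> L2_norm \<Omega> (\<rho> k) \<le> B"
    and A: "\<And>k. k < n \<Longrightarrow> L2_norm \<Omega> (\<lambda>x. \<rho> (Suc k) x - \<rho> k x) \<le> \<tau> * A"
  shows "L2_norm \<Omega> (dderiv \<tau> \<rho> n)
    \<le> \<tau> powr (1 - gam) * (\<Sum>k<n. g_partial gam k) * (A + (lam + norm p * u) * B) + lam powr gam * B"
proof -
  define z where "z x = (of_real lam + p * of_real (U x)) * of_real \<tau>" for x
  define e where "e x = exp (- z x)" for x
  define w where "w k x = e x ^ k * \<rho> (n - k) x" for k x
  have u: "0 \<le> u" using U_nonneg[of "(a + b) / 2"] U_le[of "(a + b) / 2"] ab by force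
  have B0: "0 \<le> B" using B[of 0] by (auto intro: order_trans[OF L2_norm_nonneg])
  note [measurable] = U_measurable
  have em [measurable]: "e \<in> borel_measurable (lebesgue_on \<Omega>)"
    unfolding e_def z_def by measurable
  have Rez: "0 \<le> Re (z x)" if "x \<in> \<Omega>" for x
    using lam p U_nonneg[OF that] \<tau> by (simp add: z_def)
  have zn: "norm (z x) \<le> \<tau> * (lam + norm p * u)" if "x \<in> \<Omega>" for x
  proof -
    have "norm (of_real lam + p * of_real (U x)) \<le> lam + norm p * u"
      using lam U_nonneg[OF that] U_le[OF that]
      by (intro order_trans[OF norm_triangle_ineq]) (auto simp: norm_mult mult_left_mono)
    then have "norm (of_real lam + p * of_real (U x)) * \<tau> \<le> (lam + norm p * u) * \<tau>"
      using \<tau> by (intro mult_right_mono) auto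
    then show ?thesis using \<tau> by (simp add: z_def norm_mult mult.commute)
  qed
  have en: "norm (e x ^ k) \<le> 1" if "x \<in> \<Omega>" for x k
    using Rez[OF that] by (auto simp: e_def norm_power norm_exp_eq_Re intro!: power_le_one)
  have wL: "w k \<in> L2_space \<Omega>" if "k \<le> n" for k
    unfolding w_def[abs_def] by (rule L2_mult_bounded[OF L, where C=1]) (use en in auto)
  have wdL: "(\<lambda>x. w k x - w (Suc k) x) \<in> L2_space \<Omega>" if "k < n" for k
    using that by (intro L2_diff wL) auto
  have wd: "L2_norm \<Omega> (\<lambda>x. w k x - w (Suc k) x) \<le> \<tau> * (A + (lam + norm p * u) * B)" if k: "k < n" for k
  proof -
    define m where "m = n - Suc k"
    have m: "n - k = Suc m" "m \<le> n" "m < n" using k by (auto simp: m_def)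
    have dL: "(\<lambda>x. \<rho> (Suc m) x - \<rho> m x) \<in> L2_space \<Omega>" using m by (intro L2_diff L) auto
    have eL: "(\<lambda>x. (1 - e x) * \<rho> m x) \<in> L2_space \<Omega>"
    proof (rule L2_mult_bounded[OF L[OF m(2)], where C="\<tau> * (lam + norm p * u)"])
      show "norm (1 - e x) \<le> \<tau> * (lam + norm p * u)" if "x \<in> \<Omega>" for x
        using norm_one_minus_exp_le[OF Rez[OF that]] zn[OF that] by (simp add: e_def)
    qed measurable
    have "(\<lambda>x. w k x - w (Suc k) x) = (\<lambda>x. e x ^ k * ((\<rho> (Suc m) x - \<rho> m x) + (1 - e x) * \<rho> m x))"
      unfolding w_def m(1) m_def[symmetric] by (simp add: algebra_simps)
    then have "L2_norm \<Omega> (\<lambda>x. w k x - w (Suc k) x)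
        = L2_norm \<Omega> (\<lambda>x. e x ^ k * ((\<rho> (Suc m) x - \<rho> m x) + (1 - e x) * \<rho> m x))" by simp
    also have "\<dots> \<le> 1 * L2_norm \<Omega> (\<lambda>x. (\<rho> (Suc m) x - \<rho> m x) + (1 - e x) * \<rho> m x)"
      by (rule L2_norm_mult_bounded[OF L2_add[OF dL eL]]) (use en in auto)
    also have "\<dots> \<le> L2_norm \<Omega> (\<lambda>x. \<rho> (Suc m) x - \<rho> m x) + L2_norm \<Omega> (\<lambda>x. (1 - e x) * \<rho> m x)"
      using L2_norm_triangle[OF dL eL] by simp
    also have "\<dots> \<le> \<tau> * A + \<tau> * (lam + norm p * u) * L2_norm \<Omega> (\<rho> m)"
    proof (rule add_mono[OF A[OF m(3)]])
      show "L2_norm \<Omega> (\<lambda>x. (1 - e x) * \<rho> m x) \<le> \<tau> * (lam + norm p * u) * L2_norm \<Omega> (\<rho> m)"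
      proof (rule L2_norm_mult_bounded[OF L[OF m(2)]])
        show "0 \<le> \<tau> * (lam + norm p * u)" using \<tau> lam u by simp
        show "norm (1 - e x) \<le> \<tau> * (lam + norm p * u)" if "x \<in> \<Omega>" for x
          using norm_one_minus_exp_le[OF Rez[OF that]] zn[OF that] by (simp add: e_def)
      qed measurable
    qed
    also have "\<dots> \<le> \<tau> * A + \<tau> * (lam + norm p * u) * B"
      using \<tau> lam u B[OF m(2)] by (intro add_left_mono mult_left_mono) auto
    finally show ?thesis by (simp add: algebra_simps)
  qed
  have "L2_norm \<Omega> (\<lambda>x. e x ^ n * \<rho> 0 x) \<le> 1 * L2_norm \<Omega> (\<rho> 0)"
    by (rule L2_norm_mult_bounded[OF L]) (use en in auto)
  then have wn: "L2_norm \<Omega> (w n) \<le> 0" using zero by (simp add: w_def[abs_def])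
  \<comment> \<open>The correction by which the diagonal coefficient falls short of 1. After
    division by tau^gam it is bounded by lam^gam, the last term of the estimate.\<close>
  define c where "c = exp (- (gam * lam * \<tau>)) * (lam * \<tau>) powr gam"
  have c: "0 \<le> c" "c \<le> lam powr gam * \<tau> powr gam"
  proof -
    have "c = exp (- (gam * lam * \<tau>)) * (lam powr gam * \<tau> powr gam)"
      using lam \<tau> by (simp add: c_def powr_mult)
    also have "\<dots> \<le> 1 * (lam powr gam * \<tau> powr gam)"
      using gam lam \<tau> by (intro mult_right_mono) auto
    finally show "c \<le> lam powr gam * \<tau> powr gam" by simp
  qed (simp add: c_def)
  have sL: "(\<lambda>x. \<Sum>k<n. of_real (g_partial gam k) * (w k x - w (Suc k) x)) \<in> L2_space \<Omega>"
    using wdL by (intro L2_sum L2_cmult) auto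
  have gL: "(\<lambda>x. of_real (g_partial gam n) * w n x) \<in> L2_space \<Omega>" by (intro L2_cmult wL) simp
  have rL: "(\<lambda>x. of_real c * \<rho> n x) \<in> L2_space \<Omega>" by (intro L2_cmult L) simp
  have eq: "dderiv \<tau> \<rho> n = (\<lambda>x. of_real (1 / \<tau> powr gam) *
      (((\<Sum>k<n. of_real (g_partial gam k) * (w k x - w (Suc k) x)) + of_real (g_partial gam n) * w n x)
        - of_real c * \<rho> n x))"
  proof
    fix x
    have d: "of_real (d_coeff gam lam \<tau> k) * (damp \<tau> k x * \<rho> (n - k) x)
        = of_real (g_coeff gam k) * w k x - (if k = 0 then of_real c * \<rho> n x else 0)" for k
    proof (cases "k = 0")
      case True
      then show ?thesis by (simp add: d_coeff_def damp_def w_def c_def left_diff_distrib)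
    next
      case False
      have "e x ^ k = exp (of_nat k * (- z x))" unfolding e_def by (rule exp_of_nat_mult[symmetric])
      also have "of_nat k * (- z x) = of_real (- (real k * lam * \<tau>)) + - (p * of_real (U x * real k * \<tau>))"
        by (simp add: z_def algebra_simps)
      also have "exp \<dots> = of_real (exp (- (real k * lam * \<tau>))) * damp \<tau> k x"
        unfolding damp_def exp_add by (simp add: exp_of_real del: of_real_minus of_real_mult)
      finally show ?thesis using False
        by (simp add: d_coeff_def tempered_g_coeff_def w_def mult_ac)
    qed
    have "(\<Sum>k=0..n. of_real (d_coeff gam lam \<tau> k) * (damp \<tau> k x * \<rho> (n - k) x))
        = (\<Sum>k=0..n. of_real (g_coeff gam k) * w k x) - of_real c * \<rho> n x"
      unfolding d sum_subtractf by simp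
    then show "dderiv \<tau> \<rho> n x = of_real (1 / \<tau> powr gam) *
      (((\<Sum>k<n. of_real (g_partial gam k) * (w k x - w (Suc k) x)) + of_real (g_partial gam n) * w n x)
        - of_real c * \<rho> n x)"
      unfolding dderiv_eq g_summation_by_parts by simp
  qed
  let ?S = "\<Sum>k<n. g_partial gam k"
  have "L2_norm \<Omega> (dderiv \<tau> \<rho> n) = 1 / \<tau> powr gam * L2_norm \<Omega> (\<lambda>x.
      ((\<Sum>k<n. of_real (g_partial gam k) * (w k x - w (Suc k) x)) + of_real (g_partial gam n) * w n x)
        - of_real c * \<rho> n x)"
    unfolding eq L2_norm_cmult by (simp add: norm_divide)
  also have "\<dots> \<le> 1 / \<tau> powr gam * ((?S * (\<tau> * (A + (lam + norm p * u) * B)) + 0) + c * B)"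
  proof (rule mult_left_mono)
    have "L2_norm \<Omega> (\<lambda>x. \<Sum>k<n. of_real (g_partial gam k) * (w k x - w (Suc k) x))
        \<le> (\<Sum>k<n. L2_norm \<Omega> (\<lambda>x. of_real (g_partial gam k) * (w k x - w (Suc k) x)))"
      using wdL by (intro L2_norm_sum L2_cmult) auto
    also have "\<dots> \<le> (\<Sum>k<n. g_partial gam k * (\<tau> * (A + (lam + norm p * u) * B)))"
      using g_partial_bounds(1)[OF gam] wd
      by (intro sum_mono) (auto simp: L2_norm_cmult less_imp_le intro!: mult_mono)
    finally have 1: "L2_norm \<Omega> (\<lambda>x. \<Sum>k<n. of_real (g_partial gam k) * (w k x - w (Suc k) x))
        \<le> ?S * (\<tau> * (A + (lam + norm p * u) * B))" by (simp only: sum_distrib_right)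
    have 2: "L2_norm \<Omega> (\<lambda>x. of_real (g_partial gam n) * w n x) \<le> 0"
      using wn L2_norm_nonneg[of \<Omega> "w n"] by (simp add: L2_norm_cmult)
    have 3: "L2_norm \<Omega> (\<lambda>x. of_real c * \<rho> n x) \<le> c * B"
      using c(1) B[of n] by (simp add: L2_norm_cmult mult_left_mono)
    show "L2_norm \<Omega> (\<lambda>x. ((\<Sum>k<n. of_real (g_partial gam k) * (w k x - w (Suc k) x)) + of_real (g_partial gam n) * w n x)
        - of_real c * \<rho> n x) \<le> (?S * (\<tau> * (A + (lam + norm p * u) * B)) + 0) + c * B"
      using L2_norm_triangle_diff[OF L2_add[OF sL gL] rL] L2_norm_triangle[OF sL gL] 1 2 3 by linarith
  qed simp
  also have "\<dots> \<le> 1 / \<tau> powr gam * ((?S * (\<tau> * (A + (lam + norm p * u) * B)) + 0) + lam powr gam * \<tau> powr gam * B)"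
    using c(2) B0 by (intro mult_left_mono add_left_mono mult_right_mono) auto
  also have "\<dots> = \<tau> powr (1 - gam) * ?S * (A + (lam + norm p * u) * B) + lam powr gam * B"
    using \<tau> by (simp add: powr_diff field_simps)
  finally show ?thesis .
qed

text \<open>Nothing is assumed about the measurability of the fractional derivative: it is the limit of
  discrete derivatives along refinements of the grid that keep the time fixed.\<close>

lemma truncation_residual:
  assumes c6: "truncation_constant a b gam lam p U T G c6" and N: "1 \<le> N" and n: "n \<in> {1..N}"
    and GL: "\<And>t. t \<in> {0..T} \<Longrightarrow> (\<lambda>x. G x t) \<in> L2_space \<Omega>"
  defines "\<tau> \<equiv> T / real N"
  defines "R \<equiv> \<lambda>x. dderiv \<tau> (\<lambda>k y. G y (real k * \<tau>)) n x
      - (tempered_subst_deriv gam lam p U T G x (real n * \<tau>) - of_real (lam powr gam) * G x (real n * \<tau>))"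
  shows "R \<in> L2_space \<Omega>" and "L2_norm \<Omega> R \<le> c6 * \<tau> * sqrt (b - a)" and "0 \<le> c6"
proof -
  have \<tau>: "0 < \<tau>" using T N by (simp add: \<tau>_def)
  have R: "norm (R x) \<le> c6 * \<tau>" if "x \<in> \<Omega>" for x
    using c6 N n that unfolding truncation_constant_def R_def \<tau>_def by blast
  \<comment> \<open>\<open>truncation_constant\<close> prescribes no sign for c6; it follows from
    the bound on a norm at one point, and the midpoint is a convenient one.\<close>
  have c6\<tau>: "0 \<le> c6 * \<tau>" using order_trans[OF norm_ge_zero R[of "(a + b) / 2"]] ab by simp
  then show "0 \<le> c6" using \<tau> by (simp add: zero_le_mult_iff)
  define t where "t = real n * \<tau>"
  define W where "W x = tempered_subst_deriv gam lam p U T G x t - of_real (lam powr gam) * G x t" for x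
  have dL: "dderiv (T / real k) (\<lambda>j y. G y (real j * (T / real k))) j \<in> L2_space \<Omega>" if "1 \<le> k" "j \<le> k" for j k
  proof (rule dderiv_L2)
    show "0 \<le> T / real k" using T by simp
    fix i assume "i \<le> j"
    then have "real i * T \<le> real k * T" using that T by simp
    then have "real i * (T / real k) \<le> T" using that by (simp add: pos_divide_le_eq mult.commute)
    then show "(\<lambda>y. G y (real i * (T / real k))) \<in> L2_space \<Omega>" using T by (intro GL) auto
  qed
  have "W \<in> borel_measurable (lebesgue_on \<Omega>)"
  proof (rule borel_measurable_LIMSEQ_metric)
    let ?D = "\<lambda>m. dderiv (T / real (Suc m * N)) (\<lambda>j y. G y (real j * (T / real (Suc m * N)))) (Suc m * n)"
    show "?D m \<in> borel_measurable (lebesgue_on \<Omega>)" for m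
    proof (intro L2_spaceD(1) dL)
      show "Suc m * n \<le> Suc m * N" using n by (intro mult_left_mono) auto
    qed (use N in simp)
    fix x assume "x \<in> space (lebesgue_on \<Omega>)"
    then have x: "x \<in> \<Omega>" by simp
    have bd: "norm (?D m x - W x) \<le> c6 * T * inverse (real (Suc m))" for m
    proof -
      have t: "real (Suc m * n) * (T / real (Suc m * N)) = t"
        using N by (simp only: of_nat_mult t_def \<tau>_def) (simp add: divide_simps del: of_nat_Suc)
      have "norm (?D m x - W x) \<le> c6 * (T / real (Suc m * N))"
        using c6[unfolded truncation_constant_def, rule_format, of "Suc m * N" "Suc m * n" x] N n x mult_le_mono2[of n N "Suc m"]
        unfolding t W_def by (simp del: of_nat_Suc of_nat_mult mult_Suc)
      also have "\<dots> \<le> c6 * (T / real (Suc m))"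
      proof (intro mult_left_mono divide_left_mono \<open>0 \<le> c6\<close>)
        have "Suc m * 1 \<le> Suc m * N" using N by (intro mult_le_mono2) simp
        then show "real (Suc m) \<le> real (Suc m * N)" by (subst of_nat_le_iff) simp
      qed (use T N in \<open>auto simp del: of_nat_Suc of_nat_mult mult_Suc\<close>)
      finally show ?thesis by (simp add: divide_inverse mult.assoc)
    qed
    have "(\<lambda>m. ?D m x - W x) \<longlonglongrightarrow> 0"
      by (rule Lim_null_comparison[OF always_eventually[OF allI[OF bd]]
          tendsto_mult_right_zero[OF LIMSEQ_inverse_real_of_nat]])
    then show "(\<lambda>m. ?D m x) \<longlonglongrightarrow> W x" by (simp only: LIM_zero_iff)
  qed
  moreover have "dderiv \<tau> (\<lambda>k y. G y (real k * \<tau>)) n \<in> borel_measurable (lebesgue_on \<Omega>)"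
    unfolding \<tau>_def using N n by (intro L2_spaceD(1) dL) auto
  moreover have "R = (\<lambda>x. dderiv \<tau> (\<lambda>k y. G y (real k * \<tau>)) n x - W x)"
    by (simp add: R_def W_def t_def)
  ultimately have Rm: "R \<in> borel_measurable (lebesgue_on \<Omega>)" by simp
  have ae: "AE x in lebesgue_on \<Omega>. norm (R x) \<le> c6 * \<tau>" using R by (intro AE_I2) auto
  have lm: "\<Omega> \<in> lmeasurable" by simp
  show "R \<in> L2_space \<Omega>" by (rule L2_bounded[OF lm Rm ae])
  show "L2_norm \<Omega> R \<le> c6 * \<tau> * sqrt (b - a)"
    using L2_norm_bounded[OF lm Rm c6\<tau> ae] ab by (simp)
qed

end

section \<open>The error estimate\<close>

locale fk_problem = fk_setting a b gam lam K T p U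
  for a b gam lam K T :: real and p :: complex and U :: "real \<Rightarrow> real" +
  fixes l q :: nat and G f :: "real \<Rightarrow> real \<Rightarrow> complex"
  assumes U_bdd: "bdd_above (U ` {a<..<b})" and l: "1 \<le> l" and q: "1 \<le> q"
    and initial: "\<forall>x\<in>{a..b}. G x 0 = 0"
    and G_space: "\<And>t. t \<in> {0..T} \<Longrightarrow> (\<lambda>x. G x t) \<in> H1_zero {a<..<b} \<inter> sobolev {a<..<b} q"
    and G_bounded: "bdd_above ((\<lambda>t. sobolev_norm {a<..<b} q (\<lambda>x. G x t)) ` {0..T})"
    and G_C1: "\<forall>x\<in>{a<..<b}. (\<forall>t\<in>{0..T}. G x differentiable (at t within {0..T})) \<and>
                 continuous_on {0..T} (time_deriv T G x)"
    and Gt_space: "\<forall>t\<in>{0..T}. (\<lambda>x. time_deriv T G x t) \<in> sobolev {a<..<b} q"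
    and Gt_bounded:
      "bdd_above ((\<lambda>t. sobolev_norm {a<..<b} q (\<lambda>x. time_deriv T G x t)) ` {0..T})"
    and weak_solution: "\<And>t \<eta>. t \<in> {0<..T} \<Longrightarrow> \<eta> \<in> H1_zero {a<..<b} \<Longrightarrow>
        L2_inner {a<..<b} (\<lambda>x. tempered_subst_deriv gam lam p U T G x t) \<eta>
        - L2_inner {a<..<b} (\<lambda>x. of_real (lam powr gam) * G x t) \<eta>
        + of_real K * L2_inner {a<..<b} (weak_deriv {a<..<b} 1 (\<lambda>x. G x t)) (weak_deriv {a<..<b} 1 \<eta>)
        = L2_inner {a<..<b} (\<lambda>x. f x t) \<eta>"
begin

abbreviation "supG \<equiv> sup_sobolev_norm \<Omega> T q G"

abbreviation "supGt \<equiv> sup_sobolev_norm \<Omega> T q (time_deriv T G)"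

lemma G_le_supG: "t \<in> {0..T} \<Longrightarrow> sobolev_norm \<Omega> q (\<lambda>x. G x t) \<le> supG"
  unfolding sup_sobolev_norm_def by (rule cSUP_upper[OF _ G_bounded])

lemma initial_sobolev_norm: "sobolev_norm \<Omega> q (\<lambda>x. G x 0) = 0"
proof -
  have ae: "AE x in lebesgue_on \<Omega>. 0 = G x 0" using initial by (intro AE_I2) auto
  show ?thesis
    using sobolev_cong_AE(2)[OF sobolev_zero(1)[OF ab] ab ae] sobolev_zero(2)[OF ab] by simp
qed

lemma supG_nonneg: "0 \<le> supG"
  using order_trans[OF sobolev_norm_nonneg G_le_supG[of 0]] T by simp

lemma supGt_nonneg: "0 \<le> supGt"
  unfolding sup_sobolev_norm_def using T
  by (intro order_trans[OF sobolev_norm_nonneg cSUP_upper[OF _ Gt_bounded, of 0]]) simp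

lemma U_le: "x \<in> \<Omega> \<Longrightarrow> U x \<le> (SUP x\<in>\<Omega>. U x)"
  by (rule cSUP_upper[OF _ U_bdd])

lemma SUP_U_nonneg: "0 \<le> (SUP x\<in>\<Omega>. U x)"
  using order_trans[OF U_nonneg U_le, of "(a + b) / 2"] ab by simp

text \<open>The bounds are kept abstract because they are used twice: with the constants of the estimate
  proved above, and with those of a given Ritz constant.\<close>

definition ritz_error_bound :: "nat \<Rightarrow> real \<Rightarrow> real \<Rightarrow> bool" where
  "ritz_error_bound M \<kappa>0 \<kappa>1 \<longleftrightarrow> (\<forall>v r. v \<in> H1_zero \<Omega> \<longrightarrow> v \<in> sobolev \<Omega> q \<longrightarrow> is_ritz_projection a b M l v r \<longrightarrow>
     L2_norm \<Omega> (\<lambda>x. v x - r x) \<le> \<kappa>0 * sobolev_norm \<Omega> q v \<and>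
     H1_seminorm \<Omega> (\<lambda>x. v x - r x) \<le> \<kappa>1 * sobolev_norm \<Omega> q v)"

text \<open>This is \<open>c8_constant\<close> with the factor c4 taken out, so that any constant in
  the L2 estimate of the projection can stand in front of it.\<close>

definition consistency_factor :: "real \<Rightarrow> real" where
  "consistency_factor c7 = (c7 * T powr (1 - gam) * (lam + norm p * (SUP x\<in>\<Omega>. U x)) + lam powr gam) * supG
     + c7 * T powr (1 - gam) * supGt"

text \<open>The bound A on the increments comes from linearity of the projection and the Sobolev
  bound on increments of G in time, the bound B from the projection error at one time. At time 0 the
  solution is zero, hence so is the projection error in norm, and no boundary term survives.\<close>

lemma dderiv_ritz_error_le:
  assumes \<kappa>: "ritz_error_bound M \<kappa>0 \<kappa>1" "0 \<le> \<kappa>0" and c7: "g_sum_constant gam T c7"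
    and N: "1 \<le> N" and n: "n \<in> {1..N}"
    and r: "\<And>k. k \<le> N \<Longrightarrow> is_ritz_projection a b M l (\<lambda>x. G x (real k * (T / real N))) (r k)"
  shows "L2_norm \<Omega> (dderiv (T / real N) (\<lambda>k x. G x (real k * (T / real N)) - r k x) n)
    \<le> \<kappa>0 * consistency_factor c7"
proof -
  define \<tau> where "\<tau> = T / real N"
  have \<tau>: "0 < \<tau>" using T N by (simp add: \<tau>_def)
  define g where "g k x = G x (real k * \<tau>)" for k x
  define \<rho> where "\<rho> k x = g k x - r k x" for k x
  have t: "real k * \<tau> \<in> {0..T}" if "k \<le> N" for k
    using that T N by (auto simp: \<tau>_def field_simps)
  have g: "g k \<in> H1_zero \<Omega>" "g k \<in> sobolev \<Omega> q" "sobolev_norm \<Omega> q (g k) \<le> supG" if "k \<le> N" for k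
    using G_space[OF t[OF that]] G_le_supG[OF t[OF that]] by (auto simp: g_def[abs_def])
  have r': "is_ritz_projection a b M l (g k) (r k)" if "k \<le> N" for k
    using r[OF that] by (simp add: g_def[abs_def] \<tau>_def)
  have rH: "r k \<in> H1_zero \<Omega>" if "k \<le> N" for k
    by (rule fe_space_H1[where M=M and l=l]) (use r'[OF that] in \<open>simp add: is_ritz_projection_def\<close>)
  have \<rho>L: "\<rho> k \<in> L2_space \<Omega>" if "k \<le> N" for k
    unfolding \<rho>_def[abs_def] by (intro L2_diff H1_zero_L2 g rH that)
  have g0: "sobolev_norm \<Omega> q (g 0) = 0"
    using initial_sobolev_norm by (simp add: g_def[abs_def])
  have b0: "L2_norm \<Omega> (\<rho> k) \<le> \<kappa>0 * sobolev_norm \<Omega> q (g k)" if "k \<le> N" for k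
    using \<kappa>(1) g[OF that] r'[OF that] by (simp add: ritz_error_bound_def \<rho>_def[abs_def])
  have z: "L2_norm \<Omega> (\<rho> 0) = 0" using b0[of 0] g0 L2_norm_nonneg[of \<Omega> "\<rho> 0"] by simp
  have B: "L2_norm \<Omega> (\<rho> k) \<le> \<kappa>0 * supG" if "k \<le> N" for k
    using b0[OF that] mult_left_mono[OF g(3)[OF that] \<kappa>(2)] by linarith
  have A: "L2_norm \<Omega> (\<lambda>x. \<rho> (Suc k) x - \<rho> k x) \<le> \<tau> * (\<kappa>0 * supGt)" if "k < N" for k
  proof -
    have k: "k \<le> N" "Suc k \<le> N" using that by auto
    let ?dg = "\<lambda>x. g (Suc k) x - g k x" and ?dr = "\<lambda>x. r (Suc k) x - r k x"
    have eq: "(\<lambda>x. \<rho> (Suc k) x - \<rho> k x) = (\<lambda>x. ?dg x - ?dr x)" by (simp add: \<rho>_def algebra_simps)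
    have "?dg \<in> H1_zero \<Omega>" "?dg \<in> sobolev \<Omega> q"
      by (intro H1_zero_diff sobolev_diff g k ab)+
    then have "L2_norm \<Omega> (\<lambda>x. \<rho> (Suc k) x - \<rho> k x) \<le> \<kappa>0 * sobolev_norm \<Omega> q ?dg"
      unfolding eq using \<kappa>(1) ritz_diff[OF g(1)[OF k(2)] g(1)[OF k(1)] r'[OF k(2)] r'[OF k(1)]]
      unfolding ritz_error_bound_def by blast
    also have "sobolev_norm \<Omega> q ?dg \<le> (real (Suc k) * \<tau> - real k * \<tau>) * supGt"
      unfolding g_def using t[OF k(1)] t[OF k(2)] g(2)[OF k(1)] g(2)[OF k(2)] \<tau>
      by (intro sobolev_norm_time_increment[OF ab q G_C1 Gt_space Gt_bounded]) (auto simp: g_def[abs_def])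
    also have "(real (Suc k) * \<tau> - real k * \<tau>) * supGt = \<tau> * supGt" by (simp add: algebra_simps)
    finally show ?thesis using \<kappa>(2) by (simp add: mult_left_mono mult.left_commute)
  qed
  let ?u = "SUP x\<in>\<Omega>. U x"
  have c: "\<tau> powr (1 - gam) * (\<Sum>k<n. g_partial gam k) \<le> c7 * T powr (1 - gam)"
  proof -
    have "{0..n - 1} = {..<n}" using n by auto
    then show ?thesis using c7 N n unfolding g_sum_constant_def g_partial_def \<tau>_def by metis
  qed
  have "L2_norm \<Omega> (dderiv \<tau> \<rho> n) \<le> \<tau> powr (1 - gam) * (\<Sum>k<n. g_partial gam k)
      * (\<kappa>0 * supGt + (lam + norm p * ?u) * (\<kappa>0 * supG)) + lam powr gam * (\<kappa>0 * supG)"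
    using n by (intro L2_norm_dderiv_le[OF \<tau>] \<rho>L U_le z B A) auto
  also have "\<dots> \<le> c7 * T powr (1 - gam) * (\<kappa>0 * supGt + (lam + norm p * ?u) * (\<kappa>0 * supG)) + lam powr gam * (\<kappa>0 * supG)"
    using \<kappa>(2) supGt_nonneg supG_nonneg lam SUP_U_nonneg
    by (intro add_right_mono mult_right_mono[OF c]) simp
  also have "\<dots> = \<kappa>0 * consistency_factor c7" by (simp add: consistency_factor_def algebra_simps)
  finally show ?thesis by (simp add: \<rho>_def[abs_def] g_def[abs_def] \<tau>_def)
qed

text \<open>The contributions e of the truncation and d of the projection enter the energy estimate
  as one source, with \<open>cp\<close> from Poincare's inequality. As \<open>\<rho>\<close> and
  \<open>\<theta>\<close> are orthogonal in the seminorm, their squares simply add, without the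
  factor 2 of a triangle inequality.\<close>

theorem error_bound:
  assumes \<kappa>: "ritz_error_bound M \<kappa>0 \<kappa>1" "0 \<le> \<kappa>0" "0 \<le> \<kappa>1" and c7: "g_sum_constant gam T c7"
    and c6: "truncation_constant a b gam lam p U T G c6" and M: "1 \<le> M" and N: "1 \<le> N"
    and scheme: "fe_scheme a b gam lam K p U T l M N (\<lambda>n x. f x (real n * (T / real N))) Gh"
    and Gh0: "\<forall>x\<in>{a..b}. Gh 0 x = 0"
  shows "(grid_norm_1 \<Omega> (T / real N) N (\<lambda>n x. G x (real n * (T / real N)) - Gh n x))\<^sup>2
    \<le> (b - a)\<^sup>2 / (4 * K\<^sup>2) * T * ((b - a) * c6\<^sup>2 * (T / real N)\<^sup>2 + (\<kappa>0 * consistency_factor c7)\<^sup>2)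
      + (\<kappa>1 * supG)\<^sup>2 * T"
proof -
  interpret fe_mesh a b "(b - a) / real M" M l by unfold_locales (use ab M l in auto)
  define \<tau> where "\<tau> = T / real N"
  have \<tau>: "0 < \<tau>" "real N * \<tau> = T" using T N by (simp_all add: \<tau>_def)
  define g where "g k x = G x (real k * \<tau>)" for k x
  define W where "W k x = tempered_subst_deriv gam lam p U T G x (real k * \<tau>)
      - of_real (lam powr gam) * G x (real k * \<tau>)" for k x
  have t: "real k * \<tau> \<in> {0..T}" if "k \<le> N" for k
    using that T N by (auto simp: \<tau>_def field_simps)
  have g: "g k \<in> H1_zero \<Omega>" "g k \<in> sobolev \<Omega> q" "sobolev_norm \<Omega> q (g k) \<le> supG" if "k \<le> N" for k
    using G_space[OF t[OF that]] G_le_supG[OF t[OF that]] by (auto simp: g_def[abs_def])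
  define r where "r k = (SOME r. is_ritz_projection a b M l (g k) r)" for k
  have r: "is_ritz_projection a b M l (g k) (r k)" if "k \<le> N" for k
    unfolding r_def by (rule someI_ex[OF ritz_projection_exists[OF g(1)[OF that]]])
  define \<rho> where "\<rho> k x = g k x - r k x" for k x
  define \<theta> where "\<theta> k x = Gh k x - r k x" for k x
  have fe: "r k \<in> fe_space a b M l" "Gh k \<in> fe_space a b M l" if "k \<le> N" for k
    using r[OF that] scheme that by (auto simp: is_ritz_projection_def fe_scheme_def)
  note H = fe_space_H1[OF fe(1)] fe_space_H1[OF fe(2)]
  have \<theta>: "\<theta> k \<in> fe_space a b M l" if "k \<le> N" for k
    unfolding \<theta>_def[abs_def] by (intro fe_space_diff fe that)
  have \<rho>: "\<rho> k \<in> H1_zero \<Omega>" if "k \<le> N" for k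
    unfolding \<rho>_def[abs_def] by (intro H1_zero_diff g H ab that)
  note L = H1_zero_L2[OF H(1)] H1_zero_L2[OF H(2)] H1_zero_L2[OF g(1)] H1_zero_L2[OF fe_space_H1[OF \<theta>]] H1_zero_L2[OF \<rho>]
  define d where "d = \<kappa>0 * consistency_factor c7"
  have d: "L2_norm \<Omega> (dderiv \<tau> \<rho> n) \<le> d" if "n \<in> {1..N}" for n
    using dderiv_ritz_error_le[OF \<kappa>(1,2) c7 N that, of r] r by (simp add: \<tau>_def g_def[abs_def] \<rho>_def[abs_def] d_def)
  define R where "R n x = dderiv \<tau> g n x - W n x" for n x
  have RL: "R n \<in> L2_space \<Omega>" and Rn: "L2_norm \<Omega> (R n) \<le> c6 * \<tau> * sqrt (b - a)" and c60: "0 \<le> c6"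
    if n: "n \<in> {1..N}" for n
  proof -
    have GL: "(\<lambda>x. G x t) \<in> L2_space \<Omega>" if "t \<in> {0..T}" for t
      using G_space[OF that] H1_zero_L2 by blast
    have "R n = (\<lambda>x. dderiv (T / real N) (\<lambda>k y. G y (real k * (T / real N))) n x
      - (tempered_subst_deriv gam lam p U T G x (real n * (T / real N)) - of_real (lam powr gam) * G x (real n * (T / real N))))"
      by (simp add: R_def[abs_def] W_def g_def[abs_def] \<tau>_def)
    with truncation_residual[OF c6 N n GL] show "R n \<in> L2_space \<Omega>" "L2_norm \<Omega> (R n) \<le> c6 * \<tau> * sqrt (b - a)" "0 \<le> c6"
      by (simp_all only: \<tau>_def)
  qed
  define cp where "cp = (b - a) / sqrt 8"
  have cp: "0 \<le> cp" using ab by (simp add: cp_def)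
  define e where "e = c6 * \<tau> * sqrt (b - a)"
  have ed: "0 \<le> e" "0 \<le> d"
    using order_trans[OF L2_norm_nonneg Rn[of 1]] order_trans[OF L2_norm_nonneg d[of 1]] N by (auto simp: e_def)
  have energy: "Re (L2_inner \<Omega> (dderiv \<tau> \<theta> n) (\<theta> n)) + K * (H1_seminorm \<Omega> (\<theta> n))\<^sup>2
      \<le> cp * (e + d) * H1_seminorm \<Omega> (\<theta> n)" if n: "n \<in> {1..N}" for n
  proof -
    have nN: "n \<le> N" using n by simp
    let ?\<eta> = "weak_deriv \<Omega> 1 (\<theta> n)"
    \<comment> \<open>The algebra behind the error equation. The first two premises are the weak
      form and the scheme with the same source F; R is the truncation residual, P the discrete
      derivative of the projection error, and the gradient terms combine because the projection may
      replace the solution against discrete functions.\<close>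
    have alg: "D + k * e = P - R"
      if "W + k * gg = F" "Dh + k * hh = F" "e = hh - gg" "R = Dg - W" "D = Dh - Dg + P"
      for W k gg F Dh hh e R Dg D P :: complex
    proof -
      have "Dh = (W + k * gg) - k * hh" by (simp add: that(1) that(2)[symmetric])
      then show ?thesis by (simp add: that(3-5) algebra_simps)
    qed
    have DL: "dderiv \<tau> Gh n \<in> L2_space \<Omega>" "dderiv \<tau> g n \<in> L2_space \<Omega>" "dderiv \<tau> \<rho> n \<in> L2_space \<Omega>"
      using \<tau> nN by (intro dderiv_L2 L; simp)+
    have WL: "W n \<in> L2_space \<Omega>"
    proof -
      have "W n = (\<lambda>x. dderiv \<tau> g n x - R n x)" by (simp add: R_def)
      then show ?thesis using L2_diff[OF DL(2) RL[OF n]] by simp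
    qed
    have \<theta>L: "\<theta> n \<in> L2_space \<Omega>" by (rule L(4)[OF nN])
    have tn: "real n * \<tau> \<in> {0<..T}" using t[OF nN] n \<tau> by auto
    have lL: "(\<lambda>x. of_real (lam powr gam) * g n x) \<in> L2_space \<Omega>" by (intro L2_cmult L nN)
    have DW: "(\<lambda>x. tempered_subst_deriv gam lam p U T G x (real n * \<tau>)) = (\<lambda>x. W n x + of_real (lam powr gam) * g n x)"
      by (simp add: W_def g_def)
    have "L2_inner \<Omega> (W n) (\<theta> n) + of_real K * L2_inner \<Omega> (weak_deriv \<Omega> 1 (g n)) ?\<eta> = L2_inner \<Omega> (\<lambda>x. f x (real n * \<tau>)) (\<theta> n)"
      using weak_solution[OF tn fe_space_H1[OF \<theta>[OF nN]]] unfolding DW L2_inner_add_left[OF WL lL \<theta>L]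
      by (simp add: g_def[abs_def])
    moreover have "L2_inner \<Omega> (dderiv \<tau> Gh n) (\<theta> n) + of_real K * L2_inner \<Omega> (weak_deriv \<Omega> 1 (Gh n)) ?\<eta>
        = L2_inner \<Omega> (\<lambda>x. f x (real n * \<tau>)) (\<theta> n)"
      using scheme n \<theta>[OF nN] unfolding fe_scheme_def \<tau>_def by blast
    moreover have "L2_inner \<Omega> ?\<eta> ?\<eta> = L2_inner \<Omega> (weak_deriv \<Omega> 1 (Gh n)) ?\<eta> - L2_inner \<Omega> (weak_deriv \<Omega> 1 (g n)) ?\<eta>"
    proof -
      have "L2_inner \<Omega> (weak_deriv \<Omega> 1 (r n)) ?\<eta> = L2_inner \<Omega> (weak_deriv \<Omega> 1 (g n)) ?\<eta>"
        using r[OF nN] \<theta>[OF nN] by (simp only: is_ritz_projection_def)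
      then show ?thesis
        using inner_weak_deriv_diff[OF H(2)[OF nN] H(1)[OF nN] H1_zero_weak_deriv_L2[OF fe_space_H1[OF \<theta>[OF nN]]]]
        by (simp only: \<theta>_def[abs_def])
    qed
    moreover have "L2_inner \<Omega> (R n) (\<theta> n) = L2_inner \<Omega> (dderiv \<tau> g n) (\<theta> n) - L2_inner \<Omega> (W n) (\<theta> n)"
      unfolding R_def[abs_def] by (rule L2_inner_diff_left[OF DL(2) WL \<theta>L])
    moreover have "L2_inner \<Omega> (dderiv \<tau> \<theta> n) (\<theta> n)
        = L2_inner \<Omega> (dderiv \<tau> Gh n) (\<theta> n) - L2_inner \<Omega> (dderiv \<tau> g n) (\<theta> n) + L2_inner \<Omega> (dderiv \<tau> \<rho> n) (\<theta> n)"
    proof -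
      have "dderiv \<tau> \<theta> n x = dderiv \<tau> Gh n x - dderiv \<tau> r n x" "dderiv \<tau> \<rho> n x = dderiv \<tau> g n x - dderiv \<tau> r n x" for x
        unfolding \<theta>_def[abs_def] \<rho>_def[abs_def] by (rule dderiv_diff)+
      then have "dderiv \<tau> \<theta> n = (\<lambda>x. (dderiv \<tau> Gh n x - dderiv \<tau> g n x) + dderiv \<tau> \<rho> n x)"
        by (simp add: fun_eq_iff)
      then show ?thesis
        using L2_inner_add_left[OF L2_diff[OF DL(1,2)] DL(3) \<theta>L] L2_inner_diff_left[OF DL(1,2) \<theta>L] by simp
    qed
    ultimately have "L2_inner \<Omega> (dderiv \<tau> \<theta> n) (\<theta> n) + of_real K * L2_inner \<Omega> ?\<eta> ?\<eta>
        = L2_inner \<Omega> (dderiv \<tau> \<rho> n) (\<theta> n) - L2_inner \<Omega> (R n) (\<theta> n)"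
      by (rule alg)
    then have "Re (L2_inner \<Omega> (dderiv \<tau> \<theta> n) (\<theta> n) + of_real K * L2_inner \<Omega> ?\<eta> ?\<eta>)
        = Re (L2_inner \<Omega> (dderiv \<tau> \<rho> n) (\<theta> n) - L2_inner \<Omega> (R n) (\<theta> n))" by (rule arg_cong)
    also have "\<dots> \<le> norm (L2_inner \<Omega> (dderiv \<tau> \<rho> n) (\<theta> n)) + norm (L2_inner \<Omega> (R n) (\<theta> n))"
      by (rule order_trans[OF complex_Re_le_cmod norm_triangle_ineq4])
    also have "\<dots> \<le> L2_norm \<Omega> (dderiv \<tau> \<rho> n) * L2_norm \<Omega> (\<theta> n) + L2_norm \<Omega> (R n) * L2_norm \<Omega> (\<theta> n)"
      by (intro add_mono L2_cauchy_schwarz DL RL[OF n] \<theta>L)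
    also have "\<dots> \<le> d * L2_norm \<Omega> (\<theta> n) + e * L2_norm \<Omega> (\<theta> n)"
      unfolding e_def by (intro add_mono mult_right_mono d n Rn[OF n] L2_norm_nonneg)
    also have "\<dots> = (e + d) * L2_norm \<Omega> (\<theta> n)" by (simp add: algebra_simps)
    also have "\<dots> \<le> (e + d) * (cp * H1_seminorm \<Omega> (\<theta> n))"
      unfolding cp_def using ed by (intro mult_left_mono poincare fe_space_H1[OF \<theta>[OF nN]]) auto
    finally show ?thesis by (simp add: L2_inner_self H1_seminorm_def mult_ac flip: of_real_power)
  qed
  \<comment> \<open>At time 0 both the solution and the discrete solution vanish, so
    \<open>\<theta>\<close> and \<open>\<rho>\<close> are the same function there, and the initial
    value drops out of the energy estimate.\<close>
  have \<theta>0: "L2_norm \<Omega> (\<theta> 0) = 0"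
  proof -
    have "L2_norm \<Omega> (\<theta> 0) = L2_norm \<Omega> (\<rho> 0)"
      by (rule L2_norm_cong) (use initial Gh0 in \<open>auto simp: \<theta>_def \<rho>_def g_def\<close>)
    moreover have "L2_norm \<Omega> (\<rho> 0) \<le> \<kappa>0 * sobolev_norm \<Omega> q (g 0)"
      using \<kappa>(1) g[of 0] r[of 0] by (simp add: ritz_error_bound_def \<rho>_def[abs_def])
    moreover have "sobolev_norm \<Omega> q (g 0) = 0"
      using initial_sobolev_norm by (simp add: g_def[abs_def])
    ultimately show ?thesis using L2_norm_nonneg[of \<Omega> "\<rho> 0"] by simp
  qed
  have "sqrt (\<Sum>n=1..N. (H1_seminorm \<Omega> (\<theta> n))\<^sup>2 * \<tau>)
      \<le> sqrt (T powr (1 - gam) / (2 * K)) * L2_norm \<Omega> (\<theta> 0) + (1 / K) * sqrt (\<Sum>n=1..N. (cp * (e + d))\<^sup>2 * \<tau>)"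
    using cp ed by (intro energy_estimate[OF N \<tau>_def] L(4) energy) (auto simp: H1_seminorm_def)
  also have "(\<Sum>n=1..N. (cp * (e + d))\<^sup>2 * \<tau>) = (cp * (e + d))\<^sup>2 * T"
    using \<tau>(2) by (simp add: mult.left_commute)
  finally have "(sqrt (\<Sum>n=1..N. (H1_seminorm \<Omega> (\<theta> n))\<^sup>2 * \<tau>))\<^sup>2 \<le> (1 / K * sqrt ((cp * (e + d))\<^sup>2 * T))\<^sup>2"
    unfolding \<theta>0 using \<tau> by (intro power_mono) (auto intro!: sum_nonneg)
  then have "(\<Sum>n=1..N. (H1_seminorm \<Omega> (\<theta> n))\<^sup>2 * \<tau>) \<le> 1 / K\<^sup>2 * ((cp * (e + d))\<^sup>2 * T)"
    using \<tau> T by (simp add: sum_nonneg power_mult_distrib power_divide)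
  also have "\<dots> \<le> 1 / K\<^sup>2 * ((cp\<^sup>2 * (2 * (e\<^sup>2 + d\<^sup>2))) * T)"
  proof (intro mult_left_mono mult_right_mono)
    \<comment> \<open>Separates the truncation error from the projection error at the price of a
      factor 2; with cp^2 = (b - a)^2 / 8 this becomes the 1/4 of the statement.\<close>
    have "0 \<le> (e - d)\<^sup>2" by simp
    then have "(e + d)\<^sup>2 \<le> 2 * (e\<^sup>2 + d\<^sup>2)" by (simp add: power2_eq_square algebra_simps)
    then show "(cp * (e + d))\<^sup>2 \<le> cp\<^sup>2 * (2 * (e\<^sup>2 + d\<^sup>2))" unfolding power_mult_distrib by (intro mult_left_mono) auto
  qed (use T in auto)
  also have "\<dots> = (b - a)\<^sup>2 / (4 * K\<^sup>2) * T * ((b - a) * c6\<^sup>2 * \<tau>\<^sup>2 + d\<^sup>2)"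
  proof -
    have "e\<^sup>2 = (b - a) * c6\<^sup>2 * \<tau>\<^sup>2" "cp\<^sup>2 = (b - a)\<^sup>2 / 8"
      using ab by (simp_all add: e_def cp_def power_mult_distrib power_divide)
    moreover have "1 / K\<^sup>2 * (X / 8 * (2 * Y) * T) = X / (4 * K\<^sup>2) * T * Y" for X Y by (simp add: mult_ac)
    ultimately show ?thesis by (simp only:)
  qed
  finally have 1: "(\<Sum>n=1..N. (H1_seminorm \<Omega> (\<theta> n))\<^sup>2 * \<tau>)
      \<le> (b - a)\<^sup>2 / (4 * K\<^sup>2) * T * ((b - a) * c6\<^sup>2 * \<tau>\<^sup>2 + d\<^sup>2)" .
  have "(\<Sum>n=1..N. (H1_seminorm \<Omega> (\<rho> n))\<^sup>2 * \<tau>) \<le> (\<Sum>n=1..N. (\<kappa>1 * supG)\<^sup>2 * \<tau>)"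
  proof (intro sum_mono mult_right_mono power_mono)
    fix n assume "n \<in> {1..N}"
    then have n: "n \<le> N" by simp
    have "H1_seminorm \<Omega> (\<rho> n) \<le> \<kappa>1 * sobolev_norm \<Omega> q (g n)"
      using \<kappa>(1) g[OF n] r[OF n] by (simp add: ritz_error_bound_def \<rho>_def[abs_def])
    also have "\<dots> \<le> \<kappa>1 * supG" by (rule mult_left_mono[OF g(3)[OF n] \<kappa>(3)])
    finally show "H1_seminorm \<Omega> (\<rho> n) \<le> \<kappa>1 * supG" .
  qed (use \<tau> in \<open>auto simp: H1_seminorm_def\<close>)
  also have "\<dots> = (\<kappa>1 * supG)\<^sup>2 * T" using \<tau>(2) by (simp add: mult.left_commute)
  finally have 2: "(\<Sum>n=1..N. (H1_seminorm \<Omega> (\<rho> n))\<^sup>2 * \<tau>) \<le> (\<kappa>1 * supG)\<^sup>2 * T" .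
  have "(H1_seminorm \<Omega> (\<lambda>x. g n x - Gh n x))\<^sup>2 = (H1_seminorm \<Omega> (\<rho> n))\<^sup>2 + (H1_seminorm \<Omega> (\<theta> n))\<^sup>2" if "n \<le> N" for n
  proof -
    have "L2_inner \<Omega> (weak_deriv \<Omega> 1 (\<rho> n)) (weak_deriv \<Omega> 1 (\<theta> n)) = 0"
      unfolding \<rho>_def[abs_def] by (rule ritz_orthogonal[OF g(1)[OF that] r[OF that] \<theta>[OF that]])
    from H1_pythagoras[OF \<rho>[OF that] fe_space_H1[OF \<theta>[OF that]] this] show ?thesis
      by (simp add: \<rho>_def \<theta>_def)
  qed
  then have "(\<Sum>n=1..N. (H1_seminorm \<Omega> (\<lambda>x. g n x - Gh n x))\<^sup>2 * \<tau>)
      = (\<Sum>n=1..N. (H1_seminorm \<Omega> (\<theta> n))\<^sup>2 * \<tau>) + (\<Sum>n=1..N. (H1_seminorm \<Omega> (\<rho> n))\<^sup>2 * \<tau>)"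
    unfolding sum.distrib[symmetric] by (intro sum.cong refl) (simp add: algebra_simps)
  moreover have "(grid_norm_1 \<Omega> \<tau> N (\<lambda>n x. G x (real n * \<tau>) - Gh n x))\<^sup>2
      = (\<Sum>n=1..N. (H1_seminorm \<Omega> (\<lambda>x. g n x - Gh n x))\<^sup>2 * \<tau>)"
    unfolding grid_norm_1_def g_def using \<tau> by (simp add: sum_nonneg)
  ultimately have "(grid_norm_1 \<Omega> \<tau> N (\<lambda>n x. G x (real n * \<tau>) - Gh n x))\<^sup>2
    \<le> (b - a)\<^sup>2 / (4 * K\<^sup>2) * T * ((b - a) * c6\<^sup>2 * \<tau>\<^sup>2 + d\<^sup>2) + (\<kappa>1 * supG)\<^sup>2 * T"
    using 1 2 by linarith
  then show ?thesis by (simp only: \<tau>_def d_def)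
qed

end

section \<open>The rate and the explicit bound\<close>

context fk_problem
begin

lemma ritz_error_bound_standard:
  assumes "1 \<le> M"
  shows "ritz_error_bound M ((b - a) / sqrt 8 * ((b - a) / real M) ^ min l (q - 1)) (((b - a) / real M) ^ min l (q - 1))"
  unfolding ritz_error_bound_def using ritz_error[OF _ _ q assms l] by blast

text \<open>The seminorm bound results from dividing by the mesh size, since min (l + 1) q = min l
  (q - 1) + 1 for q >= 1. A Ritz constant carries no sign condition, whereas
  \<open>error_bound\<close> asks for nonnegative factors; hence \<open>max 0 c4\<close>.\<close>

lemma ritz_error_bound_ritz_constant:
  assumes "ritz_constant a b l q c4" and M: "1 \<le> M"
  shows "ritz_error_bound M (max 0 c4 * ((b - a) / real M) ^ min (l + 1) q) (max 0 c4 * ((b - a) / real M) ^ min l (q - 1))"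
  unfolding ritz_error_bound_def
proof (intro allI impI conjI)
  fix v r assume v: "v \<in> H1_zero \<Omega>" "v \<in> sobolev \<Omega> q" and r: "is_ritz_projection a b M l v r"
  define h where "h = (b - a) / real M"
  define s where "s = sobolev_norm \<Omega> q v"
  have h: "0 < h" using ab M by (simp add: h_def)
  have m: "min (l + 1) q = Suc (min l (q - 1))" using q by simp
  have "L2_norm \<Omega> (\<lambda>x. v x - r x) + h * H1_seminorm \<Omega> (\<lambda>x. v x - r x) \<le> c4 * h ^ min (l + 1) q * s"
    using assms v r unfolding ritz_constant_def h_def s_def by blast
  also have "\<dots> \<le> max 0 c4 * h ^ min (l + 1) q * s"
    using h by (intro mult_right_mono) (auto simp: s_def)
  finally have *: "L2_norm \<Omega> (\<lambda>x. v x - r x) + h * H1_seminorm \<Omega> (\<lambda>x. v x - r x) \<le> max 0 c4 * h ^ min (l + 1) q * s" .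
  have "0 \<le> h * H1_seminorm \<Omega> (\<lambda>x. v x - r x)" using h by (simp add: H1_seminorm_def)
  then show "L2_norm \<Omega> (\<lambda>x. v x - r x) \<le> max 0 c4 * ((b - a) / real M) ^ min (l + 1) q * sobolev_norm \<Omega> q v"
    using * unfolding h_def s_def by linarith
  have "h * H1_seminorm \<Omega> (\<lambda>x. v x - r x) \<le> max 0 c4 * h ^ min (l + 1) q * s"
    using * L2_norm_nonneg[of \<Omega> "\<lambda>x. v x - r x"] by linarith
  also have "\<dots> = h * (max 0 c4 * h ^ min l (q - 1) * s)" unfolding m by (simp only: power_Suc mult_ac)
  finally show "H1_seminorm \<Omega> (\<lambda>x. v x - r x) \<le> max 0 c4 * ((b - a) / real M) ^ min l (q - 1) * sobolev_norm \<Omega> q v"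
    using h unfolding h_def s_def by (simp only: mult_le_cancel_left_pos)
qed

text \<open>Only the proved projection estimate is used, with the same power of the mesh size in
  both norms. A collects the coefficient of tau^2, C that of the squared power of the mesh size, and
  c5 = sqrt(A + C).\<close>

theorem error_rate:
  assumes c7: "g_sum_constant gam T c7" and c6: "truncation_constant a b gam lam p U T G c6"
  shows "\<exists>c5. \<forall>M\<ge>1. \<forall>N\<ge>1. \<forall>Gh.
          fe_scheme a b gam lam K p U T l M N (\<lambda>n x. f x (real n * (T / real N))) Gh \<longrightarrow>
          (\<forall>x\<in>{a..b}. Gh 0 x = 0) \<longrightarrow>
          grid_norm_1 \<Omega> (T / real N) N (\<lambda>n x. G x (real n * (T / real N)) - Gh n x)
          \<le> c5 * (T / real N + ((b - a) / real M) ^ min l (q - 1))"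
proof (intro exI allI impI)
  define A where "A = (b - a)\<^sup>2 / (4 * K\<^sup>2) * T * ((b - a) * c6\<^sup>2)"
  define C where "C = (b - a)\<^sup>2 / (4 * K\<^sup>2) * T * ((b - a) / sqrt 8 * consistency_factor c7)\<^sup>2 + supG\<^sup>2 * T"
  have AC: "0 \<le> A" "0 \<le> C" using T ab by (auto simp: A_def C_def)
  fix M N :: nat and Gh
  assume M: "1 \<le> M" and N: "1 \<le> N"
    and Gh: "fe_scheme a b gam lam K p U T l M N (\<lambda>n x. f x (real n * (T / real N))) Gh" "\<forall>x\<in>{a..b}. Gh 0 x = 0"
  let ?e = "grid_norm_1 \<Omega> (T / real N) N (\<lambda>n x. G x (real n * (T / real N)) - Gh n x)"
  define \<tau> where "\<tau> = T / real N"
  define k where "k = ((b - a) / real M) ^ min l (q - 1)"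
  have pos: "0 \<le> \<tau>" "0 \<le> k" using T ab by (auto simp: \<tau>_def k_def)
  have "?e\<^sup>2 \<le> (b - a)\<^sup>2 / (4 * K\<^sup>2) * T * ((b - a) * c6\<^sup>2 * \<tau>\<^sup>2 + ((b - a) / sqrt 8 * k * consistency_factor c7)\<^sup>2)
      + (k * supG)\<^sup>2 * T"
    unfolding \<tau>_def k_def using ab
    by (intro error_bound[OF ritz_error_bound_standard[OF M] _ _ c7 c6 M N Gh]) auto
  also have "\<dots> = A * \<tau>\<^sup>2 + C * k\<^sup>2"
    by (simp only: A_def C_def power_mult_distrib distrib_left distrib_right mult_ac)
  also have "\<dots> \<le> (A + C) * (\<tau> + k)\<^sup>2"
  proof -
    have "A * \<tau>\<^sup>2 \<le> A * (\<tau> + k)\<^sup>2" "C * k\<^sup>2 \<le> C * (\<tau> + k)\<^sup>2"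
      using pos AC by (intro mult_left_mono power_mono; simp)+
    then show ?thesis by (simp add: distrib_right)
  qed
  also have "\<dots> = (sqrt (A + C) * (\<tau> + k))\<^sup>2" using AC by (simp add: power_mult_distrib)
  finally show "?e \<le> sqrt (A + C) * (T / real N + ((b - a) / real M) ^ min l (q - 1))"
    unfolding \<tau>_def[symmetric] k_def[symmetric]
    by (rule power2_le_imp_le) (use pos AC in auto)
qed

text \<open>What \<open>error_bound\<close> yields for a given Ritz constant is sharper than the
  claim in two places: its factor 1/4 is at most 4 / pi^2 because pi < 4, and orthogonality leaves
  the projection term without the factor 2.\<close>

theorem explicit_error_bound:
  assumes c4: "ritz_constant a b l q c4" and c6: "truncation_constant a b gam lam p U T G c6"
    and c7: "g_sum_constant gam T c7" and M: "1 \<le> M" and N: "1 \<le> N"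
    and Gh: "fe_scheme a b gam lam K p U T l M N (\<lambda>n x. f x (real n * (T / real N))) Gh" "\<forall>x\<in>{a..b}. Gh 0 x = 0"
  shows "(grid_norm_1 \<Omega> (T / real N) N (\<lambda>n x. G x (real n * (T / real N)) - Gh n x))\<^sup>2
    \<le> 4 * (b - a)\<^sup>2 / (pi\<^sup>2 * K\<^sup>2) * T *
        ((b - a) * c6\<^sup>2 * (T / real N)\<^sup>2
         + (c8_constant a b gam lam p U T G q c4 c7)\<^sup>2 * ((b - a) / real M) ^ (2 * min (l + 1) q))
      + 2 * c4\<^sup>2 * supG\<^sup>2 * T * ((b - a) / real M) ^ (2 * min l (q - 1))"
proof -
  define h where "h = (b - a) / real M"
  define C where "C = consistency_factor c7"
  define X where "X = (b - a) * c6\<^sup>2 * (T / real N)\<^sup>2"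
  define Y where "Y = (c8_constant a b gam lam p U T G q c4 c7)\<^sup>2 * h ^ (2 * min (l + 1) q)"
  have h: "0 \<le> h" using ab by (simp add: h_def)
  have c8: "c8_constant a b gam lam p U T G q c4 c7 = c4 * C"
    by (simp add: c8_constant_def C_def consistency_factor_def algebra_simps)
  have c4': "(max 0 c4)\<^sup>2 \<le> c4\<^sup>2" by (simp add: max_def)
  then have c4'': "(max 0 c4)\<^sup>2 \<le> 2 * c4\<^sup>2" by (rule order_trans) simp
  have XY: "0 \<le> X" "0 \<le> Y" using ab h by (auto simp: X_def Y_def)
  have "(grid_norm_1 \<Omega> (T / real N) N (\<lambda>n x. G x (real n * (T / real N)) - Gh n x))\<^sup>2
    \<le> (b - a)\<^sup>2 / (4 * K\<^sup>2) * T * (X + (max 0 c4 * h ^ min (l + 1) q * C)\<^sup>2) + (max 0 c4 * h ^ min l (q - 1) * supG)\<^sup>2 * T"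
    unfolding X_def h_def C_def using ab
    by (intro error_bound[OF ritz_error_bound_ritz_constant[OF c4 M] _ _ c7 c6 M N Gh]) auto
  also have "\<dots> \<le> (b - a)\<^sup>2 / (4 * K\<^sup>2) * T * (X + Y) + 2 * c4\<^sup>2 * supG\<^sup>2 * T * h ^ (2 * min l (q - 1))"
  proof (intro add_mono mult_left_mono order_refl)
    have "(max 0 c4 * h ^ min (l + 1) q * C)\<^sup>2 = (max 0 c4)\<^sup>2 * (h ^ (2 * min (l + 1) q) * C\<^sup>2)"
      by (simp only: power_mult_distrib power_mult[symmetric] mult.commute[of 2] mult.assoc)
    also have "\<dots> \<le> c4\<^sup>2 * (h ^ (2 * min (l + 1) q) * C\<^sup>2)"
      using c4' h by (intro mult_right_mono) auto
    also have "\<dots> = Y" unfolding Y_def c8 by (simp only: power_mult_distrib mult_ac)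
    finally show "(max 0 c4 * h ^ min (l + 1) q * C)\<^sup>2 \<le> Y" .
    have "(max 0 c4 * h ^ min l (q - 1) * supG)\<^sup>2 * T = (max 0 c4)\<^sup>2 * (h ^ (2 * min l (q - 1)) * supG\<^sup>2 * T)"
      by (simp only: power_mult_distrib power_mult[symmetric] mult.commute[of 2] mult.assoc)
    also have "\<dots> \<le> (2 * c4\<^sup>2) * (h ^ (2 * min l (q - 1)) * supG\<^sup>2 * T)"
      using c4'' h T by (intro mult_right_mono) auto
    finally show "(max 0 c4 * h ^ min l (q - 1) * supG)\<^sup>2 * T \<le> 2 * c4\<^sup>2 * supG\<^sup>2 * T * h ^ (2 * min l (q - 1))"
      by (simp only: mult_ac)
  qed (use T in auto)
  also have "\<dots> \<le> 4 * (b - a)\<^sup>2 / (pi\<^sup>2 * K\<^sup>2) * T * (X + Y) + 2 * c4\<^sup>2 * supG\<^sup>2 * T * h ^ (2 * min l (q - 1))"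
  proof (intro add_right_mono mult_right_mono)
    have "pi\<^sup>2 \<le> 4\<^sup>2" using pi_less_4 by (intro power_mono) auto
    then have "pi\<^sup>2 * ((b - a)\<^sup>2 * K\<^sup>2) \<le> 16 * ((b - a)\<^sup>2 * K\<^sup>2)" by (intro mult_right_mono) auto
    then show "(b - a)\<^sup>2 / (4 * K\<^sup>2) \<le> 4 * (b - a)\<^sup>2 / (pi\<^sup>2 * K\<^sup>2)"
      using K by (simp add: divide_simps mult_ac)
  qed (use T XY in auto)
  finally show ?thesis by (simp only: X_def Y_def h_def)
qed

end

theorem theorem4p1:
  fixes a b gam lam K T :: real
    and p :: complex
    and U :: "real \<Rightarrow> real"
    and l q :: nat
    and G f :: "real \<Rightarrow> real \<Rightarrow> complex"
  assumes "0 < gam" "gam < 1" "0 \<le> lam" "0 < K" "0 < T" "a < b" "0 < Re p"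
    and U_nonneg: "\<forall>x\<in>{a<..<b}. 0 \<le> U x"
    and U_measurable: "U \<in> borel_measurable (lebesgue_on {a<..<b})"
    and pU_bounded: "\<exists>B. \<forall>x\<in>{a<..<b}. norm (p * of_real (U x)) \<le> B"
    and "1 \<le> l" "1 \<le> q"
    and f_L2: "\<forall>t\<in>{0<..T}. (\<lambda>x. f x t) \<in> L2_space {a<..<b}"
    and initial: "\<forall>x\<in>{a..b}. G x 0 = 0"
    and boundary: "\<forall>t\<in>{0..T}. G a t = 0 \<and> G b t = 0"
    and G_space: "\<forall>t\<in>{0..T}. (\<lambda>x. G x t) \<in> H1_zero {a<..<b} \<inter> sobolev {a<..<b} q"
    and G_bounded: "bdd_above ((\<lambda>t. sobolev_norm {a<..<b} q (\<lambda>x. G x t)) ` {0..T})"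
    and G_C1: "\<forall>x\<in>{a<..<b}. (\<forall>t\<in>{0..T}. G x differentiable (at t within {0..T})) \<and>
                 continuous_on {0..T} (time_deriv T G x)"
    and Gt_space: "\<forall>t\<in>{0..T}. (\<lambda>x. time_deriv T G x t) \<in> sobolev {a<..<b} q"
    and Gt_bounded:
      "bdd_above ((\<lambda>t. sobolev_norm {a<..<b} q (\<lambda>x. time_deriv T G x t)) ` {0..T})"
    and G_fourier: "\<exists>B. \<forall>x\<in>{a<..<b}. \<exists>V\<in>fourier_space (1 + gam).
        fourier_space_norm (1 + gam) V \<le> B \<and> (\<forall>t\<le>0. V t = 0) \<and>
        (\<forall>t\<in>{0..T}. V t = exp ((of_real lam + p * of_real (U x)) * of_real t) * G x t)"
    and weak_solution: "\<forall>t\<in>{0<..T}. \<forall>\<eta>\<in>H1_zero {a<..<b}.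
        L2_inner {a<..<b} (\<lambda>x. tempered_subst_deriv gam lam p U T G x t) \<eta>
        - L2_inner {a<..<b} (\<lambda>x. of_real (lam powr gam) * G x t) \<eta>
        + of_real K * L2_inner {a<..<b} (weak_deriv {a<..<b} 1 (\<lambda>x. G x t))
                                        (weak_deriv {a<..<b} 1 \<eta>)
        = L2_inner {a<..<b} (\<lambda>x. f x t) \<eta>"
  shows
    "unconditionally_stable a b gam lam K p U T l
     \<and> (\<exists>c5. \<forall>M\<ge>1. \<forall>N\<ge>1. \<forall>Gh.
          fe_scheme a b gam lam K p U T l M N (\<lambda>n x. f x (real n * (T / real N))) Gh \<longrightarrow>
          (\<forall>x\<in>{a..b}. Gh 0 x = 0) \<longrightarrow>
          grid_norm_1 {a<..<b} (T / real N) N (\<lambda>n x. G x (real n * (T / real N)) - Gh n x)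
          \<le> c5 * (T / real N + ((b - a) / real M) ^ min l (q - 1)))
     \<and> (\<forall>c4 c6 c7. ritz_constant a b l q c4 \<longrightarrow>
          truncation_constant a b gam lam p U T G c6 \<longrightarrow>
          g_sum_constant gam T c7 \<longrightarrow>
          (\<forall>M\<ge>1. \<forall>N\<ge>1. \<forall>Gh.
            fe_scheme a b gam lam K p U T l M N (\<lambda>n x. f x (real n * (T / real N))) Gh \<longrightarrow>
            (\<forall>x\<in>{a..b}. Gh 0 x = 0) \<longrightarrow>
            (grid_norm_1 {a<..<b} (T / real N) N
               (\<lambda>n x. G x (real n * (T / real N)) - Gh n x))\<^sup>2
            \<le> 4 * (b - a)\<^sup>2 / (pi\<^sup>2 * K\<^sup>2) * T *
                ((b - a) * c6\<^sup>2 * (T / real N)\<^sup>2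
                 + (c8_constant a b gam lam p U T G q c4 c7)\<^sup>2
                   * ((b - a) / real M) ^ (2 * min (l + 1) q))
              + 2 * c4\<^sup>2 * (sup_sobolev_norm {a<..<b} T q G)\<^sup>2 * T
                * ((b - a) / real M) ^ (2 * min l (q - 1))))"
proof -
  obtain B where B: "\<forall>x\<in>{a<..<b}. norm (p * of_real (U x)) \<le> B" using pU_bounded by blast
  \<comment> \<open>The boundedness assumption concerns p U, while the constants contain the
    supremum of U; division is possible because Re p > 0.\<close>
  have p0: "0 < norm p" using \<open>0 < Re p\<close> by auto
  have "bdd_above (U ` {a<..<b})"
  proof (rule bdd_aboveI2)
    fix x assume x: "x \<in> {a<..<b}"
    have "norm p * U x \<le> B" using B x U_nonneg by (auto simp: norm_mult)
    then show "U x \<le> B / norm p" using p0 by (simp add: pos_le_divide_eq mult.commute)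
  qed
  then interpret fk_problem a b gam lam K T p U l q G f
    by unfold_locales (use assms in auto)
  obtain B' where "\<forall>x\<in>{a<..<b}. \<exists>V\<in>fourier_space (1 + gam).
        fourier_space_norm (1 + gam) V \<le> B' \<and> (\<forall>t\<le>0. V t = 0) \<and>
        (\<forall>t\<in>{0..T}. V t = exp ((of_real lam + p * of_real (U x)) * of_real t) * G x t)"
    using G_fourier by blast
  note c6 = truncation_constant_exists[OF G_C1 initial this]
  show ?thesis
    by (intro conjI allI impI stability error_rate[OF g_sum_constant_exists[OF gam T] c6]) (rule explicit_error_bound)
qed

end
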